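(* Let $(E,d)$ be a Polish space, let $N\geq 1$, and let $\bar X$ be the non-explosive pure jump Markov process on $E^N$ with generator $$\mathcal{L} f(\bar x)=\sum_{i=1}^N \int_E \bigl(f(x_1,\ldots,x_{i-1},y,x_{i+1},\ldots,x_N)-f(x_1,\ldots,x_N)\bigr)\,F_i(x_i,\bar{x},dy),$$ where the $F_i(x_i,\bar x,\cdot)$ are finite non-negative measures in $\mathcal{M}_d(E)$, measurable with respect to $x_i$ and $\bar x$. Then there exists a coupling operator $\mathcal{L}^c$ of $\mathcal{L}$ such that, for all $\bar{x}=(x_1,\ldots,x_N),\ \bar{y}=(y_1,\ldots,y_N)\in E^N$, $$\mathcal{L}^c d(\bar{x},\bar{y})= \frac{1}{N}\sum_{i=1}^N J_{d}^{x_i,y_i}\bigl(F_i(x_i,\bar{x},\cdot),F_i(y_i,\bar{y},\cdot)\bigr).$$ In particular, the coarse Ricci curvature $\sigma$ of the process $(\bar{X}_t)_{t\geq 0}$ satisfies $$\sigma\geq -\sup_{\bar{x}\neq\bar{y}\in E^N}\frac{\frac{1}{N}\sum_{i=1}^N J_{d}^{x_i,y_i}\bigl(F_i(x_i,\bar{x},\cdot),F_i(y_i,\bar{y},\cdot)\bigr)}{d(\bar{x},\bar{y})}.$$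
   Context: Metric on $E^N$: $d(\bar x,\bar y)=\frac1N\sum_{i=1}^N d(x_i,y_i)$ (same letter $d$ as on $E$). $\mathcal{M}_d(E)$ is the set of finite non-negative measures $m$ on $E$ such that $\int_E d(x,y)\,m(dy)<\infty$ for some (equivalently all) $x\in E$. Wasserstein distance: for non-negative measures $\mu,\nu$ with the same finite mass (on $E$ or on $E^N$), $\mathcal{W}_d(\mu,\nu)=\inf_\pi\int d(u,v)\,\pi(du,dv)$, the infimum being over non-negative measures $\pi$ on the product space with marginals $\mu$ and $\nu$. For $x,y\in E$ and $m_1,m_2\in\mathcal{M}_d(E)$ (possibly of different masses), $$J_{d}^{x,y}(m_1,m_2)=\mathcal{W}_d\bigl(m_1+m_2(E)\delta_x,\ m_2+m_1(E)\delta_y\bigr)-\bigl(m_1(E)+m_2(E)\bigr)d(x,y).$$ Coarse Ricci curvature of $\bar X$: the largest $\sigma\in[-\infty,+\infty]$ such that, for all $t\geq0$ and all $\bar x,\bar y\in E^N$, $\mathcal{W}_d\bigl(\mathbb{P}(\bar X_t\in\cdot\mid\bar X_0=\bar x),\mathbb{P}(\bar X_t\in\cdot\mid\bar X_0=\bar y)\bigr)\leq e^{-\sigma t}d(\bar x,\bar y)$. Coupling operator of $\mathcal{L}$: an infinitesimal generator $\mathcal{L}^c$ of a pure jump Markov process on $E^N\times E^N$ (an operator of the form $\mathcal{L}^cf(\bar x,\bar y)=\int (f(\bar u,\bar v)-f(\bar x,\bar y))\,n_{\bar x,\bar y}(d\bar u,d\bar v)$ with $n_{\bar x,\bar y}$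 a measurable kernel of finite measures, this formula also defining $\mathcal{L}^c d$) such that, for every bounded measurable $g:E^N\to\mathbb{R}$, $\mathcal{L}^cf(\bar x,\bar y)=\mathcal{L}g(\bar x)$ if $f(\bar x,\bar y)=g(\bar x)$ for all $\bar x,\bar y$, and $\mathcal{L}^cf(\bar x,\bar y)=\mathcal{L}g(\bar y)$ if $f(\bar x,\bar y)=g(\bar y)$ for all $\bar x,\bar y$. *)

theory Defs
  imports "HOL-Probability.Probability"
begin

text \<open>
  The configuration space \<open>E\<^sup>N\<close> is the function type \<open>'n \<Rightarrow> 'a\<close> with \<open>'a\<close> a Polish space and
  \<open>'n\<close> a finite index type, so \<open>N = CARD('n) \<ge> 1\<close>.  Its topology is the product topology and its
  Borel sets are the product \<open>\<sigma>\<close>-algebra.  The instance of \<open>dist\<close> that the library puts on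
  function types induces this topology but is not the averaged metric, which is therefore
  introduced separately.
\<close>

definition avg_dist :: "('n::finite \<Rightarrow> 'a::metric_space) \<Rightarrow> ('n \<Rightarrow> 'a) \<Rightarrow> real" where
  "avg_dist x y = (\<Sum>i\<in>UNIV. dist (x i) (y i)) / real CARD('n)"


section \<open>Measures with a first moment, Wasserstein distance and \<open>J\<close>\<close>

definition first_moment_measures :: "'a::metric_space measure set" where
  "first_moment_measures =
     {m. sets m = sets borel \<and> finite_measure m \<and> (\<exists>x. (\<integral>\<^sup>+ y. ennreal (dist x y) \<partial>m) < \<infinity>)}"

definition couplings :: "'b measure \<Rightarrow> 'c measure \<Rightarrow> ('b \<times> 'c) measure set" where
  "couplings \<mu> \<nu> =
     {\<pi>. sets \<pi> = sets (\<mu> \<Otimes>\<^sub>M \<nu>) \<and> distr \<pi> \<mu> fst = \<mu> \<and> distr \<pi> \<nu> snd = \<nu>}"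

definition wasserstein :: "('b \<Rightarrow> 'b \<Rightarrow> real) \<Rightarrow> 'b measure \<Rightarrow> 'b measure \<Rightarrow> ennreal" where
  "wasserstein d \<mu> \<nu> = (INF \<pi>\<in>couplings \<mu> \<nu>. \<integral>\<^sup>+ (u, v). ennreal (d u v) \<partial>\<pi>)"

definition add_measure :: "'b measure \<Rightarrow> 'b measure \<Rightarrow> 'b measure" where
  "add_measure \<mu> \<nu> = measure_of (space \<mu>) (sets \<mu>) (\<lambda>A. emeasure \<mu> A + emeasure \<nu> A)"

lemma sets_add_measure [simp, measurable_cong]: "sets (add_measure \<mu> \<nu>) = sets \<mu>"
  by (simp add: add_measure_def)

lemma space_add_measure [simp]: "space (add_measure \<mu> \<nu>) = space \<mu>"
  by (simp add: add_measure_def)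

lemma emeasure_add_measure:
  assumes "sets \<nu> = sets \<mu>" and "A \<in> sets \<mu>"
  shows "emeasure (add_measure \<mu> \<nu>) A = emeasure \<mu> A + emeasure \<nu> A"
proof (rule emeasure_measure_of[OF add_measure_def])
  show "countably_additive (sets (add_measure \<mu> \<nu>)) (\<lambda>A. emeasure \<mu> A + emeasure \<nu> A)"
  proof (rule countably_additiveI)
    fix B :: "nat \<Rightarrow> _"
    assume B: "range B \<subseteq> sets (add_measure \<mu> \<nu>)" "disjoint_family B"
    show "(\<Sum>i. emeasure \<mu> (B i) + emeasure \<nu> (B i)) =
          emeasure \<mu> (\<Union> (range B)) + emeasure \<nu> (\<Union> (range B))"
      using B assms(1) by (subst suminf_add[symmetric]) (auto simp: suminf_emeasure)
  qed
qed (use assms sets.space_closed in \<open>auto simp: positive_def\<close>)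

text \<open>
  For \<open>m\<^sub>1\<close> and \<open>m\<^sub>2\<close> in \<^const>\<open>first_moment_measures\<close> the Wasserstein distance below is finite
  (a multiple of the product measure is a coupling of finite cost), so \<^const>\<open>enn2real\<close> loses
  nothing.
\<close>

definition J :: "'a::metric_space \<Rightarrow> 'a \<Rightarrow> 'a measure \<Rightarrow> 'a measure \<Rightarrow> real" where
  "J x y m\<^sub>1 m\<^sub>2 =
     enn2real (wasserstein dist
       (add_measure m\<^sub>1 (scale_measure (emeasure m\<^sub>2 UNIV) (return borel x)))
       (add_measure m\<^sub>2 (scale_measure (emeasure m\<^sub>1 UNIV) (return borel y))))
     - (measure m\<^sub>1 UNIV + measure m\<^sub>2 UNIV) * dist x y"


section \<open>Jump generators and coupling operators\<close>

definition finite_kernel :: "('s::topological_space \<Rightarrow> 'b::topological_space measure) \<Rightarrow> bool" where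
  "finite_kernel k \<longleftrightarrow>
     (\<forall>z. sets (k z) = sets borel \<and> finite_measure (k z)) \<and>
     (\<forall>A\<in>sets borel. (\<lambda>z. emeasure (k z) A) \<in> borel_measurable borel)"

definition bounded_measurable :: "('b::topological_space \<Rightarrow> real) \<Rightarrow> bool" where
  "bounded_measurable g \<longleftrightarrow> g \<in> borel_measurable borel \<and> bounded (range g)"

definition jump_operator :: "('b \<Rightarrow> 'b measure) \<Rightarrow> ('b \<Rightarrow> real) \<Rightarrow> 'b \<Rightarrow> real" where
  "jump_operator k f z = (\<integral>w. f w - f z \<partial>k z)"

definition particle_generator ::
  "('n::finite \<Rightarrow> 'a \<Rightarrow> ('n \<Rightarrow> 'a) \<Rightarrow> 'a measure) \<Rightarrow> (('n \<Rightarrow> 'a) \<Rightarrow> real) \<Rightarrow> ('n \<Rightarrow> 'a) \<Rightarrow> real" where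
  "particle_generator F f x = (\<Sum>i\<in>UNIV. \<integral>y. f (x(i := y)) - f x \<partial>F i (x i) x)"

text \<open>
  A coupling operator of \<open>L\<close> is represented by its jump kernel \<open>k\<close>; the operator itself is
  \<open>jump_operator k\<close>.
\<close>

definition coupling_kernel ::
  "(('b::second_countable_topology \<Rightarrow> real) \<Rightarrow> 'b \<Rightarrow> real) \<Rightarrow> ('b \<times> 'b \<Rightarrow> ('b \<times> 'b) measure) \<Rightarrow> bool" where
  "coupling_kernel L k \<longleftrightarrow>
     finite_kernel k \<and>
     (\<forall>g. bounded_measurable g \<longrightarrow>
        (\<forall>x y. jump_operator k (\<lambda>(u, v). g u) (x, y) = L g x \<and>
               jump_operator k (\<lambda>(u, v). g v) (x, y) = L g y))"


section \<open>Pure jump Markov processes\<close>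

text \<open>
  Right-continuous step functions on \<open>[0, \<infinity>)\<close> with finitely many jumps in bounded intervals.
  The path need not actually jump at the times \<open>T k\<close>, so paths that are eventually constant
  are included.
\<close>

definition step_path :: "(real \<Rightarrow> 'b) \<Rightarrow> bool" where
  "step_path w \<longleftrightarrow>
     (\<exists>T :: nat \<Rightarrow> real. T 0 = 0 \<and> strict_mono T \<and> filterlim T at_top sequentially \<and>
        (\<forall>k. \<forall>t\<in>{T k..<T (Suc k)}. w t = w (T k)))"

definition past_events :: "'w measure \<Rightarrow> (real \<Rightarrow> 'w \<Rightarrow> 'b::topological_space) \<Rightarrow> real \<Rightarrow> 'w set set" where
  "past_events M X s =
     sigma_sets (space M) {X u -` B \<inter> space M | u B. 0 \<le> u \<and> u \<le> s \<and> B \<in> sets borel}"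

definition law_at ::
  "('b \<Rightarrow> 'w measure) \<Rightarrow> (real \<Rightarrow> 'w \<Rightarrow> 'b::topological_space) \<Rightarrow> real \<Rightarrow> 'b \<Rightarrow> 'b measure" where
  "law_at P X t x = distr (P x) borel (X t)"

text \<open>
  \<open>P x\<close> is the law of the process started from \<open>x\<close>; only times \<open>t \<ge> 0\<close> matter.  Non-explosion is
  expressed by the paths being step functions on the whole half-line.
\<close>

definition pure_jump_Markov_process ::
  "(('b::second_countable_topology \<Rightarrow> real) \<Rightarrow> 'b \<Rightarrow> real) \<Rightarrow> ('b \<Rightarrow> 'w measure)
     \<Rightarrow> (real \<Rightarrow> 'w \<Rightarrow> 'b) \<Rightarrow> bool" where
  "pure_jump_Markov_process L P X \<longleftrightarrow>
     (\<forall>x. prob_space (P x)) \<and>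
     (\<forall>x. \<forall>t\<ge>0. X t \<in> P x \<rightarrow>\<^sub>M borel) \<and>
     (\<forall>t\<ge>0. \<forall>B\<in>sets borel. (\<lambda>x. emeasure (law_at P X t x) B) \<in> borel_measurable borel) \<and>
     (\<forall>x. AE \<omega> in P x. X 0 \<omega> = x \<and> step_path (\<lambda>t. X t \<omega>)) \<and>
     (\<forall>x. \<forall>s\<ge>0. \<forall>t\<ge>0. \<forall>A\<in>past_events (P x) X s. \<forall>B\<in>sets borel.
        emeasure (P x) (A \<inter> X (s + t) -` B) = (\<integral>\<^sup>+ \<omega>\<in>A. emeasure (law_at P X t (X s \<omega>)) B \<partial>P x)) \<and>
     (\<forall>g. bounded_measurable g \<longrightarrow>
        (\<forall>x. ((\<lambda>t. ((\<integral>\<omega>. g (X t \<omega>) \<partial>P x) - g x) / t) \<longlongrightarrow> L g x) (at_right 0)))"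


section \<open>Coarse Ricci curvature\<close>

text \<open>
  In \<open>e\<^bsup>- \<sigma> t\<^esup> d(x, y)\<close> with \<open>\<sigma> = \<plusminus>\<infinity>\<close> the usual conventions \<open>\<infinity> \<cdot> 0 = 0\<close>, \<open>e\<^bsup>-\<infinity>\<^esup> = 0\<close> and
  \<open>e\<^bsup>\<infinity>\<^esup> = \<infinity>\<close> are used.
\<close>

definition exp_ereal :: "ereal \<Rightarrow> ennreal" where
  "exp_ereal z = (case z of ereal r \<Rightarrow> ennreal (exp r) | PInfty \<Rightarrow> \<infinity> | MInfty \<Rightarrow> 0)"

text \<open>
  The greatest element exists whenever some \<open>\<sigma>\<close> is admissible, because the bound is continuous
  in \<open>\<sigma>\<close>; for a process with \<open>X\<^sub>0 = x\<close> under \<open>P x\<close>, \<open>\<sigma> = - \<infinity>\<close> is always admissible.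
\<close>

definition coarse_Ricci_curvature ::
  "('b \<Rightarrow> 'b \<Rightarrow> real) \<Rightarrow> (real \<Rightarrow> 'b \<Rightarrow> 'b measure) \<Rightarrow> ereal" where
  "coarse_Ricci_curvature d Q =
     (GREATEST \<sigma>. \<forall>t\<ge>0. \<forall>x y.
        wasserstein d (Q t x) (Q t y) \<le> exp_ereal (- \<sigma> * ereal t) * ennreal (d x y))"

end

theory Submission imports Defs begin

text \<open>
  The coupling operator lets the \<open>i\<close>-th coordinates of the pair jump according to an optimal coupling
  of \<open>F i (x i) x\<close> and \<open>F i (y i) y\<close>, completed to the same mass by atoms at \<open>x i\<close> and \<open>y i\<close> that
  stand for the absence of a jump; its cost minus the mass times \<open>dist (x i) (y i)\<close> is \<^const>\<open>J\<close>.
  The difficulty is to choose the optimal coupling measurably in \<open>(x, y)\<close>. Couplings with fixed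
  marginals form a compact set, and explicit step couplings with rational weights are dense in it.
  Minimising first the cost and then a strictly convex functional singles out one optimal coupling,
  which is the limit of step couplings found by a measurable search.

  For the curvature, let \<open>S\<close> be the supremum and consider the minimal, possibly explosive, process
  of the coupling kernel, built by iterating over the number of jumps. By the backward equation its
  marginals are dominated by the laws of the given process. As that process does not explode, the
  coupled one loses no mass, so that it couples the two laws. The drift inequality \<open>\<L>\<^sup>c d \<le> S d\<close>
  propagates through the iteration and bounds the expected distance at time \<open>t\<close> by \<open>e\<^bsup>S t\<^esup> d(x, y)\<close>.
\<close>

section \<open>Binary codes of Polish spaces\<close>

text \<open>Two obstacles shape the proof. An optimal coupling is a jump kernel only if it depends
  measurably on the pair of configurations. Instead of a topology on measures, the points are coded
  by countably many bits and couplings are tested on a countable intersection-stable family of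
  rectangles; since the marginals stay fixed and dominate, convergence there extends to all Borel
  rectangles. The second obstacle is that the jump rates may be unbounded and that the process is
  known only through right derivatives of its semigroup on bounded functions, a class that does not
  contain \<open>avg_dist\<close>. The expectation of the distance is therefore estimated on the
  iterates, through their integral equation between nonnegative functions. Explosion of the pair is
  excluded by its rate, which is at most the sum of the two single rates: a second jump of the pair
  in a short time is bounded by quick jumps of single coordinates, and these are rare as long as
  both marginals stay in a set where rates are under control.\<close>

abbreviation bit_space :: "(nat \<Rightarrow> bool) measure" where
  "bit_space \<equiv> Pi\<^sub>M UNIV (\<lambda>_. count_space UNIV)"

text \<open>\<open>U\<close> lists the balls of radius \<open>(1/2) ^ k\<close> about a dense
  sequence. Reading for each \<open>k\<close> the first centre whose bit is set gives approximations
  of the point, and completeness turns them into a decoder. The decoder has to make sense on every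
  bit sequence, genuine code or not, because laws obtained later as limits live on the whole bit
  space.\<close>

lemma polish_binary_code:
  obtains U :: "nat \<Rightarrow> 'a::polish_space set" and \<sigma> :: "(nat \<Rightarrow> bool) \<Rightarrow> 'a"
  where "\<And>n. open (U n)" and "\<sigma> \<in> borel_measurable bit_space" and "\<And>u. \<sigma> (\<lambda>n. u \<in> U n) = u"
proof -
  obtain D :: "'a set" where D: "countable D" "\<And>X. open X \<Longrightarrow> X \<noteq> {} \<Longrightarrow> \<exists>d\<in>D. d \<in> X"
    using countable_dense_exists by blast
  have "D \<noteq> {}" using D(2)[of UNIV] by auto
  define a where "a = from_nat_into D"
  have dense: "\<exists>n. dist (a n) u < e" if e: "e > 0" for u e
  proof -
    obtain d where "d \<in> D" "d \<in> ball u e"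
      using D(2)[of "ball u e"] e centre_in_ball[of u e] by (metis empty_iff open_ball)
    moreover obtain n where "d = a n"
      using \<open>d \<in> D\<close> D(1) unfolding a_def by (metis from_nat_into_surj)
    ultimately show ?thesis by (auto simp: dist_commute)
  qed
  define U where "U i = (case prod_decode i of (n, k) \<Rightarrow> ball (a n) ((1/2) ^ k))" for i
  define x where "x b k = a (LEAST n. b (prod_encode (n, k)))" for b :: "nat \<Rightarrow> bool" and k
  \<comment> \<open>A step that is too large is suppressed, so that \<open>y b\<close> is a Cauchy sequence for every \<open>b\<close>.\<close>
  define y where "y b = rec_nat (x b 0) (\<lambda>k z. if dist (x b (Suc k)) z \<le> 2 * (1/2) ^ k then x b (Suc k) else z)"
    for b :: "nat \<Rightarrow> bool"
  have y0: "y b 0 = x b 0" and ySuc: "y b (Suc k) =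
      (if dist (x b (Suc k)) (y b k) \<le> 2 * (1/2) ^ k then x b (Suc k) else y b k)" for b k
    by (simp_all add: y_def)
  have step: "dist (y b (Suc k)) (y b k) \<le> 2 * (1/2) ^ k" for b k by (simp add: ySuc)
  \<comment> \<open>\<open>4 * (1/2) ^ k\<close> is the sum of the step bounds
    \<open>2 * (1/2) ^ j\<close> over all \<open>j \<ge> k\<close>; keeping the exact difference
    lets the induction close.\<close>
  have tail: "dist (y b (k + j)) (y b k) \<le> 4 * (1/2) ^ k - 4 * (1/2) ^ (k + j)" for b k j
  proof (induction j)
    case (Suc j)
    show ?case using step[of b "k + j"] Suc dist_triangle[of "y b (k + Suc j)" "y b k" "y b (k + j)"]
      by simp
  qed simp
  have Cauchy: "Cauchy (y b)" for b
  proof (rule metric_CauchyI)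
    fix e :: real assume "e > 0"
    then obtain N where N: "(1/2::real) ^ N < e / 8"
      using real_arch_pow_inv[of "e/8" "1/2"] by auto
    have *: "dist (y b m) (y b N) < e / 2" if "m \<ge> N" for m
    proof -
      have "4 * (1/2) ^ N - 4 * (1/2) ^ m < e / 2" using N zero_less_power[of "1/2::real" m] by linarith
      then show ?thesis using tail[of b N "m - N"] that by simp
    qed
    then show "\<exists>M. \<forall>m\<ge>M. \<forall>n\<ge>M. dist (y b m) (y b n) < e"
      by (meson dist_triangle_half_l dist_commute)
  qed
  define \<sigma> where "\<sigma> b = lim (y b)" for b
  have lim: "y b \<longlonglongrightarrow> \<sigma> b" for b
    using Cauchy[of b] by (simp add: \<sigma>_def Cauchy_convergent_iff convergent_LIMSEQ_iff)
  have x_meas[measurable]: "(\<lambda>b. x b k) \<in> borel_measurable bit_space" for k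
    unfolding x_def by measurable
  have y_meas: "(\<lambda>b. y b k) \<in> borel_measurable bit_space" for k
  proof (induction k)
    case (Suc k)
    note [measurable] = Suc
    show ?case unfolding ySuc by measurable
  qed (simp add: y0)
  show ?thesis
  proof
    show "open (U n)" for n by (simp add: U_def split: prod.split)
    show "\<sigma> \<in> borel_measurable bit_space"
      by (rule borel_measurable_LIMSEQ_metric[OF y_meas lim])
    show "\<sigma> (\<lambda>n. u \<in> U n) = u" for u
    proof -
      define b where "b = (\<lambda>n. u \<in> U n)"
      have xu: "dist (x b k) u < (1/2) ^ k" for k
      proof -
        have "b (prod_encode (n, k)) \<longleftrightarrow> dist (a n) u < (1/2) ^ k" for n by (simp add: b_def U_def)
        then show ?thesis unfolding x_def using LeastI_ex[OF dense[of "(1/2)^k" u]] by simp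
      qed
      \<comment> \<open>For a genuine code consecutive centres are closer than
        \<open>(1/2) ^ k + (1/2) ^ Suc k\<close>, which is below the threshold, so no step is
        suppressed.\<close>
      have yx: "y b k = x b k" for k
      proof (induction k)
        case (Suc k)
        have "(1/2::real) ^ Suc k < (1/2) ^ k" by simp
        then have "dist (x b (Suc k)) (x b k) \<le> 2 * (1/2) ^ k"
          using xu[of k] xu[of "Suc k"] dist_triangle2[of "x b (Suc k)" "x b k" u] by linarith
        then show ?case by (simp add: ySuc Suc)
      qed (simp add: y0)
      have "y b \<longlonglongrightarrow> u"
      proof (rule metric_LIMSEQ_I)
        fix e :: real assume "e > 0"
        then obtain N where N: "(1/2::real) ^ N < e" using real_arch_pow_inv[of e "1/2"] by auto
        have "dist (y b n) u < e" if "n \<ge> N" for n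
          using xu[of n] power_decreasing[OF that, of "1/2::real"] N unfolding yx by linarith
        then show "\<exists>no. \<forall>n\<ge>no. dist (y b n) u < e" by blast
      qed
      then show ?thesis using lim[of b] LIMSEQ_unique b_def by blast
    qed
  qed
qed


section \<open>Reading the digits of a base three expansion continuously\<close>

definition ternary :: "(nat \<Rightarrow> bool) \<Rightarrow> nat \<Rightarrow> real" where
  "ternary b n = (\<Sum>k. of_bool (b (n + k)) / 3 ^ Suc k)"

lemma ternary_summable: "summable (\<lambda>k. of_bool (b (n + k)) / 3 ^ Suc k :: real)"
proof (rule summable_comparison_test')
  show "summable (\<lambda>k. (1/3) * (1/3) ^ k :: real)" by (intro summable_mult summable_geometric) simp
  show "norm (of_bool (b (n + k)) / 3 ^ Suc k :: real) \<le> (1/3) * (1/3) ^ k" if "k \<ge> 0" for k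
    by (simp add: field_simps)
qed

text \<open>1/2 is the value of the expansion whose digits are all 1. Hence expansions starting with
  0 lie in \<open>[0, 1/6]\<close> and those starting with 1 in \<open>[1/3, 1/2]\<close>; base
  three instead of two leaves this gap.\<close>

lemma ternary_bounds: "0 \<le> ternary b n" "ternary b n \<le> 1/2"
proof -
  show "0 \<le> ternary b n" unfolding ternary_def by (intro suminf_nonneg ternary_summable) simp
  have s: "(\<lambda>k. (1/3) * (1/3) ^ k :: real) sums (1/2)"
    using sums_mult[OF geometric_sums[of "1/3::real"], of "1/3"] by simp
  show "ternary b n \<le> 1/2" unfolding ternary_def
    by (rule suminf_le[OF _ ternary_summable sums_summable[OF s], unfolded sums_unique[OF s, symmetric]])
      (simp add: field_simps)
qed

lemma ternary_rec: "3 * ternary b n = of_bool (b n) + ternary b (Suc n)"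
proof -
  have "ternary b n = of_bool (b n) / 3 + (\<Sum>k. of_bool (b (n + Suc k)) / 3 ^ Suc (Suc k))"
    unfolding ternary_def by (subst suminf_split_head[OF ternary_summable]) simp
  also have "(\<Sum>k. of_bool (b (n + Suc k)) / 3 ^ Suc (Suc k) :: real) = ternary b (Suc n) / 3"
    unfolding ternary_def by (subst suminf_divide[OF ternary_summable, symmetric]) (simp add: field_simps)
  finally show ?thesis by simp
qed

text \<open>Constant 0 up to 1/6, constant 1 from 1/3 on and linear across the gap between the two
  kinds of expansions: a continuous extension of the first digit to the line.\<close>

definition clamp_digit :: "real \<Rightarrow> real" where
  "clamp_digit r = max 0 (min 1 (6 * r - 1))"

lemma clamp_digit_ternary: "clamp_digit (ternary b n) = of_bool (b n)"
  using ternary_rec[of b n] ternary_bounds[of b n] ternary_bounds[of b "Suc n"]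
  by (cases "b n") (auto simp: clamp_digit_def)

text \<open>The shift of the expansion, extended continuously to all reals, so that every digit
  becomes a test function for weak convergence.\<close>

primrec remainder :: "nat \<Rightarrow> real \<Rightarrow> real" where
  "remainder 0 = (\<lambda>x. x)"
| "remainder (Suc n) = (\<lambda>x. 3 * remainder n x - clamp_digit (remainder n x))"

definition digit :: "nat \<Rightarrow> real \<Rightarrow> real" where
  "digit n x = clamp_digit (remainder n x)"

lemma isCont_clamp_digit: "isCont f x \<Longrightarrow> isCont (\<lambda>x. clamp_digit (f x)) x"
  unfolding clamp_digit_def by (intro continuous_intros)

lemma isCont_remainder: "isCont (remainder n) x"
proof (induction n arbitrary: x)
  case 0
  show ?case by simp
next
  case (Suc n)
  show ?case by (simp add: continuous_intros isCont_clamp_digit Suc)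
qed

lemma isCont_digit: "isCont (digit n) x"
  unfolding digit_def[abs_def] by (intro isCont_clamp_digit isCont_remainder)

lemma borel_measurable_digit[measurable]: "digit n \<in> borel_measurable borel"
  by (intro borel_measurable_continuous_onI continuous_at_imp_continuous_on ballI isCont_digit)

lemma digit_bounds: "0 \<le> digit n x" "digit n x \<le> 1"
  by (simp_all add: digit_def clamp_digit_def)

lemma digit_ternary: "digit n (ternary b 0) = of_bool (b n)"
proof -
  have "remainder n (ternary b 0) = ternary b n"
    by (induction n) (simp_all add: ternary_rec clamp_digit_ternary)
  then show ?thesis by (simp add: digit_def clamp_digit_ternary)
qed

text \<open>Helly's theorem for the laws on the line of the ternary codes with digits \<open>0\<close> and \<open>1\<close>: the
  digits are restrictions of continuous functions, hence pass to the weak limit.\<close>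

lemma bit_law_subsequence_limit:
  fixes \<pi> :: "nat \<Rightarrow> 'x measure" and W :: "nat \<Rightarrow> 'x set"
  assumes prob: "\<And>m. prob_space (\<pi> m)" and W: "\<And>m n. W n \<in> sets (\<pi> m)"
  obtains s :: "nat \<Rightarrow> nat" and R where "strict_mono s" "prob_space R" "sets R = sets bit_space"
    and "\<And>J. finite J \<Longrightarrow> (\<lambda>m. measure (\<pi> (s m)) {x\<in>space (\<pi> (s m)). \<forall>n\<in>J. x \<in> W n})
            \<longlonglongrightarrow> measure R {b. \<forall>n\<in>J. b n}"
proof -
  define c where "c x = ternary (\<lambda>n. x \<in> W n) 0" for x
  have c_meas[measurable]: "c \<in> borel_measurable (\<pi> m)" for m
  proof -
    note [measurable] = W[of _ m]
    show ?thesis unfolding c_def ternary_def by measurable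
  qed
  define \<mu> where "\<mu> m = distr (\<pi> m) borel c" for m
  interpret \<pi>: prob_space "\<pi> m" for m by (rule prob)
  have rd: "real_distribution (\<mu> m)" for m
    unfolding \<mu>_def by (intro \<pi>.real_distribution_distr) simp
  \<comment> \<open>All codes lie in \<open>[0, 1/2]\<close>, so \<open>{-1<..1}\<close> carries the
    full mass of every law.\<close>
  have "tight \<mu>"
    unfolding tight_def
  proof (intro conjI allI impI rd)
    fix e :: real assume "e > 0"
    have "-1 < c x \<and> c x \<le> 1" for x
      using ternary_bounds[of "\<lambda>n. x \<in> W n" 0] by (simp add: c_def)
    then have "c -` {-1<..1} \<inter> space (\<pi> m) = space (\<pi> m)" for m
      by auto
    then have "measure (\<mu> m) {-1<..1} = 1" for m
      unfolding \<mu>_def by (simp add: measure_distr \<pi>.prob_space)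
    then show "\<exists>a b. a < b \<and> (\<forall>m. measure (\<mu> m) {a<..b} > 1 - e)"
      using \<open>e > 0\<close> by (intro exI[of _ "-1"] exI[of _ 1]) simp
  qed
  then obtain r M where r: "strict_mono (r :: nat \<Rightarrow> nat)" and M: "real_distribution M"
    and weak: "weak_conv_m (\<mu> \<circ> id \<circ> r) M"
    using tight_imp_convergent_subsubsequence[of \<mu> id] strict_mono_id by blast
  interpret M: real_distribution M by (rule M)
  have conv: "(\<lambda>m. \<integral>x. f (c x) \<partial>\<pi> (r m)) \<longlonglongrightarrow> integral\<^sup>L M f"
    if "\<And>x. isCont f x" "\<And>x. norm (f x) \<le> B" for f :: "real \<Rightarrow> real" and B
  proof -
    have [measurable]: "f \<in> borel_measurable borel"
      using that(1) by (intro borel_measurable_continuous_onI continuous_at_imp_continuous_on) auto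
    have "(\<lambda>m. integral\<^sup>L (\<mu> (r m)) f) \<longlonglongrightarrow> integral\<^sup>L M f"
      using weak_conv_imp_integral_bdd_continuous_conv[OF _ M weak, of f B] rd that by simp
    then show ?thesis by (simp add: \<mu>_def integral_distr)
  qed
  have digit_c: "digit n (c x) = of_bool (x \<in> W n)" for n x by (simp add: c_def digit_ternary)
  have int[simp]: "integrable M (\<lambda>x. \<Prod>n\<in>J. digit n x)" for J
    by (rule M.integrable_const_bound[where B=1])
      (auto intro!: prod_le_1 simp: abs_prod digit_bounds abs_of_nonneg)
  \<comment> \<open>\<open>digit n x * (1 - digit n x)\<close> is continuous and vanishes on every
    code. Its integral is therefore 0 in the limit as well, which confines the limit digit to 0 and
    1.\<close>
  have ae: "AE x in M. digit n x = of_bool (digit n x = 1)" for n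
  proof -
    have b: "norm (digit n x * (1 - digit n x)) \<le> 1" for x
      using digit_bounds[of n x] by (simp add: abs_mult mult_le_one)
    have "(\<lambda>m. \<integral>x. digit n (c x) * (1 - digit n (c x)) \<partial>\<pi> (r m)) \<longlonglongrightarrow> (\<integral>x. digit n x * (1 - digit n x) \<partial>M)"
      by (rule conv[OF _ b]) (intro continuous_intros isCont_digit)
    moreover have "(\<lambda>x. digit n (c x) * (1 - digit n (c x))) = (\<lambda>x. 0)"
      by (auto simp: digit_c fun_eq_iff)
    ultimately have "(\<integral>x. digit n x * (1 - digit n x) \<partial>M) = 0"
      by (simp add: LIMSEQ_const_iff)
    moreover have "integrable M (\<lambda>x. digit n x * (1 - digit n x))"
      using b by (intro M.integrable_const_bound[where B=1]) auto
    ultimately have "AE x in M. digit n x * (1 - digit n x) = 0"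
      by (subst (asm) integral_nonneg_eq_0_iff_AE) (auto simp: digit_bounds)
    then show ?thesis by (rule AE_mp) auto
  qed
  \<comment> \<open>Almost everywhere the digits are 0 or 1, so comparing with 1 loses
    nothing.\<close>
  define R where "R = distr M bit_space (\<lambda>x n. digit n x = 1)"
  have [measurable]: "(\<lambda>x n. digit n x = 1) \<in> M \<rightarrow>\<^sub>M bit_space"
    by (rule measurable_PiM_single') auto
  show ?thesis
  proof
    show "strict_mono r" by fact
    show "prob_space R" unfolding R_def by (rule M.prob_space_distr) simp
    show "sets R = sets bit_space" by (simp add: R_def)
    fix J :: "nat set" assume J: "finite J"
    have "(\<lambda>m. \<integral>x. (\<Prod>n\<in>J. digit n (c x)) \<partial>\<pi> (r m)) \<longlonglongrightarrow> (\<integral>x. (\<Prod>n\<in>J. digit n x) \<partial>M)"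
    proof (rule conv)
      show "isCont (\<lambda>x. \<Prod>n\<in>J. digit n x) x" for x by (intro continuous_intros isCont_digit)
      show "norm (\<Prod>n\<in>J. digit n x) \<le> 1" for x
        by (auto intro!: prod_le_1 simp: abs_prod digit_bounds abs_of_nonneg)
    qed
    moreover have "(\<integral>x. (\<Prod>n\<in>J. digit n (c x)) \<partial>\<pi> m) = measure (\<pi> m) {x\<in>space (\<pi> m). \<forall>n\<in>J. x \<in> W n}" for m
    proof -
      have "(\<Prod>n\<in>J. digit n (c x)) = indicator {x\<in>space (\<pi> m). \<forall>n\<in>J. x \<in> W n} x" if "x \<in> space (\<pi> m)" for x
        using J that by (auto simp: digit_c indicator_def prod_eq_1_iff)
      then have "(\<integral>x. (\<Prod>n\<in>J. digit n (c x)) \<partial>\<pi> m) = (\<integral>x. indicator {x\<in>space (\<pi> m). \<forall>n\<in>J. x \<in> W n} x \<partial>\<pi> m)"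
        by (rule Bochner_Integration.integral_cong[OF refl])
      then show ?thesis by (simp add: Int_absorb2 subset_iff)
    qed
    moreover have "(\<integral>x. (\<Prod>n\<in>J. digit n x) \<partial>M) = measure R {b. \<forall>n\<in>J. b n}"
    proof -
      have 1: "AE x in M. (\<Prod>n\<in>J. digit n x) = indicator {x. \<forall>n\<in>J. digit n x = 1} x"
      proof -
        have "AE x in M. \<forall>n\<in>J. digit n x = of_bool (digit n x = 1)"
          using ae J by (intro AE_finite_allI) auto
        then show ?thesis
          by (rule AE_mp) (use J in \<open>auto simp: indicator_def prod_eq_1_iff intro!: AE_I2\<close>)
      qed
      have [measurable]: "{x. \<forall>n\<in>J. digit n x = 1} \<in> sets borel"
      proof -
        have "Measurable.pred borel (\<lambda>x. \<forall>n\<in>J. digit n x = 1)" using J by measurable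
        then show ?thesis by (simp add: pred_def)
      qed
      have [measurable]: "{b. \<forall>n\<in>J. b n} \<in> sets bit_space"
      proof -
        have "Measurable.pred bit_space (\<lambda>b. \<forall>n\<in>J. b n)" using J by measurable
        then show ?thesis by (simp add: pred_def space_PiM)
      qed
      have "(\<integral>x. (\<Prod>n\<in>J. digit n x) \<partial>M) = (\<integral>x. indicator {x. \<forall>n\<in>J. digit n x = 1} x \<partial>M)"
        by (rule integral_cong_AE[OF _ _ 1]) auto
      also have "\<dots> = measure R {b. \<forall>n\<in>J. b n}"
        by (simp add: R_def measure_distr vimage_def)
      finally show ?thesis .
    qed
    ultimately show "(\<lambda>m. measure (\<pi> (r m)) {x\<in>space (\<pi> (r m)). \<forall>n\<in>J. x \<in> W n})
            \<longlonglongrightarrow> measure R {b. \<forall>n\<in>J. b n}" by simp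
  qed
qed

section \<open>Sequential compactness of couplings\<close>

lemma couplings_iff:
  "\<pi> \<in> couplings \<mu> \<nu> \<longleftrightarrow> sets \<pi> = sets (\<mu> \<Otimes>\<^sub>M \<nu>) \<and>
     (\<forall>A\<in>sets \<mu>. emeasure \<pi> (A \<times> space \<nu>) = emeasure \<mu> A) \<and>
     (\<forall>B\<in>sets \<nu>. emeasure \<pi> (space \<mu> \<times> B) = emeasure \<nu> B)"
proof (cases "sets \<pi> = sets (\<mu> \<Otimes>\<^sub>M \<nu>)")
  case True
  note [measurable_cong] = True
  have sp: "space \<pi> = space \<mu> \<times> space \<nu>"
    using sets_eq_imp_space_eq[OF True] by (simp add: space_pair_measure)
  have "distr \<pi> \<mu> fst = \<mu> \<longleftrightarrow> (\<forall>A\<in>sets \<mu>. emeasure \<pi> (A \<times> space \<nu>) = emeasure \<mu> A)"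
  proof -
    have "emeasure (distr \<pi> \<mu> fst) A = emeasure \<pi> (A \<times> space \<nu>)" if "A \<in> sets \<mu>" for A
      using that sets.sets_into_space[OF that]
      by (subst emeasure_distr) (auto simp: sp intro!: arg_cong[where f="emeasure \<pi>"])
    then show ?thesis by (metis measure_eqI sets_distr)
  qed
  moreover have "distr \<pi> \<nu> snd = \<nu> \<longleftrightarrow> (\<forall>B\<in>sets \<nu>. emeasure \<pi> (space \<mu> \<times> B) = emeasure \<nu> B)"
  proof -
    have "emeasure (distr \<pi> \<nu> snd) A = emeasure \<pi> (space \<mu> \<times> A)" if "A \<in> sets \<nu>" for A
      using that sets.sets_into_space[OF that]
      by (subst emeasure_distr) (auto simp: sp intro!: arg_cong[where f="emeasure \<pi>"])
    then show ?thesis by (metis measure_eqI sets_distr)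
  qed
  ultimately show ?thesis using True by (simp add: couplings_def)
qed (simp add: couplings_def)

lemma coupling_sets: "\<pi> \<in> couplings \<mu> \<nu> \<Longrightarrow> sets \<pi> = sets (\<mu> \<Otimes>\<^sub>M \<nu>)"
  by (simp add: couplings_def)

lemma coupling_space: "\<pi> \<in> couplings \<mu> \<nu> \<Longrightarrow> space \<pi> = space \<mu> \<times> space \<nu>"
  by (drule coupling_sets, drule sets_eq_imp_space_eq) (simp add: space_pair_measure)

lemma prob_space_coupling:
  assumes "\<pi> \<in> couplings \<mu> \<nu>" "prob_space \<mu>"
  shows "prob_space \<pi>"
proof (rule prob_spaceI)
  have "emeasure \<pi> (space \<mu> \<times> space \<nu>) = emeasure \<mu> (space \<mu>)"
    using assms(1) by (simp add: couplings_iff)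
  then show "emeasure \<pi> (space \<pi>) = 1"
    by (simp add: coupling_space[OF assms(1)] prob_space.emeasure_space_1[OF assms(2)])
qed

lemma
  assumes "\<pi> \<in> couplings \<mu> \<nu>" "sets \<mu> = sets borel" "sets \<nu> = sets borel"
  shows measure_coupling_fst: "A \<in> sets borel \<Longrightarrow> measure \<pi> (A \<times> UNIV) = measure \<mu> A"
    and measure_coupling_snd: "A \<in> sets borel \<Longrightarrow> measure \<pi> (UNIV \<times> A) = measure \<nu> A"
  using assms sets_eq_imp_space_eq[OF assms(2)] sets_eq_imp_space_eq[OF assms(3)]
  by (simp_all add: couplings_iff measure_def)

section \<open>Generating the product and the Borel sigma-algebras by finitely many positive
  bits\<close>

lemma sets_bit_space: "sets bit_space = sigma_sets UNIV {{b. \<forall>n\<in>J. b n} | J. finite J}"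
proof
  let ?G = "{{b. \<forall>n\<in>J. b n} | J :: nat set. finite J}"
  have "(\<lambda>b. b) \<in> sigma UNIV ?G \<rightarrow>\<^sub>M bit_space"
  proof (rule measurable_PiM_single')
    fix n :: nat
    have "{b. \<forall>k\<in>{n}. b k} \<in> ?G" by blast
    then have "{b. b n} \<in> sigma_sets UNIV ?G" by auto
    then show "(\<lambda>b. b n) \<in> sigma UNIV ?G \<rightarrow>\<^sub>M count_space UNIV"
      by (simp add: pred_def)
  qed auto
  then show "sets bit_space \<subseteq> sigma_sets UNIV ?G"
    by (auto dest!: measurable_sets[where M="sigma UNIV ?G"])
  have "{b. \<forall>n\<in>J. b n} \<in> sets bit_space" if "finite J" for J
  proof -
    have "Measurable.pred bit_space (\<lambda>b. \<forall>n\<in>J. b n)" using that by measurable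
    then show ?thesis by (simp add: pred_def space_PiM)
  qed
  then show "sigma_sets UNIV ?G \<subseteq> sets bit_space"
    using sets.top[of bit_space] by (intro sets.sigma_sets_subset') (auto simp: space_PiM)
qed

lemma Int_stable_finite_intersections:
  "Int_stable {{u. \<forall>n\<in>J. u \<in> U n} | J. finite J}"
proof (rule Int_stableI)
  fix a b assume "a \<in> {{u. \<forall>n\<in>J. u \<in> U n} | J. finite J}" "b \<in> {{u. \<forall>n\<in>J. u \<in> U n} | J. finite J}"
  then obtain I J where "finite I" "finite J" "a = {u. \<forall>n\<in>I. u \<in> U n}" "b = {u. \<forall>n\<in>J. u \<in> U n}" by blast
  then have "finite (I \<union> J)" "a \<inter> b = {u. \<forall>n\<in>I \<union> J. u \<in> U n}" by auto
  then show "a \<inter> b \<in> {{u. \<forall>n\<in>J. u \<in> U n} | J. finite J}" by blast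
qed

text \<open>The identity is the decoder after the code, so it is measurable for the sigma-algebra
  that the code generates; hence that sigma-algebra already contains every Borel set.\<close>

lemma sigma_sets_binary_code:
  fixes U :: "nat \<Rightarrow> 'a::topological_space set"
  assumes "\<And>n. U n \<in> sets borel" and \<sigma>: "\<sigma> \<in> borel_measurable bit_space" "\<And>u. \<sigma> (\<lambda>n. u \<in> U n) = u"
  shows "sigma_sets UNIV {{u. \<forall>n\<in>J. u \<in> U n} | J. finite J} = sets borel"
proof
  let ?G = "{{u. \<forall>n\<in>J. u \<in> U n} | J. finite J}"
  have J: "{u. \<forall>n\<in>J. u \<in> U n} \<in> sets borel" if "finite J" for J
  proof -
    note [measurable] = assms(1)
    have "Measurable.pred borel (\<lambda>u. \<forall>n\<in>J. u \<in> U n)" using that by measurable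
    then show ?thesis by (simp add: pred_def)
  qed
  then show "sigma_sets UNIV ?G \<subseteq> sets borel"
    by (intro sets.sigma_sets_subset'[of _ borel, simplified]) auto
  have "(\<lambda>u n. u \<in> U n) \<in> sigma UNIV ?G \<rightarrow>\<^sub>M bit_space"
  proof (rule measurable_PiM_single')
    fix n :: nat
    have "{u. \<forall>k\<in>{n}. u \<in> U k} \<in> ?G" by blast
    then have "{u. u \<in> U n} \<in> sigma_sets UNIV ?G" by auto
    then show "(\<lambda>u. u \<in> U n) \<in> sigma UNIV ?G \<rightarrow>\<^sub>M count_space UNIV"
      by (simp add: pred_def)
  qed auto
  from measurable_compose[OF this \<sigma>(1)] have "(\<lambda>u. u) \<in> sigma UNIV ?G \<rightarrow>\<^sub>M borel"
    by (simp add: \<sigma>(2))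
  then show "sets borel \<subseteq> sigma_sets UNIV ?G"
    by (auto dest!: measurable_sets[where M="sigma UNIV ?G"])
qed

text \<open>Convergence on an intersection-stable generator extends by induction over disjoint
  unions. A countable union exchanges a limit with a series, which is where the dominating
  \<open>h\<close> enters through Tannery's theorem. The form with countably additive set functions
  allows one factor of a rectangle to be frozen.\<close>

lemma dominated_setwise_limit:
  fixes f :: "nat \<Rightarrow> 'x set \<Rightarrow> real"
  assumes G: "Int_stable G" "G \<subseteq> Pow \<Omega>" and A: "A \<in> sigma_sets \<Omega> G"
    and conv: "\<And>A. A \<in> G \<Longrightarrow> (\<lambda>m. f m A) \<longlonglongrightarrow> g A" and top: "(\<lambda>m. f m \<Omega>) \<longlonglongrightarrow> g \<Omega>"
    and f: "\<And>m A. range A \<subseteq> sigma_sets \<Omega> G \<Longrightarrow> disjoint_family A \<Longrightarrow> (\<lambda>i. f m (A i)) sums f m (\<Union> (range A))"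
    and g: "\<And>A. range A \<subseteq> sigma_sets \<Omega> G \<Longrightarrow> disjoint_family A \<Longrightarrow> (\<lambda>i. g (A i)) sums g (\<Union> (range A))"
    and h: "\<And>A. range A \<subseteq> sigma_sets \<Omega> G \<Longrightarrow> disjoint_family A \<Longrightarrow> summable (\<lambda>i. h (A i))"
    and dom: "\<And>m A. A \<in> sigma_sets \<Omega> G \<Longrightarrow> \<bar>f m A\<bar> \<le> h A"
  shows "(\<lambda>m. f m A) \<longlonglongrightarrow> g A"
  using G A
proof (induction rule: sigma_sets_induct_disjoint)
  \<comment> \<open>Additivity for the constant sequence of empty sets gives a convergent series
    with constant terms, so the term is 0.\<close>
  have empty: "F {} = 0" if "(\<lambda>i::nat. F {}) sums F {}" for F :: "'x set \<Rightarrow> real"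
    using sums_summable[OF that] by (simp add: summable_const_iff)
  have f0: "f m {} = 0" for m using f[of "\<lambda>_. {}" m] by (intro empty) (auto simp: sigma_sets.Empty disjoint_family_on_def)
  have g0: "g {} = 0" using g[of "\<lambda>_. {}"] by (intro empty) (auto simp: sigma_sets.Empty disjoint_family_on_def)
  {
    case empty
    show ?case by (simp add: f0 g0)
  next
    case (compl A)
    have 1: "F (\<Omega> - A) = F \<Omega> - F A"
      if F: "\<And>A. range A \<subseteq> sigma_sets \<Omega> G \<Longrightarrow> disjoint_family A \<Longrightarrow> (\<lambda>i. F (A i)) sums F (\<Union> (range A))"
        and F0: "F {} = 0" for F :: "'x set \<Rightarrow> real"
    proof -
      have A: "A \<subseteq> \<Omega>" using sigma_sets_into_sp[OF G(2) compl(1)] .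
      let ?B = "\<lambda>i::nat. if i = 0 then A else if i = 1 then \<Omega> - A else {}"
      have "(\<lambda>i. F (?B i)) sums F (\<Union> (range ?B))"
        using compl(1) by (intro F) (auto simp: disjoint_family_on_def sigma_sets.Empty sigma_sets.Compl split: if_splits)
      moreover have "\<Union> (range ?B) = \<Omega>" using A by (auto split: if_splits)
      moreover have "(\<lambda>i. F (?B i)) sums (\<Sum>i\<in>{0,1}. F (?B i))"
        by (rule sums_finite) (auto simp: F0)
      ultimately show ?thesis 
        by (simp add: sums_iff)
    qed
    have "f m (\<Omega> - A) = f m \<Omega> - f m A" for m by (rule 1) (auto simp: f0 intro: f)
    moreover have "g (\<Omega> - A) = g \<Omega> - g A" by (rule 1) (auto simp: g0 intro: g)
    ultimately show ?case using compl(2) top by (auto intro!: tendsto_diff)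
  next
    case (union A)
    have "(\<lambda>m. \<Sum>i. f m (A i)) \<longlonglongrightarrow> (\<Sum>i. g (A i))"
    proof -
      have "((\<lambda>m. suminf (\<lambda>i. f m (A i))) \<longlongrightarrow> suminf (\<lambda>i. g (A i))) sequentially"
        using union by (intro tannerys_theorem[where M="\<lambda>i. h (A i)", THEN conjunct2, THEN conjunct2])
           (auto intro!: h always_eventually dom)
      then show ?thesis .
    qed
    moreover have "(\<Sum>i. f m (A i)) = f m (\<Union> (range A))" for m using f[of A m] union by (simp add: sums_iff)
    moreover have "(\<Sum>i. g (A i)) = g (\<Union> (range A))" using g[of A] union by (simp add: sums_iff)
    ultimately show ?case by simp
  next
    case (basic A)
    then show ?case by (rule conv)
  }
qed

text \<open>The left factor is extended from the generator to all Borel sets first, then the right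
  one. The domination comes for free: every coupling gives a rectangle at most the marginal mass of
  either side, whatever \<open>m\<close> is.\<close>

lemma coupling_rectangles_limit:
  fixes \<mu> \<nu> :: "'a::second_countable_topology measure" and \<pi> :: "nat \<Rightarrow> ('a \<times> 'a) measure"
  assumes prob: "prob_space \<mu>" "prob_space \<nu>" and sets: "sets \<mu> = sets borel" "sets \<nu> = sets borel"
    and \<pi>: "\<And>m. \<pi> m \<in> couplings \<mu> \<nu>" and \<Lambda>: "\<Lambda> \<in> couplings \<mu> \<nu>"
    and G: "Int_stable G" "sigma_sets UNIV G = sets borel"
    and conv: "\<And>A B. A \<in> G \<Longrightarrow> B \<in> G \<Longrightarrow> (\<lambda>m. measure (\<pi> m) (A \<times> B)) \<longlonglongrightarrow> measure \<Lambda> (A \<times> B)"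
    and A: "A \<in> sets borel" and B: "B \<in> sets borel"
  shows "(\<lambda>m. measure (\<pi> m) (A \<times> B)) \<longlonglongrightarrow> measure \<Lambda> (A \<times> B)"
proof -
  interpret \<mu>: prob_space \<mu> by fact
  interpret \<nu>: prob_space \<nu> by fact
  interpret \<pi>: prob_space "\<pi> m" for m by (rule prob_space_coupling[OF \<pi> prob(1)])
  interpret \<Lambda>: prob_space \<Lambda> by (rule prob_space_coupling[OF \<Lambda> prob(1)])
  have se: "sets P = sets (borel \<Otimes>\<^sub>M borel)" if "P \<in> couplings \<mu> \<nu>" for P
    using coupling_sets[OF that] sets by (metis sets_pair_measure_cong)
  have GU: "G \<subseteq> Pow UNIV" by simp
  have rect: "A \<times> B \<in> sets P" if "A \<in> sets borel" "B \<in> sets borel" "P \<in> couplings \<mu> \<nu>" for A B P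
    using that by (simp add: se)
  have UNION1: "(\<lambda>i. measure P (X i \<times> B)) sums measure P (\<Union> (range X) \<times> B)"
    if "P \<in> couplings \<mu> \<nu>" "range X \<subseteq> sets borel" "disjoint_family X" "B \<in> sets borel" for P X B
  proof -
    interpret P: prob_space P by (rule prob_space_coupling[OF that(1) prob(1)])
    have "(\<lambda>i. measure P (X i \<times> B)) sums measure P (\<Union>i. X i \<times> B)"
      using that by (intro P.finite_measure_UNION) (auto simp: disjoint_family_on_def intro!: rect)
    moreover have "(\<Union>i. X i \<times> B) = \<Union> (range X) \<times> B" by auto
    ultimately show ?thesis by simp
  qed
  have UNION2: "(\<lambda>i. measure P (A \<times> X i)) sums measure P (A \<times> \<Union> (range X))"
    if "P \<in> couplings \<mu> \<nu>" "range X \<subseteq> sets borel" "disjoint_family X" "A \<in> sets borel" for P X A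
  proof -
    interpret P: prob_space P by (rule prob_space_coupling[OF that(1) prob(1)])
    have "(\<lambda>i. measure P (A \<times> X i)) sums measure P (\<Union>i. A \<times> X i)"
      using that by (intro P.finite_measure_UNION) (auto simp: disjoint_family_on_def intro!: rect)
    moreover have "(\<Union>i. A \<times> X i) = A \<times> \<Union> (range X)" by auto
    ultimately show ?thesis by simp
  qed
  have le1: "measure P (A \<times> B) \<le> measure \<mu> A" and le2: "measure P (A \<times> B) \<le> measure \<nu> B"
    if "P \<in> couplings \<mu> \<nu>" "A \<in> sets borel" "B \<in> sets borel" for P A B
  proof -
    interpret P: prob_space P by (rule prob_space_coupling[OF that(1) prob(1)])
    have "measure P (A \<times> B) \<le> measure P (A \<times> UNIV)" using that by (intro P.finite_measure_mono rect) auto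
    then show "measure P (A \<times> B) \<le> measure \<mu> A" using measure_coupling_fst[OF that(1) sets] that by simp
    have "measure P (A \<times> B) \<le> measure P (UNIV \<times> B)" using that by (intro P.finite_measure_mono rect) auto
    then show "measure P (A \<times> B) \<le> measure \<nu> B" using measure_coupling_snd[OF that(1) sets] that by simp
  qed
  have step1: "(\<lambda>m. measure (\<pi> m) (A \<times> B)) \<longlonglongrightarrow> measure \<Lambda> (A \<times> B)" if "A \<in> sets borel" "B \<in> G" for A B
  proof -
    have B: "B \<in> sets borel" using that G(2) by auto
    show ?thesis
    proof (rule dominated_setwise_limit[OF G(1) GU, where h="\<lambda>A. measure \<mu> A" and f="\<lambda>m A. measure (\<pi> m) (A \<times> B)" and g="\<lambda>A. measure \<Lambda> (A \<times> B)"], unfold G(2))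
      show "(\<lambda>m. measure (\<pi> m) (UNIV \<times> B)) \<longlonglongrightarrow> measure \<Lambda> (UNIV \<times> B)"
        using measure_coupling_snd[OF \<pi> sets] measure_coupling_snd[OF \<Lambda> sets] B by simp
      show "summable (\<lambda>i. measure \<mu> (X i))" if "range X \<subseteq> sets borel" "disjoint_family X" for X
        using \<mu>.finite_measure_UNION[of X] that sets by (auto simp: sums_iff)
    qed (use that B in \<open>auto intro!: conv UNION1 le1 \<pi> \<Lambda>\<close>)
  qed
  show ?thesis
  proof (rule dominated_setwise_limit[OF G(1) GU, where h="\<lambda>A. measure \<nu> A" and f="\<lambda>m B. measure (\<pi> m) (A \<times> B)" and g="\<lambda>B. measure \<Lambda> (A \<times> B)"], unfold G(2))
    show "(\<lambda>m. measure (\<pi> m) (A \<times> UNIV)) \<longlonglongrightarrow> measure \<Lambda> (A \<times> UNIV)"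
      using measure_coupling_fst[OF \<pi> sets] measure_coupling_fst[OF \<Lambda> sets] A by simp
    show "summable (\<lambda>i. measure \<nu> (X i))" if "range X \<subseteq> sets borel" "disjoint_family X" for X
      using \<nu>.finite_measure_UNION[of X] that sets by (auto simp: sums_iff)
  qed (use A B in \<open>auto intro!: step1 UNION2 le2 \<pi> \<Lambda>\<close>)
qed

text \<open>Prokhorov's theorem for couplings of fixed marginals: no tightness has to be checked, and no
  regularity of the test sets is needed, because the marginals do not move.\<close>

lemma coupling_sequence_limit:
  fixes \<mu> \<nu> :: "'a::polish_space measure" and \<pi> :: "nat \<Rightarrow> ('a \<times> 'a) measure" and U :: "nat \<Rightarrow> 'a set"
  assumes U: "\<And>n. open (U n)" and \<sigma>: "\<sigma> \<in> borel_measurable bit_space" "\<And>u. \<sigma> (\<lambda>n. u \<in> U n) = u"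
    and prob: "prob_space \<mu>" "prob_space \<nu>" and sets: "sets \<mu> = sets borel" "sets \<nu> = sets borel"
    and \<pi>: "\<And>m. \<pi> m \<in> couplings \<mu> \<nu>"
    and conv: "\<And>I J. finite I \<Longrightarrow> finite J \<Longrightarrow>
       convergent (\<lambda>m. measure (\<pi> m) ({u. \<forall>n\<in>I. u \<in> U n} \<times> {v. \<forall>n\<in>J. v \<in> U n}))"
  obtains \<Lambda> where "\<Lambda> \<in> couplings \<mu> \<nu>"
    and "\<And>A B. A \<in> sets borel \<Longrightarrow> B \<in> sets borel \<Longrightarrow> (\<lambda>m. measure (\<pi> m) (A \<times> B)) \<longlonglongrightarrow> measure \<Lambda> (A \<times> B)"
proof -
  note [measurable] = borel_open[OF U] \<sigma>(1)
  \<comment> \<open>The codes of both coordinates are interleaved into one bit sequence, so that the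
    subsequence limit keeps their joint law.\<close>
  define e1 e2 where "e1 n = sum_encode (Inl n)" and "e2 n = sum_encode (Inr n)" for n :: nat
  define W where "W i = (case sum_decode i of Inl n \<Rightarrow> U n \<times> UNIV | Inr n \<Rightarrow> UNIV \<times> U n)" for i
  have W: "W (e1 n) = U n \<times> UNIV" "W (e2 n) = UNIV \<times> U n" for n by (simp_all add: W_def e1_def e2_def)
  interpret \<mu>: prob_space \<mu> by fact
  interpret \<nu>: prob_space \<nu> by fact
  interpret \<pi>: prob_space "\<pi> m" for m by (rule prob_space_coupling[OF \<pi> prob(1)])
  have sets_\<pi>: "sets (\<pi> m) = sets (borel \<Otimes>\<^sub>M borel)" for m
    using coupling_sets[OF \<pi>] sets by (metis sets_pair_measure_cong)
  have space_\<pi>: "space (\<pi> m) = UNIV" for m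
    using sets_eq_imp_space_eq[OF sets_\<pi>] by (simp add: space_pair_measure)
  have "W n \<in> sets (\<pi> m)" for n m by (simp add: W_def sets_\<pi> split: sum.split)
  from bit_law_subsequence_limit[of \<pi> W, OF \<pi>.prob_space_axioms this]
  obtain s R where s: "strict_mono s" and R: "prob_space R" and sets_R: "sets R = sets bit_space"
    and lim: "\<And>J. finite J \<Longrightarrow> (\<lambda>m. measure (\<pi> (s m)) {x. \<forall>n\<in>J. x \<in> W n}) \<longlonglongrightarrow> measure R {b. \<forall>n\<in>J. b n}"
    unfolding space_\<pi> by auto
  interpret R: prob_space R by fact
  note [measurable_cong] = sets_R sets
  define p1 p2 where "p1 b n = b (e1 n)" and "p2 b n = b (e2 n)" for b :: "nat \<Rightarrow> bool" and n
  have [measurable]: "p1 \<in> bit_space \<rightarrow>\<^sub>M bit_space" "p2 \<in> bit_space \<rightarrow>\<^sub>M bit_space"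
    unfolding p1_def p2_def by (auto intro!: measurable_PiM_single')
  define c where "c u n = (u \<in> U n)" for u n
  have [measurable]: "c \<in> borel \<rightarrow>\<^sub>M bit_space" unfolding c_def by (auto intro!: measurable_PiM_single')
  have \<sigma>c: "\<sigma> (c u) = u" for u by (simp add: c_def[abs_def] \<sigma>(2))
  have lim2: "(\<lambda>m. measure (\<pi> (s m)) ({u. \<forall>n\<in>I. u \<in> U n} \<times> {v. \<forall>n\<in>J. v \<in> U n}))
      \<longlonglongrightarrow> measure R {b. (\<forall>n\<in>I. p1 b n) \<and> (\<forall>n\<in>J. p2 b n)}" if "finite I" "finite J" for I J
  proof -
    have "{x. \<forall>n\<in>e1 ` I \<union> e2 ` J. x \<in> W n} = {u. \<forall>n\<in>I. u \<in> U n} \<times> {v. \<forall>n\<in>J. v \<in> U n}"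
      by (auto simp: ball_Un W)
    moreover have "{b. \<forall>n\<in>e1 ` I \<union> e2 ` J. b n} = {b. (\<forall>n\<in>I. p1 b n) \<and> (\<forall>n\<in>J. p2 b n)}"
      by (auto simp: p1_def p2_def)
    ultimately show ?thesis using lim[of "e1 ` I \<union> e2 ` J"] that by simp
  qed
  have space_R: "space R = UNIV" using sets_eq_imp_space_eq[OF sets_R] by (simp add: space_PiM)
  have meas_U: "{u. \<forall>n\<in>I. u \<in> U n} \<in> sets borel" if "finite I" for I
  proof -
    have "Measurable.pred borel (\<lambda>u. \<forall>n\<in>I. u \<in> U n)" using that by measurable
    then show ?thesis by (simp add: pred_def)
  qed
  have meas_b: "{b. \<forall>n\<in>I. b n} \<in> sets bit_space" if "finite I" for I
    using that unfolding sets_bit_space by blast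
  \<comment> \<open>Agreement on the cylinders of positive bits, an intersection-stable generator,
    identifies the law of one half of the bits with the law of the code under a marginal.\<close>
  have code: "distr R bit_space p = distr \<rho> bit_space c"
    if [measurable]: "p \<in> bit_space \<rightarrow>\<^sub>M bit_space" and sets_\<rho>[measurable_cong]: "sets \<rho> = sets borel" and \<rho>: "prob_space \<rho>"
      and eq: "\<And>I. finite I \<Longrightarrow> measure R {b. \<forall>n\<in>I. p b n} = measure \<rho> {u. \<forall>n\<in>I. u \<in> U n}" for p \<rho>
  proof (rule measure_eqI_generator_eq[where \<Omega>=UNIV and E="{{b. \<forall>n\<in>J. b n} | J. finite J}" and A="\<lambda>_. UNIV"])
    interpret \<rho>: prob_space \<rho> by fact
    have sp: "space \<rho> = UNIV" using sets_eq_imp_space_eq[OF sets_\<rho>] by simp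
    show "Int_stable {{b. \<forall>n\<in>J. b n} | J :: nat set. finite J}"
      using Int_stable_finite_intersections[of "\<lambda>n. {b. b n}"] by simp
    show "emeasure (distr R bit_space p) X = emeasure (distr \<rho> bit_space c) X"
      if X: "X \<in> {{b. \<forall>n\<in>J. b n} | J. finite J}" for X
    proof -
      obtain J where J: "finite J" "X = {b. \<forall>n\<in>J. b n}" using X by blast
      have [measurable]: "X \<in> sets bit_space" using meas_b J by simp
      have "emeasure (distr R bit_space p) X = emeasure R {b. \<forall>n\<in>J. p b n}"
        by (subst emeasure_distr) (auto simp: space_R J(2) vimage_def meas_b J(1))
      also have "\<dots> = emeasure \<rho> {u. \<forall>n\<in>J. u \<in> U n}"
        using eq[OF J(1)] by (simp add: R.emeasure_eq_measure \<rho>.emeasure_eq_measure)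
      also have "\<dots> = emeasure (distr \<rho> bit_space c) X"
        by (subst emeasure_distr) (auto simp: sp J(2) vimage_def c_def meas_b J(1))
      finally show ?thesis .
    qed
    show "range (\<lambda>_. UNIV) \<subseteq> {{b. \<forall>n\<in>J. b n} | J :: nat set. finite J}" by auto
    interpret D: prob_space "distr R bit_space p" by (rule R.prob_space_distr) simp
    show "emeasure (distr R bit_space p) UNIV \<noteq> \<infinity>" by simp
  qed (auto simp: sets_bit_space)
  \<comment> \<open>A cylinder on one side has the same mass under all \<open>\<pi> m\<close>, so
    the limit keeps it.\<close>
  have code1: "distr R bit_space p1 = distr \<mu> bit_space c"
  proof (rule code[OF _ sets(1) prob(1)])
    show "measure R {b. \<forall>n\<in>I. p1 b n} = measure \<mu> {u. \<forall>n\<in>I. u \<in> U n}" if "finite I" for I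
      using LIMSEQ_unique[OF lim2[OF that finite.emptyI]] measure_coupling_fst[OF \<pi> sets meas_U[OF that]] by simp
  qed simp
  have code2: "distr R bit_space p2 = distr \<nu> bit_space c"
  proof (rule code[OF _ sets(2) prob(2)])
    show "measure R {b. \<forall>n\<in>I. p2 b n} = measure \<nu> {u. \<forall>n\<in>I. u \<in> U n}" if "finite I" for I
      using LIMSEQ_unique[OF lim2[OF finite.emptyI that]] measure_coupling_snd[OF \<pi> sets meas_U[OF that]] by simp
  qed simp
  define \<Lambda> where "\<Lambda> = distr R (borel \<Otimes>\<^sub>M borel) (\<lambda>b. (\<sigma> (p1 b), \<sigma> (p2 b)))"
  have marg: "distr R borel (\<lambda>b. \<sigma> (p b)) = \<rho>"
    if [measurable]: "p \<in> bit_space \<rightarrow>\<^sub>M bit_space" and [measurable_cong]: "sets \<rho> = sets borel"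
      and eq: "distr R bit_space p = distr \<rho> bit_space c" for p \<rho>
  proof -
    have "distr R borel (\<lambda>b. \<sigma> (p b)) = distr (distr R bit_space p) borel \<sigma>"
      by (simp add: distr_distr comp_def)
    also have "\<dots> = distr \<rho> borel (\<lambda>u. u)" unfolding eq by (simp add: distr_distr comp_def \<sigma>c)
    also have "\<dots> = \<rho>" using that(2) by (simp add: distr_id2)
    finally show ?thesis .
  qed
  have \<Lambda>: "\<Lambda> \<in> couplings \<mu> \<nu>"
  proof -
    have "distr \<Lambda> \<mu> fst = distr \<Lambda> borel fst" "distr \<Lambda> \<nu> snd = distr \<Lambda> borel snd"
      using sets by (auto intro!: distr_cong)
    moreover have "distr \<Lambda> borel fst = \<mu>" "distr \<Lambda> borel snd = \<nu>"
      using marg[OF _ sets(1) code1] marg[OF _ sets(2) code2] by (simp_all add: \<Lambda>_def distr_distr comp_def)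
    moreover have "sets \<Lambda> = sets (\<mu> \<Otimes>\<^sub>M \<nu>)" using sets by (simp add: \<Lambda>_def cong: sets_pair_measure_cong)
    ultimately show ?thesis by (simp add: couplings_def)
  qed
  \<comment> \<open>A bit sequence drawn from \<open>R\<close> need not be a genuine code. Its
    one-sided law is the law of the codes under a marginal, however, so almost surely decoding and
    coding again returns the same bits.\<close>
  have ae: "AE b in R. \<sigma> (p b) \<in> U n \<longleftrightarrow> p b n"
    if [measurable]: "p \<in> bit_space \<rightarrow>\<^sub>M bit_space" and [measurable_cong]: "sets \<rho> = sets borel"
      and eq: "distr R bit_space p = distr \<rho> bit_space c" for p \<rho> n
  proof -
    have "AE b in distr \<rho> bit_space c. \<sigma> b \<in> U n \<longleftrightarrow> b n"
      by (subst AE_distr_iff) (auto simp: \<sigma>c c_def[of _ n])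
    then have "AE b in distr R bit_space p. \<sigma> b \<in> U n \<longleftrightarrow> b n" by (subst eq)
    then show ?thesis by (subst (asm) AE_distr_iff) auto
  qed
  note ae1 = ae[OF _ sets(1) code1, simplified] and ae2 = ae[OF _ sets(2) code2, simplified]
  let ?G = "{{u. \<forall>n\<in>J. u \<in> U n} | J. finite J}"
  have "(\<lambda>m. measure (\<pi> m) (A \<times> B)) \<longlonglongrightarrow> measure \<Lambda> (A \<times> B)" if AB: "A \<in> ?G" "B \<in> ?G" for A B
  proof -
    obtain I J where IJ: "finite I" "finite J" "A = {u. \<forall>n\<in>I. u \<in> U n}" "B = {u. \<forall>n\<in>J. u \<in> U n}"
      using AB by blast
    have [measurable]: "A \<in> sets borel" "B \<in> sets borel" using meas_U IJ by auto
    have "measure \<Lambda> (A \<times> B) = measure R {b. \<sigma> (p1 b) \<in> A \<and> \<sigma> (p2 b) \<in> B}"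
      unfolding \<Lambda>_def by (subst measure_distr) (auto simp: space_R vimage_def)
    also have "\<dots> = measure R {b. (\<forall>n\<in>I. p1 b n) \<and> (\<forall>n\<in>J. p2 b n)}"
    proof (rule R.finite_measure_eq_AE)
      have "AE b in R. (\<forall>n\<in>I. \<sigma> (p1 b) \<in> U n \<longleftrightarrow> p1 b n) \<and> (\<forall>n\<in>J. \<sigma> (p2 b) \<in> U n \<longleftrightarrow> p2 b n)"
        using IJ ae1 ae2 by (intro AE_conjI AE_finite_allI) auto
      then show "AE b in R. (b \<in> {b. \<sigma> (p1 b) \<in> A \<and> \<sigma> (p2 b) \<in> B}) = (b \<in> {b. (\<forall>n\<in>I. p1 b n) \<and> (\<forall>n\<in>J. p2 b n)})"
        by (rule AE_mp) (auto simp: IJ)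
      have "Measurable.pred R (\<lambda>b. \<sigma> (p1 b) \<in> A \<and> \<sigma> (p2 b) \<in> B)" by measurable
      then show "{b. \<sigma> (p1 b) \<in> A \<and> \<sigma> (p2 b) \<in> B} \<in> sets R" by (simp add: pred_def space_R)
      have "Measurable.pred R (\<lambda>b. (\<forall>n\<in>I. b (e1 n)) \<and> (\<forall>n\<in>J. b (e2 n)))" using IJ by measurable
      then show "{b. (\<forall>n\<in>I. p1 b n) \<and> (\<forall>n\<in>J. p2 b n)} \<in> sets R" by (simp add: pred_def space_R p1_def p2_def)
    qed
    finally have eq: "measure \<Lambda> (A \<times> B) = measure R {b. (\<forall>n\<in>I. p1 b n) \<and> (\<forall>n\<in>J. p2 b n)}" .
    \<comment> \<open>\<open>R\<close> was found along the subsequence \<open>s\<close> only; the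
      assumed convergence of the whole sequence carries its values over.\<close>
    obtain L where L: "(\<lambda>m. measure (\<pi> m) (A \<times> B)) \<longlonglongrightarrow> L"
      using conv[OF IJ(1,2)] by (auto simp: IJ convergent_def)
    have "(\<lambda>m. measure (\<pi> (s m)) (A \<times> B)) \<longlonglongrightarrow> measure \<Lambda> (A \<times> B)"
      unfolding eq unfolding IJ(3,4) by (rule lim2[OF IJ(1,2)])
    then have "L = measure \<Lambda> (A \<times> B)"
      by (rule LIMSEQ_unique[OF LIMSEQ_subseq_LIMSEQ[OF L s, unfolded comp_def]])
    then show ?thesis using L by simp
  qed
  note conv_G = this
  have "(\<lambda>m. measure (\<pi> m) (A \<times> B)) \<longlonglongrightarrow> measure \<Lambda> (A \<times> B)"
    if "A \<in> sets borel" "B \<in> sets borel" for A B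
    by (rule coupling_rectangles_limit[OF prob sets \<pi> \<Lambda> Int_stable_finite_intersections
          sigma_sets_binary_code[OF borel_open[OF U] \<sigma>] conv_G that])
  then show ?thesis using \<Lambda> that by blast
qed

section \<open>Small cells and lower semicontinuity of the transport cost\<close>

lemma small_partition:
  fixes e :: real
  assumes "e > 0"
  obtains C :: "nat \<Rightarrow> 'a::{metric_space, second_countable_topology} set" and c
  where "disjoint_family C" "(\<Union>i. C i) = UNIV" "\<And>i. C i \<in> sets borel" "\<And>i u. u \<in> C i \<Longrightarrow> dist u (c i) < e"
proof -
  obtain D :: "'a set" where D: "countable D" "\<And>X. open X \<Longrightarrow> X \<noteq> {} \<Longrightarrow> \<exists>d\<in>D. d \<in> X"
    using countable_dense_exists by blast
  have "D \<noteq> {}" using D(2)[of UNIV] by auto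
  define a where "a = from_nat_into D"
  have "\<exists>n. u \<in> ball (a n) e" for u
  proof -
    obtain d where d: "d \<in> D" "d \<in> ball u e"
      using D(2)[of "ball u e"] assms centre_in_ball[of u e] by (metis empty_iff open_ball)
    moreover obtain n where "d = a n"
      using d D(1) unfolding a_def by (metis from_nat_into_surj)
    ultimately show ?thesis by (auto simp: dist_commute)
  qed
  then have U: "(\<Union>i. disjointed (\<lambda>n. ball (a n) e) i) = UNIV" by (auto simp: UN_disjointed_eq)
  have sub: "dist u (a i) < e" if "u \<in> disjointed (\<lambda>n. ball (a n) e) i" for u i
    using disjointed_subset[of "\<lambda>n. ball (a n) e" i] that by (auto simp: dist_commute)
  show ?thesis
    by (rule that[OF disjoint_family_disjointed U _ sub])
      (use sets.range_disjointed_sets[of "\<lambda>n. ball (a n) e" borel] in \<open>auto simp: image_subset_iff\<close>)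
qed

lemma partition_sum_eq:
  fixes f :: "nat \<Rightarrow> 'b::semiring_1"
  assumes "disjoint_family C" "u \<in> C i" "i < n"
  shows "(\<Sum>k<n. f k * indicator (C k) u) = f i"
proof -
  have "(\<Sum>k<n. f k * indicator (C k) u) = (\<Sum>k\<in>{i}. f k * indicator (C k) u)"
    by (rule sum.mono_neutral_right) (use assms in \<open>auto simp: disjoint_family_on_def indicator_def split: if_splits\<close>)
  then show ?thesis using assms by simp
qed

text \<open>The distance is unbounded and convergence is known on rectangles. Up to
  \<open>4 * e\<close> the distance is approximated from below by an increasing sequence of finite
  step functions on products of cells; the integrals of these converge, and then \<open>e\<close>
  tends to 0.\<close>

lemma coupling_cost_lower_semicontinuous:
  fixes \<pi> :: "nat \<Rightarrow> ('a::{metric_space, second_countable_topology} \<times> 'a) measure"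
  assumes fin: "\<And>m. finite_measure (\<pi> m)" "finite_measure \<Lambda>"
    and sets: "\<And>m. sets (\<pi> m) = sets (borel \<Otimes>\<^sub>M borel)" "sets \<Lambda> = sets (borel \<Otimes>\<^sub>M borel)"
    and conv: "\<And>A B. A \<in> sets borel \<Longrightarrow> B \<in> sets borel \<Longrightarrow> (\<lambda>m. measure (\<pi> m) (A \<times> B)) \<longlonglongrightarrow> measure \<Lambda> (A \<times> B)"
    and cost: "\<And>m. (\<integral>\<^sup>+ (u, v). ennreal (dist u v) \<partial>\<pi> m) \<le> ennreal (w m)" and w: "w \<longlonglongrightarrow> w0" and w_pos: "\<And>m. 0 \<le> w m"
  shows "(\<integral>\<^sup>+ (u, v). ennreal (dist u v) \<partial>\<Lambda>) \<le> ennreal w0"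
proof -
  note [measurable_cong] = sets
  interpret \<pi>: finite_measure "\<pi> m" for m by (rule fin)
  interpret \<Lambda>: finite_measure \<Lambda> by (rule fin)
  have sp: "space \<Lambda> = UNIV" "space (\<pi> m) = UNIV" for m
    using sets_eq_imp_space_eq[OF sets(2)] sets_eq_imp_space_eq[OF sets(1)] by (simp_all add: space_pair_measure)
  have main: "(\<integral>\<^sup>+ (u, v). ennreal (dist u v) \<partial>\<Lambda>) \<le> ennreal w0 + ennreal (4 * e) * emeasure \<Lambda> UNIV" if "e > 0" for e
  proof -
    obtain C :: "nat \<Rightarrow> 'a set" and c where C: "disjoint_family C" "(\<Union>i. C i) = UNIV"
        and C_meas[measurable]: "\<And>i. C i \<in> sets borel" and c: "\<And>i u. u \<in> C i \<Longrightarrow> dist u (c i) < e"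
      by (rule small_partition[OF \<open>e > 0\<close>]) blast
    \<comment> \<open>For points within \<open>e\<close> of their centres the distance differs from
      that of the centres by at most \<open>2 * e\<close>. Subtracting this keeps the step function
      below the distance and costs \<open>4 * e\<close> in all.\<close>
    define a where "a i j = max 0 (dist (c i) (c j) - 2 * e)" for i j
    define f where "f n p = (\<Sum>i<n. \<Sum>j<n. a i j * indicator (C i \<times> C j) p)" for n p
    have a_pos: "0 \<le> a i j" for i j by (simp add: a_def)
    have f_pos: "0 \<le> f n p" for n p unfolding f_def by (intro sum_nonneg mult_nonneg_nonneg a_pos) simp
    have f_eq: "f n (u, v) = a i j" if "u \<in> C i" "v \<in> C j" "i < n" "j < n" for n u v i j
    proof -
      have "f n (u, v) = (\<Sum>i<n. (\<Sum>j<n. a i j * indicator (C j) v) * indicator (C i) u)"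
        unfolding f_def sum_distrib_right indicator_times fst_conv snd_conv by (simp only: mult_ac)
      also have "\<dots> = (\<Sum>j<n. a i j * indicator (C j) v)" by (rule partition_sum_eq[OF C(1) that(1,3)])
      also have "\<dots> = a i j" by (rule partition_sum_eq[OF C(1) that(2,4)])
      finally show ?thesis .
    qed
    have cell: "\<exists>i. u \<in> C i" for u using C(2) by (metis UNIV_I UN_E)
    have tri: "dist (c i) (c j) \<le> dist u v + 2 * e" "dist u v \<le> dist (c i) (c j) + 2 * e"
      if "u \<in> C i" "v \<in> C j" for u v i j
    proof -
      have "dist (c i) (c j) \<le> dist (c i) u + dist u v + dist v (c j)" "dist u v \<le> dist u (c i) + dist (c i) (c j) + dist (c j) v"
        by (metric, metric)
      then show "dist (c i) (c j) \<le> dist u v + 2 * e" "dist u v \<le> dist (c i) (c j) + 2 * e"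
        using c[OF that(1)] c[OF that(2)] by (simp_all add: dist_commute)
    qed
    have f_mono: "f n p \<le> f m p" if "n \<le> m" for n m p
    proof -
      have "f n p \<le> (\<Sum>i<n. \<Sum>j<m. a i j * indicator (C i \<times> C j) p)"
        unfolding f_def using that by (intro sum_mono sum_mono2) (auto simp: a_pos)
      also have "\<dots> \<le> f m p"
        unfolding f_def using that by (intro sum_mono2) (auto simp: a_pos intro!: sum_nonneg)
      finally show ?thesis .
    qed
    have f_le: "f n (u, v) \<le> dist u v" for n u v
    proof -
      obtain i j where ij: "u \<in> C i" "v \<in> C j" using cell by metis
      have "f n (u, v) \<le> f (max n (max (Suc i) (Suc j))) (u, v)" by (rule f_mono) simp
      also have "\<dots> = a i j" by (rule f_eq[OF ij]) auto
      also have "\<dots> \<le> dist u v" using tri[OF ij] by (simp add: a_def)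
      finally show ?thesis .
    qed
    have f_ge: "ennreal (dist u v) \<le> (SUP n. ennreal (f n (u, v))) + ennreal (4 * e)" for u v
    proof -
      obtain i j where ij: "u \<in> C i" "v \<in> C j" using cell by metis
      let ?n = "max (Suc i) (Suc j)"
      have "dist u v \<le> f ?n (u, v) + 4 * e" using tri[OF ij] by (subst f_eq[OF ij]) (auto simp: a_def)
      then have "ennreal (dist u v) \<le> ennreal (f ?n (u, v)) + ennreal (4 * e)"
        using f_pos \<open>e > 0\<close> by (simp flip: ennreal_plus)
      also have "\<dots> \<le> (SUP n. ennreal (f n (u, v))) + ennreal (4 * e)" by (intro add_mono SUP_upper) auto
      finally show ?thesis .
    qed
    have f_meas[measurable]: "f n \<in> borel_measurable (borel \<Otimes>\<^sub>M borel)" for n unfolding f_def by measurable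
    have f_int: "(\<integral>\<^sup>+ p. ennreal (f n p) \<partial>M) = ennreal (\<Sum>i<n. \<Sum>j<n. a i j * measure M (C i \<times> C j))"
      if M: "finite_measure M" and M'[measurable_cong]: "sets M = sets (borel \<Otimes>\<^sub>M borel)" for n M
    proof -
      interpret M: finite_measure M by fact
      have "(\<integral>\<^sup>+ p. ennreal (f n p) \<partial>M) = (\<integral>\<^sup>+ p. (\<Sum>i<n. \<Sum>j<n. ennreal (a i j) * indicator (C i \<times> C j) p) \<partial>M)"
        unfolding f_def by (simp add: sum_nonneg a_pos ennreal_mult'' ennreal_indicator flip: sum_ennreal)
      also have "\<dots> = (\<Sum>i<n. \<integral>\<^sup>+ p. (\<Sum>j<n. ennreal (a i j) * indicator (C i \<times> C j) p) \<partial>M)"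
        by (rule nn_integral_sum) measurable
      also have "\<dots> = (\<Sum>i<n. \<Sum>j<n. \<integral>\<^sup>+ p. ennreal (a i j) * indicator (C i \<times> C j) p \<partial>M)"
        by (intro sum.cong refl nn_integral_sum) measurable
      also have "\<dots> = (\<Sum>i<n. \<Sum>j<n. ennreal (a i j) * emeasure M (C i \<times> C j))"
        by (intro sum.cong refl nn_integral_cmult_indicator) (simp add: M')
      also have "\<dots> = ennreal (\<Sum>i<n. \<Sum>j<n. a i j * measure M (C i \<times> C j))"
        by (simp add: sum_nonneg a_pos ennreal_mult'' M.emeasure_eq_measure flip: sum_ennreal)
      finally show ?thesis .
    qed
    have "(\<integral>\<^sup>+ p. ennreal (f n p) \<partial>\<Lambda>) \<le> ennreal w0" for n
    proof -
      have "(\<Sum>i<n. \<Sum>j<n. a i j * measure \<Lambda> (C i \<times> C j)) \<le> w0"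
      proof (rule LIMSEQ_le[OF _ w])
        show "(\<lambda>m. \<Sum>i<n. \<Sum>j<n. a i j * measure (\<pi> m) (C i \<times> C j)) \<longlonglongrightarrow> (\<Sum>i<n. \<Sum>j<n. a i j * measure \<Lambda> (C i \<times> C j))"
          by (intro tendsto_intros conv C_meas)
        have "ennreal (\<Sum>i<n. \<Sum>j<n. a i j * measure (\<pi> m) (C i \<times> C j)) \<le> ennreal (w m)" for m
        proof -
          have "(\<integral>\<^sup>+ p. ennreal (f n p) \<partial>\<pi> m) \<le> (\<integral>\<^sup>+ (u, v). ennreal (dist u v) \<partial>\<pi> m)"
            by (intro nn_integral_mono) (auto intro!: ennreal_leI f_le)
          then show ?thesis using cost[of m] f_int[OF fin(1) sets(1)] by simp
        qed
        then show "\<exists>N. \<forall>m\<ge>N. (\<Sum>i<n. \<Sum>j<n. a i j * measure (\<pi> m) (C i \<times> C j)) \<le> w m"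
          using w_pos by (simp add: ennreal_le_iff)
      qed
      then show ?thesis by (simp add: f_int[OF fin(2) sets(2)] ennreal_leI)
    qed
    then have "(SUP n. \<integral>\<^sup>+ p. ennreal (f n p) \<partial>\<Lambda>) \<le> ennreal w0" by (intro SUP_least)
    moreover have "(SUP n. \<integral>\<^sup>+ p. ennreal (f n p) \<partial>\<Lambda>) = (\<integral>\<^sup>+ p. (SUP n. ennreal (f n p)) \<partial>\<Lambda>)"
      by (rule nn_integral_monotone_convergence_SUP[symmetric])
        (auto simp: incseq_def le_fun_def intro!: ennreal_leI f_mono)
    ultimately have *: "(\<integral>\<^sup>+ p. (SUP n. ennreal (f n p)) \<partial>\<Lambda>) \<le> ennreal w0" by simp
    have "(\<integral>\<^sup>+ (u, v). ennreal (dist u v) \<partial>\<Lambda>) \<le> (\<integral>\<^sup>+ p. (SUP n. ennreal (f n p)) + ennreal (4 * e) \<partial>\<Lambda>)"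
      using f_ge by (intro nn_integral_mono) auto
    also have "\<dots> = (\<integral>\<^sup>+ p. (SUP n. ennreal (f n p)) \<partial>\<Lambda>) + ennreal (4 * e) * emeasure \<Lambda> UNIV"
      by (subst nn_integral_add) (auto simp: sp)
    finally show ?thesis using * by (meson add_right_mono order_trans)
  qed
  have "(\<lambda>n. ennreal w0 + ennreal (4 * (1 / real (Suc n))) * emeasure \<Lambda> UNIV) \<longlonglongrightarrow> ennreal w0 + ennreal (4 * 0) * emeasure \<Lambda> UNIV"
  proof (intro tendsto_intros tendsto_ennrealI)
    show "(\<lambda>n. 1 / real (Suc n)) \<longlonglongrightarrow> 0" using LIMSEQ_Suc lim_1_over_n by blast
  qed (auto simp: \<Lambda>.emeasure_eq_measure)
  then have "(\<lambda>n. ennreal w0 + ennreal (4 * (1 / real (Suc n))) * emeasure \<Lambda> UNIV) \<longlonglongrightarrow> ennreal w0" by simp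
  then show ?thesis by (rule LIMSEQ_le_const) (intro exI allI impI main, simp)
qed

section \<open>A countable dense family of couplings\<close>

text \<open>A partial plan with density \<open>s\<close> whose marginal densities are at most 1
  leaves \<open>1 - s1\<close> and \<open>1 - s2\<close> unplaced, of mass \<open>1 - m\<close> on
  either side; their normalised product places them. For \<open>m = 1\<close> the quotient is 0 by
  convention, and the unplaced parts vanish almost everywhere. As \<open>d u v\<close> is at most
  \<open>f u + g v\<close>, the completion is paid for by \<open>f\<close> and \<open>g\<close> on
  the unplaced parts.\<close>

lemma density_coupling:
  fixes s :: "'a \<times> 'b \<Rightarrow> real"
  assumes prob: "prob_space \<mu>" "prob_space \<nu>"
    and [measurable]: "s \<in> borel_measurable (\<mu> \<Otimes>\<^sub>M \<nu>)" "s1 \<in> borel_measurable \<mu>" "s2 \<in> borel_measurable \<nu>"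
    and s_pos: "\<And>p. 0 \<le> s p" and s1: "\<And>u. 0 \<le> s1 u" "\<And>u. s1 u \<le> 1" and s2: "\<And>v. 0 \<le> s2 v" "\<And>v. s2 v \<le> 1"
    and s1_eq: "\<And>u. u \<in> space \<mu> \<Longrightarrow> (\<integral>\<^sup>+ v. s (u, v) \<partial>\<nu>) = ennreal (s1 u)"
    and s2_eq: "\<And>v. v \<in> space \<nu> \<Longrightarrow> (\<integral>\<^sup>+ u. s (u, v) \<partial>\<mu>) = ennreal (s2 v)"
    and m: "(\<integral>\<^sup>+ u. s1 u \<partial>\<mu>) = ennreal m" "0 \<le> m"
  defines "\<pi> \<equiv> density (\<mu> \<Otimes>\<^sub>M \<nu>) (\<lambda>(u, v). ennreal (s (u, v) + (1 - s1 u) * (1 - s2 v) / (1 - m)))"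
  shows "\<pi> \<in> couplings \<mu> \<nu>"
    and "\<And>d f g. \<lbrakk>case_prod d \<in> borel_measurable (\<mu> \<Otimes>\<^sub>M \<nu>); f \<in> borel_measurable \<mu>; g \<in> borel_measurable \<nu>;
          \<And>u v. 0 \<le> f u \<and> 0 \<le> g v \<and> d u v \<le> f u + g v\<rbrakk> \<Longrightarrow>
       (\<integral>\<^sup>+ (u, v). ennreal (d u v) \<partial>\<pi>) \<le> (\<integral>\<^sup>+ (u, v). ennreal (d u v) * ennreal (s (u, v)) \<partial>(\<mu> \<Otimes>\<^sub>M \<nu>))
          + (\<integral>\<^sup>+ u. ennreal (f u) * ennreal (1 - s1 u) \<partial>\<mu>) + (\<integral>\<^sup>+ v. ennreal (g v) * ennreal (1 - s2 v) \<partial>\<nu>)"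
proof -
  interpret \<mu>: prob_space \<mu> by fact
  interpret \<nu>: prob_space \<nu> by fact
  interpret P: pair_prob_space \<mu> \<nu> ..
  have m2: "(\<integral>\<^sup>+ v. s2 v \<partial>\<nu>) = ennreal m"
  proof -
    have "(\<integral>\<^sup>+ v. s2 v \<partial>\<nu>) = (\<integral>\<^sup>+ v. (\<integral>\<^sup>+ u. s (u, v) \<partial>\<mu>) \<partial>\<nu>)" by (intro nn_integral_cong) (simp add: s2_eq)
    also have "\<dots> = (\<integral>\<^sup>+ u. (\<integral>\<^sup>+ v. s (u, v) \<partial>\<nu>) \<partial>\<mu>)" by (rule P.Fubini') simp
    also have "\<dots> = (\<integral>\<^sup>+ u. s1 u \<partial>\<mu>)" by (intro nn_integral_cong) (simp add: s1_eq)
    finally show ?thesis by (simp add: m)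
  qed
  have "ennreal m \<le> (\<integral>\<^sup>+ u. 1 \<partial>\<mu>)" unfolding m(1)[symmetric] by (intro nn_integral_mono) (simp add: s1)
  then have m1: "m \<le> 1" by (simp add: \<mu>.emeasure_space_1)
  have compl: "(\<integral>\<^sup>+ x. ennreal (1 - r x) \<partial>N) = ennreal (1 - m)"
    if N: "prob_space N" and [measurable]: "r \<in> borel_measurable N"
      and r: "\<And>x. 0 \<le> r x" "\<And>x. r x \<le> 1" "(\<integral>\<^sup>+ x. r x \<partial>N) = ennreal m" for N and r :: "_ \<Rightarrow> real"
  proof -
    interpret N: prob_space N by fact
    have "(\<integral>\<^sup>+ x. ennreal (1 - r x) \<partial>N) = (\<integral>\<^sup>+ x. 1 - ennreal (r x) \<partial>N)"
      using r by (intro nn_integral_cong) (simp flip: ennreal_minus)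
    also have "\<dots> = (\<integral>\<^sup>+ x. 1 \<partial>N) - (\<integral>\<^sup>+ x. r x \<partial>N)"
      by (rule nn_integral_diff) (use r in auto)
    finally show ?thesis using r(3) by (simp add: N.emeasure_space_1 ennreal_minus[OF m(2), of 1, simplified])
  qed
  note c1 = compl[OF prob(1) _ s1 m(1), simplified] and c2 = compl[OF prob(2) _ s2 m2, simplified]
  have h_eq: "ennreal (s (u, v) + (1 - s1 u) * (1 - s2 v) / (1 - m)) =
      ennreal (s (u, v)) + ennreal (1 - s1 u) * ennreal (1 - s2 v) * ennreal (1 / (1 - m))" for u v
    using s1 s2 s_pos m1 by (simp add: divide_inverse flip: ennreal_plus ennreal_mult)
  have marginal: "AE x in N. q x + ennreal (1 - r x) * ennreal (1 - m) * ennreal (1 / (1 - m)) = 1"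
    if N: "prob_space N" and [measurable]: "r \<in> borel_measurable N"
      and r: "\<And>x. 0 \<le> r x" "\<And>x. r x \<le> 1" "(\<integral>\<^sup>+ x. r x \<partial>N) = ennreal m" and q: "\<And>x. x \<in> space N \<Longrightarrow> q x = ennreal (r x)"
    for N and r :: "_ \<Rightarrow> real" and q
  proof (cases "m = 1")
    case True
    then have "(\<integral>\<^sup>+ x. ennreal (1 - r x) \<partial>N) = 0" by (simp add: compl[OF N _ r])
    then have "AE x in N. ennreal (1 - r x) = 0" by (subst (asm) nn_integral_0_iff_AE) auto
    then have "AE x in N. r x = 1" by (rule AE_mp) (use r(2) in \<open>auto simp: antisym_conv ennreal_eq_0_iff\<close>)
    then show ?thesis by (rule AE_mp) (auto simp: True q)
  next
    case False
    then have "ennreal (1 - m) * ennreal (1 / (1 - m)) = 1"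
      using m1 by (simp flip: ennreal_mult)
    then have "q x + ennreal (1 - r x) * ennreal (1 - m) * ennreal (1 / (1 - m)) = 1" if "x \<in> space N" for x
      using r q[OF that] by (simp add: mult.assoc flip: ennreal_plus)
    then show ?thesis by auto
  qed
  have h_meas[measurable]: "(\<lambda>(u, v). ennreal (s (u, v) + (1 - s1 u) * (1 - s2 v) / (1 - m))) \<in> borel_measurable (\<mu> \<Otimes>\<^sub>M \<nu>)"
    by measurable
  have em: "emeasure \<pi> X = (\<integral>\<^sup>+ p. ennreal (s p) * indicator X p + ennreal (1 - s1 (fst p)) * ennreal (1 - s2 (snd p)) * ennreal (1 / (1 - m)) * indicator X p \<partial>(\<mu> \<Otimes>\<^sub>M \<nu>))"
    if "X \<in> sets (\<mu> \<Otimes>\<^sub>M \<nu>)" for X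
    unfolding \<pi>_def using that
    by (subst emeasure_density) (auto intro!: nn_integral_cong simp: h_eq distrib_right)
  show "\<pi> \<in> couplings \<mu> \<nu>" unfolding couplings_iff
  proof (intro conjI ballI)
    show "sets \<pi> = sets (\<mu> \<Otimes>\<^sub>M \<nu>)" by (simp add: \<pi>_def)
    show "emeasure \<pi> (A \<times> space \<nu>) = emeasure \<mu> A" if A[measurable]: "A \<in> sets \<mu>" for A
    proof -
      have "emeasure \<pi> (A \<times> space \<nu>) = (\<integral>\<^sup>+ u. (\<integral>\<^sup>+ v. ennreal (s (u, v)) * indicator (A \<times> space \<nu>) (u, v) +
          ennreal (1 - s1 u) * ennreal (1 - s2 v) * ennreal (1 / (1 - m)) * indicator (A \<times> space \<nu>) (u, v) \<partial>\<nu>) \<partial>\<mu>)"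
        by (subst em) (auto simp: \<nu>.nn_integral_fst[symmetric])
      also have "\<dots> = (\<integral>\<^sup>+ u. (ennreal (s1 u) + ennreal (1 - s1 u) * ennreal (1 - m) * ennreal (1 / (1 - m))) * indicator A u \<partial>\<mu>)"
      proof (intro nn_integral_cong)
        fix u assume [simp]: "u \<in> space \<mu>"
        have "(\<integral>\<^sup>+ v. ennreal (s (u, v)) * indicator (A \<times> space \<nu>) (u, v) +
          ennreal (1 - s1 u) * ennreal (1 - s2 v) * ennreal (1 / (1 - m)) * indicator (A \<times> space \<nu>) (u, v) \<partial>\<nu>)
          = (\<integral>\<^sup>+ v. ennreal (s (u, v)) * indicator A u + ennreal (1 - s2 v) * (ennreal (1 - s1 u) * ennreal (1 / (1 - m)) * indicator A u) \<partial>\<nu>)"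
          by (intro nn_integral_cong) (auto simp: indicator_times mult_ac)
        also have "\<dots> = (ennreal (s1 u) + ennreal (1 - s1 u) * ennreal (1 - m) * ennreal (1 / (1 - m))) * indicator A u"
          by (subst nn_integral_add, simp, simp, simp add: nn_integral_multc s1_eq c2, simp add: algebra_simps)
        finally show "(\<integral>\<^sup>+ v. ennreal (s (u, v)) * indicator (A \<times> space \<nu>) (u, v) +
          ennreal (1 - s1 u) * ennreal (1 - s2 v) * ennreal (1 / (1 - m)) * indicator (A \<times> space \<nu>) (u, v) \<partial>\<nu>) = \<dots>" .
      qed
      also have "\<dots> = (\<integral>\<^sup>+ u. 1 * indicator A u \<partial>\<mu>)"
      proof (rule nn_integral_cong_AE)
        have "AE u in \<mu>. ennreal (s1 u) + ennreal (1 - s1 u) * ennreal (1 - m) * ennreal (1 / (1 - m)) = 1"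
          by (rule marginal[OF prob(1) _ s1 m(1)]) auto
        then show "AE u in \<mu>. (ennreal (s1 u) + ennreal (1 - s1 u) * ennreal (1 - m) * ennreal (1 / (1 - m))) * indicator A u = 1 * indicator A u"
          by (rule AE_mp) auto
      qed
      finally show ?thesis by simp
    qed
    show "emeasure \<pi> (space \<mu> \<times> A) = emeasure \<nu> A" if A[measurable]: "A \<in> sets \<nu>" for A
    proof -
      have "emeasure \<pi> (space \<mu> \<times> A) = (\<integral>\<^sup>+ v. (\<integral>\<^sup>+ u. ennreal (s (u, v)) * indicator (space \<mu> \<times> A) (u, v) +
          ennreal (1 - s1 u) * ennreal (1 - s2 v) * ennreal (1 / (1 - m)) * indicator (space \<mu> \<times> A) (u, v) \<partial>\<mu>) \<partial>\<nu>)"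
        by (subst em) (auto simp: P.nn_integral_snd[symmetric])
      also have "\<dots> = (\<integral>\<^sup>+ v. (ennreal (s2 v) + ennreal (1 - s2 v) * ennreal (1 - m) * ennreal (1 / (1 - m))) * indicator A v \<partial>\<nu>)"
      proof (intro nn_integral_cong)
        fix v assume [simp]: "v \<in> space \<nu>"
        have "(\<integral>\<^sup>+ u. ennreal (s (u, v)) * indicator (space \<mu> \<times> A) (u, v) +
          ennreal (1 - s1 u) * ennreal (1 - s2 v) * ennreal (1 / (1 - m)) * indicator (space \<mu> \<times> A) (u, v) \<partial>\<mu>)
          = (\<integral>\<^sup>+ u. ennreal (s (u, v)) * indicator A v + ennreal (1 - s1 u) * (ennreal (1 - s2 v) * ennreal (1 / (1 - m)) * indicator A v) \<partial>\<mu>)"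
          by (intro nn_integral_cong) (auto simp: indicator_times mult_ac)
        also have "\<dots> = (ennreal (s2 v) + ennreal (1 - s2 v) * ennreal (1 - m) * ennreal (1 / (1 - m))) * indicator A v"
          by (subst nn_integral_add, simp, simp, simp add: nn_integral_multc s2_eq c1, simp add: algebra_simps)
        finally show "(\<integral>\<^sup>+ u. ennreal (s (u, v)) * indicator (space \<mu> \<times> A) (u, v) +
          ennreal (1 - s1 u) * ennreal (1 - s2 v) * ennreal (1 / (1 - m)) * indicator (space \<mu> \<times> A) (u, v) \<partial>\<mu>) = \<dots>" .
      qed
      also have "\<dots> = (\<integral>\<^sup>+ v. 1 * indicator A v \<partial>\<nu>)"
      proof (rule nn_integral_cong_AE)
        have "AE v in \<nu>. ennreal (s2 v) + ennreal (1 - s2 v) * ennreal (1 - m) * ennreal (1 / (1 - m)) = 1"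
          by (rule marginal[OF prob(2) _ s2 m2]) auto
        then show "AE v in \<nu>. (ennreal (s2 v) + ennreal (1 - s2 v) * ennreal (1 - m) * ennreal (1 / (1 - m))) * indicator A v = 1 * indicator A v"
          by (rule AE_mp) auto
      qed
      finally show ?thesis by simp
    qed
  qed
  fix d :: "'a \<Rightarrow> 'b \<Rightarrow> real" and f g
  assume [measurable]: "case_prod d \<in> borel_measurable (\<mu> \<Otimes>\<^sub>M \<nu>)" "f \<in> borel_measurable \<mu>" "g \<in> borel_measurable \<nu>"
    and fg: "\<And>u v. 0 \<le> f u \<and> 0 \<le> g v \<and> d u v \<le> f u + g v"
  let ?F = "\<lambda>u. ennreal (f u) * ennreal (1 - s1 u)" and ?G = "\<lambda>v. ennreal (g v) * ennreal (1 - s2 v)"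
  let ?c = "ennreal (1 / (1 - m))"
  \<comment> \<open>Equal to 1 except for \<open>m = 1\<close>, where division by zero makes it
    0.\<close>
  have c_le: "ennreal (1 - m) * ?c \<le> 1" using m1 by (cases "m = 1") (auto simp flip: ennreal_mult)
  have "(\<integral>\<^sup>+ (u, v). ennreal (d u v) \<partial>\<pi>) = (\<integral>\<^sup>+ p. (\<lambda>(u, v). ennreal (s (u, v) + (1 - s1 u) * (1 - s2 v) / (1 - m))) p * (\<lambda>(u, v). ennreal (d u v)) p \<partial>(\<mu> \<Otimes>\<^sub>M \<nu>))"
    unfolding \<pi>_def by (rule nn_integral_density) measurable
  also have "\<dots> \<le> (\<integral>\<^sup>+ p. (\<lambda>(u, v). ennreal (d u v) * ennreal (s (u, v))) p +
      (?F (fst p) * ennreal (1 - s2 (snd p)) * ?c + ennreal (1 - s1 (fst p)) * ?G (snd p) * ?c) \<partial>(\<mu> \<Otimes>\<^sub>M \<nu>))"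
  proof (intro nn_integral_mono)
    fix p :: "'a \<times> 'b"
    obtain u v where p: "p = (u, v)" by (cases p)
    have "ennreal (s (u, v) + (1 - s1 u) * (1 - s2 v) / (1 - m)) * ennreal (d u v)
       = ennreal (d u v) * ennreal (s (u, v)) + ennreal (d u v) * (ennreal (1 - s1 u) * ennreal (1 - s2 v) * ?c)"
      unfolding h_eq by (simp add: algebra_simps)
    also have "\<dots> \<le> ennreal (d u v) * ennreal (s (u, v)) + (ennreal (f u) + ennreal (g v)) * (ennreal (1 - s1 u) * ennreal (1 - s2 v) * ?c)"
      using fg[of u v] by (intro add_left_mono mult_right_mono) (auto simp: ennreal_leI simp flip: ennreal_plus)
    finally show "(\<lambda>(u, v). ennreal (s (u, v) + (1 - s1 u) * (1 - s2 v) / (1 - m))) p * (\<lambda>(u, v). ennreal (d u v)) p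
       \<le> (\<lambda>(u, v). ennreal (d u v) * ennreal (s (u, v))) p +
      (?F (fst p) * ennreal (1 - s2 (snd p)) * ?c + ennreal (1 - s1 (fst p)) * ?G (snd p) * ?c)"
      unfolding p by (simp add: algebra_simps)
  qed
  also have "\<dots> = (\<integral>\<^sup>+ (u, v). ennreal (d u v) * ennreal (s (u, v)) \<partial>(\<mu> \<Otimes>\<^sub>M \<nu>)) +
      ((\<integral>\<^sup>+ p. ?F (fst p) * ennreal (1 - s2 (snd p)) * ?c \<partial>(\<mu> \<Otimes>\<^sub>M \<nu>)) + (\<integral>\<^sup>+ p. ennreal (1 - s1 (fst p)) * ?G (snd p) * ?c \<partial>(\<mu> \<Otimes>\<^sub>M \<nu>)))"
    by (simp add: nn_integral_add)
  also have "(\<integral>\<^sup>+ p. ?F (fst p) * ennreal (1 - s2 (snd p)) * ?c \<partial>(\<mu> \<Otimes>\<^sub>M \<nu>)) = (\<integral>\<^sup>+ u. ?F u \<partial>\<mu>) * (ennreal (1 - m) * ?c)"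
    by (simp add: \<nu>.nn_integral_fst[symmetric] nn_integral_multc nn_integral_cmult c2) (simp add: mult.assoc)
  also have "(\<integral>\<^sup>+ p. ennreal (1 - s1 (fst p)) * ?G (snd p) * ?c \<partial>(\<mu> \<Otimes>\<^sub>M \<nu>)) = (\<integral>\<^sup>+ v. ?G v \<partial>\<nu>) * (ennreal (1 - m) * ?c)"
    by (simp add: P.nn_integral_snd[symmetric] nn_integral_multc nn_integral_cmult c1) (simp add: mult_ac)
  also have "(\<integral>\<^sup>+ (u, v). ennreal (d u v) * ennreal (s (u, v)) \<partial>(\<mu> \<Otimes>\<^sub>M \<nu>)) +
      ((\<integral>\<^sup>+ u. ?F u \<partial>\<mu>) * (ennreal (1 - m) * ?c) + (\<integral>\<^sup>+ v. ?G v \<partial>\<nu>) * (ennreal (1 - m) * ?c))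
     \<le> (\<integral>\<^sup>+ (u, v). ennreal (d u v) * ennreal (s (u, v)) \<partial>(\<mu> \<Otimes>\<^sub>M \<nu>)) + ((\<integral>\<^sup>+ u. ?F u \<partial>\<mu>) * 1 + (\<integral>\<^sup>+ v. ?G v \<partial>\<nu>) * 1)"
    by (intro add_left_mono add_mono mult_left_mono c_le) auto
  finally show "(\<integral>\<^sup>+ (u, v). ennreal (d u v) \<partial>\<pi>) \<le> (\<integral>\<^sup>+ (u, v). ennreal (d u v) * ennreal (s (u, v)) \<partial>(\<mu> \<Otimes>\<^sub>M \<nu>))
          + (\<integral>\<^sup>+ u. ennreal (f u) * ennreal (1 - s1 u) \<partial>\<mu>) + (\<integral>\<^sup>+ v. ennreal (g v) * ennreal (1 - s2 v) \<partial>\<nu>)"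
    by (simp add: add.assoc)
qed

text \<open>By dominated convergence the part of \<open>f\<close> above some level \<open>k\<close>
  has integral below \<open>e / 2\<close>; where \<open>f\<close> is at most the level, the product
  with \<open>r\<close> is at most the level times \<open>r\<close>.\<close>

lemma small_mass_small_integral:
  fixes f :: "'a \<Rightarrow> real"
  assumes [measurable]: "f \<in> borel_measurable M" and f: "\<And>x. 0 \<le> f x" "(\<integral>\<^sup>+ x. f x \<partial>M) < \<infinity>" and e: "e > 0"
  obtains \<delta> where "\<delta> > 0"
    and "\<And>r. r \<in> borel_measurable M \<Longrightarrow> (\<And>x. 0 \<le> r x \<and> r x \<le> 1) \<Longrightarrow> (\<integral>\<^sup>+ x. ennreal (r x) \<partial>M) \<le> ennreal \<delta>
          \<Longrightarrow> (\<integral>\<^sup>+ x. ennreal (f x) * ennreal (r x) \<partial>M) \<le> ennreal e"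
proof -
  have "(\<lambda>k. \<integral>\<^sup>+ x. ennreal (f x) * indicator {x. f x > real k} x \<partial>M) \<longlonglongrightarrow> (\<integral>\<^sup>+ x. 0 \<partial>M)"
  proof (rule nn_integral_dominated_convergence[where w="\<lambda>x. ennreal (f x)"])
    show "AE x in M. (\<lambda>k. ennreal (f x) * indicator {x. f x > real k} x) \<longlonglongrightarrow> 0"
    proof (rule AE_I2)
      fix x
      have "eventually (\<lambda>k. f x \<le> real k) sequentially"
        by (meson eventually_sequentiallyI le_nat_iff nat_ceiling_le_eq order.trans real_nat_ceiling_ge of_nat_mono)
      then have "eventually (\<lambda>k. ennreal (f x) * indicator {x. f x > real k} x = 0) sequentially"
        by eventually_elim auto
      then show "(\<lambda>k. ennreal (f x) * indicator {x. f x > real k} x) \<longlonglongrightarrow> 0" by (rule tendsto_eventually)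
    qed
  qed (use f in \<open>auto intro!: AE_I2 simp: indicator_def\<close>)
  then have "eventually (\<lambda>k. (\<integral>\<^sup>+ x. ennreal (f x) * indicator {x. f x > real k} x \<partial>M) < ennreal (e / 2)) sequentially"
    using e by (intro order_tendstoD) auto
  then obtain k where k: "(\<integral>\<^sup>+ x. ennreal (f x) * indicator {x. f x > real k} x \<partial>M) < ennreal (e / 2)"
    by (meson eventually_sequentially order_refl)
  show ?thesis
  proof
    \<comment> \<open>Half of \<open>e\<close> divided by the level; \<open>real k + 1\<close> keeps
      the divisor positive.\<close>
    show "e / (2 * (real k + 1)) > 0" using e by simp
    fix r assume [measurable]: "r \<in> borel_measurable M" and r: "\<And>x. 0 \<le> r x \<and> r x \<le> 1"
      and small: "(\<integral>\<^sup>+ x. ennreal (r x) \<partial>M) \<le> ennreal (e / (2 * (real k + 1)))"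
    have "(\<integral>\<^sup>+ x. ennreal (f x) * ennreal (r x) \<partial>M) \<le> (\<integral>\<^sup>+ x. ennreal (f x) * indicator {x. f x > real k} x + ennreal (real k + 1) * ennreal (r x) \<partial>M)"
    proof (intro nn_integral_mono)
      fix x
      show "ennreal (f x) * ennreal (r x) \<le> ennreal (f x) * indicator {x. f x > real k} x + ennreal (real k + 1) * ennreal (r x)"
      proof (cases "f x > real k")
        case True
        have "ennreal (f x) * ennreal (r x) \<le> ennreal (f x) * 1" using r[of x] by (intro mult_left_mono) (auto simp: ennreal_le_1)
        then show ?thesis using True by (simp add: add_increasing2)
      next
        case False
        then have "ennreal (f x) \<le> ennreal (real k + 1)" by (intro ennreal_leI) simp
        then show ?thesis using False by (auto intro!: mult_right_mono)
      qed
    qed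
    also have "\<dots> = (\<integral>\<^sup>+ x. ennreal (f x) * indicator {x. f x > real k} x \<partial>M) + ennreal (real k + 1) * (\<integral>\<^sup>+ x. ennreal (r x) \<partial>M)"
      by (simp add: nn_integral_add nn_integral_cmult)
    also have "\<dots> \<le> ennreal (e / 2) + ennreal (real k + 1) * ennreal (e / (2 * (real k + 1)))"
      using k small by (intro add_mono mult_left_mono) auto
    also have "\<dots> = ennreal (e / 2 + (real k + 1) * (e / (2 * (real k + 1))))"
      using e by (simp flip: ennreal_mult ennreal_plus)
    also have "e / 2 + (real k + 1) * (e / (2 * (real k + 1))) = e" by (simp add: field_simps)
    finally show "(\<integral>\<^sup>+ x. ennreal (f x) * ennreal (r x) \<partial>M) \<le> ennreal e" .
  qed
qed

section \<open>Step couplings over finitely many cells\<close>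

definition step_fun :: "(nat \<Rightarrow> 'a set) \<Rightarrow> nat \<Rightarrow> (nat \<Rightarrow> nat \<Rightarrow> real) \<Rightarrow> 'a \<times> 'a \<Rightarrow> real" where
  "step_fun C n r p = (\<Sum>i<n. \<Sum>j<n. r i j * (indicator (C i) (fst p) * indicator (C j) (snd p)))"

definition step_fst :: "(nat \<Rightarrow> 'a set) \<Rightarrow> nat \<Rightarrow> (nat \<Rightarrow> nat \<Rightarrow> real) \<Rightarrow> 'a measure \<Rightarrow> 'a \<Rightarrow> real" where
  "step_fst C n r \<nu> u = (\<Sum>i<n. (\<Sum>j<n. r i j * measure \<nu> (C j)) * indicator (C i) u)"

definition step_snd :: "(nat \<Rightarrow> 'a set) \<Rightarrow> nat \<Rightarrow> (nat \<Rightarrow> nat \<Rightarrow> real) \<Rightarrow> 'a measure \<Rightarrow> 'a \<Rightarrow> real" where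
  "step_snd C n r \<mu> v = (\<Sum>j<n. (\<Sum>i<n. r i j * measure \<mu> (C i)) * indicator (C j) v)"

definition step_mass :: "(nat \<Rightarrow> 'a set) \<Rightarrow> nat \<Rightarrow> (nat \<Rightarrow> nat \<Rightarrow> real) \<Rightarrow> 'a measure \<Rightarrow> 'a measure \<Rightarrow> real" where
  "step_mass C n r \<mu> \<nu> = (\<Sum>i<n. \<Sum>j<n. r i j * measure \<mu> (C i) * measure \<nu> (C j))"

text \<open>The marginal densities of the step function are at most 1 on every cell, which is what
  its completion to a coupling requires.\<close>

definition admissible :: "(nat \<Rightarrow> 'a set) \<Rightarrow> nat \<Rightarrow> (nat \<Rightarrow> nat \<Rightarrow> real) \<Rightarrow> 'a measure \<Rightarrow> 'a measure \<Rightarrow> bool" where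
  "admissible C n r \<mu> \<nu> \<longleftrightarrow> (\<forall>i<n. (\<Sum>j<n. r i j * measure \<nu> (C j)) \<le> 1) \<and>
     (\<forall>j<n. (\<Sum>i<n. r i j * measure \<mu> (C i)) \<le> 1)"

text \<open>Falling back to the zero matrix, hence to the product measure, makes every nonnegative
  matrix yield a coupling for every pair of marginals; the case distinction is measurable in the
  pair.\<close>

definition if_admissible :: "(nat \<Rightarrow> 'a set) \<Rightarrow> nat \<Rightarrow> (nat \<Rightarrow> nat \<Rightarrow> real) \<Rightarrow> 'a measure \<Rightarrow> 'a measure \<Rightarrow> nat \<Rightarrow> nat \<Rightarrow> real" where
  "if_admissible C n r \<mu> \<nu> i j = (if admissible C n r \<mu> \<nu> then r i j else 0)"

definition step_density :: "(nat \<Rightarrow> 'a set) \<Rightarrow> nat \<Rightarrow> (nat \<Rightarrow> nat \<Rightarrow> real) \<Rightarrow> 'a measure \<Rightarrow> 'a measure \<Rightarrow> 'a \<times> 'a \<Rightarrow> real" where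
  "step_density C n r \<mu> \<nu> = (\<lambda>(u, v). step_fun C n r (u, v) +
     (1 - step_fst C n r \<nu> u) * (1 - step_snd C n r \<mu> v) / (1 - step_mass C n r \<mu> \<nu>))"

text \<open>The density is relative to \<open>\<mu> \<Otimes>\<^sub>M \<nu>\<close> and depends on
  the marginals only through finitely many cell masses. One countable set of rational matrices
  therefore serves all marginals, and measurable dependence on them is inherited.\<close>

definition step_coupling :: "(nat \<Rightarrow> 'a set) \<Rightarrow> nat \<Rightarrow> (nat \<Rightarrow> nat \<Rightarrow> real) \<Rightarrow> 'a measure \<Rightarrow> 'a measure \<Rightarrow> ('a \<times> 'a) measure" where
  "step_coupling C n r \<mu> \<nu> = density (\<mu> \<Otimes>\<^sub>M \<nu>)
     (\<lambda>p. ennreal (step_density C n (if_admissible C n r \<mu> \<nu>) \<mu> \<nu> p))"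

declare sum_mult_indicator [simp del]

lemma partition_sum_le:
  fixes f :: "nat \<Rightarrow> real"
  assumes "disjoint_family C" "\<And>i. i < n \<Longrightarrow> f i \<le> b" "0 \<le> b"
  shows "(\<Sum>i<n. f i * indicator (C i) u) \<le> b"
proof (cases "\<exists>i<n. u \<in> C i")
  case True
  then show ?thesis using assms partition_sum_eq[OF assms(1)] by metis
next
  case False
  then have "(\<Sum>i<n. f i * indicator (C i) u) = (\<Sum>i<n. 0)" by (intro sum.cong) auto
  then show ?thesis using assms by simp
qed

lemma
  fixes C :: "nat \<Rightarrow> 'a set"
  assumes C: "disjoint_family C" "\<And>i. C i \<in> sets \<mu>" "\<And>i. C i \<in> sets \<nu>" and prob: "prob_space \<mu>" "prob_space \<nu>"
    and r: "\<And>i j. 0 \<le> r i j" and adm: "admissible C n r \<mu> \<nu>"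
  shows step_fst_bounds: "0 \<le> step_fst C n r \<nu> u" "step_fst C n r \<nu> u \<le> 1"
    and step_snd_bounds: "0 \<le> step_snd C n r \<mu> v" "step_snd C n r \<mu> v \<le> 1"
    and step_fun_nonneg: "0 \<le> step_fun C n r p"
    and step_mass_nonneg: "0 \<le> step_mass C n r \<mu> \<nu>"
    and step_fun_fst: "(\<integral>\<^sup>+ v. step_fun C n r (u, v) \<partial>\<nu>) = ennreal (step_fst C n r \<nu> u)"
    and step_fun_snd: "(\<integral>\<^sup>+ u. step_fun C n r (u, v) \<partial>\<mu>) = ennreal (step_snd C n r \<mu> v)"
    and step_fst_mass: "(\<integral>\<^sup>+ u. step_fst C n r \<nu> u \<partial>\<mu>) = ennreal (step_mass C n r \<mu> \<nu>)"
proof -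
  interpret \<mu>: prob_space \<mu> by fact
  interpret \<nu>: prob_space \<nu> by fact
  note [measurable] = C(2,3)
  show b1: "0 \<le> step_fst C n r \<nu> u" for u unfolding step_fst_def by (intro sum_nonneg mult_nonneg_nonneg) (auto simp: r)
  show b2: "0 \<le> step_snd C n r \<mu> v" for v unfolding step_snd_def by (intro sum_nonneg mult_nonneg_nonneg) (auto simp: r)
  show "step_fst C n r \<nu> u \<le> 1" "step_snd C n r \<mu> v \<le> 1"
    unfolding step_fst_def step_snd_def using adm by (auto intro!: partition_sum_le C(1) simp: admissible_def)
  show b3: "0 \<le> step_fun C n r p" for p unfolding step_fun_def by (intro sum_nonneg mult_nonneg_nonneg) (auto simp: r)
  show b4: "0 \<le> step_mass C n r \<mu> \<nu>" unfolding step_mass_def by (intro sum_nonneg mult_nonneg_nonneg) (auto simp: r)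
  have [measurable]: "(\<lambda>v. step_fun C n r (u, v)) \<in> borel_measurable \<nu>" "(\<lambda>u. step_fun C n r (u, v)) \<in> borel_measurable \<mu>" for u v
    unfolding step_fun_def by simp_all
  have int1: "integrable \<nu> (indicat_real (C j))" and int2: "integrable \<mu> (indicat_real (C j))" for j
    by (auto simp: \<nu>.emeasure_eq_measure \<mu>.emeasure_eq_measure)
  have "(\<integral>\<^sup>+ v. step_fun C n r (u, v) \<partial>\<nu>) = ennreal (\<integral> v. step_fun C n r (u, v) \<partial>\<nu>)" unfolding step_fun_def
    by (intro nn_integral_eq_integral) (auto intro!: Bochner_Integration.integrable_sum integrable_mult_right int1 AE_I2 sum_nonneg simp: r)
  also have "(\<integral> v. step_fun C n r (u, v) \<partial>\<nu>) = (\<Sum>i<n. \<Sum>j<n. r i j * (indicator (C i) u * measure \<nu> (C j)))"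
    unfolding step_fun_def using int1
    by (simp add: Bochner_Integration.integral_sum integrable_mult_right)
  also have "\<dots> = step_fst C n r \<nu> u" unfolding step_fst_def by (simp only: sum_distrib_right sum_distrib_left mult_ac)
  finally show "(\<integral>\<^sup>+ v. step_fun C n r (u, v) \<partial>\<nu>) = ennreal (step_fst C n r \<nu> u)" .
  have "(\<integral>\<^sup>+ u. step_fun C n r (u, v) \<partial>\<mu>) = ennreal (\<integral> u. step_fun C n r (u, v) \<partial>\<mu>)" unfolding step_fun_def
    by (intro nn_integral_eq_integral) (auto intro!: Bochner_Integration.integrable_sum integrable_mult_right integrable_mult_left int2 AE_I2 sum_nonneg simp: r)
  also have "(\<integral> u. step_fun C n r (u, v) \<partial>\<mu>) = (\<Sum>i<n. \<Sum>j<n. r i j * (measure \<mu> (C i) * indicator (C j) v))"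
    unfolding step_fun_def using int2
    by (simp add: Bochner_Integration.integral_sum integrable_mult_right)
  also have "\<dots> = (\<Sum>j<n. \<Sum>i<n. r i j * (measure \<mu> (C i) * indicator (C j) v))" by (rule sum.swap)
  also have "\<dots> = step_snd C n r \<mu> v" unfolding step_snd_def by (simp only: sum_distrib_right sum_distrib_left mult_ac)
  finally show "(\<integral>\<^sup>+ u. step_fun C n r (u, v) \<partial>\<mu>) = ennreal (step_snd C n r \<mu> v)" .
  have "(\<integral>\<^sup>+ u. step_fst C n r \<nu> u \<partial>\<mu>) = ennreal (\<integral> u. step_fst C n r \<nu> u \<partial>\<mu>)" unfolding step_fst_def
    by (intro nn_integral_eq_integral) (auto intro!: Bochner_Integration.integrable_sum integrable_mult_right int2 AE_I2 sum_nonneg mult_nonneg_nonneg simp: r)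
  also have "(\<integral> u. step_fst C n r \<nu> u \<partial>\<mu>) = (\<Sum>i<n. (\<Sum>j<n. r i j * measure \<nu> (C j)) * measure \<mu> (C i))"
    unfolding step_fst_def using int2
    by (simp add: Bochner_Integration.integral_sum integrable_mult_right)
  also have "\<dots> = step_mass C n r \<mu> \<nu>" unfolding step_mass_def by (simp only: sum_distrib_right sum_distrib_left mult_ac)
  finally show "(\<integral>\<^sup>+ u. step_fst C n r \<nu> u \<partial>\<mu>) = ennreal (step_mass C n r \<mu> \<nu>)" .
qed

lemma if_admissible: "admissible C n (if_admissible C n r \<mu> \<nu>) \<mu> \<nu>"
  by (cases "admissible C n r \<mu> \<nu>") (auto simp: if_admissible_def[abs_def], simp add: admissible_def)

lemma if_admissible_nonneg: "(\<And>i j. 0 \<le> r i j) \<Longrightarrow> 0 \<le> if_admissible C n r \<mu> \<nu> i j"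
  by (simp add: if_admissible_def)

lemma step_coupling:
  fixes C :: "nat \<Rightarrow> 'a set"
  assumes C: "disjoint_family C" "\<And>i. C i \<in> sets \<mu>" "\<And>i. C i \<in> sets \<nu>" and prob: "prob_space \<mu>" "prob_space \<nu>"
    and r: "\<And>i j. 0 \<le> r i j"
  shows "step_coupling C n r \<mu> \<nu> \<in> couplings \<mu> \<nu>"
    and "\<lbrakk>admissible C n r \<mu> \<nu>; case_prod d \<in> borel_measurable (\<mu> \<Otimes>\<^sub>M \<nu>); f \<in> borel_measurable \<mu>; g \<in> borel_measurable \<nu>;
          \<And>u v. 0 \<le> f u \<and> 0 \<le> g v \<and> d u v \<le> f u + g v\<rbrakk> \<Longrightarrow>
       (\<integral>\<^sup>+ (u, v). ennreal (d u v) \<partial>step_coupling C n r \<mu> \<nu>)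
          \<le> (\<integral>\<^sup>+ (u, v). ennreal (d u v) * ennreal (step_fun C n r (u, v)) \<partial>(\<mu> \<Otimes>\<^sub>M \<nu>))
          + (\<integral>\<^sup>+ u. ennreal (f u) * ennreal (1 - step_fst C n r \<nu> u) \<partial>\<mu>)
          + (\<integral>\<^sup>+ v. ennreal (g v) * ennreal (1 - step_snd C n r \<mu> v) \<partial>\<nu>)"
proof -
  note [measurable] = C(2,3)
  have [measurable]: "step_fun C n r \<in> borel_measurable (\<mu> \<Otimes>\<^sub>M \<nu>)" "step_fst C n r \<nu> \<in> borel_measurable \<mu>" "step_snd C n r \<mu> \<in> borel_measurable \<nu>" for r
    unfolding step_fun_def[abs_def] step_fst_def[abs_def] step_snd_def[abs_def] by measurable
  have eq: "step_coupling C n r \<mu> \<nu> = density (\<mu> \<Otimes>\<^sub>M \<nu>) (\<lambda>(u, v). ennreal (step_fun C n r' (u, v) +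
     (1 - step_fst C n r' \<nu> u) * (1 - step_snd C n r' \<mu> v) / (1 - step_mass C n r' \<mu> \<nu>)))"
    if "r' = if_admissible C n r \<mu> \<nu>" for r'
    by (auto simp: step_coupling_def step_density_def that intro!: arg_cong2[where f=density] simp: fun_eq_iff)
  show "step_coupling C n r \<mu> \<nu> \<in> couplings \<mu> \<nu>"
    unfolding eq[OF refl]
    by (rule density_coupling(1)[OF prob])
      (auto intro!: step_fst_bounds[where \<mu>=\<mu> and \<nu>=\<nu>] step_snd_bounds[where \<mu>=\<mu> and \<nu>=\<nu>]
        step_fun_nonneg[where \<mu>=\<mu> and \<nu>=\<nu>] step_mass_nonneg step_fun_fst[where \<mu>=\<mu> and \<nu>=\<nu>]
        step_fun_snd[where \<mu>=\<mu> and \<nu>=\<nu>] step_fst_mass C prob r if_admissible if_admissible_nonneg)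
  assume adm: "admissible C n r \<mu> \<nu>" and *: "case_prod d \<in> borel_measurable (\<mu> \<Otimes>\<^sub>M \<nu>)" "f \<in> borel_measurable \<mu>" "g \<in> borel_measurable \<nu>"
     "\<And>u v. 0 \<le> f u \<and> 0 \<le> g v \<and> d u v \<le> f u + g v"
  have r': "r = if_admissible C n r \<mu> \<nu>" using adm by (simp add: if_admissible_def fun_eq_iff)
  show "(\<integral>\<^sup>+ (u, v). ennreal (d u v) \<partial>step_coupling C n r \<mu> \<nu>)
          \<le> (\<integral>\<^sup>+ (u, v). ennreal (d u v) * ennreal (step_fun C n r (u, v)) \<partial>(\<mu> \<Otimes>\<^sub>M \<nu>))
          + (\<integral>\<^sup>+ u. ennreal (f u) * ennreal (1 - step_fst C n r \<nu> u) \<partial>\<mu>)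
          + (\<integral>\<^sup>+ v. ennreal (g v) * ennreal (1 - step_snd C n r \<mu> v) \<partial>\<nu>)"
    unfolding eq[OF r']
    by (rule density_coupling(2)[OF prob])
      (auto intro!: step_fst_bounds[where \<mu>=\<mu> and \<nu>=\<nu>] step_snd_bounds[where \<mu>=\<mu> and \<nu>=\<nu>]
        step_fun_nonneg[where \<mu>=\<mu> and \<nu>=\<nu>] step_mass_nonneg step_fun_fst[where \<mu>=\<mu> and \<nu>=\<nu>]
        step_fun_snd[where \<mu>=\<mu> and \<nu>=\<nu>] step_fst_mass C prob r adm *)
qed

text \<open>\<open>\<pi>\<close> is replaced by its average density
  \<open>p i j / (a i * b j)\<close> on each product of cells, cut to finitely many cells and
  rounded down to rationals. Cutting and rounding down keep the plan admissible. The lost mass is at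
  most \<open>\<delta>\<close>, so small that the first moments make its completion cost at most
  \<open>g\<close> on each side.\<close>

lemma step_coupling_dense:
  fixes \<mu> \<nu> :: "'a::{metric_space, second_countable_topology} measure" and C :: "nat \<Rightarrow> nat \<Rightarrow> 'a set"
  assumes C: "\<And>k. disjoint_family (C k)" "\<And>k. (\<Union>i. C k i) = UNIV" "\<And>k i. C k i \<in> sets borel"
      "\<And>k i. \<forall>u\<in>C k i. dist u (c k i) < (1/2) ^ k"
    and prob: "prob_space \<mu>" "prob_space \<nu>" and sets: "sets \<mu> = sets borel" "sets \<nu> = sets borel"
    and mom: "(\<integral>\<^sup>+ u. dist x0 u \<partial>\<mu>) < \<infinity>" "(\<integral>\<^sup>+ u. dist x0 u \<partial>\<nu>) < \<infinity>"
    and \<pi>: "\<pi> \<in> couplings \<mu> \<nu>" and cost: "(\<integral>\<^sup>+ (u, v). ennreal (dist u v) \<partial>\<pi>) < w"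
  obtains k n and q :: "nat \<Rightarrow> nat \<Rightarrow> rat" where "\<And>i j. 0 \<le> q i j"
    and "(\<integral>\<^sup>+ (u, v). ennreal (dist u v) \<partial>step_coupling (C k) n (\<lambda>i j. of_rat (q i j)) \<mu> \<nu>) < w"
proof -
  interpret \<mu>: prob_space \<mu> by fact
  interpret \<nu>: prob_space \<nu> by fact
  interpret \<pi>: prob_space \<pi> by (rule prob_space_coupling[OF \<pi> prob(1)])
  have sets_\<pi>: "sets \<pi> = sets (borel \<Otimes>\<^sub>M borel)"
    using coupling_sets[OF \<pi>] sets by (metis sets_pair_measure_cong)
  note [measurable_cong] = sets sets_\<pi> and [measurable] = C(3)
  have space: "space \<mu> = UNIV" "space \<nu> = UNIV" "space \<pi> = UNIV"
    using sets_eq_imp_space_eq[OF sets(1)] sets_eq_imp_space_eq[OF sets(2)] sets_eq_imp_space_eq[OF sets_\<pi>]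
    by (simp_all add: space_pair_measure)
  obtain \<kappa> where \<kappa>: "0 \<le> \<kappa>" "(\<integral>\<^sup>+ (u, v). ennreal (dist u v) \<partial>\<pi>) = ennreal \<kappa>"
    using cost by (metis ennreal_cases less_top order.strict_trans2 top_greatest)
  \<comment> \<open>\<open>g\<close> is the unit of error: one for the size of the cells and one for
    each of the two first moments. A quarter of a gap below \<open>w\<close> leaves room for all
    three.\<close>
  obtain g where g: "0 < g" "ennreal (\<kappa> + 4 * g) < w"
  proof -
    obtain w' where "ennreal \<kappa> < ennreal w'" "ennreal w' < w"
      using cost \<kappa>(2) dense[of "ennreal \<kappa>" w] by (metis ennreal_cases less_top order.strict_trans2 top_greatest)
    moreover have "\<kappa> + 4 * ((w' - \<kappa>) / 4) = w'" by (simp add: field_simps)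
    ultimately show ?thesis using that[of "(w' - \<kappa>) / 4"] \<kappa>(1) by (simp only:) (simp add: ennreal_less_iff)
  qed
  obtain k where k: "(1/2::real) ^ k < g / 4" using real_arch_pow_inv[of "g/4" "1/2"] g by auto
  define e :: real where "e = (1/2) ^ k"
  have e: "0 < e" "4 * e < g" using k by (auto simp: e_def)
  define a where "a i = measure \<mu> (C k i)" for i
  define b where "b i = measure \<nu> (C k i)" for i
  define p where "p i j = measure \<pi> (C k i \<times> C k j)" for i j
  have pos: "0 \<le> a i" "0 \<le> b i" "0 \<le> p i j" "a i \<le> 1" "b i \<le> 1" for i j by (simp_all add: a_def b_def p_def)
  have sum_fst: "(\<Sum>j<n. p i j) \<le> a i" for i n
  proof -
    have "(\<Sum>j<n. p i j) = measure \<pi> (\<Union>j<n. C k i \<times> C k j)" unfolding p_def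
      using C(1)[of k] by (intro \<pi>.finite_measure_finite_Union[symmetric]) (auto simp: disjoint_family_on_def sets_\<pi>)
    also have "\<dots> \<le> measure \<pi> (C k i \<times> UNIV)" by (rule \<pi>.finite_measure_mono) (auto simp: sets_\<pi>)
    also have "\<dots> = a i" unfolding a_def by (rule measure_coupling_fst[OF \<pi> sets C(3)])
    finally show ?thesis .
  qed
  have sum_snd: "(\<Sum>i<n. p i j) \<le> b j" for j n
  proof -
    have "(\<Sum>i<n. p i j) = measure \<pi> (\<Union>i<n. C k i \<times> C k j)" unfolding p_def
      using C(1)[of k] by (intro \<pi>.finite_measure_finite_Union[symmetric]) (auto simp: disjoint_family_on_def sets_\<pi>)
    also have "\<dots> \<le> measure \<pi> (UNIV \<times> C k j)" by (rule \<pi>.finite_measure_mono) (auto simp: sets_\<pi>)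
    also have "\<dots> = b j" unfolding b_def by (rule measure_coupling_snd[OF \<pi> sets C(3)])
    finally show ?thesis .
  qed
  have p_le: "p i j \<le> a i" "p i j \<le> b j" for i j
    using sum_fst[of i "Suc j"] sum_snd[of j "Suc i"] sum_nonneg[of "{..<j}" "\<lambda>j. p i j"] sum_nonneg[of "{..<i}" "\<lambda>i. p i j"] pos
    by simp_all
  have mom': "(\<integral>\<^sup>+ v. dist v x0 \<partial>\<nu>) < \<infinity>" using mom(2) by (simp add: dist_commute)
  have mom'': "(\<integral>\<^sup>+ u. dist u x0 \<partial>\<mu>) < \<infinity>" using mom(1) by (simp add: dist_commute)
  obtain \<delta>1 where \<delta>1: "\<delta>1 > 0" "\<And>r. r \<in> borel_measurable \<mu> \<Longrightarrow> (\<And>x. 0 \<le> r x \<and> r x \<le> 1) \<Longrightarrow> (\<integral>\<^sup>+ x. ennreal (r x) \<partial>\<mu>) \<le> ennreal \<delta>1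
          \<Longrightarrow> (\<integral>\<^sup>+ x. ennreal (dist x x0) * ennreal (r x) \<partial>\<mu>) \<le> ennreal g"
    by (rule small_mass_small_integral[of "\<lambda>u. dist u x0" \<mu> g]) (use mom'' g in auto)
  obtain \<delta>2 where \<delta>2: "\<delta>2 > 0" "\<And>r. r \<in> borel_measurable \<nu> \<Longrightarrow> (\<And>x. 0 \<le> r x \<and> r x \<le> 1) \<Longrightarrow> (\<integral>\<^sup>+ x. ennreal (r x) \<partial>\<nu>) \<le> ennreal \<delta>2
          \<Longrightarrow> (\<integral>\<^sup>+ x. ennreal (dist x x0) * ennreal (r x) \<partial>\<nu>) \<le> ennreal g"
    by (rule small_mass_small_integral[of "\<lambda>u. dist u x0" \<nu> g]) (use mom' g in auto)
  define \<delta> where "\<delta> = min \<delta>1 \<delta>2"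
  have \<delta>: "\<delta> > 0" using \<delta>1 \<delta>2 by (simp add: \<delta>_def)
  \<comment> \<open>Finite blocks of cells exhaust the product space, so some block carries all but
    \<open>\<delta> / 2\<close> of \<open>\<pi>\<close>.\<close>
  obtain n where n: "(\<Sum>i<n. \<Sum>j<n. p i j) > 1 - \<delta> / 2"
  proof -
    define X where "X n = (\<Union>i<n. \<Union>j<n. C k i \<times> C k j)" for n
    have "(\<lambda>n. measure \<pi> (X n)) \<longlonglongrightarrow> measure \<pi> (\<Union>n. X n)"
    proof (rule \<pi>.finite_Lim_measure_incseq)
      show "range X \<subseteq> sets \<pi>" by (auto simp: X_def sets_\<pi>)
      show "incseq X" unfolding X_def by (intro incseq_SucI) fastforce
    qed
    also have "(\<Union>n. X n) = UNIV"
    proof -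
      have "\<exists>n. (u, v) \<in> X n" for u v
      proof -
        obtain i j where "u \<in> C k i" "v \<in> C k j" using C(2)[of k] by (metis UNIV_I UN_E)
        then have "(u, v) \<in> X (max (Suc i) (Suc j))" by (auto simp: X_def)
        then show ?thesis ..
      qed
      then show ?thesis by auto
    qed
    finally have "(\<lambda>n. measure \<pi> (X n)) \<longlonglongrightarrow> 1" using \<pi>.prob_space by (simp add: space)
    then have "eventually (\<lambda>n. measure \<pi> (X n) > 1 - \<delta> / 2) sequentially" using \<delta> by (intro order_tendstoD) auto
    then obtain n where "measure \<pi> (X n) > 1 - \<delta> / 2" by (meson eventually_sequentially order_refl)
    moreover have "measure \<pi> (X n) \<le> (\<Sum>i<n. \<Sum>j<n. p i j)"
    proof -
      have "measure \<pi> (X n) \<le> (\<Sum>i<n. measure \<pi> (\<Union>j<n. C k i \<times> C k j))" unfolding X_def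
        by (rule \<pi>.finite_measure_subadditive_finite) (auto simp: sets_\<pi>)
      also have "\<dots> \<le> (\<Sum>i<n. \<Sum>j<n. p i j)" unfolding p_def
        by (intro sum_mono \<pi>.finite_measure_subadditive_finite) (auto simp: sets_\<pi>)
      finally show ?thesis .
    qed
    ultimately show ?thesis using that[of n] by simp
  qed
  \<comment> \<open>Rounding on \<open>n * n\<close> pairs of cells loses at most
    \<open>\<delta> / 2\<close>, the other half being lost outside the block; the added 1 guards
    against \<open>n = 0\<close>.\<close>
  define \<eta> where "\<eta> = \<delta> / (2 * (real n * real n + 1))"
  have \<eta>: "\<eta> > 0" "real n * real n * \<eta> \<le> \<delta> / 2"
  proof -
    show "\<eta> > 0" unfolding \<eta>_def using \<delta> by (intro divide_pos_pos mult_pos_pos add_nonneg_pos) auto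
    have "real n * real n / (real n * real n + 1) \<le> 1"
      by (subst divide_le_eq_1_pos) (auto intro: add_nonneg_pos)
    from mult_left_mono[OF this, of "\<delta> / 2"] \<delta> show "real n * real n * \<eta> \<le> \<delta> / 2"
      by (simp add: \<eta>_def mult_ac)
  qed
  have rat: "\<exists>q::rat. 0 \<le> q \<and> of_rat q \<le> x \<and> x - \<eta> \<le> of_rat q" if "0 \<le> x" for x :: real
  proof (cases "x = 0")
    case True
    then show ?thesis using \<eta> by (intro exI[of _ 0]) simp
  next
    case False
    then have "max 0 (x - \<eta>) < x" using \<eta> that by simp
    then obtain q :: rat where "max 0 (x - \<eta>) < of_rat q" "of_rat q < x"
      using of_rat_dense by blast
    then show ?thesis by (intro exI[of _ q]) auto
  qed
  have "\<exists>q::rat. 0 \<le> q \<and> of_rat q \<le> p i j / (a i * b j) \<and> p i j / (a i * b j) - \<eta> \<le> of_rat q" for i j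
    by (intro rat divide_nonneg_nonneg mult_nonneg_nonneg pos)
  then obtain q :: "nat \<Rightarrow> nat \<Rightarrow> rat" where q: "\<And>i j. 0 \<le> q i j" "\<And>i j. of_rat (q i j) \<le> p i j / (a i * b j)"
      "\<And>i j. p i j / (a i * b j) - \<eta> \<le> of_rat (q i j)"
    by metis
  define r :: "nat \<Rightarrow> nat \<Rightarrow> real" where "r i j = of_rat (q i j)" for i j
  have r: "0 \<le> r i j" "r i j \<le> p i j / (a i * b j)" "p i j / (a i * b j) - \<eta> \<le> r i j" for i j
    using q by (simp_all add: r_def)
  \<comment> \<open>A pair of cells with a null marginal has quotient 0 by convention, so the bound
    holds there as well.\<close>
  have r_fst: "r i j * b j * a i \<le> p i j" for i j
    using mult_right_mono[OF r(2)[of i j], of "a i * b j"] pos by (cases "a i * b j = 0") (auto simp: mult_ac)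
  have r_low: "p i j - \<eta> \<le> r i j * a i * b j" for i j
  proof (cases "a i * b j = 0")
    case True
    then have "p i j \<le> 0" using p_le[of i j] by auto
    then show ?thesis using True \<eta> by auto
  next
    case False
    have "p i j - \<eta> * 1 \<le> p i j - \<eta> * (a i * b j)" using \<eta> pos by (simp add: mult_le_one)
    also have "\<dots> = (p i j / (a i * b j) - \<eta>) * (a i * b j)" using False by (simp add: left_diff_distrib)
    also have "\<dots> \<le> r i j * (a i * b j)" using pos by (intro mult_right_mono r) auto
    finally show ?thesis by (simp add: mult_ac)
  qed
  have adm: "admissible (C k) n r \<mu> \<nu>" unfolding admissible_def
  proof (intro conjI allI impI)
    fix i
    show "(\<Sum>j<n. r i j * measure \<nu> (C k j)) \<le> 1"
    proof (cases "a i = 0")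
      case True
      then have "r i j = 0" for j using r(1,2)[of i j] by simp
      then show ?thesis by simp
    next
      case False
      have "(\<Sum>j<n. r i j * b j) * a i = (\<Sum>j<n. r i j * b j * a i)" by (rule sum_distrib_right)
      also have "\<dots> \<le> (\<Sum>j<n. p i j)" by (intro sum_mono r_fst)
      also have "\<dots> \<le> 1 * a i" using sum_fst by simp
      finally show ?thesis using False pos(1)[of i] by (simp add: b_def)
    qed
    show "(\<Sum>j<n. r j i * measure \<mu> (C k j)) \<le> 1"
    proof (cases "b i = 0")
      case True
      then have "r j i = 0" for j using r(1,2)[of j i] by simp
      then show ?thesis by simp
    next
      case False
      have "(\<Sum>j<n. r j i * a j) * b i = (\<Sum>j<n. r j i * b i * a j)"
        unfolding sum_distrib_right by (simp only: mult_ac)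
      also have "\<dots> \<le> (\<Sum>j<n. p j i)" by (intro sum_mono r_fst)
      also have "\<dots> \<le> 1 * b i" using sum_snd by simp
      finally show ?thesis using False pos(2)[of i] by (simp add: a_def)
    qed
  qed
  note CC = C(1)[of k] C(3)[of k, folded sets(1)] C(3)[of k, folded sets(2)] prob r(1)
  define m where "m = step_mass (C k) n r \<mu> \<nu>"
  have m: "1 - \<delta> \<le> m"
  proof -
    have "1 - \<delta> \<le> (\<Sum>i<n. \<Sum>j<n. p i j) - real n * real n * \<eta>" using n \<eta> by simp
    also have "\<dots> = (\<Sum>i<n. \<Sum>j<n. p i j - \<eta>)" by (simp add: sum_subtractf)
    also have "\<dots> \<le> m" unfolding m_def step_mass_def a_def[symmetric] b_def[symmetric] by (intro sum_mono r_low)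
    finally show ?thesis .
  qed
  have compl: "(\<integral>\<^sup>+ x. ennreal (1 - h x) \<partial>N) \<le> ennreal \<delta>"
    if N: "prob_space N" and [measurable]: "h \<in> borel_measurable N"
      and h: "\<And>x. 0 \<le> h x" "\<And>x. h x \<le> 1" "(\<integral>\<^sup>+ x. h x \<partial>N) = ennreal m" for N and h :: "'a \<Rightarrow> real"
  proof -
    interpret N: prob_space N by fact
    have "(\<integral>\<^sup>+ x. ennreal (1 - h x) \<partial>N) = (\<integral>\<^sup>+ x. 1 - ennreal (h x) \<partial>N)"
      using h by (intro nn_integral_cong) (simp flip: ennreal_minus)
    also have "\<dots> = (\<integral>\<^sup>+ x. 1 \<partial>N) - (\<integral>\<^sup>+ x. h x \<partial>N)"
      by (rule nn_integral_diff) (use h in auto)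
    also have "\<dots> \<le> ennreal 1 - ennreal (1 - \<delta>)"
    proof -
      have "ennreal (1 - \<delta>) \<le> ennreal m" using m by (rule ennreal_leI)
      then show ?thesis unfolding h(3) by (intro ennreal_minus_mono) (auto simp: N.emeasure_space_1)
    qed
    also have "\<dots> \<le> ennreal \<delta>" using \<delta> by (cases "\<delta> \<le> 1") (auto simp: ennreal_minus ennreal_neg simp del: ennreal_1)
    finally show ?thesis .
  qed
  have [measurable]: "step_fst (C k) n r \<nu> \<in> borel_measurable borel" "step_snd (C k) n r \<mu> \<in> borel_measurable borel"
    "step_fun (C k) n r \<in> borel_measurable (borel \<Otimes>\<^sub>M borel)"
    unfolding step_fun_def[abs_def] step_fst_def[abs_def] step_snd_def[abs_def] by measurable
  have step_snd_mass: "(\<integral>\<^sup>+ v. step_snd (C k) n r \<mu> v \<partial>\<nu>) = ennreal m"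
  proof -
    interpret P: pair_prob_space \<mu> \<nu> ..
    have "(\<integral>\<^sup>+ v. step_snd (C k) n r \<mu> v \<partial>\<nu>) = (\<integral>\<^sup>+ v. (\<integral>\<^sup>+ u. step_fun (C k) n r (u, v) \<partial>\<mu>) \<partial>\<nu>)"
      by (simp add: step_fun_snd[OF CC adm])
    also have "\<dots> = (\<integral>\<^sup>+ u. (\<integral>\<^sup>+ v. step_fun (C k) n r (u, v) \<partial>\<nu>) \<partial>\<mu>)" by (rule P.Fubini') simp
    also have "\<dots> = ennreal m" by (simp add: step_fun_fst[OF CC adm] step_fst_mass[OF CC adm] m_def)
    finally show ?thesis .
  qed
  have 1: "(\<integral>\<^sup>+ u. ennreal (dist u x0) * ennreal (1 - step_fst (C k) n r \<nu> u) \<partial>\<mu>) \<le> ennreal g"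
  proof (rule \<delta>1(2))
    have "(\<integral>\<^sup>+ x. ennreal (1 - step_fst (C k) n r \<nu> x) \<partial>\<mu>) \<le> ennreal \<delta>"
      by (rule compl[OF prob(1)]) (auto simp: step_fst_bounds[OF CC adm] step_fst_mass[OF CC adm] m_def)
    then show "(\<integral>\<^sup>+ x. ennreal (1 - step_fst (C k) n r \<nu> x) \<partial>\<mu>) \<le> ennreal \<delta>1"
      by (rule order_trans) (auto simp: \<delta>_def ennreal_leI)
  qed (auto simp: step_fst_bounds[OF CC adm])
  have 2: "(\<integral>\<^sup>+ v. ennreal (dist v x0) * ennreal (1 - step_snd (C k) n r \<mu> v) \<partial>\<nu>) \<le> ennreal g"
  proof (rule \<delta>2(2))
    have "(\<integral>\<^sup>+ x. ennreal (1 - step_snd (C k) n r \<mu> x) \<partial>\<nu>) \<le> ennreal \<delta>"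
      by (rule compl[OF prob(2)]) (auto simp: step_snd_bounds[OF CC adm] step_snd_mass)
    then show "(\<integral>\<^sup>+ x. ennreal (1 - step_snd (C k) n r \<mu> x) \<partial>\<nu>) \<le> ennreal \<delta>2"
      by (rule order_trans) (auto simp: \<delta>_def ennreal_leI)
  qed (auto simp: step_snd_bounds[OF CC adm])
  \<comment> \<open>An upper value of the distance on a product of cells, at most
    \<open>4 * e\<close> too large. It is constant there, so averaging \<open>\<pi>\<close> over the
    cells does not change its integral and rounding down can only lower it.\<close>
  define D where "D i j = dist (c k i) (c k j) + 2 * e" for i j
  have D_pos: "0 \<le> D i j" for i j using e by (simp add: D_def)
  have tri: "dist u v \<le> D i j" "D i j \<le> dist u v + 4 * e" if "u \<in> C k i" "v \<in> C k j" for u v i j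
  proof -
    have "dist (c k i) (c k j) \<le> dist (c k i) u + dist u v + dist v (c k j)" "dist u v \<le> dist u (c k i) + dist (c k i) (c k j) + dist (c k j) v"
      by (metric, metric)
    then show "dist u v \<le> D i j" "D i j \<le> dist u v + 4 * e"
      using bspec[OF C(4) that(1)] bspec[OF C(4) that(2)] by (simp_all add: dist_commute D_def e_def)
  qed
  have sum_cell: "(\<Sum>i<n. \<Sum>j<n. h i j * (indicator (C k i) u * indicator (C k j) v)) \<le> (B::real)"
    if "\<And>i j. u \<in> C k i \<Longrightarrow> v \<in> C k j \<Longrightarrow> h i j \<le> B" "0 \<le> B" for h u v B
  proof -
    define h' where "h' i j = (if u \<in> C k i \<and> v \<in> C k j then h i j else 0)" for i j
    have "(\<Sum>i<n. \<Sum>j<n. h i j * (indicator (C k i) u * indicator (C k j) v))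
        = (\<Sum>i<n. (\<Sum>j<n. h' i j * indicator (C k j) v) * indicator (C k i) u)"
      unfolding sum_distrib_right by (intro sum.cong refl) (simp add: indicator_def h'_def)
    also have "\<dots> \<le> B"
      using that by (intro partition_sum_le[OF C(1)]) (auto simp: h'_def)
    finally show ?thesis .
  qed
  have 3: "(\<integral>\<^sup>+ (u, v). ennreal (dist u v) * ennreal (step_fun (C k) n r (u, v)) \<partial>(\<mu> \<Otimes>\<^sub>M \<nu>)) \<le> ennreal (\<kappa> + g)"
  proof -
    interpret P: pair_prob_space \<mu> \<nu> ..
    have int: "(\<integral>\<^sup>+ z. ennreal (\<Sum>i<n. \<Sum>j<n. h i j * indicator (C k i \<times> C k j) z) \<partial>M) = ennreal (\<Sum>i<n. \<Sum>j<n. h i j * measure M (C k i \<times> C k j))"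
      if M: "finite_measure M" and M'[measurable_cong]: "sets M = sets (borel \<Otimes>\<^sub>M borel)" and h: "\<And>i j. 0 \<le> h i j" for h M
    proof -
      interpret M: finite_measure M by fact
      have "(\<integral>\<^sup>+ z. ennreal (\<Sum>i<n. \<Sum>j<n. h i j * indicator (C k i \<times> C k j) z) \<partial>M)
         = (\<integral>\<^sup>+ z. (\<Sum>i<n. \<Sum>j<n. ennreal (h i j) * indicator (C k i \<times> C k j) z) \<partial>M)"
        by (simp add: sum_nonneg h ennreal_mult'' ennreal_indicator flip: sum_ennreal)
      also have "\<dots> = (\<Sum>i<n. \<integral>\<^sup>+ z. (\<Sum>j<n. ennreal (h i j) * indicator (C k i \<times> C k j) z) \<partial>M)"
        by (rule nn_integral_sum) measurable
      also have "\<dots> = (\<Sum>i<n. \<Sum>j<n. \<integral>\<^sup>+ z. ennreal (h i j) * indicator (C k i \<times> C k j) z \<partial>M)"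
        by (intro sum.cong refl nn_integral_sum) measurable
      also have "\<dots> = (\<Sum>i<n. \<Sum>j<n. ennreal (h i j) * emeasure M (C k i \<times> C k j))"
        by (intro sum.cong refl nn_integral_cmult_indicator) (simp add: M')
      also have "\<dots> = ennreal (\<Sum>i<n. \<Sum>j<n. h i j * measure M (C k i \<times> C k j))"
        by (simp add: sum_nonneg h ennreal_mult'' M.emeasure_eq_measure flip: sum_ennreal)
      finally show ?thesis .
    qed
    have "(\<integral>\<^sup>+ (u, v). ennreal (dist u v) * ennreal (step_fun (C k) n r (u, v)) \<partial>(\<mu> \<Otimes>\<^sub>M \<nu>))
       \<le> (\<integral>\<^sup>+ z. ennreal (\<Sum>i<n. \<Sum>j<n. (r i j * D i j) * indicator (C k i \<times> C k j) z) \<partial>(\<mu> \<Otimes>\<^sub>M \<nu>))"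
    proof (intro nn_integral_mono)
      fix z :: "'a \<times> 'a"
      obtain u v where z: "z = (u, v)" by (cases z)
      have "dist u v * step_fun (C k) n r (u, v) = (\<Sum>i<n. \<Sum>j<n. dist u v * (r i j * (indicator (C k i) u * indicator (C k j) v)))"
        by (simp add: step_fun_def sum_distrib_left)
      also have "\<dots> \<le> (\<Sum>i<n. \<Sum>j<n. (r i j * D i j) * indicator (C k i \<times> C k j) z)"
        using tri(1)[of u _ v] r(1) by (intro sum_mono) (auto simp: z indicator_def mult.commute intro!: mult_right_mono)
      finally show "(case z of (u, v) \<Rightarrow> ennreal (dist u v) * ennreal (step_fun (C k) n r (u, v))) \<le> ennreal (\<Sum>i<n. \<Sum>j<n. (r i j * D i j) * indicator (C k i \<times> C k j) z)"
        by (auto simp: z step_fun_nonneg[OF CC adm] intro!: ennreal_leI simp flip: ennreal_mult)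
    qed
    also have "\<dots> = ennreal (\<Sum>i<n. \<Sum>j<n. (r i j * D i j) * measure (\<mu> \<Otimes>\<^sub>M \<nu>) (C k i \<times> C k j))"
      by (rule int) (auto simp: r D_pos sets P.finite_measure_axioms cong: sets_pair_measure_cong)
    also have "\<dots> \<le> ennreal (\<Sum>i<n. \<Sum>j<n. D i j * measure \<pi> (C k i \<times> C k j))"
    proof (intro ennreal_leI sum_mono)
      fix i j
      have "measure (\<mu> \<Otimes>\<^sub>M \<nu>) (C k i \<times> C k j) = a i * b j"
        by (simp add: a_def b_def measure_def \<nu>.emeasure_pair_measure_Times enn2real_mult sets)
      then have "(r i j * D i j) * measure (\<mu> \<Otimes>\<^sub>M \<nu>) (C k i \<times> C k j) = D i j * (r i j * b j * a i)" by (simp add: mult_ac)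
      also have "\<dots> \<le> D i j * p i j" by (intro mult_left_mono r_fst D_pos)
      finally show "(r i j * D i j) * measure (\<mu> \<Otimes>\<^sub>M \<nu>) (C k i \<times> C k j) \<le> D i j * measure \<pi> (C k i \<times> C k j)" by (simp add: p_def)
    qed
    also have "\<dots> = (\<integral>\<^sup>+ z. ennreal (\<Sum>i<n. \<Sum>j<n. D i j * indicator (C k i \<times> C k j) z) \<partial>\<pi>)"
      by (rule int[symmetric]) (auto simp: D_pos sets_\<pi> \<pi>.finite_measure_axioms)
    also have "\<dots> \<le> (\<integral>\<^sup>+ z. (\<lambda>(u, v). ennreal (dist u v)) z + ennreal (4 * e) \<partial>\<pi>)"
    proof (intro nn_integral_mono)
      fix z :: "'a \<times> 'a"
      obtain u v where z: "z = (u, v)" by (cases z)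
      have "(\<Sum>i<n. \<Sum>j<n. D i j * indicator (C k i \<times> C k j) z) \<le> dist u v + 4 * e"
        unfolding z indicator_times fst_conv snd_conv using tri(2)[of u _ v] e by (intro sum_cell) auto
      then show "ennreal (\<Sum>i<n. \<Sum>j<n. D i j * indicator (C k i \<times> C k j) z) \<le> (\<lambda>(u, v). ennreal (dist u v)) z + ennreal (4 * e)"
        using e by (auto simp: z intro!: ennreal_leI simp flip: ennreal_plus)
    qed
    also have "\<dots> = ennreal \<kappa> + ennreal (4 * e)"
      by (subst nn_integral_add) (auto simp: \<kappa>(2) \<pi>.emeasure_space_1)
    also have "\<dots> \<le> ennreal (\<kappa> + g)" using e \<kappa>(1) by (auto intro!: ennreal_leI simp flip: ennreal_plus)
    finally show ?thesis .
  qed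
  show ?thesis
  proof (rule that[OF q(1)])
    have "(\<integral>\<^sup>+ (u, v). ennreal (dist u v) \<partial>step_coupling (C k) n r \<mu> \<nu>)
          \<le> (\<integral>\<^sup>+ (u, v). ennreal (dist u v) * ennreal (step_fun (C k) n r (u, v)) \<partial>(\<mu> \<Otimes>\<^sub>M \<nu>))
          + (\<integral>\<^sup>+ u. ennreal (dist u x0) * ennreal (1 - step_fst (C k) n r \<nu> u) \<partial>\<mu>)
          + (\<integral>\<^sup>+ v. ennreal (dist v x0) * ennreal (1 - step_snd (C k) n r \<mu> v) \<partial>\<nu>)"
      by (rule step_coupling(2)[OF CC adm]) (auto simp: dist_triangle2)
    also have "\<dots> \<le> ennreal (\<kappa> + g) + ennreal g + ennreal g" by (intro add_mono 1 2 3)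
    also have "\<dots> = ennreal (\<kappa> + 3 * g)" using \<kappa>(1) g(1) by (simp flip: ennreal_plus)
    also have "\<dots> < w" using g by (intro le_less_trans[OF _ g(2)] ennreal_leI) auto
    finally show "(\<integral>\<^sup>+ (u, v). ennreal (dist u v) \<partial>step_coupling (C k) n (\<lambda>i j. of_rat (q i j)) \<mu> \<nu>) < w"
      by (simp add: r_def[abs_def])
  qed
qed

section \<open>Midpoints of couplings and a countable family closed under them\<close>

lemma nn_integral_add_measure:
  assumes sets: "sets \<nu> = sets \<mu>" and f: "f \<in> borel_measurable \<mu>"
  shows "(\<integral>\<^sup>+ x. f x \<partial>add_measure \<mu> \<nu>) = (\<integral>\<^sup>+ x. f x \<partial>\<mu>) + (\<integral>\<^sup>+ x. f x \<partial>\<nu>)"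
  using f
proof (induction rule: borel_measurable_induct)
  case (cong f g)
  have "(\<integral>\<^sup>+ x. f x \<partial>N) = (\<integral>\<^sup>+ x. g x \<partial>N)" if "sets N = sets \<mu>" for N
    using sets_eq_imp_space_eq[OF that] cong(3) by (intro nn_integral_cong) simp
  then show ?case using cong(4) sets by simp
next
  case (set A)
  then show ?case by (simp add: sets emeasure_add_measure)
next
  case (mult u c)
  then show ?case by (simp add: nn_integral_cmult measurable_cong_sets[OF sets refl] distrib_left
      measurable_cong_sets[OF sets_add_measure refl])
next
  case (add u v)
  then show ?case by (simp add: nn_integral_add measurable_cong_sets[OF sets refl]
      measurable_cong_sets[OF sets_add_measure refl] ac_simps)
next
  case (seq U)
  have inc: "incseq (\<lambda>i. \<integral>\<^sup>+ x. U i x \<partial>N)" for N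
    using seq(3) by (auto simp: incseq_def le_fun_def intro!: nn_integral_mono)
  have SUP: "(\<integral>\<^sup>+ x. (SUP i. U i) x \<partial>N) = (SUP i. \<integral>\<^sup>+ x. U i x \<partial>N)" if "sets N = sets \<mu>" for N
    unfolding SUP_apply
  proof (rule nn_integral_monotone_convergence_SUP)
    show "U i \<in> borel_measurable N" for i using seq(1)[of i] by (simp add: measurable_cong_sets[OF that refl])
  qed (rule seq(3))
  show ?case
    by (simp only: SUP sets sets_add_measure seq.IH) (simp add: ennreal_SUP_add inc)
qed

text \<open>The midpoint of two couplings. Cost and rectangle masses are averaged by it, which the
  convexity argument of the selection exploits.\<close>

definition half_sum :: "'b measure \<Rightarrow> 'b measure \<Rightarrow> 'b measure" where
  "half_sum P Q = scale_measure (1/2) (add_measure P Q)"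

lemma sets_half_sum [simp]: "sets (half_sum P Q) = sets P"
  by (simp add: half_sum_def)

lemma emeasure_half_sum:
  "sets Q = sets P \<Longrightarrow> A \<in> sets P \<Longrightarrow> emeasure (half_sum P Q) A = (emeasure P A + emeasure Q A) / 2"
  by (simp add: half_sum_def emeasure_add_measure divide_ennreal_def mult.commute)

lemma nn_integral_half_sum:
  "sets Q = sets P \<Longrightarrow> f \<in> borel_measurable P \<Longrightarrow>
    (\<integral>\<^sup>+ x. f x \<partial>half_sum P Q) = ((\<integral>\<^sup>+ x. f x \<partial>P) + (\<integral>\<^sup>+ x. f x \<partial>Q)) / 2"
  by (simp add: half_sum_def nn_integral_scale_measure nn_integral_add_measure divide_ennreal_def mult.commute
      measurable_cong_sets[OF sets_add_measure refl])

lemma ennreal_half_double: "(x + x) / 2 = (x::ennreal)"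
  by (simp add: mult_2[symmetric] ennreal_mult_divide_eq mult.commute)

lemma half_sum_coupling:
  "P \<in> couplings \<mu> \<nu> \<Longrightarrow> Q \<in> couplings \<mu> \<nu> \<Longrightarrow> half_sum P Q \<in> couplings \<mu> \<nu>"
  by (auto simp: couplings_iff emeasure_half_sum ennreal_half_double)

text \<open>The marginals enter the density through cell masses, so it is jointly measurable in the
  parameter and the point; integration against the measurable kernel of product measures preserves
  this.\<close>

lemma measurable_step_coupling:
  fixes \<mu> \<nu> :: "'s \<Rightarrow> 'a::second_countable_topology measure"
  assumes C: "disjoint_family C" "\<And>i. C i \<in> sets borel" and r: "\<And>i j. 0 \<le> r i j"
    and [measurable]: "\<mu> \<in> M \<rightarrow>\<^sub>M subprob_algebra borel" "\<nu> \<in> M \<rightarrow>\<^sub>M subprob_algebra borel"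
    and prob: "\<And>z. z \<in> space M \<Longrightarrow> prob_space (\<mu> z)" "\<And>z. z \<in> space M \<Longrightarrow> prob_space (\<nu> z)"
  shows "(\<lambda>z. step_coupling C n r (\<mu> z) (\<nu> z)) \<in> M \<rightarrow>\<^sub>M subprob_algebra (borel \<Otimes>\<^sub>M borel)"
proof (rule measurable_subprob_algebra)
  note [measurable] = C(2)
  fix z assume z: "z \<in> space M"
  have sets: "sets (\<mu> z) = sets borel" "sets (\<nu> z) = sets borel"
    using subprob_measurableD(2)[OF assms(4) z] subprob_measurableD(2)[OF assms(5) z] by auto
  then show "sets (step_coupling C n r (\<mu> z) (\<nu> z)) = sets (borel \<Otimes>\<^sub>M borel)"
    by (simp add: step_coupling_def cong: sets_pair_measure_cong)
  have "step_coupling C n r (\<mu> z) (\<nu> z) \<in> couplings (\<mu> z) (\<nu> z)"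
    using C r prob z by (intro step_coupling(1)) (auto simp: sets)
  then have "prob_space (step_coupling C n r (\<mu> z) (\<nu> z))"
    using prob(1)[OF z] by (rule prob_space_coupling)
  then show "subprob_space (step_coupling C n r (\<mu> z) (\<nu> z))" by (rule prob_space_imp_subprob_space)
next
  note [measurable] = C(2)
  fix A :: "('a \<times> 'a) set" assume A[measurable]: "A \<in> sets (borel \<Otimes>\<^sub>M borel)"
  have [measurable]: "(\<lambda>z. if_admissible C n r (\<mu> z) (\<nu> z) i j) \<in> borel_measurable M" for i j
    unfolding if_admissible_def admissible_def by measurable
  have m: "(\<lambda>z. \<mu> z \<Otimes>\<^sub>M \<nu> z) \<in> M \<rightarrow>\<^sub>M subprob_algebra (borel \<Otimes>\<^sub>M borel)"
    by (intro measurable_pair_measure) measurable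
  have f: "(\<lambda>(z, p). ennreal (step_density C n (if_admissible C n r (\<mu> z) (\<nu> z)) (\<mu> z) (\<nu> z) p) * indicator A p)
      \<in> borel_measurable (M \<Otimes>\<^sub>M (borel \<Otimes>\<^sub>M borel))"
    unfolding step_density_def step_fun_def step_fst_def step_snd_def step_mass_def by measurable
  have "(\<lambda>z. \<integral>\<^sup>+ p. ennreal (step_density C n (if_admissible C n r (\<mu> z) (\<nu> z)) (\<mu> z) (\<nu> z) p) * indicator A p \<partial>(\<mu> z \<Otimes>\<^sub>M \<nu> z))
      \<in> borel_measurable M"
    by (rule nn_integral_measurable_subprob_algebra2[OF f m])
  moreover have "emeasure (step_coupling C n r (\<mu> z) (\<nu> z)) A =
     (\<integral>\<^sup>+ p. ennreal (step_density C n (if_admissible C n r (\<mu> z) (\<nu> z)) (\<mu> z) (\<nu> z) p) * indicator A p \<partial>(\<mu> z \<Otimes>\<^sub>M \<nu> z))"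
    if z: "z \<in> space M" for z
  proof -
    have sp: "sets (\<mu> z \<Otimes>\<^sub>M \<nu> z) = sets (borel \<Otimes>\<^sub>M borel)"
      using subprob_measurableD(2)[OF assms(4) z] subprob_measurableD(2)[OF assms(5) z] by (intro sets_pair_measure_cong)
    show ?thesis unfolding step_coupling_def
    proof (rule emeasure_density)
      show "(\<lambda>p. ennreal (step_density C n (if_admissible C n r (\<mu> z) (\<nu> z)) (\<mu> z) (\<nu> z) p)) \<in> borel_measurable (\<mu> z \<Otimes>\<^sub>M \<nu> z)"
        unfolding measurable_cong_sets[OF sp refl] step_density_def step_fun_def step_fst_def step_snd_def
        by measurable
      show "A \<in> sets (\<mu> z \<Otimes>\<^sub>M \<nu> z)" by (simp add: sp A)
    qed
  qed
  ultimately show "(\<lambda>z. emeasure (step_coupling C n r (\<mu> z) (\<nu> z)) A) \<in> borel_measurable M"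
    by (simp cong: measurable_cong)
qed

text \<open>Codes of the countable family: step couplings, with their rational matrices stored as
  lists, closed under midpoints. Countability turns infima and least-index choices into measurable
  operations.\<close>

datatype mix = Step nat nat "rat list list" | Half mix mix

instance mix :: countable by countable_datatype

text \<open>Negative entries are cut off at 0, so every list is a legitimate code; entries outside
  the list are unspecified numbers and are cut off likewise.\<close>

definition matrix_entry :: "rat list list \<Rightarrow> nat \<Rightarrow> nat \<Rightarrow> real" where
  "matrix_entry l i j = max 0 (of_rat (l ! i ! j))"

primrec mix_coupling :: "(nat \<Rightarrow> nat \<Rightarrow> 'a set) \<Rightarrow> 'a measure \<Rightarrow> 'a measure \<Rightarrow> mix \<Rightarrow> ('a \<times> 'a) measure" where
  "mix_coupling C \<mu> \<nu> (Step k n l) = step_coupling (C k) n (matrix_entry l) \<mu> \<nu>"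
| "mix_coupling C \<mu> \<nu> (Half s t) = half_sum (mix_coupling C \<mu> \<nu> s) (mix_coupling C \<mu> \<nu> t)"

lemma mix_coupling:
  assumes "\<And>k. disjoint_family (C k)" "\<And>k i. C k i \<in> sets \<mu>" "\<And>k i. C k i \<in> sets \<nu>" "prob_space \<mu>" "prob_space \<nu>"
  shows "mix_coupling C \<mu> \<nu> t \<in> couplings \<mu> \<nu>"
proof (induction t)
  case (Step k n l)
  show ?case using assms by (auto intro!: step_coupling(1) simp: matrix_entry_def)
qed (simp add: half_sum_coupling)

lemma measurable_mix_coupling:
  fixes \<mu> \<nu> :: "'s \<Rightarrow> 'a::second_countable_topology measure"
  assumes C: "\<And>k. disjoint_family (C k)" "\<And>k i. C k i \<in> sets borel"
    and \<mu>\<nu>: "\<mu> \<in> M \<rightarrow>\<^sub>M subprob_algebra borel" "\<nu> \<in> M \<rightarrow>\<^sub>M subprob_algebra borel"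
    and prob: "\<And>z. z \<in> space M \<Longrightarrow> prob_space (\<mu> z)" "\<And>z. z \<in> space M \<Longrightarrow> prob_space (\<nu> z)"
  shows "(\<lambda>z. mix_coupling C (\<mu> z) (\<nu> z) t) \<in> M \<rightarrow>\<^sub>M subprob_algebra (borel \<Otimes>\<^sub>M borel)"
proof (induction t)
  case (Step k n l)
  show ?case using assms by (auto intro!: measurable_step_coupling simp: matrix_entry_def)
next
  case (Half s t)
  note [measurable] = Half
  show ?case
  proof (rule measurable_subprob_algebra)
    fix z assume z: "z \<in> space M"
    have sets: "sets (\<mu> z) = sets borel" "sets (\<nu> z) = sets borel"
      using subprob_measurableD(2)[OF \<mu>\<nu>(1) z] subprob_measurableD(2)[OF \<mu>\<nu>(2) z] by auto
    have "mix_coupling C (\<mu> z) (\<nu> z) (Half s t) \<in> couplings (\<mu> z) (\<nu> z)"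
      using C prob z by (intro mix_coupling) (auto simp: sets)
    then have "prob_space (mix_coupling C (\<mu> z) (\<nu> z) (Half s t))"
      using prob(1)[OF z] by (rule prob_space_coupling)
    then show "subprob_space (mix_coupling C (\<mu> z) (\<nu> z) (Half s t))" by (rule prob_space_imp_subprob_space)
    show "sets (mix_coupling C (\<mu> z) (\<nu> z) (Half s t)) = sets (borel \<Otimes>\<^sub>M borel)"
      using subprob_measurableD(2)[OF Half(1) z] by simp
  next
    fix A :: "('a \<times> 'a) set" assume A[measurable]: "A \<in> sets (borel \<Otimes>\<^sub>M borel)"
    have "(\<lambda>z. (emeasure (mix_coupling C (\<mu> z) (\<nu> z) s) A + emeasure (mix_coupling C (\<mu> z) (\<nu> z) t) A) / 2) \<in> borel_measurable M"
      by measurable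
    moreover have "emeasure (mix_coupling C (\<mu> z) (\<nu> z) (Half s t)) A =
        (emeasure (mix_coupling C (\<mu> z) (\<nu> z) s) A + emeasure (mix_coupling C (\<mu> z) (\<nu> z) t) A) / 2" if "z \<in> space M" for z
      using subprob_measurableD(2)[OF Half(1) that] subprob_measurableD(2)[OF Half(2) that] by (simp add: emeasure_half_sum)
    ultimately show "(\<lambda>z. emeasure (mix_coupling C (\<mu> z) (\<nu> z) (Half s t)) A) \<in> borel_measurable M"
      by (simp cong: measurable_cong)
  qed
qed

text \<open>Density of the step couplings turns the infimum over all couplings into a countable one,
  hence into a measurable function of the marginals.\<close>

lemma wasserstein_mix_coupling:
  fixes \<mu> \<nu> :: "'a::{metric_space, second_countable_topology} measure"
  assumes C: "\<And>k. disjoint_family (C k)" "\<And>k. (\<Union>i. C k i) = UNIV" "\<And>k i. C k i \<in> sets borel"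
      "\<And>k i. \<forall>u\<in>C k i. dist u (c k i) < (1/2) ^ k"
    and prob: "prob_space \<mu>" "prob_space \<nu>" and sets: "sets \<mu> = sets borel" "sets \<nu> = sets borel"
    and mom: "(\<integral>\<^sup>+ u. dist x0 u \<partial>\<mu>) < \<infinity>" "(\<integral>\<^sup>+ u. dist x0 u \<partial>\<nu>) < \<infinity>"
  shows "wasserstein dist \<mu> \<nu> = (INF t. \<integral>\<^sup>+ (u, v). ennreal (dist u v) \<partial>mix_coupling C \<mu> \<nu> t)"
    and "wasserstein dist \<mu> \<nu> < \<infinity>"
proof -
  have mix: "mix_coupling C \<mu> \<nu> t \<in> couplings \<mu> \<nu>" for t
    using C prob by (intro mix_coupling) (auto simp: sets)
  show "wasserstein dist \<mu> \<nu> = (INF t. \<integral>\<^sup>+ (u, v). ennreal (dist u v) \<partial>mix_coupling C \<mu> \<nu> t)"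
  proof (rule antisym)
    show "wasserstein dist \<mu> \<nu> \<le> (INF t. \<integral>\<^sup>+ (u, v). ennreal (dist u v) \<partial>mix_coupling C \<mu> \<nu> t)"
      unfolding wasserstein_def by (intro INF_mono) (auto intro: mix)
    have "(INF t. \<integral>\<^sup>+ (u, v). ennreal (dist u v) \<partial>mix_coupling C \<mu> \<nu> t) \<le> (\<integral>\<^sup>+ (u, v). ennreal (dist u v) \<partial>\<pi>)"
      if \<pi>: "\<pi> \<in> couplings \<mu> \<nu>" for \<pi>
    proof (rule dense_ge)
      fix w assume "(\<integral>\<^sup>+ (u, v). ennreal (dist u v) \<partial>\<pi>) < w"
      then obtain k n and q :: "nat \<Rightarrow> nat \<Rightarrow> rat" where q: "\<And>i j. 0 \<le> q i j"
        and less: "(\<integral>\<^sup>+ (u, v). ennreal (dist u v) \<partial>step_coupling (C k) n (\<lambda>i j. of_rat (q i j)) \<mu> \<nu>) < w"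
        by (rule step_coupling_dense[OF C prob sets mom \<pi>]) blast
      \<comment> \<open>Only entries with indices below \<open>n\<close> enter a step coupling, so a
        finite list encodes the rational matrix.\<close>
      define l where "l = map (\<lambda>i. map (q i) [0..<n]) [0..<n]"
      have l: "matrix_entry l i j = of_rat (q i j)" if "i < n" "j < n" for i j
        using that q by (simp add: matrix_entry_def l_def)
      have adm: "admissible (C k) n (matrix_entry l) \<mu> \<nu> = admissible (C k) n (\<lambda>i j. of_rat (q i j)) \<mu> \<nu>"
        by (simp add: admissible_def l)
      have if_adm: "if_admissible (C k) n (matrix_entry l) \<mu> \<nu> i j = if_admissible (C k) n (\<lambda>i j. of_rat (q i j)) \<mu> \<nu> i j"
        if "i < n" "j < n" for i j
        using that by (simp add: if_admissible_def adm l)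
      have "step_coupling (C k) n (matrix_entry l) \<mu> \<nu> = step_coupling (C k) n (\<lambda>i j. of_rat (q i j)) \<mu> \<nu>"
        by (simp add: step_coupling_def step_density_def step_fun_def step_fst_def step_snd_def step_mass_def if_adm)
      then have "(\<integral>\<^sup>+ (u, v). ennreal (dist u v) \<partial>mix_coupling C \<mu> \<nu> (Step k n l)) < w" using less by simp
      then show "(INF t. \<integral>\<^sup>+ (u, v). ennreal (dist u v) \<partial>mix_coupling C \<mu> \<nu> t) \<le> w"
        by (intro INF_lower2[where i="Step k n l"]) auto
    qed
    then show "(INF t. \<integral>\<^sup>+ (u, v). ennreal (dist u v) \<partial>mix_coupling C \<mu> \<nu> t) \<le> wasserstein dist \<mu> \<nu>"
      unfolding wasserstein_def by (intro INF_greatest)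
  qed
  note [measurable_cong] = sets
  \<comment> \<open>With no cells at all the step coupling is the product measure, whose cost is at
    most the sum of the two first moments.\<close>
  have "wasserstein dist \<mu> \<nu> \<le> (\<integral>\<^sup>+ (u, v). ennreal (dist u v) \<partial>step_coupling (C 0) 0 (\<lambda>_ _. 0) \<mu> \<nu>)"
    unfolding wasserstein_def using C prob by (intro INF_lower step_coupling(1)) (auto simp: sets)
  also have "\<dots> \<le> (\<integral>\<^sup>+ (u, v). ennreal (dist u v) * ennreal (step_fun (C 0) 0 (\<lambda>_ _. 0) (u, v)) \<partial>(\<mu> \<Otimes>\<^sub>M \<nu>))
          + (\<integral>\<^sup>+ u. ennreal (dist x0 u) * ennreal (1 - step_fst (C 0) 0 (\<lambda>_ _. 0) \<nu> u) \<partial>\<mu>)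
          + (\<integral>\<^sup>+ v. ennreal (dist x0 v) * ennreal (1 - step_snd (C 0) 0 (\<lambda>_ _. 0) \<mu> v) \<partial>\<nu>)"
    using C prob by (intro step_coupling(2)) (auto simp: sets admissible_def intro: dist_triangle3)
  also have "\<dots> = (\<integral>\<^sup>+ u. dist x0 u \<partial>\<mu>) + (\<integral>\<^sup>+ u. dist x0 u \<partial>\<nu>)"
    by (simp add: step_fun_def step_fst_def step_snd_def case_prod_beta')
  also have "\<dots> < \<infinity>" using mom by simp
  finally show "wasserstein dist \<mu> \<nu> < \<infinity>" .
qed

section \<open>Measurable choice of an optimal coupling\<close>

text \<open>The selection is made among the codes, where the least index of an acceptable code
  depends measurably on \<open>z\<close>. Asking for almost minimal cost and then for almost minimal
  \<open>\<Psi>\<close> makes the selected couplings converge on rectangles. The limit is measurable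
  as a pointwise limit, and optimal because the cost is lower semicontinuous.\<close>

lemma measurable_optimal_coupling:
  fixes \<mu> \<nu> :: "'s \<Rightarrow> 'a::polish_space measure"
  assumes \<mu>\<nu>: "\<mu> \<in> M \<rightarrow>\<^sub>M subprob_algebra borel" "\<nu> \<in> M \<rightarrow>\<^sub>M subprob_algebra borel"
    and prob: "\<And>z. z \<in> space M \<Longrightarrow> prob_space (\<mu> z)" "\<And>z. z \<in> space M \<Longrightarrow> prob_space (\<nu> z)"
    and mom: "\<And>z. z \<in> space M \<Longrightarrow> (\<integral>\<^sup>+ u. dist x0 u \<partial>\<mu> z) < \<infinity>" "\<And>z. z \<in> space M \<Longrightarrow> (\<integral>\<^sup>+ u. dist x0 u \<partial>\<nu> z) < \<infinity>"
  obtains \<pi> where "\<pi> \<in> M \<rightarrow>\<^sub>M subprob_algebra (borel \<Otimes>\<^sub>M borel)"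
    and "\<And>z. z \<in> space M \<Longrightarrow> \<pi> z \<in> couplings (\<mu> z) (\<nu> z)"
    and "\<And>z. z \<in> space M \<Longrightarrow> (\<integral>\<^sup>+ (u, v). ennreal (dist u v) \<partial>\<pi> z) = wasserstein dist (\<mu> z) (\<nu> z)"
    and "\<And>z. z \<in> space M \<Longrightarrow> wasserstein dist (\<mu> z) (\<nu> z) < \<infinity>"
proof -
  have "\<exists>(C :: nat \<Rightarrow> 'a set) c. disjoint_family C \<and> (\<Union>i. C i) = UNIV \<and> (\<forall>i. C i \<in> sets borel) \<and> (\<forall>i. \<forall>u\<in>C i. dist u (c i) < (1/2) ^ k)" for k
    by (rule small_partition[of "(1/2) ^ k", where 'a='a]) (simp, blast)
  then obtain C :: "nat \<Rightarrow> nat \<Rightarrow> 'a set" and c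
    where C: "\<And>k. disjoint_family (C k)" "\<And>k. (\<Union>i. C k i) = UNIV" "\<And>k i. C k i \<in> sets borel"
      "\<And>k i. \<forall>u\<in>C k i. dist u (c k i) < (1/2) ^ k"
    by metis
  obtain U :: "nat \<Rightarrow> 'a set" and \<sigma> where U: "\<And>n. open (U n)" and \<sigma>: "\<sigma> \<in> borel_measurable bit_space" "\<And>u. \<sigma> (\<lambda>n. u \<in> U n) = u"
    by (rule polish_binary_code[where 'a='a]) blast
  have sets: "sets (\<mu> z) = sets borel" "sets (\<nu> z) = sets borel" if "z \<in> space M" for z
    using subprob_measurableD(2)[OF \<mu>\<nu>(1) that] subprob_measurableD(2)[OF \<mu>\<nu>(2) that] by auto
  define K where "K t z = mix_coupling C (\<mu> z) (\<nu> z) t" for t z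
  have K_meas[measurable]: "K t \<in> M \<rightarrow>\<^sub>M subprob_algebra (borel \<Otimes>\<^sub>M borel)" for t
    unfolding K_def by (rule measurable_mix_coupling[OF C(1,3) \<mu>\<nu> prob])
  have K: "K t z \<in> couplings (\<mu> z) (\<nu> z)" if "z \<in> space M" for t z
    unfolding K_def using C prob that by (intro mix_coupling) (auto simp: sets)
  define cost where "cost t z = (\<integral>\<^sup>+ (u, v). ennreal (dist u v) \<partial>K t z)" for t z
  have cost_meas[measurable]: "cost t \<in> borel_measurable M" for t
    unfolding cost_def by (rule measurable_compose[OF K_meas nn_integral_measurable_subprob_algebra]) measurable
  define W where "W z = (INF t. cost t z)" for z
  have W: "W z = wasserstein dist (\<mu> z) (\<nu> z)" "W z < \<infinity>" if "z \<in> space M" for z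
    using wasserstein_mix_coupling[OF C prob(1)[OF that] prob(2)[OF that] sets[OF that] mom(1)[OF that] mom(2)[OF that]]
    by (simp_all add: W_def cost_def K_def)
  have W_meas[measurable]: "W \<in> borel_measurable M" unfolding W_def by (rule borel_measurable_INF) auto
  \<comment> \<open>Enumerates the products of finite intersections of coding sets, the rectangles
    on which the compactness argument wants convergence.\<close>
  define R :: "nat \<Rightarrow> ('a \<times> 'a) set" where "R j = (case from_nat j of (a, b) \<Rightarrow> {u. \<forall>n\<in>set a. u \<in> U n} \<times> {v. \<forall>n\<in>set b. v \<in> U n})" for j
  have R_meas[measurable]: "R j \<in> sets (borel \<Otimes>\<^sub>M borel)" for j
  proof -
    have "{u. \<forall>n\<in>set I. u \<in> U n} \<in> sets borel" for I
      using borel_open[OF U] sets.finite_INT[of "set I" U borel] 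
      by (cases "set I = {}") (auto simp: INTER_eq)
    then show ?thesis by (auto simp: R_def split: prod.split)
  qed
  define f where "f t j z = measure (K t z) (R j)" for t j z
  have f_meas[measurable]: "f t j \<in> borel_measurable M" for t j unfolding f_def by measurable
  have f_bounds: "0 \<le> f t j z" "f t j z \<le> 1" if "z \<in> space M" for t j z
  proof -
    interpret prob_space "K t z" by (rule prob_space_coupling[OF K[OF that] prob(1)[OF that]])
    show "0 \<le> f t j z" "f t j z \<le> 1" by (simp_all add: f_def)
  qed
  \<comment> \<open>A strictly convex functional, which singles out one optimal coupling: midpoints make an
    almost minimising sequence converge.\<close>
  define \<Psi> where "\<Psi> t z = (\<Sum>j. (1/2) ^ j * (f t j z)\<^sup>2)" for t z
  have summ: "summable (\<lambda>j. (1/2) ^ j * h j)" if "\<And>j. \<bar>h j\<bar> \<le> 1" for h :: "nat \<Rightarrow> real"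
    by (rule summable_comparison_test'[where N=0, OF summable_geometric[of "1/2"]])
      (auto simp: abs_mult intro!: mult_left_le that)
  have f2: "\<bar>(f t j z)\<^sup>2\<bar> \<le> 1" if "z \<in> space M" for t j z using f_bounds[OF that] by (simp add: power_le_one)
  have \<Psi>_summ: "summable (\<lambda>j. (1/2) ^ j * (f t j z)\<^sup>2)" if "z \<in> space M" for t z by (intro summ f2 that)
  have \<Psi>_meas[measurable]: "\<Psi> t \<in> borel_measurable M" for t unfolding \<Psi>_def by measurable
  have \<Psi>_pos: "0 \<le> \<Psi> t z" if "z \<in> space M" for t z unfolding \<Psi>_def by (intro suminf_nonneg \<Psi>_summ that) simp
  have \<Psi>_le: "\<Psi> t z \<le> 2" if "z \<in> space M" for t z
  proof -
    have "\<Psi> t z \<le> (\<Sum>j. (1/2) ^ j)" unfolding \<Psi>_def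
      using f2[OF that] by (intro suminf_le \<Psi>_summ that summable_geometric) (auto intro!: mult_left_le)
    then show ?thesis using suminf_geometric[of "1/2::real"] by simp
  qed
  define e where "e m = 1 / real (Suc m)" for m
  have e: "0 < e m" "m \<le> m' \<Longrightarrow> e m' \<le> e m" for m m' by (simp_all add: e_def frac_le)
  define ok where "ok m t z \<longleftrightarrow> cost t z \<le> W z + ennreal (e m)" for m t z
  have ok_mono: "ok m' t z \<Longrightarrow> m \<le> m' \<Longrightarrow> ok m t z" for m m' t z
    unfolding ok_def using e(2) by (meson add_left_mono ennreal_leI order_trans)
  have ok_meas[measurable]: "Measurable.pred M (ok m t)" for m t unfolding ok_def by measurable
  have ok_ex: "\<exists>t. ok m t z" if "z \<in> space M" for m z
  proof -
    have "W z < W z + ennreal (e m)" using W(2)[OF that] e by (simp add: ennreal_add_left_cancel_less[of _ 0, simplified] less_top)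
    then show ?thesis unfolding ok_def W_def[of z, unfolded] by (auto simp: W_def INF_less_iff intro: less_imp_le)
  qed
  \<comment> \<open>The least \<open>\<Psi>\<close> among couplings that are optimal up to
    \<open>e m\<close>. It increases with \<open>m\<close> and is at most 2, hence converges, and
    its increments control how far the selected couplings are apart.\<close>
  define V where "V m z = (INF t. if ok m t z then ennreal (\<Psi> t z) else \<infinity>)" for m z
  have V_meas[measurable]: "V m \<in> borel_measurable M" for m unfolding V_def by (rule borel_measurable_INF) auto
  have V_lower: "V m z \<le> ennreal (\<Psi> t z)" if "ok m t z" for m t z
    unfolding V_def using that by (intro INF_lower2[of t]) auto
  have V_mono: "V m z \<le> V m' z" if "m \<le> m'" for m m' z
    unfolding V_def using ok_mono[OF _ that] by (intro INF_mono) auto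
  have V_le: "V m z \<le> 2" if z: "z \<in> space M" for m z
  proof -
    obtain t where "ok m t z" using ok_ex[OF z] by blast
    then show ?thesis using V_lower ennreal_leI[OF \<Psi>_le[OF z, of t]] by (metis ennreal_numeral order_trans zero_le_numeral)
  qed
  define v where "v m z = enn2real (V m z)" for m z
  have v: "V m z = ennreal (v m z)" "0 \<le> v m z" "v m z \<le> 2" if "z \<in> space M" for m z
    using V_le[OF that, of m] by (auto simp: v_def top_unique le_less_trans[of _ 2 \<top>] less_top enn2real_leI intro!: ennreal_enn2real[symmetric])
  have v_mono: "v m z \<le> v m' z" if "m \<le> m'" "z \<in> space M" for m m' z
    using V_mono[OF that(1), of z] v[OF that(2)] by (simp add: ennreal_le_iff)
  define good where "good m n z \<longleftrightarrow> ok m (from_nat n) z \<and> ennreal (\<Psi> (from_nat n) z) \<le> V m z + ennreal (e m)" for m n z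
  have good_meas[measurable]: "Measurable.pred M (good m n)" for m n unfolding good_def by measurable
  have good_ex: "\<exists>n. good m n z" if z: "z \<in> space M" for m z
  proof -
    have "V m z < V m z + ennreal (e m)" using V_le[OF z, of m] e
      by (simp add: ennreal_add_left_cancel_less[of _ 0, simplified] less_top le_less_trans[of _ 2 \<top>])
    then have "(INF t. if ok m t z then ennreal (\<Psi> t z) else \<infinity>) < V m z + ennreal (e m)"
      by (simp only: V_def)
    then obtain t where "(if ok m t z then ennreal (\<Psi> t z) else \<infinity>) < V m z + ennreal (e m)"
      unfolding INF_less_iff by blast
    then have "good m (to_nat t) z" by (auto simp: good_def split: if_splits)
    then show ?thesis ..
  qed
  define \<tau> where "\<tau> m z = (LEAST n. good m n z)" for m z
  have \<tau>_meas[measurable]: "\<tau> m \<in> M \<rightarrow>\<^sub>M count_space UNIV" for m unfolding \<tau>_def by measurable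
  have \<tau>: "good m (\<tau> m z) z" if "z \<in> space M" for m z unfolding \<tau>_def by (rule LeastI_ex[OF good_ex[OF that]])
  define T :: "nat \<Rightarrow> 's \<Rightarrow> mix" where "T m z = from_nat (\<tau> m z)" for m z
  have T: "ok m (T m z) z" "\<Psi> (T m z) z \<le> v m z + e m" if "z \<in> space M" for m z
    using \<tau>[OF that, of m] v[OF that, of m] e(1)[of m] by (auto simp: good_def T_def simp flip: ennreal_plus)
  define \<pi> where "\<pi> m z = K (T m z) z" for m z
  have \<pi>_meas[measurable]: "\<pi> m \<in> M \<rightarrow>\<^sub>M subprob_algebra (borel \<Otimes>\<^sub>M borel)" for m
    unfolding \<pi>_def T_def by (rule measurable_compose_countable[OF _ \<tau>_meas]) simp
  have \<pi>: "\<pi> m z \<in> couplings (\<mu> z) (\<nu> z)" if "z \<in> space M" for m z unfolding \<pi>_def by (rule K[OF that])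
  have conv: "convergent (\<lambda>m. measure (\<pi> m z) (R j))" if z: "z \<in> space M" for z j
  proof -
    \<comment> \<open>The cost is affine, so the midpoint of two selected couplings is again optimal
      up to \<open>e m\<close>, and its \<open>\<Psi>\<close> is at least \<open>v m z\<close>. The
      parallelogram identity then bounds the squared distance; the factor \<open>2 ^ j\<close>
      undoes the weight of the \<open>j\<close>-th rectangle.\<close>
    have sq: "(f (T m z) j z - f (T m' z) j z)\<^sup>2 \<le> 2 ^ j * (2 * (v m' z - v m z) + 4 * e m)" if mm: "m \<le> m'" for m m'
    proof -
      let ?s = "T m z" and ?t = "T m' z"
      have sets_K: "sets (K t z) = sets (borel \<Otimes>\<^sub>M borel)" for t using subprob_measurableD(2)[OF K_meas z] .
      have K_mid: "K (Half ?s ?t) z = half_sum (K ?s z) (K ?t z)" by (simp add: K_def)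
      have "cost (Half ?s ?t) z = (cost ?s z + cost ?t z) / 2"
        unfolding cost_def K_mid by (rule nn_integral_half_sum) (auto simp: sets_K measurable_cong_sets[OF sets_K refl])
      also have "\<dots> \<le> ((W z + ennreal (e m)) + (W z + ennreal (e m))) / 2"
        using T(1)[OF z, of m] ok_mono[OF T(1)[OF z, of m'] mm] by (intro divide_right_mono_ennreal add_mono) (auto simp: ok_def)
      finally have "ok m (Half ?s ?t) z" unfolding ok_def ennreal_half_double .
      from V_lower[OF this] have low: "v m z \<le> \<Psi> (Half ?s ?t) z" using v[OF z] \<Psi>_pos[OF z] by (simp add: ennreal_le_iff)
      have f_mid: "f (Half ?s ?t) i z = (f ?s i z + f ?t i z) / 2" for i
      proof -
        interpret S: prob_space "K ?s z" by (rule prob_space_coupling[OF K[OF z] prob(1)[OF z]])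
        interpret T: prob_space "K ?t z" by (rule prob_space_coupling[OF K[OF z] prob(1)[OF z]])
        have "emeasure (K (Half ?s ?t) z) (R i) = ennreal ((f ?s i z + f ?t i z) / 2)"
          unfolding K_mid by (subst emeasure_half_sum)
            (auto simp: sets_K f_def S.emeasure_eq_measure T.emeasure_eq_measure divide_ennreal[symmetric] simp flip: ennreal_plus)
        then show ?thesis using f_bounds[OF z, of ?s i] f_bounds[OF z, of ?t i] by (simp add: f_def measure_def)
      qed
      have diff: "\<bar>(f ?s i z - f ?t i z)\<^sup>2\<bar> \<le> 1" for i
        using f_bounds[OF z, of ?s i] f_bounds[OF z, of ?t i] by (simp add: abs_square_le_1 abs_le_iff)
      have expand: "(\<lambda>i. (1/2) ^ i * (f ?s i z - f ?t i z)\<^sup>2) =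
          (\<lambda>i. 2 * ((1/2) ^ i * (f ?s i z)\<^sup>2) + 2 * ((1/2) ^ i * (f ?t i z)\<^sup>2) - 4 * ((1/2) ^ i * (f (Half ?s ?t) i z)\<^sup>2))"
        unfolding f_mid by (simp add: fun_eq_iff power2_eq_square field_simps)
      have "(1/2) ^ j * (f ?s j z - f ?t j z)\<^sup>2 \<le> (\<Sum>i. (1/2) ^ i * (f ?s i z - f ?t i z)\<^sup>2)"
        using sum_le_suminf[OF summ[OF diff], of "{j}"] by simp
      also have "\<dots> = 2 * \<Psi> ?s z + 2 * \<Psi> ?t z - 4 * \<Psi> (Half ?s ?t) z"
        unfolding expand \<Psi>_def using \<Psi>_summ[OF z]
        by (simp add: suminf_diff[symmetric] suminf_add[symmetric] suminf_mult summable_mult summable_add)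
      also have "\<dots> \<le> 2 * (v m z + e m) + 2 * (v m' z + e m) - 4 * v m z"
        using T(2)[OF z, of m] T(2)[OF z, of m'] e(2)[OF mm] low by simp
      finally have "(f ?s j z - f ?t j z)\<^sup>2 * (1/2) ^ j \<le> 2 * (v m' z - v m z) + 4 * e m" by (simp add: mult.commute)
      then show ?thesis by (simp add: power_one_over field_simps)
    qed
    have "Cauchy (\<lambda>m. v m z)"
      by (intro convergent_Cauchy Bseq_mono_convergent BseqI'[of _ 2] allI impI v_mono z) (use v[OF z] in auto)
    have e_lim: "e \<longlonglongrightarrow> 0" unfolding e_def using LIMSEQ_Suc[OF lim_1_over_n] by simp
    have "Cauchy (\<lambda>m. f (T m z) j z)"
    proof (rule CauchyI')
      fix d :: real assume "d > 0"
      \<comment> \<open>The increment of \<open>v\<close> contributes less than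
        \<open>2 * d'\<close> and \<open>e m\<close> less than \<open>4 * d'\<close>; together they
        stay below \<open>8 * d'\<close>, which times \<open>2 ^ j\<close> is
        \<open>d\<^sup>2\<close>.\<close>
      define d' where "d' = d\<^sup>2 / 2 ^ j / 8"
      have d': "d' > 0" using \<open>d > 0\<close> by (simp add: d'_def)
      obtain N1 where N1: "\<And>m m'. m \<ge> N1 \<Longrightarrow> m' \<ge> N1 \<Longrightarrow> \<bar>v m z - v m' z\<bar> < d'"
        using CauchyD[OF \<open>Cauchy (\<lambda>m. v m z)\<close> d'] by auto
      obtain N2 where N2: "\<And>m. m \<ge> N2 \<Longrightarrow> e m < d'"
        using order_tendstoD(2)[OF e_lim d'] by (auto simp: eventually_sequentially)
      show "\<exists>N. \<forall>m\<ge>N. \<forall>n>m. dist (f (T m z) j z) (f (T n z) j z) < d"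
      proof (intro exI[of _ "max N1 N2"] allI impI)
        fix m n assume mn: "max N1 N2 \<le> m" "m < n"
        have "(f (T m z) j z - f (T n z) j z)\<^sup>2 \<le> 2 ^ j * (2 * (v n z - v m z) + 4 * e m)" using mn by (intro sq) auto
        also have "\<dots> < 2 ^ j * (8 * d')" using N1[of m n] N2[of m] mn by (intro mult_strict_left_mono) auto
        also have "\<dots> = d\<^sup>2" by (simp add: d'_def)
        finally show "dist (f (T m z) j z) (f (T n z) j z) < d"
          using \<open>d > 0\<close> power2_less_imp_less[of "\<bar>f (T m z) j z - f (T n z) j z\<bar>" d] by (simp add: dist_real_def)
      qed
    qed
    then show ?thesis by (simp add: f_def \<pi>_def Cauchy_convergent_iff)
  qed
  have lim: "\<exists>L. L \<in> couplings (\<mu> z) (\<nu> z) \<and> (\<forall>A\<in>sets borel. \<forall>B\<in>sets borel. (\<lambda>m. measure (\<pi> m z) (A \<times> B)) \<longlonglongrightarrow> measure L (A \<times> B))"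
    if z: "z \<in> space M" for z
  proof (rule coupling_sequence_limit[OF U \<sigma> prob(1)[OF z] prob(2)[OF z] sets[OF z] \<pi>[OF z]])
    fix I J :: "nat set" assume "finite I" "finite J"
    then obtain I' J' where "I = set I'" "J = set J'" using finite_list by metis
    then have "R (to_nat (I', J')) = {u. \<forall>n\<in>I. u \<in> U n} \<times> {v. \<forall>n\<in>J. v \<in> U n}" by (simp add: R_def)
    then show "convergent (\<lambda>m. measure (\<pi> m z) ({u. \<forall>n\<in>I. u \<in> U n} \<times> {v. \<forall>n\<in>J. v \<in> U n}))"
      using conv[OF z, of "to_nat (I', J')"] by simp
  qed blast
  then obtain L where L: "\<And>z. z \<in> space M \<Longrightarrow> L z \<in> couplings (\<mu> z) (\<nu> z)"
    "\<And>z A B. z \<in> space M \<Longrightarrow> A \<in> sets borel \<Longrightarrow> B \<in> sets borel \<Longrightarrow> (\<lambda>m. measure (\<pi> m z) (A \<times> B)) \<longlonglongrightarrow> measure (L z) (A \<times> B)"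
    by metis
  have sets_cpl: "sets P = sets (borel \<Otimes>\<^sub>M borel)" if "P \<in> couplings (\<mu> z) (\<nu> z)" "z \<in> space M" for P z
    using coupling_sets[OF that(1)] sets[OF that(2)] by (metis sets_pair_measure_cong)
  have L_prob: "prob_space (L z)" if "z \<in> space M" for z by (rule prob_space_coupling[OF L(1)[OF that] prob(1)[OF that]])
  show ?thesis
  proof (rule that[of L])
    show "L \<in> M \<rightarrow>\<^sub>M subprob_algebra (borel \<Otimes>\<^sub>M borel)"
    proof (rule measurable_subprob_algebra_generated[where \<Omega>=UNIV and G="{A \<times> B | A B. A \<in> sets borel \<and> B \<in> sets borel}"])
      show "sets (borel \<Otimes>\<^sub>M borel) = sigma_sets UNIV {A \<times> B |A B. A \<in> sets borel \<and> B \<in> sets (borel :: 'a measure)}"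
        by (simp add: sets_pair_measure)
      show "Int_stable {A \<times> B |A B. A \<in> sets borel \<and> B \<in> sets (borel :: 'a measure)}"
        using Int_stable_pair_measure_generator[of borel borel] by simp
      show "subprob_space (L z)" if "z \<in> space M" for z using L_prob[OF that] by (rule prob_space_imp_subprob_space)
      show "sets (L z) = sets (borel \<Otimes>\<^sub>M borel)" if "z \<in> space M" for z using sets_cpl[OF L(1)[OF that] that] .
      have rect: "(\<lambda>z. emeasure (L z) (A \<times> B)) \<in> borel_measurable M" if [measurable]: "A \<in> sets borel" "B \<in> sets borel" for A B
      proof -
        have "(\<lambda>z. measure (L z) (A \<times> B)) \<in> borel_measurable M"
        proof (rule borel_measurable_LIMSEQ_metric)
          show "(\<lambda>z. measure (\<pi> m z) (A \<times> B)) \<in> borel_measurable M" for m by measurable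
          show "(\<lambda>m. measure (\<pi> m z) (A \<times> B)) \<longlonglongrightarrow> measure (L z) (A \<times> B)" if "z \<in> space M" for z
            by (rule L(2)) (use that in auto)
        qed
        then have "(\<lambda>z. ennreal (measure (L z) (A \<times> B))) \<in> borel_measurable M" by measurable
        moreover have "ennreal (measure (L z) (A \<times> B)) = emeasure (L z) (A \<times> B)" if "z \<in> space M" for z
          using finite_measure.emeasure_eq_measure[OF prob_space.finite_measure[OF L_prob[OF that]]] by simp
        ultimately show ?thesis by (simp cong: measurable_cong)
      qed
      show "(\<lambda>z. emeasure (L z) A) \<in> borel_measurable M" if "A \<in> {A \<times> B |A B. A \<in> sets borel \<and> B \<in> sets borel}" for A
        using that rect by auto
      show "(\<lambda>z. emeasure (L z) UNIV) \<in> borel_measurable M" using rect[of UNIV UNIV] by simp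
    qed auto
    fix z assume z: "z \<in> space M"
    show "L z \<in> couplings (\<mu> z) (\<nu> z)" by (rule L(1)[OF z])
    show "wasserstein dist (\<mu> z) (\<nu> z) < \<infinity>" using W[OF z] by simp
    show "(\<integral>\<^sup>+ (u, v). ennreal (dist u v) \<partial>L z) = wasserstein dist (\<mu> z) (\<nu> z)"
    proof (rule antisym)
      show "wasserstein dist (\<mu> z) (\<nu> z) \<le> (\<integral>\<^sup>+ (u, v). ennreal (dist u v) \<partial>L z)"
        unfolding wasserstein_def by (rule INF_lower[OF L(1)[OF z]])
      obtain w where w: "W z = ennreal w" "0 \<le> w" using W(2)[OF z] by (metis ennreal_cases infinity_ennreal_def less_irrefl)
      have "(\<integral>\<^sup>+ (u, v). ennreal (dist u v) \<partial>L z) \<le> ennreal w"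
      proof (rule coupling_cost_lower_semicontinuous[where \<pi>="\<lambda>m. \<pi> m z" and w="\<lambda>m. w + e m"])
        show "(\<integral>\<^sup>+ (u, v). ennreal (dist u v) \<partial>\<pi> m z) \<le> ennreal (w + e m)" for m
          using T(1)[OF z, of m] w e(1)[of m] by (simp add: ok_def cost_def \<pi>_def ennreal_plus)
        show "(\<lambda>m. w + e m) \<longlonglongrightarrow> w"
          unfolding e_def using tendsto_add[OF tendsto_const LIMSEQ_Suc[OF lim_1_over_n], of w] by simp
        show "finite_measure (\<pi> m z)" for m
          by (rule prob_space.finite_measure[OF prob_space_coupling[OF \<pi>[OF z] prob(1)[OF z]]])
        show "finite_measure (L z)" by (rule prob_space.finite_measure[OF L_prob[OF z]])
      qed (use w e(1) in \<open>auto simp: sets_cpl[OF L(1)[OF z] z] sets_cpl[OF \<pi>[OF z] z] less_imp_le add_nonneg_nonneg intro!: L(2)[OF z]\<close>)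
      then show "(\<integral>\<^sup>+ (u, v). ennreal (dist u v) \<partial>L z) \<le> wasserstein dist (\<mu> z) (\<nu> z)" using w W(1)[OF z] by simp
    qed
  qed
qed

section \<open>From probabilities to finite kernels and finite marginals\<close>

lemma nn_integral_measurable_finite_kernel:
  assumes sets: "\<And>z. z \<in> space M \<Longrightarrow> sets (\<kappa> z) = sets N" and fin: "\<And>z. z \<in> space M \<Longrightarrow> finite_measure (\<kappa> z)"
    and meas: "\<And>A. A \<in> sets N \<Longrightarrow> (\<lambda>z. emeasure (\<kappa> z) A) \<in> borel_measurable M"
    and f: "(\<lambda>(z, w). f z w) \<in> borel_measurable (M \<Otimes>\<^sub>M N)"
  shows "(\<lambda>z. \<integral>\<^sup>+ w. f z w \<partial>\<kappa> z) \<in> borel_measurable M"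
proof (cases "space N = {}")
  case True
  then have "(\<integral>\<^sup>+ w. f z w \<partial>\<kappa> z) = 0" if "z \<in> space M" for z
    using sets_eq_imp_space_eq[OF sets[OF that]] by (simp add: nn_integral_empty)
  then show ?thesis by (simp cong: measurable_cong)
next
  case False
  \<comment> \<open>Dividing by the total mass plus 1 gives a subprobability kernel without a case
    distinction for mass 0.\<close>
  define c where "c z = emeasure (\<kappa> z) (space N) + 1" for z
  have [measurable]: "c \<in> borel_measurable M" unfolding c_def using meas by measurable
  have c: "c z \<noteq> 0" "c z \<noteq> \<infinity>" "emeasure (\<kappa> z) (space N) \<le> c z" if "z \<in> space M" for z
    using finite_measure.emeasure_finite[OF fin[OF that]] by (auto simp: c_def)
  define \<kappa>' where "\<kappa>' z = scale_measure (1 / c z) (\<kappa> z)" for z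
  have "\<kappa>' \<in> M \<rightarrow>\<^sub>M subprob_algebra N"
  proof (rule measurable_subprob_algebra)
    fix z assume z: "z \<in> space M"
    show "sets (\<kappa>' z) = sets N" using sets[OF z] by (simp add: \<kappa>'_def)
    have sp: "space (\<kappa> z) = space N" using sets_eq_imp_space_eq[OF sets[OF z]] .
    show "subprob_space (\<kappa>' z)"
    proof (rule subprob_spaceI)
      have "emeasure (\<kappa> z) (space N) / c z \<le> 1" using c[OF z] by (intro divide_le_posI_ennreal) (auto simp: zero_less_iff_neq_zero)
      then show "emeasure (\<kappa>' z) (space (\<kappa>' z)) \<le> 1"
        by (simp add: \<kappa>'_def space_scale_measure sp divide_ennreal_def mult.commute)
    qed (use False sp in \<open>simp add: \<kappa>'_def space_scale_measure\<close>)
  next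
    fix A assume "A \<in> sets N"
    then show "(\<lambda>z. emeasure (\<kappa>' z) A) \<in> borel_measurable M" using meas unfolding \<kappa>'_def by simp
  qed
  from nn_integral_measurable_subprob_algebra2[OF f this]
  have "(\<lambda>z. c z * (\<integral>\<^sup>+ w. f z w \<partial>\<kappa>' z)) \<in> borel_measurable M" by measurable
  moreover have "c z * (\<integral>\<^sup>+ w. f z w \<partial>\<kappa>' z) = (\<integral>\<^sup>+ w. f z w \<partial>\<kappa> z)" if z: "z \<in> space M" for z
  proof -
    have "f z \<in> borel_measurable (\<kappa> z)"
      using measurable_Pair2[OF f z] by (simp add: measurable_cong_sets[OF sets[OF z] refl])
    then have "(\<integral>\<^sup>+ w. f z w \<partial>\<kappa>' z) = 1 / c z * (\<integral>\<^sup>+ w. f z w \<partial>\<kappa> z)"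
      unfolding \<kappa>'_def by (rule nn_integral_scale_measure)
    moreover have "c z * (1 / c z) = 1" using c[OF z] by (simp add: ennreal_times_divide ennreal_divide_self less_top)
    ultimately show ?thesis by (simp add: mult.assoc[symmetric])
  qed
  ultimately show ?thesis by (simp cong: measurable_cong)
qed

lemma first_moment_any_point:
  assumes "m \<in> first_moment_measures"
  shows "(\<integral>\<^sup>+ y. dist x0 y \<partial>m) < \<infinity>"
proof -
  from assms obtain x where sets[measurable_cong]: "sets m = sets borel" and fin: "finite_measure m" and x: "(\<integral>\<^sup>+ y. ennreal (dist x y) \<partial>m) < \<infinity>"
    by (auto simp: first_moment_measures_def)
  interpret finite_measure m by fact
  have [measurable]: "(\<lambda>y. dist x y) \<in> borel_measurable m"
    unfolding measurable_cong_sets[OF sets refl] by (intro borel_measurable_continuous_onI continuous_intros)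
  have "(\<integral>\<^sup>+ y. dist x0 y \<partial>m) \<le> (\<integral>\<^sup>+ y. ennreal (dist x0 x) + ennreal (dist x y) \<partial>m)"
    by (intro nn_integral_mono) (auto simp flip: ennreal_plus intro!: ennreal_leI dist_triangle)
  also have "\<dots> = ennreal (dist x0 x) * emeasure m (space m) + (\<integral>\<^sup>+ y. dist x y \<partial>m)"
    by (subst nn_integral_add) measurable
  also have "\<dots> < \<infinity>" using x by (simp add: emeasure_eq_measure flip: ennreal_mult)
  finally show ?thesis .
qed

text \<open>Both marginals have the same mass, so dividing by it reduces to probability measures;
  couplings and their costs scale along.\<close>

lemma measurable_optimal_coupling_finite:
  fixes \<mu> \<nu> :: "'s \<Rightarrow> 'a::polish_space measure"
  assumes sets: "\<And>z. z \<in> space M \<Longrightarrow> sets (\<mu> z) = sets borel" "\<And>z. z \<in> space M \<Longrightarrow> sets (\<nu> z) = sets borel"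
    and fin: "\<And>z. z \<in> space M \<Longrightarrow> finite_measure (\<mu> z)"
    and meas[measurable]: "\<And>A. A \<in> sets borel \<Longrightarrow> (\<lambda>z. emeasure (\<mu> z) A) \<in> borel_measurable M"
      "\<And>A. A \<in> sets borel \<Longrightarrow> (\<lambda>z. emeasure (\<nu> z) A) \<in> borel_measurable M"
    and mass: "\<And>z. z \<in> space M \<Longrightarrow> emeasure (\<nu> z) UNIV = emeasure (\<mu> z) UNIV"
    and mom: "\<And>z. z \<in> space M \<Longrightarrow> (\<integral>\<^sup>+ u. dist x0 u \<partial>\<mu> z) < \<infinity>" "\<And>z. z \<in> space M \<Longrightarrow> (\<integral>\<^sup>+ u. dist x0 u \<partial>\<nu> z) < \<infinity>"
  obtains \<pi> where "\<And>z. z \<in> space M \<Longrightarrow> \<pi> z \<in> couplings (\<mu> z) (\<nu> z)"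
    and "\<And>A. A \<in> sets (borel \<Otimes>\<^sub>M borel) \<Longrightarrow> (\<lambda>z. emeasure (\<pi> z) A) \<in> borel_measurable M"
    and "\<And>z. z \<in> space M \<Longrightarrow> (\<integral>\<^sup>+ (u, v). ennreal (dist u v) \<partial>\<pi> z) = wasserstein dist (\<mu> z) (\<nu> z)"
    and "\<And>z. z \<in> space M \<Longrightarrow> wasserstein dist (\<mu> z) (\<nu> z) < \<infinity>"
proof -
  define c where "c z = emeasure (\<mu> z) UNIV" for z
  have [measurable]: "c \<in> borel_measurable M" unfolding c_def by measurable
  have space: "space (\<mu> z) = UNIV" "space (\<nu> z) = UNIV" if "z \<in> space M" for z
    using sets_eq_imp_space_eq[OF sets(1)[OF that]] sets_eq_imp_space_eq[OF sets(2)[OF that]] by auto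
  have c: "c z \<noteq> \<infinity>" if "z \<in> space M" for z
    using finite_measure.emeasure_finite[OF fin[OF that]] by (simp add: c_def)
  have c_inv: "c z * (1 / c z) = 1" if "z \<in> space M" "c z \<noteq> 0" for z
    using c[OF that(1)] that(2) by (simp add: ennreal_times_divide ennreal_divide_self less_top)
  \<comment> \<open>At mass 0 a Dirac measure stands in, so that the normalised kernels are
    probabilities everywhere; the factor \<open>c z\<close> removes it when the coupling is scaled
    back.\<close>
  define normal where "normal \<rho> z = (if c z = 0 then return borel x0 else scale_measure (1 / c z) (\<rho> z))" for \<rho> :: "'s \<Rightarrow> 'a measure" and z
  have normal_prob: "prob_space (normal \<rho> z)" if "z \<in> space M" "sets (\<rho> z) = sets borel" "emeasure (\<rho> z) UNIV = c z" for \<rho> z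
  proof (cases "c z = 0")
    case True
    then show ?thesis by (simp add: normal_def prob_space_return)
  next
    case False
    have "space (\<rho> z) = UNIV" using sets_eq_imp_space_eq[OF that(2)] by simp
    then show ?thesis using False that c_inv[OF that(1) False]
      by (intro prob_spaceI) (simp add: normal_def space_scale_measure mult.commute)
  qed
  have normal_meas: "normal \<rho> \<in> M \<rightarrow>\<^sub>M subprob_algebra borel"
    if "\<And>z. z \<in> space M \<Longrightarrow> sets (\<rho> z) = sets borel" "\<And>z. z \<in> space M \<Longrightarrow> emeasure (\<rho> z) UNIV = c z"
      and [measurable]: "\<And>A. A \<in> sets borel \<Longrightarrow> (\<lambda>z. emeasure (\<rho> z) A) \<in> borel_measurable M" for \<rho>
  proof (rule measurable_subprob_algebra)
    show "subprob_space (normal \<rho> z)" if "z \<in> space M" for z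
      using normal_prob[OF that] \<open>\<And>z. z \<in> space M \<Longrightarrow> sets (\<rho> z) = sets borel\<close>[OF that] \<open>\<And>z. z \<in> space M \<Longrightarrow> emeasure (\<rho> z) UNIV = c z\<close>[OF that]
      by (intro prob_space_imp_subprob_space)
    show "sets (normal \<rho> z) = sets borel" if "z \<in> space M" for z
      using \<open>\<And>z. z \<in> space M \<Longrightarrow> sets (\<rho> z) = sets borel\<close>[OF that] by (simp add: normal_def)
    fix A :: "'a set" assume [measurable]: "A \<in> sets borel"
    have "(\<lambda>z. if c z = 0 then indicator A x0 else (1 / c z) * emeasure (\<rho> z) A) \<in> borel_measurable M" by measurable
    moreover have "(\<lambda>z. emeasure (normal \<rho> z) A) = (\<lambda>z. if c z = 0 then indicator A x0 else (1 / c z) * emeasure (\<rho> z) A)"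
      by (auto simp: normal_def fun_eq_iff)
    ultimately show "(\<lambda>z. emeasure (normal \<rho> z) A) \<in> borel_measurable M" by simp
  qed
  have normal_mom: "(\<integral>\<^sup>+ u. dist x0 u \<partial>normal \<rho> z) < \<infinity>"
    if "z \<in> space M" "sets (\<rho> z) = sets borel" "(\<integral>\<^sup>+ u. dist x0 u \<partial>\<rho> z) < \<infinity>" for \<rho> z
  proof (cases "c z = 0")
    case True
    then show ?thesis by (simp add: normal_def nn_integral_return)
  next
    case False
    have "(\<lambda>u. ennreal (dist x0 u)) \<in> borel_measurable (\<rho> z)" by (simp add: measurable_cong_sets[OF that(2) refl])
    moreover have "1 / c z < \<top>" using False by (simp add: ennreal_divide_eq_top_iff flip: less_top)
    ultimately show ?thesis using False that(3)
      by (auto simp: normal_def nn_integral_scale_measure ennreal_mult_less_top)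
  qed
  have \<nu>c: "emeasure (\<nu> z) UNIV = c z" if "z \<in> space M" for z using mass[OF that] by (simp add: c_def)
  obtain \<pi>' where \<pi>'_meas: "\<pi>' \<in> M \<rightarrow>\<^sub>M subprob_algebra (borel \<Otimes>\<^sub>M borel)"
    and \<pi>': "\<And>z. z \<in> space M \<Longrightarrow> \<pi>' z \<in> couplings (normal \<mu> z) (normal \<nu> z)"
      "\<And>z. z \<in> space M \<Longrightarrow> (\<integral>\<^sup>+ (u, v). ennreal (dist u v) \<partial>\<pi>' z) = wasserstein dist (normal \<mu> z) (normal \<nu> z)"
      "\<And>z. z \<in> space M \<Longrightarrow> wasserstein dist (normal \<mu> z) (normal \<nu> z) < \<infinity>"
  proof (rule measurable_optimal_coupling[of "normal \<mu>" M "normal \<nu>" x0])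
    show "normal \<mu> \<in> M \<rightarrow>\<^sub>M subprob_algebra borel" "normal \<nu> \<in> M \<rightarrow>\<^sub>M subprob_algebra borel"
      using sets \<nu>c by (auto intro!: normal_meas simp: c_def)
    show "prob_space (normal \<mu> z)" "prob_space (normal \<nu> z)" if "z \<in> space M" for z
      using sets \<nu>c that by (auto intro!: normal_prob simp: c_def)
    show "(\<integral>\<^sup>+ u. dist x0 u \<partial>normal \<mu> z) < \<infinity>" "(\<integral>\<^sup>+ u. dist x0 u \<partial>normal \<nu> z) < \<infinity>" if "z \<in> space M" for z
      using normal_mom[of z \<mu>, OF that sets(1)[OF that] mom(1)[OF that]] normal_mom[of z \<nu>, OF that sets(2)[OF that] mom(2)[OF that]] by simp_all
  qed blast
  define \<pi> where "\<pi> z = scale_measure (c z) (\<pi>' z)" for z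
  have sets_normal: "sets (normal \<mu> z) = sets borel" "sets (normal \<nu> z) = sets borel" if "z \<in> space M" for z
    using sets that by (auto simp: normal_def)
  have sets_\<pi>': "sets (\<pi>' z) = sets (borel \<Otimes>\<^sub>M borel)" if "z \<in> space M" for z
    using subprob_measurableD(2)[OF \<pi>'_meas that] .
  have cost: "(\<integral>\<^sup>+ (u, v). ennreal (dist u v) \<partial>\<pi> z) = c z * wasserstein dist (normal \<mu> z) (normal \<nu> z)" if "z \<in> space M" for z
    unfolding \<pi>_def \<pi>'(2)[OF that, symmetric]
    by (rule nn_integral_scale_measure) (simp add: measurable_cong_sets[OF sets_\<pi>'[OF that] refl])
  have rescale: "c z * emeasure (normal \<rho> z) A = emeasure (\<rho> z) A"
    if "z \<in> space M" "sets (\<rho> z) = sets borel" "emeasure (\<rho> z) UNIV = c z" "A \<in> sets borel" for \<rho> z A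
  proof (cases "c z = 0")
    case True
    have "emeasure (\<rho> z) A \<le> emeasure (\<rho> z) UNIV" using that by (intro emeasure_mono) auto
    then show ?thesis using True that by simp
  next
    case False
    then show ?thesis using c_inv[OF that(1) False] by (simp add: normal_def mult.assoc[symmetric])
  qed
  have cpl: "\<pi> z \<in> couplings (\<mu> z) (\<nu> z)" if z: "z \<in> space M" for z
  proof -
    have sn: "space (normal \<mu> z) = UNIV" "space (normal \<nu> z) = UNIV"
      using sets_eq_imp_space_eq[OF sets_normal(1)[OF z]] sets_eq_imp_space_eq[OF sets_normal(2)[OF z]] by auto
    show ?thesis
      using \<pi>'(1)[OF z] sets[OF z] sets_normal[OF z] space[OF z] sn
        rescale[of z \<mu>, OF z sets(1)[OF z]] rescale[of z \<nu>, OF z sets(2)[OF z] \<nu>c[OF z]]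
      by (auto simp: couplings_iff \<pi>_def c_def[symmetric] sets_\<pi>'[OF z] cong: sets_pair_measure_cong)
  qed
  have W: "c z * wasserstein dist (normal \<mu> z) (normal \<nu> z) \<le> (\<integral>\<^sup>+ (u, v). ennreal (dist u v) \<partial>P)"
    if z: "z \<in> space M" and P: "P \<in> couplings (\<mu> z) (\<nu> z)" for z P
  proof (cases "c z = 0")
    case False
    have sets_P: "sets P = sets (borel \<Otimes>\<^sub>M borel)"
      using coupling_sets[OF P] sets[OF z] by (metis sets_pair_measure_cong)
    have "scale_measure (1 / c z) P \<in> couplings (normal \<mu> z) (normal \<nu> z)"
      using P sets[OF z] space[OF z] False
      by (auto simp: couplings_iff normal_def sets_P space_scale_measure cong: sets_pair_measure_cong)
    then have "wasserstein dist (normal \<mu> z) (normal \<nu> z) \<le> (\<integral>\<^sup>+ (u, v). ennreal (dist u v) \<partial>scale_measure (1 / c z) P)"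
      unfolding wasserstein_def by (rule INF_lower)
    also have "\<dots> = 1 / c z * (\<integral>\<^sup>+ (u, v). ennreal (dist u v) \<partial>P)"
      by (rule nn_integral_scale_measure) (simp add: measurable_cong_sets[OF sets_P refl])
    finally have "c z * wasserstein dist (normal \<mu> z) (normal \<nu> z) \<le> c z * (1 / c z * (\<integral>\<^sup>+ (u, v). ennreal (dist u v) \<partial>P))"
      by (intro mult_left_mono) auto
    then show ?thesis by (simp only: mult.assoc[symmetric] c_inv[OF z False] mult_1)
  qed simp
  have eq: "wasserstein dist (\<mu> z) (\<nu> z) = c z * wasserstein dist (normal \<mu> z) (normal \<nu> z)" if z: "z \<in> space M" for z
  proof (rule antisym)
    show "wasserstein dist (\<mu> z) (\<nu> z) \<le> c z * wasserstein dist (normal \<mu> z) (normal \<nu> z)"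
      unfolding cost[OF z, symmetric] wasserstein_def[of _ "\<mu> z"] by (rule INF_lower[OF cpl[OF z]])
    show "c z * wasserstein dist (normal \<mu> z) (normal \<nu> z) \<le> wasserstein dist (\<mu> z) (\<nu> z)"
      unfolding wasserstein_def[of _ "\<mu> z"] by (intro INF_greatest W z)
  qed
  show ?thesis
  proof (rule that[of \<pi>])
    show "(\<lambda>z. emeasure (\<pi> z) A) \<in> borel_measurable M" if [measurable]: "A \<in> sets (borel \<Otimes>\<^sub>M borel)" for A
    proof -
      note [measurable] = \<pi>'_meas
      show ?thesis unfolding \<pi>_def emeasure_scale_measure by measurable
    qed
    show "wasserstein dist (\<mu> z) (\<nu> z) < \<infinity>" if "z \<in> space M" for z
      unfolding eq[OF that] using \<pi>'(3)[OF that] c[OF that] by (simp add: ennreal_mult_less_top less_top)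
  qed (simp_all add: cpl cost eq)
qed

lemma finite_sum_measure_exists:
  assumes "finite I" "\<And>i. i \<in> I \<Longrightarrow> sets (M i) = sets N"
  shows "\<exists>\<kappa>. sets \<kappa> = sets N \<and> (\<forall>f\<in>borel_measurable N. (\<integral>\<^sup>+ x. f x \<partial>\<kappa>) = (\<Sum>i\<in>I. \<integral>\<^sup>+ x. f x \<partial>M i))"
  using assms
proof (induction rule: finite_induct)
  case empty
  show ?case by (intro exI[of _ "null_measure N"]) simp
next
  case (insert i I)
  then obtain \<kappa> where \<kappa>: "sets \<kappa> = sets N" "\<forall>f\<in>borel_measurable N. (\<integral>\<^sup>+ x. f x \<partial>\<kappa>) = (\<Sum>i\<in>I. \<integral>\<^sup>+ x. f x \<partial>M i)"
    by auto
  have "sets (M i) = sets N" using insert by simp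
  then show ?case using \<kappa> insert(1,2)
    by (intro exI[of _ "add_measure (M i) \<kappa>"]) (auto simp: nn_integral_add_measure measurable_cong_sets[of "M i" N])
qed

text \<open>A signed integral is split into its positive and negative parts, which are finite under
  every summand.\<close>

lemma integral_eq_sum_of_nn_integral:
  fixes h :: "'x \<Rightarrow> real"
  assumes "finite I" and sets: "sets \<kappa> = sets N" "\<And>i. i \<in> I \<Longrightarrow> sets (M i) = sets N"
    and nn: "\<And>f. f \<in> borel_measurable N \<Longrightarrow> (\<integral>\<^sup>+ x. f x \<partial>\<kappa>) = (\<Sum>i\<in>I. \<integral>\<^sup>+ x. f x \<partial>M i)"
    and h: "h \<in> borel_measurable N" "\<And>i. i \<in> I \<Longrightarrow> integrable (M i) h"
  shows "integrable \<kappa> h" and "(\<integral>x. h x \<partial>\<kappa>) = (\<Sum>i\<in>I. \<integral>x. h x \<partial>M i)"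
proof -
  have fin: "(\<integral>\<^sup>+ x. ennreal (norm (h x)) \<partial>M i) < \<infinity>" if "i \<in> I" for i
    using h(2)[OF that] by (simp add: integrable_iff_bounded)
  have "(\<integral>\<^sup>+ x. ennreal (norm (h x)) \<partial>\<kappa>) = (\<Sum>i\<in>I. \<integral>\<^sup>+ x. ennreal (norm (h x)) \<partial>M i)"
    using h(1) by (intro nn) auto
  also have "\<dots> < \<infinity>" using fin assms(1) by simp
  finally show int: "integrable \<kappa> h"
    using h(1) by (simp add: integrable_iff_bounded measurable_cong_sets[OF sets(1) refl])
  have fin2: "(\<integral>\<^sup>+ x. ennreal (h x) \<partial>M i) \<noteq> \<top>" "(\<integral>\<^sup>+ x. ennreal (- h x) \<partial>M i) \<noteq> \<top>" if "i \<in> I" for i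
    using h(2)[OF that] by (auto simp: real_integrable_def)
  have "(\<integral>x. h x \<partial>\<kappa>) = enn2real (\<Sum>i\<in>I. \<integral>\<^sup>+ x. ennreal (h x) \<partial>M i) - enn2real (\<Sum>i\<in>I. \<integral>\<^sup>+ x. ennreal (- h x) \<partial>M i)"
    using h(1) by (simp add: real_lebesgue_integral_def[OF int] nn)
  also have "\<dots> = (\<Sum>i\<in>I. enn2real (\<integral>\<^sup>+ x. ennreal (h x) \<partial>M i)) - (\<Sum>i\<in>I. enn2real (\<integral>\<^sup>+ x. ennreal (- h x) \<partial>M i))"
    using fin2 by (simp add: enn2real_sum less_top)
  also have "\<dots> = (\<Sum>i\<in>I. \<integral>x. h x \<partial>M i)"
    by (simp add: sum_subtractf[symmetric] real_lebesgue_integral_def[OF h(2)])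
  finally show "(\<integral>x. h x \<partial>\<kappa>) = (\<Sum>i\<in>I. \<integral>x. h x \<partial>M i)" .
qed

section \<open>Kernels of the particle system and its coupling\<close>

text \<open>The particle system and its coupling both have this shape: each index \<open>i\<close>
  contributes jumps with rates \<open>\<kappa> i\<close> that move the state by \<open>g i\<close>.
  The sum is pinned down by its integrals, so one construction serves both.\<close>

lemma sum_kernel:
  fixes \<kappa> :: "'i::finite \<Rightarrow> 's::topological_space \<Rightarrow> 't::topological_space measure"
    and g :: "'i \<Rightarrow> 's \<Rightarrow> 't \<Rightarrow> 'b::topological_space"
  assumes \<kappa>: "\<And>i. finite_kernel (\<kappa> i)" and g: "\<And>i. (\<lambda>(z, w). g i z w) \<in> borel \<Otimes>\<^sub>M borel \<rightarrow>\<^sub>M borel"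
  obtains K where "finite_kernel K"
    and "\<And>z f. f \<in> borel_measurable borel \<Longrightarrow> (\<integral>\<^sup>+ x. f x \<partial>K z) = (\<Sum>i\<in>UNIV. \<integral>\<^sup>+ w. f (g i z w) \<partial>\<kappa> i z)"
    and "\<And>z (h :: 'b \<Rightarrow> real). h \<in> borel_measurable borel \<Longrightarrow> (\<And>i. integrable (\<kappa> i z) (\<lambda>w. h (g i z w)))
       \<Longrightarrow> integrable (K z) h \<and> (\<integral>x. h x \<partial>K z) = (\<Sum>i\<in>UNIV. \<integral>w. h (g i z w) \<partial>\<kappa> i z)"
proof -
  have sets: "sets (\<kappa> i z) = sets borel" and fin: "finite_measure (\<kappa> i z)" for i z
    using \<kappa>[of i] by (auto simp: finite_kernel_def)
  have space: "space (\<kappa> i z) = UNIV" for i z using sets_eq_imp_space_eq[OF sets] by simp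
  have g_meas: "g i z \<in> \<kappa> i z \<rightarrow>\<^sub>M borel" for i z
    using measurable_Pair2[OF g, of z i] by (simp add: measurable_cong_sets[OF sets refl])
  define D where "D i z = distr (\<kappa> i z) borel (g i z)" for i z
  have "\<exists>\<rho>. sets \<rho> = sets borel \<and> (\<forall>f\<in>borel_measurable borel. (\<integral>\<^sup>+ x. f x \<partial>\<rho>) = (\<Sum>i\<in>UNIV. \<integral>\<^sup>+ x. f x \<partial>D i z))" for z
    by (rule finite_sum_measure_exists) (auto simp: D_def)
  then obtain K where K: "\<And>z. sets (K z) = sets borel"
    "\<And>z f. f \<in> borel_measurable borel \<Longrightarrow> (\<integral>\<^sup>+ x. f x \<partial>K z) = (\<Sum>i\<in>UNIV. \<integral>\<^sup>+ x. f x \<partial>D i z)" by metis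
  have nn: "(\<integral>\<^sup>+ x. f x \<partial>K z) = (\<Sum>i\<in>UNIV. \<integral>\<^sup>+ w. f (g i z w) \<partial>\<kappa> i z)" if "f \<in> borel_measurable borel" for z f
    using that by (simp add: K(2) D_def nn_integral_distr[OF g_meas])
  have em: "emeasure (K z) A = (\<Sum>i\<in>UNIV. \<integral>\<^sup>+ w. indicator A (g i z w) \<partial>\<kappa> i z)" if "A \<in> sets borel" for z A
    using nn[of "indicator A" z] that by (simp add: K(1))
  show ?thesis
  proof (rule that[of K])
    show "finite_kernel K" unfolding finite_kernel_def
    proof (intro conjI allI ballI)
      fix z
      show "sets (K z) = sets borel" by (rule K)
      have "emeasure (K z) UNIV = (\<Sum>i\<in>UNIV. emeasure (\<kappa> i z) UNIV)" using space by (simp add: em)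
      also have "\<dots> < \<infinity>" using finite_measure.emeasure_finite[OF fin] by (simp add: less_top)
      finally show "finite_measure (K z)"
        using sets_eq_imp_space_eq[OF K(1)] by (intro finite_measureI) (simp add: less_top)
    next
      fix A :: "'b set" assume A[measurable]: "A \<in> sets borel"
      have "(\<lambda>z. \<integral>\<^sup>+ w. indicator A (g i z w) \<partial>\<kappa> i z) \<in> borel_measurable borel" for i
      proof (rule nn_integral_measurable_finite_kernel[where N=borel])
        show "(\<lambda>z. emeasure (\<kappa> i z) B) \<in> borel_measurable borel" if "B \<in> sets borel" for B
          using \<kappa>[of i] that by (simp add: finite_kernel_def)
        note [measurable] = g
        show "(\<lambda>(z, w). indicator A (g i z w) :: ennreal) \<in> borel_measurable (borel \<Otimes>\<^sub>M borel)" by measurable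
      qed (simp_all add: sets fin)
      then show "(\<lambda>z. emeasure (K z) A) \<in> borel_measurable borel" by (simp add: em[OF A])
    qed
    show "integrable (K z) h \<and> (\<integral>x. h x \<partial>K z) = (\<Sum>i\<in>UNIV. \<integral>w. h (g i z w) \<partial>\<kappa> i z)"
      if h: "h \<in> borel_measurable borel" and int: "\<And>i. integrable (\<kappa> i z) (\<lambda>w. h (g i z w))" for z and h :: "'b \<Rightarrow> real"
    proof -
      have D: "integrable (D i z) h" "(\<integral>x. h x \<partial>D i z) = (\<integral>w. h (g i z w) \<partial>\<kappa> i z)" for i
        using int[of i] h by (simp_all add: D_def integrable_distr_eq[OF g_meas] integral_distr[OF g_meas])
      have *: "sets (D i z) = sets borel" for i by (simp add: D_def)
      show ?thesis
        using integral_eq_sum_of_nn_integral[where M="\<lambda>i. D i z", OF finite_class.finite_UNIV K(1) * K(2) h D(1)] by (simp add: D(2))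
    qed
  qed (rule nn)
qed

lemma measurable_fun_upd:
  fixes f :: "'s \<Rightarrow> 'n::finite \<Rightarrow> 'a::second_countable_topology"
  assumes [measurable]: "f \<in> M \<rightarrow>\<^sub>M borel" "h \<in> M \<rightarrow>\<^sub>M borel"
  shows "(\<lambda>s. (f s)(i := h s)) \<in> M \<rightarrow>\<^sub>M borel"
proof (rule measurable_coordinatewise_then_product)
  fix j
  have "(\<lambda>s. f s j) \<in> M \<rightarrow>\<^sub>M borel" by (rule measurable_product_then_coordinatewise) fact
  then show "(\<lambda>s. ((f s)(i := h s)) j) \<in> M \<rightarrow>\<^sub>M borel" by (cases "j = i") simp_all
qed

lemma borel_measurable_avg_dist[measurable]:
  "(\<lambda>(u, v). avg_dist u v) \<in> borel_measurable (borel :: (('n::finite \<Rightarrow> 'a::{metric_space, second_countable_topology}) \<times> _) measure)"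
proof -
  have c: "(\<lambda>p :: ('n \<Rightarrow> 'a) \<times> ('n \<Rightarrow> 'a). fst p i) \<in> borel_measurable (borel \<Otimes>\<^sub>M borel)"
    "(\<lambda>p :: ('n \<Rightarrow> 'a) \<times> ('n \<Rightarrow> 'a). snd p i) \<in> borel_measurable (borel \<Otimes>\<^sub>M borel)" for i
    by (rule measurable_product_then_coordinatewise, simp)+
  have "(\<lambda>p. (\<Sum>i\<in>(UNIV :: 'n set). dist (fst p i) (snd p i :: 'a)) / real CARD('n)) \<in> borel_measurable (borel \<Otimes>\<^sub>M borel)"
    by (intro borel_measurable_divide borel_measurable_sum borel_measurable_dist borel_measurable_const c)
  then show ?thesis unfolding avg_dist_def borel_prod[symmetric] by (simp add: case_prod_beta')
qed

lemma particle_kernel_at: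
  fixes F :: "'n::finite \<Rightarrow> 'a::polish_space \<Rightarrow> ('n \<Rightarrow> 'a) \<Rightarrow> 'a measure"
  assumes F: "finite_kernel (\<lambda>(z, x). F i z x)"
  shows "finite_kernel (\<lambda>x. F i (x i) x)"
proof -
  have "(\<lambda>x. emeasure (F i (x i) x) A) \<in> borel_measurable borel" if "A \<in> sets borel" for A
  proof -
    have F': "(\<lambda>p. emeasure ((\<lambda>(z, x). F i z x) p) A) \<in> borel_measurable borel"
      using F that by (simp add: finite_kernel_def)
    have "(\<lambda>x. (x i, x)) \<in> borel \<rightarrow>\<^sub>M (borel :: ('a \<times> ('n \<Rightarrow> 'a)) measure)"
      unfolding borel_prod[symmetric] by measurable
    from measurable_compose[OF this F'] show ?thesis by simp
  qed
  then show ?thesis using F by (auto simp: finite_kernel_def)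
qed

text \<open>A single kernel for the generator makes the total jump rate of a configuration
  available, to be compared with the rate of the coupling.\<close>

lemma particle_generator_kernel:
  fixes F :: "'n::finite \<Rightarrow> 'a::polish_space \<Rightarrow> ('n \<Rightarrow> 'a) \<Rightarrow> 'a measure"
  assumes F: "\<And>i. finite_kernel (\<lambda>(z, x). F i z x)"
  obtains \<kappa> where "finite_kernel \<kappa>"
    and "\<And>g x. bounded_measurable g \<Longrightarrow> particle_generator F g x = jump_operator \<kappa> g x"
    and "\<And>x. emeasure (\<kappa> x) UNIV = (\<Sum>i\<in>UNIV. emeasure (F i (x i) x) UNIV)"
proof -
  have g: "(\<lambda>(x, y). x(i := y)) \<in> borel \<Otimes>\<^sub>M borel \<rightarrow>\<^sub>M (borel :: ('n \<Rightarrow> 'a) measure)" for i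
    unfolding case_prod_beta' by (rule measurable_fun_upd) measurable
  obtain \<kappa> where \<kappa>: "finite_kernel \<kappa>"
    "\<And>x f. f \<in> borel_measurable borel \<Longrightarrow> (\<integral>\<^sup>+ u. f u \<partial>\<kappa> x) = (\<Sum>i\<in>UNIV. \<integral>\<^sup>+ y. f (x(i := y)) \<partial>F i (x i) x)"
    "\<And>x (h :: ('n \<Rightarrow> 'a) \<Rightarrow> real). h \<in> borel_measurable borel \<Longrightarrow> (\<And>i. integrable (F i (x i) x) (\<lambda>y. h (x(i := y))))
       \<Longrightarrow> integrable (\<kappa> x) h \<and> (\<integral>u. h u \<partial>\<kappa> x) = (\<Sum>i\<in>UNIV. \<integral>y. h (x(i := y)) \<partial>F i (x i) x)"
    by (rule sum_kernel[of "\<lambda>i x. F i (x i) x" "\<lambda>i x y. x(i := y)"], rule particle_kernel_at, rule F, rule g, blast)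
  show ?thesis
  proof (rule that[OF \<kappa>(1)])
    fix g :: "('n \<Rightarrow> 'a) \<Rightarrow> real" and x assume bm: "bounded_measurable g"
    then have [measurable]: "g \<in> borel_measurable borel" by (simp add: bounded_measurable_def)
    obtain B where B: "\<And>x. \<bar>g x\<bar> \<le> B" using bm by (auto simp: bounded_measurable_def bounded_iff)
    have "integrable (F i (x i) x) (\<lambda>y. g (x(i := y)) - g x)" for i
    proof -
      have sets: "sets (F i (x i) x) = sets borel" and "finite_measure (F i (x i) x)"
        using F[of i] by (auto simp: finite_kernel_def)
      then interpret finite_measure "F i (x i) x" by simp
      note [measurable_cong] = sets
      have [measurable]: "(\<lambda>y. x(i := y)) \<in> F i (x i) x \<rightarrow>\<^sub>M borel" by (rule measurable_fun_upd) measurable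
      show ?thesis
      proof (rule integrable_const_bound[where B="2 * B"])
        show "AE y in F i (x i) x. norm (g (x(i := y)) - g x) \<le> 2 * B"
          using B by (intro AE_I2) (smt (verit) real_norm_def)
      qed measurable
    qed
    then show "particle_generator F g x = jump_operator \<kappa> g x"
      unfolding particle_generator_def jump_operator_def by (subst \<kappa>(3)[THEN conjunct2]) auto
  next
    fix x
    have sets: "sets (F i (x i) x) = sets borel" for i using F[of i] by (auto simp: finite_kernel_def)
    have "(\<integral>\<^sup>+ u. 1 \<partial>\<kappa> x) = (\<Sum>i\<in>UNIV. \<integral>\<^sup>+ y. 1 \<partial>F i (x i) x)" by (rule \<kappa>(2)) simp
    moreover have "space (\<kappa> x) = UNIV" using \<kappa>(1) sets_eq_imp_space_eq[of "\<kappa> x" borel] by (simp add: finite_kernel_def)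
    ultimately show "emeasure (\<kappa> x) UNIV = (\<Sum>i\<in>UNIV. emeasure (F i (x i) x) UNIV)"
      using sets_eq_imp_space_eq[OF sets] by simp
  qed
qed

text \<open>Computes the effect of the atoms that complete the masses: for an increment vanishing at
  \<open>a\<close> they leave the integral unchanged.\<close>

lemma integral_add_dirac:
  fixes h :: "'a::topological_space \<Rightarrow> real"
  assumes sets: "sets m = sets borel" and c: "c \<noteq> \<infinity>" and h: "h \<in> borel_measurable borel" "integrable m h"
  shows "integrable (add_measure m (scale_measure c (return borel a))) h"
    and "(\<integral>u. h u \<partial>add_measure m (scale_measure c (return borel a))) = (\<integral>u. h u \<partial>m) + enn2real c * h a"
proof -
  define M where "M i = (if i then m else scale_measure c (return borel a))" for i
  have sM: "sets (M i) = sets borel" for i by (simp add: M_def sets)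
  have nn: "(\<integral>\<^sup>+ x. f x \<partial>add_measure m (scale_measure c (return borel a))) = (\<Sum>i\<in>UNIV. \<integral>\<^sup>+ x. f x \<partial>M i)"
    if "f \<in> borel_measurable borel" for f
    using that by (subst nn_integral_add_measure) (simp_all add: sets M_def UNIV_bool measurable_cong_sets[OF sets refl] add.commute)
  have dirac: "integrable (scale_measure c (return borel a)) h" "(\<integral>u. h u \<partial>scale_measure c (return borel a)) = enn2real c * h a"
  proof -
    have 1: "(\<integral>\<^sup>+ u. f u \<partial>scale_measure c (return borel a)) = c * f a" if "f \<in> borel_measurable borel" for f
      using that by (simp add: nn_integral_scale_measure nn_integral_return)
    have "(\<integral>\<^sup>+ u. ennreal (norm (h u)) \<partial>scale_measure c (return borel a)) < \<infinity>"
      using h(1) c by (subst 1) (auto simp: ennreal_mult_less_top less_top)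
    then show int: "integrable (scale_measure c (return borel a)) h"
      using h(1) by (simp add: integrable_iff_bounded measurable_cong_sets[OF sets_scale_measure refl])
    show "(\<integral>u. h u \<partial>scale_measure c (return borel a)) = enn2real c * h a"
      using h(1) by (cases "0 \<le> h a") (simp_all add: real_lebesgue_integral_def[OF int] 1 enn2real_mult ennreal_neg)
  qed
  have int: "integrable (M i) h" for i by (simp add: M_def h dirac)
  have s: "sets (add_measure m (scale_measure c (return borel a))) = sets borel" by (simp add: sets)
  note r = integral_eq_sum_of_nn_integral[OF finite_class.finite_UNIV s sM nn h(1) int]
  show "integrable (add_measure m (scale_measure c (return borel a))) h" by (rule r(1))
  show "(\<integral>u. h u \<partial>add_measure m (scale_measure c (return borel a))) = (\<integral>u. h u \<partial>m) + enn2real c * h a"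
    using r(2) by (simp add: M_def UNIV_bool dirac add.commute)
qed

text \<open>The increment of a function of one configuration vanishes at the completing atom, which
  gives the marginals of the generator. Each coordinate coupling has mass equal to the sum of both
  original masses: this is the factor of \<open>dist (x i) (y i)\<close> in \<open>J\<close>, and
  summed over \<open>i\<close> it is the total rate.\<close>

lemma optimal_coupling_kernel:
  fixes F :: "'n::finite \<Rightarrow> 'a::polish_space \<Rightarrow> ('n \<Rightarrow> 'a) \<Rightarrow> 'a measure"
  assumes F: "\<And>i. finite_kernel (\<lambda>(z, x). F i z x)" and mom: "\<And>i z x. F i z x \<in> first_moment_measures"
  obtains k where "coupling_kernel (particle_generator F) k"
    and "\<And>x y. integrable (k (x, y)) (\<lambda>(u, v). avg_dist u v)"
    and "\<And>x y. jump_operator k (\<lambda>(u, v). avg_dist u v) (x, y) =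
            (\<Sum>i\<in>UNIV. J (x i) (y i) (F i (x i) x) (F i (y i) y)) / real CARD('n)"
    and "\<And>x y. emeasure (k (x, y)) UNIV =
            (\<Sum>i\<in>UNIV. emeasure (F i (x i) x) UNIV) + (\<Sum>i\<in>UNIV. emeasure (F i (y i) y) UNIV)"
proof -
  define m1 where "m1 i z = F i (fst z i) (fst z)" for i and z :: "('n \<Rightarrow> 'a) \<times> ('n \<Rightarrow> 'a)"
  define m2 where "m2 i z = F i (snd z i) (snd z)" for i and z :: "('n \<Rightarrow> 'a) \<times> ('n \<Rightarrow> 'a)"
  have sets[simp]: "sets (m1 i z) = sets borel" "sets (m2 i z) = sets borel"
    and fin: "finite_measure (m1 i z)" "finite_measure (m2 i z)" for i z
    using F[of i] by (auto simp: finite_kernel_def m1_def m2_def)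
  have space[simp]: "space (m1 i z) = UNIV" "space (m2 i z) = UNIV" for i z
    using sets_eq_imp_space_eq[OF sets(1)] sets_eq_imp_space_eq[OF sets(2)] by auto
  have fin_top[simp]: "emeasure (m1 i z) A \<noteq> \<top>" "emeasure (m2 i z) A \<noteq> \<top>" for i z A
    using finite_measure.emeasure_finite[OF fin(1)] finite_measure.emeasure_finite[OF fin(2)] by auto
  define c1 where "c1 i z = emeasure (m1 i z) UNIV" for i z
  define c2 where "c2 i z = emeasure (m2 i z) UNIV" for i z
  define \<mu> where "\<mu> i z = add_measure (m1 i z) (scale_measure (c2 i z) (return borel (fst z i)))" for i z
  define \<nu> where "\<nu> i z = add_measure (m2 i z) (scale_measure (c1 i z) (return borel (snd z i)))" for i z
  have sets_\<mu>\<nu>: "sets (\<mu> i z) = sets borel" "sets (\<nu> i z) = sets borel" for i z by (simp_all add: \<mu>_def \<nu>_def)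
  have space_\<mu>\<nu>: "space (\<mu> i z) = UNIV" "space (\<nu> i z) = UNIV" for i z by (simp_all add: \<mu>_def \<nu>_def)
  have em: "emeasure (\<mu> i z) A = emeasure (m1 i z) A + c2 i z * indicator A (fst z i)"
    "emeasure (\<nu> i z) A = emeasure (m2 i z) A + c1 i z * indicator A (snd z i)" if "A \<in> sets borel" for i z A
    using that by (simp_all add: \<mu>_def \<nu>_def emeasure_add_measure)
  have mass: "emeasure (\<mu> i z) UNIV = c1 i z + c2 i z" "emeasure (\<nu> i z) UNIV = c1 i z + c2 i z" for i z
    by (simp_all add: em) (simp_all add: c1_def c2_def add.commute)
  have c_top[simp]: "c1 i z \<noteq> \<top>" "c2 i z \<noteq> \<top>" for i z by (simp_all add: c1_def c2_def)
  have c_real: "c1 i z + c2 i z = ennreal (measure (m1 i z) UNIV + measure (m2 i z) UNIV)" for i z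
    by (simp add: c1_def c2_def finite_measure.emeasure_eq_measure[OF fin(1)] finite_measure.emeasure_eq_measure[OF fin(2)] ennreal_plus)
  have coord: "(\<lambda>z :: ('n \<Rightarrow> 'a) \<times> ('n \<Rightarrow> 'a). fst z i) \<in> borel_measurable (borel \<Otimes>\<^sub>M borel)"
    "(\<lambda>z :: ('n \<Rightarrow> 'a) \<times> ('n \<Rightarrow> 'a). snd z i) \<in> borel_measurable (borel \<Otimes>\<^sub>M borel)" for i
    by (rule measurable_product_then_coordinatewise, simp)+
  have meas_m[measurable]: "(\<lambda>z. emeasure (m1 i z) A) \<in> borel_measurable (borel \<Otimes>\<^sub>M borel)" "(\<lambda>z. emeasure (m2 i z) A) \<in> borel_measurable (borel \<Otimes>\<^sub>M borel)"
    if "A \<in> sets borel" for A i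
  proof -
    have "(\<lambda>x. emeasure (F i (x i) x) A) \<in> borel_measurable borel"
      using particle_kernel_at[where F=F and i=i, OF F] that by (simp add: finite_kernel_def)
    then show "(\<lambda>z. emeasure (m1 i z) A) \<in> borel_measurable (borel \<Otimes>\<^sub>M borel)" "(\<lambda>z. emeasure (m2 i z) A) \<in> borel_measurable (borel \<Otimes>\<^sub>M borel)"
      unfolding m1_def m2_def by (rule measurable_compose[rotated], simp)+
  qed
  have c_meas: "c1 i \<in> borel_measurable (borel \<Otimes>\<^sub>M borel)" "c2 i \<in> borel_measurable (borel \<Otimes>\<^sub>M borel)" for i
    unfolding c1_def c2_def by (simp_all add: meas_m)
  have meas: "(\<lambda>z. emeasure (\<mu> i z) A) \<in> borel_measurable (borel \<Otimes>\<^sub>M borel)" "(\<lambda>z. emeasure (\<nu> i z) A) \<in> borel_measurable (borel \<Otimes>\<^sub>M borel)"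
    if A[measurable]: "A \<in> sets borel" for A i
  proof -
    have "(\<lambda>z :: ('n \<Rightarrow> 'a) \<times> ('n \<Rightarrow> 'a). indicator A (fst z i) :: ennreal) \<in> borel_measurable (borel \<Otimes>\<^sub>M borel)"
      "(\<lambda>z :: ('n \<Rightarrow> 'a) \<times> ('n \<Rightarrow> 'a). indicator A (snd z i) :: ennreal) \<in> borel_measurable (borel \<Otimes>\<^sub>M borel)"
      by (rule measurable_compose[OF coord(1) borel_measurable_indicator[OF A]],
          rule measurable_compose[OF coord(2) borel_measurable_indicator[OF A]])
    note ind = this
    show "(\<lambda>z. emeasure (\<mu> i z) A) \<in> borel_measurable (borel \<Otimes>\<^sub>M borel)"
      unfolding em[OF A] by (intro borel_measurable_add borel_measurable_times_ennreal meas_m A c_meas ind)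
    show "(\<lambda>z. emeasure (\<nu> i z) A) \<in> borel_measurable (borel \<Otimes>\<^sub>M borel)"
      unfolding em[OF A] by (intro borel_measurable_add borel_measurable_times_ennreal meas_m A c_meas ind)
  qed
  have mom_m: "(\<integral>\<^sup>+ u. dist x0 u \<partial>m1 i z) < \<infinity>" "(\<integral>\<^sup>+ u. dist x0 u \<partial>m2 i z) < \<infinity>" for x0 i z
    unfolding m1_def m2_def by (intro first_moment_any_point mom)+
  have d_meas: "(\<lambda>u. ennreal (dist x0 u)) \<in> borel_measurable borel" for x0 :: 'a by measurable
  have mom_\<mu>: "(\<integral>\<^sup>+ u. dist x0 u \<partial>\<mu> i z) < \<infinity>" "(\<integral>\<^sup>+ u. dist x0 u \<partial>\<nu> i z) < \<infinity>" for x0 i z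
  proof -
    have "(\<integral>\<^sup>+ u. dist x0 u \<partial>\<mu> i z) = (\<integral>\<^sup>+ u. dist x0 u \<partial>m1 i z) + c2 i z * ennreal (dist x0 (fst z i))"
      unfolding \<mu>_def by (subst nn_integral_add_measure)
        (simp_all add: measurable_cong_sets[OF sets(1) refl] nn_integral_scale_measure nn_integral_return)
    then show "(\<integral>\<^sup>+ u. dist x0 u \<partial>\<mu> i z) < \<infinity>"
      using mom_m[of i z x0] by (simp add: ennreal_mult_eq_top_iff less_top[symmetric])
    have "(\<integral>\<^sup>+ u. dist x0 u \<partial>\<nu> i z) = (\<integral>\<^sup>+ u. dist x0 u \<partial>m2 i z) + c1 i z * ennreal (dist x0 (snd z i))"
      unfolding \<nu>_def by (subst nn_integral_add_measure)
        (simp_all add: measurable_cong_sets[OF sets(2) refl] nn_integral_scale_measure nn_integral_return)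
    then show "(\<integral>\<^sup>+ u. dist x0 u \<partial>\<nu> i z) < \<infinity>"
      using mom_m[of i z x0] by (simp add: ennreal_mult_eq_top_iff less_top[symmetric])
  qed
  have "\<exists>\<pi>. (\<forall>z. \<pi> z \<in> couplings (\<mu> i z) (\<nu> i z)) \<and>
      (\<forall>A\<in>sets (borel \<Otimes>\<^sub>M borel). (\<lambda>z. emeasure (\<pi> z) A) \<in> borel_measurable (borel \<Otimes>\<^sub>M borel)) \<and>
      (\<forall>z. (\<integral>\<^sup>+ (u, v). ennreal (dist u v) \<partial>\<pi> z) = wasserstein dist (\<mu> i z) (\<nu> i z)) \<and>
      (\<forall>z. wasserstein dist (\<mu> i z) (\<nu> i z) < \<infinity>)" for i
  \<comment> \<open>The moments are finite from every base point, so an arbitrary one is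
    passed.\<close>
  proof (rule measurable_optimal_coupling_finite[of "borel \<Otimes>\<^sub>M borel" "\<mu> i" "\<nu> i" undefined])
    show "finite_measure (\<mu> i z)" for z
      by (rule finite_measureI) (simp add: space_\<mu>\<nu> mass)
    fix \<pi>
    assume "\<And>z. z \<in> space (borel \<Otimes>\<^sub>M borel) \<Longrightarrow> \<pi> z \<in> couplings (\<mu> i z) (\<nu> i z)"
      "\<And>A. A \<in> sets (borel \<Otimes>\<^sub>M borel) \<Longrightarrow> (\<lambda>z. emeasure (\<pi> z) A) \<in> borel_measurable (borel \<Otimes>\<^sub>M borel)"
      "\<And>z. z \<in> space (borel \<Otimes>\<^sub>M borel) \<Longrightarrow> (\<integral>\<^sup>+ (u, v). ennreal (dist u v) \<partial>\<pi> z) = wasserstein dist (\<mu> i z) (\<nu> i z)"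
      "\<And>z. z \<in> space (borel \<Otimes>\<^sub>M borel) \<Longrightarrow> wasserstein dist (\<mu> i z) (\<nu> i z) < \<infinity>"
    then show ?thesis by (intro exI[of _ \<pi>]) (simp add: space_pair_measure)
  qed (simp_all add: sets_\<mu>\<nu> meas mass mom_\<mu>[simplified])
  then obtain \<pi> where cpl: "\<And>i z. \<pi> i z \<in> couplings (\<mu> i z) (\<nu> i z)"
    and \<pi>_meas: "\<And>i A. A \<in> sets (borel \<Otimes>\<^sub>M borel) \<Longrightarrow> (\<lambda>z. emeasure (\<pi> i z) A) \<in> borel_measurable (borel \<Otimes>\<^sub>M borel)"
    and cost: "\<And>i z. (\<integral>\<^sup>+ (u, v). ennreal (dist u v) \<partial>\<pi> i z) = wasserstein dist (\<mu> i z) (\<nu> i z)"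
    and cost_fin: "\<And>i z. wasserstein dist (\<mu> i z) (\<nu> i z) < \<infinity>"
    by metis
  have sets_\<pi>': "sets (\<pi> i z) = sets (borel \<Otimes>\<^sub>M borel)" for i z
    using coupling_sets[OF cpl] sets_\<mu>\<nu> by (metis sets_pair_measure_cong)
  have sets_\<pi>: "sets (\<pi> i z) = sets borel" for i z using sets_\<pi>'[of i z] unfolding borel_prod .
  have space_\<pi>: "space (\<pi> i z) = UNIV" for i z using sets_eq_imp_space_eq[OF sets_\<pi>] by simp
  have mass_\<pi>: "emeasure (\<pi> i z) UNIV = c1 i z + c2 i z" for i z
  proof -
    have "emeasure (\<pi> i z) (UNIV \<times> space (\<nu> i z)) = emeasure (\<mu> i z) UNIV"
      using cpl[of i z] by (simp add: couplings_iff sets_\<mu>\<nu>)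
    then show ?thesis by (simp add: space_\<mu>\<nu> mass)
  qed
  have fin_\<pi>: "finite_measure (\<pi> i z)" for i z by (rule finite_measureI) (simp add: space_\<pi> mass_\<pi>)
  have mass_\<pi>_real: "measure (\<pi> i z) UNIV = measure (m1 i z) UNIV + measure (m2 i z) UNIV" for i z
    by (simp add: measure_def[of "\<pi> i z"] mass_\<pi> c_real del: ennreal_plus)
  have kernel_\<pi>: "finite_kernel (\<pi> i)" for i
    using \<pi>_meas[unfolded borel_prod, of _ i] by (simp add: finite_kernel_def sets_\<pi> fin_\<pi>)
  define jump where "jump i z w = ((fst z)(i := fst w), (snd z)(i := snd w))" for i and z :: "('n \<Rightarrow> 'a) \<times> ('n \<Rightarrow> 'a)" and w :: "'a \<times> 'a"
  have jump_meas: "(\<lambda>(z, w). jump i z w) \<in> borel \<Otimes>\<^sub>M borel \<rightarrow>\<^sub>M borel" for i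
    unfolding jump_def case_prod_beta' borel_prod[symmetric]
    by (intro measurable_Pair measurable_fun_upd) measurable
  obtain k where k: "finite_kernel k"
    "\<And>z f. f \<in> borel_measurable borel \<Longrightarrow> (\<integral>\<^sup>+ p. f p \<partial>k z) = (\<Sum>i\<in>UNIV. \<integral>\<^sup>+ w. f (jump i z w) \<partial>\<pi> i z)"
    "\<And>z (h :: ('n \<Rightarrow> 'a) \<times> ('n \<Rightarrow> 'a) \<Rightarrow> real). h \<in> borel_measurable borel \<Longrightarrow> (\<And>i. integrable (\<pi> i z) (\<lambda>w. h (jump i z w)))
       \<Longrightarrow> integrable (k z) h \<and> (\<integral>p. h p \<partial>k z) = (\<Sum>i\<in>UNIV. \<integral>w. h (jump i z w) \<partial>\<pi> i z)"
    by (rule sum_kernel[of \<pi> jump], rule kernel_\<pi>, rule jump_meas, blast)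
  have d_int: "integrable (\<pi> i z) (\<lambda>w. dist (fst w) (snd w))"
    and d_val: "(\<integral>w. dist (fst w) (snd w) \<partial>\<pi> i z) = enn2real (wasserstein dist (\<mu> i z) (\<nu> i z))" for i z
  proof -
    have [measurable]: "(\<lambda>w. dist (fst w) (snd w)) \<in> borel_measurable (\<pi> i z)"
      unfolding measurable_cong_sets[OF sets_\<pi>' refl] by measurable
    show int: "integrable (\<pi> i z) (\<lambda>w. dist (fst w) (snd w))"
      by (simp add: integrable_iff_bounded cost[unfolded case_prod_beta'] cost_fin[simplified])
    show "(\<integral>w. dist (fst w) (snd w) \<partial>\<pi> i z) = enn2real (wasserstein dist (\<mu> i z) (\<nu> i z))"
      by (subst integral_eq_nn_integral) (auto simp: cost[unfolded case_prod_beta'])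
  qed
  \<comment> \<open>A joint jump of the \<open>i\<close>-th coordinates changes a single term of the
    averaged distance; the increment depends on the new pair through \<open>dist u v\<close>
    alone.\<close>
  have avg: "avg_dist (x(i := u)) (y(i := v)) = avg_dist x y + (dist u v - dist (x i) (y i)) / real CARD('n)" for x y :: "'n \<Rightarrow> 'a" and i u v
  proof -
    have "(\<Sum>j\<in>UNIV. dist ((x(i := u)) j) ((y(i := v)) j)) = dist u v + (\<Sum>j\<in>UNIV - {i}. dist (x j) (y j))"
      by (subst sum.remove[of _ i]) (auto intro!: sum.cong)
    moreover have "(\<Sum>j\<in>UNIV. dist (x j) (y j)) = dist (x i) (y i) + (\<Sum>j\<in>UNIV - {i}. dist (x j) (y j))"
      by (subst sum.remove[of _ i]) auto
    ultimately show ?thesis by (simp add: avg_dist_def add_divide_distrib diff_divide_distrib)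
  qed
  have const_int: "integrable (\<pi> i z) (\<lambda>_. c :: real)" for i z c
    using fin_\<pi> by (simp add: finite_measure.integrable_const)
  have avg_jump: "(\<lambda>(u, v). avg_dist u v) (jump i (x, y) w) = avg_dist x y + (dist (fst w) (snd w) - dist (x i) (y i)) / real CARD('n)" for i x y w
    by (simp add: jump_def avg)
  have avg_int: "integrable (\<pi> i (x, y)) (\<lambda>w. (\<lambda>(u, v). avg_dist u v) (jump i (x, y) w))" for i x y
    unfolding avg_jump by (intro Bochner_Integration.integrable_add integrable_divide Bochner_Integration.integrable_diff d_int const_int)
  show ?thesis
  proof (rule that[of k])
    show "integrable (k (x, y)) (\<lambda>(u, v). avg_dist u v)" for x y
      using k(3)[OF borel_measurable_avg_dist avg_int] by blast
    show "jump_operator k (\<lambda>(u, v). avg_dist u v) (x, y) =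
            (\<Sum>i\<in>UNIV. J (x i) (y i) (F i (x i) x) (F i (y i) y)) / real CARD('n)" for x y
    proof -
      let ?h = "\<lambda>w :: ('n \<Rightarrow> 'a) \<times> ('n \<Rightarrow> 'a). (\<lambda>(u, v). avg_dist u v) w - avg_dist x y"
      have h: "?h (jump i (x, y) w) = (dist (fst w) (snd w) - dist (x i) (y i)) / real CARD('n)" for i w
        by (simp add: jump_def avg)
      have "(\<integral>w. ?h w \<partial>k (x, y)) = (\<Sum>i\<in>UNIV. \<integral>w. ?h (jump i (x, y) w) \<partial>\<pi> i (x, y))"
      proof (rule k(3)[THEN conjunct2])
        show "?h \<in> borel_measurable borel" by (rule borel_measurable_diff[OF borel_measurable_avg_dist borel_measurable_const])
        show "integrable (\<pi> i (x, y)) (\<lambda>w. ?h (jump i (x, y) w))" for i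
          unfolding h by (intro integrable_divide Bochner_Integration.integrable_diff d_int const_int)
      qed
      also have "\<dots> = (\<Sum>i\<in>UNIV. J (x i) (y i) (F i (x i) x) (F i (y i) y) / real CARD('n))"
      proof (intro sum.cong refl)
        fix i
        have "(\<integral>w. ?h (jump i (x, y) w) \<partial>\<pi> i (x, y)) = (\<integral>w. dist (fst w) (snd w) - dist (x i) (y i) \<partial>\<pi> i (x, y)) / real CARD('n)"
          unfolding h by simp
        also have "(\<integral>w. dist (fst w) (snd w) - dist (x i) (y i) \<partial>\<pi> i (x, y)) =
            enn2real (wasserstein dist (\<mu> i (x, y)) (\<nu> i (x, y))) - (measure (m1 i (x, y)) UNIV + measure (m2 i (x, y)) UNIV) * dist (x i) (y i)"
          by (subst Bochner_Integration.integral_diff[OF d_int const_int]) (simp add: d_val space_\<pi> mass_\<pi>_real)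
        also have "\<dots> = J (x i) (y i) (F i (x i) x) (F i (y i) y)"
          by (simp add: J_def \<mu>_def \<nu>_def m1_def m2_def c1_def c2_def)
        finally show "(\<integral>w. ?h (jump i (x, y) w) \<partial>\<pi> i (x, y)) = J (x i) (y i) (F i (x i) x) (F i (y i) y) / real CARD('n)" .
      qed
      finally show ?thesis by (simp add: jump_operator_def sum_divide_distrib)
    qed
    show "emeasure (k (x, y)) UNIV = (\<Sum>i\<in>UNIV. emeasure (F i (x i) x) UNIV) + (\<Sum>i\<in>UNIV. emeasure (F i (y i) y) UNIV)" for x y
    proof -
      have "space (k (x, y)) = UNIV" using k(1) sets_eq_imp_space_eq[of "k (x, y)" borel] by (simp add: finite_kernel_def)
      then have "emeasure (k (x, y)) UNIV = (\<integral>\<^sup>+ p. 1 \<partial>k (x, y))" by simp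
      also have "\<dots> = (\<Sum>i\<in>UNIV. \<integral>\<^sup>+ w. 1 \<partial>\<pi> i (x, y))" by (rule k(2)) simp
      also have "\<dots> = (\<Sum>i\<in>UNIV. emeasure (F i (x i) x) UNIV) + (\<Sum>i\<in>UNIV. emeasure (F i (y i) y) UNIV)"
        by (simp add: space_\<pi> mass_\<pi> sum.distrib) (simp add: c1_def c2_def m1_def m2_def)
      finally show ?thesis .
    qed
    show "coupling_kernel (particle_generator F) k" unfolding coupling_kernel_def
    proof (intro conjI allI impI k(1))
      fix g :: "('n \<Rightarrow> 'a) \<Rightarrow> real" and x y assume bm: "bounded_measurable g"
      then have g[measurable]: "g \<in> borel_measurable borel" by (simp add: bounded_measurable_def)
      obtain B where B: "\<And>x. \<bar>g x\<bar> \<le> B" using bm by (auto simp: bounded_measurable_def bounded_iff)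
      have upd: "(\<lambda>u. x(i := u)) \<in> borel \<rightarrow>\<^sub>M borel" for x :: "'n \<Rightarrow> 'a" and i by (rule measurable_fun_upd) measurable
      have gx: "(\<lambda>u. g (x(i := u)) - g x) \<in> borel_measurable borel" for x i
        using measurable_compose[OF upd g, of x i] by simp
      have bound: "norm (g (x(i := u)) - g x) \<le> 2 * B" for x i u
        using B[of x] B[of "x(i := u)"] by simp
      have int: "integrable N (\<lambda>u. g (x(i := u)) - g x)" if "finite_measure N" "sets N = sets borel" for N x i
        using finite_measure.integrable_const_bound[OF that(1), of "\<lambda>u. g (x(i := u)) - g x" "2 * B"] bound gx
        by (simp add: measurable_cong_sets[OF that(2) refl])
      have fin_\<mu>: "finite_measure (\<mu> i z)" "finite_measure (\<nu> i z)" for i z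
        by (rule finite_measureI, simp add: space_\<mu>\<nu> mass)+
      have gp: "(\<lambda>(u, v). g u) \<in> borel_measurable (borel :: (('n \<Rightarrow> 'a) \<times> ('n \<Rightarrow> 'a)) measure)"
        "(\<lambda>(u, v). g v) \<in> borel_measurable (borel :: (('n \<Rightarrow> 'a) \<times> ('n \<Rightarrow> 'a)) measure)"
        unfolding borel_prod[symmetric] by measurable
      have marg: "distr (\<pi> i z) (\<mu> i z) fst = \<mu> i z" "distr (\<pi> i z) (\<nu> i z) snd = \<nu> i z" for i z
        using cpl[of i z] by (auto simp: couplings_def)
      have proj: "fst \<in> \<pi> i z \<rightarrow>\<^sub>M \<mu> i z" "snd \<in> \<pi> i z \<rightarrow>\<^sub>M \<nu> i z" for i z
        using measurable_cong_sets[OF sets_\<pi>' sets_\<mu>\<nu>(1)] measurable_cong_sets[OF sets_\<pi>' sets_\<mu>\<nu>(2)] by auto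
      show "jump_operator k (\<lambda>(u, v). g u) (x, y) = particle_generator F g x"
      proof -
        let ?h = "\<lambda>w. (\<lambda>(u, v). g u) w - g x"
        have h: "?h (jump i (x, y) w) = (\<lambda>u. g (x(i := u)) - g x) (fst w)" for i w by (simp add: jump_def)
        have intm: "integrable (\<mu> i (x, y)) (\<lambda>u. g (x(i := u)) - g x)" for i by (rule int[OF fin_\<mu>(1) sets_\<mu>\<nu>(1)])
        have eq: "(\<integral>w. ?h (jump i (x, y) w) \<partial>\<pi> i (x, y)) = (\<integral>u. g (x(i := u)) - g x \<partial>\<mu> i (x, y))"
          "integrable (\<pi> i (x, y)) (\<lambda>w. ?h (jump i (x, y) w))" for i
        proof -
          have m: "(\<lambda>u. g (x(i := u)) - g x) \<in> borel_measurable (\<mu> i (x, y))" using gx by (simp add: measurable_cong_sets[OF sets_\<mu>\<nu>(1) refl])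
          show "(\<integral>w. ?h (jump i (x, y) w) \<partial>\<pi> i (x, y)) = (\<integral>u. g (x(i := u)) - g x \<partial>\<mu> i (x, y))"
            unfolding h using integral_distr[OF proj(1) m] by (simp only: marg)
          show "integrable (\<pi> i (x, y)) (\<lambda>w. ?h (jump i (x, y) w))"
            unfolding h using intm[of i] integrable_distr_eq[OF proj(1) m] by (simp add: marg)
        qed
        have "(\<integral>w. ?h w \<partial>k (x, y)) = (\<Sum>i\<in>UNIV. \<integral>w. ?h (jump i (x, y) w) \<partial>\<pi> i (x, y))"
          using gp(1) eq(2) by (intro k(3)[THEN conjunct2]) auto
        \<comment> \<open>The atom at \<open>x i\<close> contributes
          \<open>g (x(i := x i)) - g x\<close>, which is 0.\<close>
        also have "\<dots> = (\<Sum>i\<in>UNIV. \<integral>u. g (x(i := u)) - g x \<partial>m1 i (x, y))"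
          unfolding eq(1) \<mu>_def
          by (subst integral_add_dirac(2)) (auto intro!: gx int fin)
        also have "\<dots> = particle_generator F g x" by (simp add: particle_generator_def m1_def)
        finally show ?thesis by (simp add: jump_operator_def)
      qed
      show "jump_operator k (\<lambda>(u, v). g v) (x, y) = particle_generator F g y"
      proof -
        let ?h = "\<lambda>w. (\<lambda>(u, v). g v) w - g y"
        have h: "?h (jump i (x, y) w) = (\<lambda>u. g (y(i := u)) - g y) (snd w)" for i w by (simp add: jump_def)
        have intm: "integrable (\<nu> i (x, y)) (\<lambda>u. g (y(i := u)) - g y)" for i by (rule int[OF fin_\<mu>(2) sets_\<mu>\<nu>(2)])
        have eq: "(\<integral>w. ?h (jump i (x, y) w) \<partial>\<pi> i (x, y)) = (\<integral>u. g (y(i := u)) - g y \<partial>\<nu> i (x, y))"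
          "integrable (\<pi> i (x, y)) (\<lambda>w. ?h (jump i (x, y) w))" for i
        proof -
          have m: "(\<lambda>u. g (y(i := u)) - g y) \<in> borel_measurable (\<nu> i (x, y))" using gx by (simp add: measurable_cong_sets[OF sets_\<mu>\<nu>(2) refl])
          show "(\<integral>w. ?h (jump i (x, y) w) \<partial>\<pi> i (x, y)) = (\<integral>u. g (y(i := u)) - g y \<partial>\<nu> i (x, y))"
            unfolding h using integral_distr[OF proj(2) m] by (simp only: marg)
          show "integrable (\<pi> i (x, y)) (\<lambda>w. ?h (jump i (x, y) w))"
            unfolding h using intm[of i] integrable_distr_eq[OF proj(2) m] by (simp add: marg)
        qed
        have "(\<integral>w. ?h w \<partial>k (x, y)) = (\<Sum>i\<in>UNIV. \<integral>w. ?h (jump i (x, y) w) \<partial>\<pi> i (x, y))"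
          using gp(2) eq(2) by (intro k(3)[THEN conjunct2]) auto
        also have "\<dots> = (\<Sum>i\<in>UNIV. \<integral>u. g (y(i := u)) - g y \<partial>m2 i (x, y))"
          unfolding eq(1) \<nu>_def
          by (subst integral_add_dirac(2)) (auto intro!: gx int fin)
        also have "\<dots> = particle_generator F g y" by (simp add: particle_generator_def m2_def)
        finally show ?thesis by (simp add: jump_operator_def)
      qed
    qed
  qed
qed

section \<open>Laws of a jump process with given rates\<close>

text \<open>With a derivative from the right only, the mean value theorem is out of reach. Instead,
  the last time at which \<open>H\<close> is at most \<open>H 0\<close> cannot precede
  \<open>t\<close>, because a negative right derivative would allow a later one.\<close>

lemma right_derivative_nonpos_imp_le:
  fixes H :: "real \<Rightarrow> real"
  assumes "0 \<le> t" and cont: "continuous_on {0..t} H"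
    and deriv: "\<And>s. 0 \<le> s \<Longrightarrow> s < t \<Longrightarrow> (H has_real_derivative D s) (at_right s)" and D: "\<And>s. 0 \<le> s \<Longrightarrow> s < t \<Longrightarrow> D s < 0"
  shows "H t \<le> H 0"
proof (rule ccontr)
  assume "\<not> H t \<le> H 0"
  define A where "A = {0..t} \<inter> H -` {..H 0}"
  have A: "closed A" "0 \<in> A" "bdd_above A" "A \<subseteq> {0..t}"
    unfolding A_def using \<open>0 \<le> t\<close> by (auto intro!: continuous_closed_preimage cont bdd_aboveI[of _ t])
  have "Sup A \<in> A" using A by (intro closed_contains_Sup) auto
  define s where "s = Sup A"
  have s: "0 \<le> s" "s \<le> t" "H s \<le> H 0" using \<open>Sup A \<in> A\<close> by (auto simp: s_def A_def)
  have "s \<noteq> t" using s \<open>\<not> H t \<le> H 0\<close> by auto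
  then have "s < t" using s by simp
  have "eventually (\<lambda>u. (H u - H s) / (u - s) < 0) (at_right s)"
    using deriv[OF s(1) \<open>s < t\<close>] D[OF s(1) \<open>s < t\<close>] by (auto simp: has_field_derivative_iff dest: order_tendstoD)
  moreover have "eventually (\<lambda>u. u \<in> {s<..<t}) (at_right s)" using \<open>s < t\<close> by (rule eventually_at_right_real)
  ultimately have "eventually (\<lambda>u. (H u - H s) / (u - s) < 0 \<and> u \<in> {s<..<t}) (at_right s)" by (rule eventually_conj)
  from eventually_happens'[OF trivial_limit_at_right_real this]
  obtain u where u: "(H u - H s) / (u - s) < 0" "s < u" "u < t" by auto
  then have "H u < H s" by (simp add: divide_less_0_iff)
  then have "u \<in> A" using u s by (simp add: A_def)
  then have "u \<le> s" unfolding s_def using A(3) by (rule cSup_upper)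
  then show False using u by simp
qed

text \<open>Subtracting a line of small positive slope makes the derivative strictly negative; the
  slope is chosen to cost at most \<open>e\<close> up to time \<open>t\<close>. The factor
  \<open>c\<close> treats \<open>H\<close> and \<open>- H\<close> at once.\<close>

lemma right_derivative_zero_imp_const:
  fixes H :: "real \<Rightarrow> real"
  assumes t: "0 \<le> t" and cont: "continuous_on {0..t} H"
    and deriv: "\<And>s. 0 \<le> s \<Longrightarrow> s < t \<Longrightarrow> (H has_real_derivative 0) (at_right s)"
  shows "H t = H 0"
proof (rule antisym)
  have *: "c * H t \<le> c * H 0" for c
  proof (rule field_le_epsilon)
    fix e :: real assume "e > 0"
    define d where "d = e / (t + 1)"
    have d: "d > 0" "d * t \<le> e" using \<open>e > 0\<close> t by (auto simp: d_def field_simps)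
    have "c * H t - d * t \<le> c * H 0 - d * 0"
    proof (rule right_derivative_nonpos_imp_le[OF t, where D="\<lambda>_. - d"])
      show "continuous_on {0..t} (\<lambda>s. c * H s - d * s)" by (intro continuous_intros cont)
      show "((\<lambda>s. c * H s - d * s) has_real_derivative - d) (at_right s)" if "0 \<le> s" "s < t" for s
        using deriv[OF that] by (auto intro!: derivative_eq_intros)
    qed (use d in auto)
    then show "c * H t \<le> c * H 0 + e" using d by simp
  qed
  show "H t \<le> H 0" using *[of 1] by simp
  show "H 0 \<le> H t" using *[of "-1"] by simp
qed

text \<open>Integrating factor: \<open>exp (r * s) * y s\<close> minus the integral of
  \<open>exp (r * u) * a u\<close> up to \<open>s\<close> has right derivative 0.\<close>

lemma variation_of_constants:
  fixes y a :: "real \<Rightarrow> real"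
  assumes t: "0 \<le> t" and y: "continuous_on {0..} y" and a: "continuous_on {0..} a"
    and deriv: "\<And>s. 0 \<le> s \<Longrightarrow> ((\<lambda>h. (y (s + h) - y s) / h) \<longlongrightarrow> a s - r * y s) (at_right 0)"
  shows "((\<lambda>s. exp (- r * (t - s)) * a s) has_integral (y t - exp (- r * t) * y 0)) {0..t}"
proof -
  define G where "G s = integral {0..s} (\<lambda>u. exp (r * u) * a u)" for s
  have cont: "continuous_on {0..b} (\<lambda>u. exp (r * u) * a u)" for b
    using continuous_on_subset[OF a, of "{0..b}"] by (intro continuous_intros) auto
  have G: "(G has_real_derivative exp (r * s) * a s) (at s within {0..b})" if "0 \<le> s" "s \<le> b" for s b
    unfolding G_def by (rule integral_has_real_derivative[OF cont]) (use that in auto)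
  define H where "H s = exp (r * s) * y s - G s" for s
  have "H t = H 0"
  proof (rule right_derivative_zero_imp_const[OF t])
    have "continuous_on {0..t} G"
      by (rule DERIV_continuous_on[where D="\<lambda>s. exp (r * s) * a s"]) (rule G, auto)
    then show "continuous_on {0..t} H"
      unfolding H_def using continuous_on_subset[OF y, of "{0..t}"] by (intro continuous_intros) auto
    fix s assume s: "0 \<le> s" "s < t"
    have "((\<lambda>u. (y u - y s) / (u - s)) \<longlongrightarrow> a s - r * y s) (at_right s)"
      unfolding filterlim_at_right_to_0[of _ _ s] using deriv[OF s(1)] by (simp add: add.commute)
    then have y': "(y has_real_derivative a s - r * y s) (at_right s)" by (simp add: has_field_derivative_iff)
    have "(G has_real_derivative exp (r * s) * a s) (at s within {s..t})"
      by (rule DERIV_subset[OF G[of s t]]) (use s in auto)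
    then have G': "(G has_real_derivative exp (r * s) * a s) (at_right s)"
      using s by (simp add: at_within_Icc_at_right)
    show "(H has_real_derivative 0) (at_right s)"
      unfolding H_def by (rule derivative_eq_intros y' G' refl)+ (simp add: algebra_simps)
  qed
  then have "G t = exp (r * t) * y t - y 0" by (simp add: H_def G_def)
  moreover have "((\<lambda>u. exp (r * u) * a u) has_integral G t) {0..t}"
    unfolding G_def by (rule integrable_integral[OF integrable_continuous_real[OF cont]])
  ultimately have "((\<lambda>u. exp (- r * t) * (exp (r * u) * a u)) has_integral exp (- r * t) * (exp (r * t) * y t - y 0)) {0..t}"
    by (intro has_integral_mult_right) simp
  moreover have "exp (- r * t) * (exp (r * u) * a u) = exp (- r * (t - u)) * a u" for u
  proof -
    have "exp (- r * (t - u)) = exp (- r * t) * exp (r * u)"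
      unfolding mult_exp_exp by (simp add: right_diff_distrib)
    then show ?thesis by simp
  qed
  moreover have "exp (- r * t) * (exp (r * t) * y t - y 0) = y t - exp (- r * t) * y 0"
  proof -
    have "exp (- r * t) * exp (r * t) = 1" unfolding mult_exp_exp by simp
    then show ?thesis by (simp only: right_diff_distrib mult.assoc[symmetric] mult_1)
  qed
  ultimately show ?thesis by (simp only:)
qed

text \<open>This class is preserved by the transition semigroup, and on it real integrals and
  extended nonnegative ones can be exchanged freely.\<close>

definition unit_function :: "('b::topological_space \<Rightarrow> real) \<Rightarrow> bool" where
  "unit_function g \<longleftrightarrow> g \<in> borel_measurable borel \<and> (\<forall>x. 0 \<le> g x \<and> g x \<le> 1)"

lemma unit_function_bounded: "unit_function g \<Longrightarrow> bounded_measurable g"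
  by (auto simp: unit_function_def bounded_measurable_def bounded_iff intro!: exI[of _ 1])

section \<open>The transition semigroup of the given process\<close>

locale jump_process =
  fixes \<kappa> :: "'b::polish_space \<Rightarrow> 'b measure" and L :: "('b \<Rightarrow> real) \<Rightarrow> 'b \<Rightarrow> real"
    and P :: "'b \<Rightarrow> 'w measure" and X :: "real \<Rightarrow> 'w \<Rightarrow> 'b"
  assumes kernel: "finite_kernel \<kappa>"
    and generator: "\<And>g x. bounded_measurable g \<Longrightarrow> L g x = jump_operator \<kappa> g x"
    and process: "pure_jump_Markov_process L P X"
begin

abbreviation law :: "real \<Rightarrow> 'b \<Rightarrow> 'b measure" where
  "law \<equiv> law_at P X"

definition markov_op :: "real \<Rightarrow> ('b \<Rightarrow> real) \<Rightarrow> 'b \<Rightarrow> real" where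
  "markov_op t g x = (\<integral>u. g u \<partial>law t x)"

lemma prob_space_P: "prob_space (P x)"
  using process by (simp add: pure_jump_Markov_process_def)

lemma X_measurable: "0 \<le> t \<Longrightarrow> X t \<in> P x \<rightarrow>\<^sub>M borel"
  using process by (simp add: pure_jump_Markov_process_def)

lemma sets_law [simp, measurable_cong]: "sets (law t x) = sets borel"
  by (simp add: law_at_def)

lemma space_law [simp]: "space (law t x) = UNIV"
  by (simp add: law_at_def)

lemma prob_space_law: "0 \<le> t \<Longrightarrow> prob_space (law t x)"
  unfolding law_at_def by (rule prob_space.prob_space_distr[OF prob_space_P X_measurable])

lemma law_measurable: "0 \<le> t \<Longrightarrow> law t \<in> borel \<rightarrow>\<^sub>M subprob_algebra borel"
  using process
  by (intro measurable_subprob_algebra)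
    (auto simp: prob_space_law prob_space_imp_subprob_space pure_jump_Markov_process_def)

lemma nn_integral_law: "0 \<le> t \<Longrightarrow> f \<in> borel_measurable borel \<Longrightarrow> (\<integral>\<^sup>+ u. f u \<partial>law t x) = (\<integral>\<^sup>+ \<omega>. f (X t \<omega>) \<partial>P x)"
  by (simp add: law_at_def nn_integral_distr X_measurable)

lemma ennreal_markov_op:
  assumes "0 \<le> t" "unit_function g"
  shows "ennreal (markov_op t g x) = (\<integral>\<^sup>+ u. g u \<partial>law t x)"
proof -
  interpret prob_space "law t x" by (rule prob_space_law) fact
  have "integrable (law t x) g"
    using assms(2) by (intro integrable_const_bound[of _ 1]) (auto simp: unit_function_def)
  then show ?thesis
    unfolding markov_op_def using assms(2) by (intro nn_integral_eq_integral[symmetric]) (auto simp: unit_function_def)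
qed

lemma unit_function_markov_op:
  assumes t: "0 \<le> t" and g: "unit_function g"
  shows "unit_function (markov_op t g)"
  unfolding unit_function_def
proof (intro conjI allI)
  have [measurable]: "g \<in> borel_measurable borel" using g by (simp add: unit_function_def)
  note [measurable] = law_measurable[OF t]
  show "markov_op t g \<in> borel_measurable borel" unfolding markov_op_def by measurable
  fix x
  interpret prob_space "law t x" by (rule prob_space_law[OF t])
  show "0 \<le> markov_op t g x" unfolding markov_op_def using g by (intro integral_nonneg_AE) (auto simp: unit_function_def)
  have "ennreal (markov_op t g x) \<le> (\<integral>\<^sup>+ u. 1 \<partial>law t x)"
    unfolding ennreal_markov_op[OF t g] using g by (intro nn_integral_mono) (auto simp: unit_function_def)
  then show "markov_op t g x \<le> 1" using emeasure_space_1 by simp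
qed

text \<open>Chapman-Kolmogorov equation, from the Markov property with the whole space as past
  event.\<close>

lemma emeasure_law_add:
  assumes s: "0 \<le> s" and t: "0 \<le> t" and B: "B \<in> sets borel"
  shows "emeasure (law (s + t) x) B = (\<integral>\<^sup>+ u. emeasure (law t u) B \<partial>law s x)"
proof -
  have [measurable]: "(\<lambda>u. emeasure (law t u) B) \<in> borel_measurable borel"
    using law_measurable[OF t] B by measurable
  have "space (P x) \<in> past_events (P x) X s" unfolding past_events_def by (rule sigma_sets_top)
  then have "emeasure (P x) (space (P x) \<inter> X (s + t) -` B) = (\<integral>\<^sup>+ \<omega>\<in>space (P x). emeasure (law t (X s \<omega>)) B \<partial>P x)"
    using process s t B by (simp add: pure_jump_Markov_process_def)
  also have "\<dots> = (\<integral>\<^sup>+ \<omega>. emeasure (law t (X s \<omega>)) B \<partial>P x)" by (intro nn_integral_cong) simp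
  also have "\<dots> = (\<integral>\<^sup>+ u. emeasure (law t u) B \<partial>law s x)" by (rule nn_integral_law[OF s, symmetric]) measurable
  finally show ?thesis
    using s t B X_measurable[of "s + t" x] by (simp add: law_at_def emeasure_distr Int_commute)
qed

lemma law_add:
  assumes "0 \<le> s" "0 \<le> t"
  shows "law (s + t) x = law s x \<bind> law t"
proof (rule measure_eqI)
  have m: "law t \<in> law s x \<rightarrow>\<^sub>M subprob_algebra borel"
    using law_measurable[OF assms(2)] by (simp add: measurable_cong_sets[OF sets_law refl])
  then show "sets (law (s + t) x) = sets (law s x \<bind> law t)" by (subst sets_bind[where N=borel]) auto
  show "emeasure (law (s + t) x) A = emeasure (law s x \<bind> law t) A" if "A \<in> sets (law (s + t) x)" for A
    using that by (simp add: emeasure_law_add assms emeasure_bind[OF _ m])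
qed

lemma markov_op_add:
  assumes s: "0 \<le> s" and t: "0 \<le> t" and g: "unit_function g"
  shows "markov_op (s + t) g x = markov_op s (markov_op t g) x"
proof -
  have m: "g \<in> borel_measurable borel" using g by (simp add: unit_function_def)
  have "ennreal (markov_op (s + t) g x) = (\<integral>\<^sup>+ u. \<integral>\<^sup>+ v. g v \<partial>law t u \<partial>law s x)"
    using s t g m law_measurable[OF t]
    by (simp add: ennreal_markov_op law_add nn_integral_bind[where B=borel] measurable_cong_sets[OF sets_law refl])
  also have "\<dots> = (\<integral>\<^sup>+ u. ennreal (markov_op t g u) \<partial>law s x)" by (simp add: ennreal_markov_op[OF t g])
  also have "\<dots> = ennreal (markov_op s (markov_op t g) x)"
    by (rule ennreal_markov_op[symmetric, OF s unit_function_markov_op[OF t g]])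
  finally show ?thesis
    using unit_function_markov_op[OF s unit_function_markov_op[OF t g]] unit_function_markov_op[OF _ g, of "s + t"] s t
    by (simp add: unit_function_def)
qed

lemma markov_op_right_derivative:
  assumes "bounded_measurable g"
  shows "((\<lambda>t. (markov_op t g x - g x) / t) \<longlongrightarrow> L g x) (at_right 0)"
proof -
  have "((\<lambda>t. ((\<integral>\<omega>. g (X t \<omega>) \<partial>P x) - g x) / t) \<longlongrightarrow> L g x) (at_right 0)"
    using process assms by (simp add: pure_jump_Markov_process_def)
  moreover have "eventually (\<lambda>t. ((\<integral>\<omega>. g (X t \<omega>) \<partial>P x) - g x) / t = (markov_op t g x - g x) / t) (at_right 0)"
    using eventually_at_right_less[of "0::real"]
  proof eventually_elim
    case (elim t)
    then show ?case unfolding markov_op_def law_at_def using assms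
      by (subst integral_distr) (auto simp: X_measurable bounded_measurable_def)
  qed
  ultimately show ?thesis by (rule Lim_transform_eventually)
qed

lemma law_zero: "law 0 x = return borel x"
proof (rule measure_eqI)
  fix A assume "A \<in> sets (law 0 x)"
  then have A[measurable]: "A \<in> sets borel" by simp
  have "AE \<omega> in P x. X 0 \<omega> = x \<and> step_path (\<lambda>t. X t \<omega>)"
    using process by (simp add: pure_jump_Markov_process_def)
  then have "AE \<omega> in P x. indicator A (X 0 \<omega>) = (indicator A x :: ennreal)" by (rule AE_mp) simp
  then have "(\<integral>\<^sup>+ \<omega>. indicator A (X 0 \<omega>) \<partial>P x) = (\<integral>\<^sup>+ \<omega>. indicator A x \<partial>P x)" by (rule nn_integral_cong_AE)
  also have "\<dots> = indicator A x" using prob_space.emeasure_space_1[OF prob_space_P] by simp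
  finally show "emeasure (law 0 x) A = emeasure (return borel x) A"
    using nn_integral_law[of 0 "indicator A" x] by simp
qed simp

lemma markov_op_zero: "unit_function g \<Longrightarrow> markov_op 0 g x = g x"
  by (simp add: markov_op_def law_zero integral_return unit_function_def)

definition stay :: "real \<Rightarrow> 'b \<Rightarrow> real" where
  "stay h x = markov_op h (indicator {x}) x"

text \<open>The difference quotient of the indicator of \<open>{x}\<close> has a finite limit, so
  its numerator tends to 0. All continuity in time rests on this.\<close>

lemma stay_tendsto: "((\<lambda>h. stay h x) \<longlongrightarrow> 1) (at_right 0)"
proof -
  have bm: "bounded_measurable (indicator {x} :: 'b \<Rightarrow> real)"
    by (auto simp: bounded_measurable_def bounded_iff indicator_def intro!: exI[of _ 1])
  have "((\<lambda>h. h * ((stay h x - 1) / h) + 1) \<longlongrightarrow> 0 * L (indicator {x}) x + 1) (at_right 0)"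
    using markov_op_right_derivative[OF bm, of x] by (intro tendsto_intros) (auto simp: stay_def)
  moreover have "eventually (\<lambda>h. h * ((stay h x - 1) / h) + 1 = stay h x) (at_right (0::real))"
    using eventually_at_right_less[of "0::real"] by eventually_elim simp
  ultimately show ?thesis by (simp add: Lim_transform_eventually)
qed

text \<open>A function with values in the unit interval changes by at most 1, and only where the
  state has left \<open>x\<close>.\<close>

lemma markov_op_diff_bound:
  assumes h: "0 \<le> h" and g: "unit_function g"
  shows "\<bar>markov_op h g x - g x\<bar> \<le> 1 - stay h x"
proof -
  interpret prob_space "law h x" by (rule prob_space_law[OF h])
  have [measurable]: "g \<in> borel_measurable borel" and g01: "\<And>u. 0 \<le> g u" "\<And>u. g u \<le> 1" using g by (auto simp: unit_function_def)
  have int: "integrable (law h x) g" using g01 by (intro integrable_const_bound[of _ 1]) auto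
  have int1: "integrable (law h x) (indicat_real {x})" by (intro integrable_const_bound[of _ 1]) auto
  have "markov_op h g x - g x = (\<integral>u. g u - g x \<partial>law h x)"
    unfolding markov_op_def using int prob_space by (subst Bochner_Integration.integral_diff) auto
  also have "\<bar>\<dots>\<bar> \<le> (\<integral>u. \<bar>g u - g x\<bar> \<partial>law h x)" by (rule integral_abs_bound)
  also have "\<dots> \<le> (\<integral>u. 1 - indicat_real {x} u \<partial>law h x)"
  proof (rule integral_mono)
    show "\<bar>g u - g x\<bar> \<le> 1 - indicat_real {x} u" for u using g01[of u] g01[of x] by (auto simp: indicator_def)
  qed (use int int1 in auto)
  also have "\<dots> = 1 - stay h x"
    unfolding stay_def markov_op_def using int1 prob_space by (subst Bochner_Integration.integral_diff) auto
  finally show ?thesis .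
qed

text \<open>The semigroup property writes the difference between times \<open>s\<close> and
  \<open>t\<close> as a short step applied to \<open>markov_op s g\<close>, and the bound through
  \<open>stay\<close> is the same for all such functions. This yields continuity from both sides
  although the generator acts from the right.\<close>

lemma markov_op_continuous:
  assumes g: "unit_function g"
  shows "continuous_on {0..} (\<lambda>t. markov_op t g x)"
proof -
  have *: "\<bar>markov_op t g x - markov_op s g x\<bar> \<le> 1 - stay (t - s) x" if "0 \<le> s" "s \<le> t" for s t
    using markov_op_diff_bound[of "t - s" "markov_op s g" x] markov_op_add[of "t - s" s g x] unit_function_markov_op[OF _ g] g that
    by simp
  show ?thesis unfolding continuous_on_iff
  proof (intro ballI allI impI)
    fix t e :: real assume "t \<in> {0..}" "e > 0"
    then have "eventually (\<lambda>h. stay h x > 1 - e) (at_right 0)" by (intro order_tendstoD[OF stay_tendsto]) auto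
    then obtain d where d: "d > 0" "\<And>h. 0 < h \<Longrightarrow> h < d \<Longrightarrow> stay h x > 1 - e"
      unfolding eventually_at_right_field by auto
    show "\<exists>d>0. \<forall>s\<in>{0..}. dist s t < d \<longrightarrow> dist (markov_op s g x) (markov_op t g x) < e"
    proof (intro exI[of _ d] conjI ballI impI d)
      fix s :: real assume s: "s \<in> {0..}" "dist s t < d"
      consider "s < t" | "s = t" | "t < s" by linarith
      then show "dist (markov_op s g x) (markov_op t g x) < e"
      proof cases
        case 1
        then show ?thesis using *[of s t] d(2)[of "t - s"] s by (simp add: dist_real_def)
      next
        case 3
        then show ?thesis using *[of t s] d(2)[of "s - t"] s \<open>t \<in> {0..}\<close> by (simp add: dist_real_def)
      qed (use \<open>e > 0\<close> in simp)
    qed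
  qed
qed

lemma markov_op_derivative:
  assumes t: "0 \<le> t" and g: "unit_function g"
  shows "((\<lambda>h. (markov_op (t + h) g x - markov_op t g x) / h) \<longlongrightarrow> L (markov_op t g) x) (at_right 0)"
proof -
  have "((\<lambda>h. (markov_op h (markov_op t g) x - markov_op t g x) / h) \<longlongrightarrow> L (markov_op t g) x) (at_right 0)"
    by (rule markov_op_right_derivative[OF unit_function_bounded[OF unit_function_markov_op[OF t g]]])
  moreover have "eventually (\<lambda>h. (markov_op h (markov_op t g) x - markov_op t g x) / h = (markov_op (t + h) g x - markov_op t g x) / h) (at_right (0::real))"
    using eventually_at_right_less[of "0::real"]
    by eventually_elim (simp add: markov_op_add[OF _ t g, symmetric] add.commute)
  ultimately show ?thesis by (rule Lim_transform_eventually)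
qed

text \<open>The backward equation, written with the jump rates of a process of which \<open>X\<close> is a
  marginal.\<close>

lemma backward_equation:
  fixes k :: "'c::topological_space \<Rightarrow> 'c measure" and pr :: "'c \<Rightarrow> 'b"
  assumes k: "finite_kernel k" and pr[measurable]: "pr \<in> borel \<rightarrow>\<^sub>M borel"
    and marginal: "\<forall>g z. bounded_measurable g \<longrightarrow> jump_operator k (\<lambda>w. g (pr w)) z = L g (pr z)"
    and t: "0 \<le> t" and g: "unit_function g"
  shows "ennreal (markov_op t g (pr z)) = ennreal (exp (- measure (k z) UNIV * t)) * ennreal (g (pr z)) +
    (\<integral>\<^sup>+ s. ennreal (exp (- measure (k z) UNIV * (t - s))) * indicator {0..t} s *
       (\<integral>\<^sup>+ w. ennreal (markov_op s g (pr w)) \<partial>k z) \<partial>lborel)"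
proof -
  have sets[measurable_cong]: "sets (k z) = sets borel" and "finite_measure (k z)" using k by (auto simp: finite_kernel_def)
  then interpret finite_measure "k z" by simp
  have space: "space (k z) = UNIV" using sets_eq_imp_space_eq[OF sets] by simp
  \<comment> \<open>The rate of \<open>k\<close> at \<open>z\<close> may differ from that of the
    marginal process, because jumps that leave \<open>pr z\<close> in place are invisible to the
    generator.\<close>
  define r where "r = measure (k z) UNIV"
  define a where "a s = (\<integral>w. markov_op s g (pr w) \<partial>k z)" for s
  have u: "unit_function (markov_op s g)" if "0 \<le> s" for s by (rule unit_function_markov_op[OF that g])
  have meas: "(\<lambda>w. markov_op s g (pr w)) \<in> borel_measurable (k z)" if "0 \<le> s" for s
  proof -
    have [measurable]: "markov_op s g \<in> borel_measurable borel" using u[OF that] by (simp add: unit_function_def)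
    show ?thesis by measurable
  qed
  have int: "integrable (k z) (\<lambda>w. markov_op s g (pr w))" if "0 \<le> s" for s
    using u[OF that] meas[OF that] by (intro integrable_const_bound[of _ 1]) (auto simp: unit_function_def)
  have a_nn: "(\<integral>\<^sup>+ w. ennreal (markov_op s g (pr w)) \<partial>k z) = ennreal (a s)" "0 \<le> a s" if "0 \<le> s" for s
    unfolding a_def using u[OF that] int[OF that]
    by (auto simp: unit_function_def intro!: nn_integral_eq_integral integral_nonneg_AE)
  \<comment> \<open>Dominated convergence: \<open>k z\<close> is finite and the integrands are
    bounded by 1.\<close>
  have a_cont: "continuous_on {0..} a"
    unfolding continuous_on_sequentially
  proof (intro allI ballI impI, elim conjE)
    fix \<tau> :: "nat \<Rightarrow> real" and s assume s: "s \<in> {0..}" "\<forall>n. \<tau> n \<in> {0..}" "\<tau> \<longlonglongrightarrow> s"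
    show "(a \<circ> \<tau>) \<longlonglongrightarrow> a s" unfolding a_def comp_def
    proof (rule integral_dominated_convergence[where w="\<lambda>_. 1"])
      show "AE w in k z. (\<lambda>n. markov_op (\<tau> n) g (pr w)) \<longlonglongrightarrow> markov_op s g (pr w)"
        using s markov_op_continuous[OF g] by (auto simp: continuous_on_sequentially comp_def)
      show "AE w in k z. norm (markov_op (\<tau> n) g (pr w)) \<le> 1" for n
        using u[of "\<tau> n"] s by (auto simp: unit_function_def)
    qed (use s meas in auto)
  qed
  have "((\<lambda>s. exp (- r * (t - s)) * a s) has_integral (markov_op t g (pr z) - exp (- r * t) * markov_op 0 g (pr z))) {0..t}"
  proof (rule variation_of_constants[OF t markov_op_continuous[OF g] a_cont])
    fix s :: real assume s: "0 \<le> s"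
    have "L (markov_op s g) (pr z) = jump_operator k (\<lambda>w. markov_op s g (pr w)) z"
      by (rule marginal[rule_format, OF unit_function_bounded[OF u[OF s]], symmetric])
    also have "\<dots> = a s - r * markov_op s g (pr z)"
      unfolding jump_operator_def a_def r_def using int[OF s]
      by (subst Bochner_Integration.integral_diff) (auto simp: space)
    finally show "((\<lambda>h. (markov_op (s + h) g (pr z) - markov_op s g (pr z)) / h) \<longlongrightarrow> a s - r * markov_op s g (pr z)) (at_right 0)"
      using markov_op_derivative[OF s g, of "pr z"] by simp
  qed
  then have "(\<integral>\<^sup>+ s. ennreal (exp (- r * (t - s)) * a s) * indicator {0..t} s \<partial>lborel) = ennreal (markov_op t g (pr z) - exp (- r * t) * g (pr z))"
    unfolding markov_op_zero[OF g] by (intro nn_integral_has_integral_lebesgue') (auto intro!: mult_nonneg_nonneg a_nn)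
  moreover have "(\<integral>\<^sup>+ s. ennreal (exp (- r * (t - s)) * a s) * indicator {0..t} s \<partial>lborel) =
     (\<integral>\<^sup>+ s. ennreal (exp (- r * (t - s))) * indicator {0..t} s * (\<integral>\<^sup>+ w. ennreal (markov_op s g (pr w)) \<partial>k z) \<partial>lborel)"
    by (intro nn_integral_cong) (auto simp: a_nn ennreal_mult split: split_indicator)
  ultimately have I: "ennreal (markov_op t g (pr z) - exp (- r * t) * g (pr z)) =
     (\<integral>\<^sup>+ s. ennreal (exp (- r * (t - s))) * indicator {0..t} s * (\<integral>\<^sup>+ w. ennreal (markov_op s g (pr w)) \<partial>k z) \<partial>lborel)"
    by simp
  \<comment> \<open>The sign has to be known before the real identity can be split into two terms in
    \<open>ennreal\<close>.\<close>
  have pos: "0 \<le> markov_op t g (pr z) - exp (- r * t) * g (pr z)"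
  proof (rule has_integral_nonneg)
    show "((\<lambda>s. exp (- r * (t - s)) * a s) has_integral (markov_op t g (pr z) - exp (- r * t) * g (pr z))) {0..t}"
      using \<open>((\<lambda>s. exp (- r * (t - s)) * a s) has_integral _) {0..t}\<close> by (simp add: markov_op_zero[OF g])
  qed (auto intro!: mult_nonneg_nonneg a_nn)
  have "0 \<le> exp (- r * t) * g (pr z)" using g by (simp add: unit_function_def)
  from ennreal_plus[OF this pos] have "ennreal (markov_op t g (pr z)) = ennreal (exp (- r * t) * g (pr z)) +
     (\<integral>\<^sup>+ s. ennreal (exp (- r * (t - s))) * indicator {0..t} s * (\<integral>\<^sup>+ w. ennreal (markov_op s g (pr w)) \<partial>k z) \<partial>lborel)"
    unfolding I by simp
  then show ?thesis using g by (simp add: r_def ennreal_mult unit_function_def)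
qed

end

section \<open>The minimal process of a jump kernel\<close>

text \<open>\<open>jump_iter k m f t z\<close> is the expectation of \<open>f\<close> at time \<open>t\<close> on the event that the process with
  jump kernel \<open>k\<close> started from \<open>z\<close> has made fewer than \<open>m\<close> jumps.\<close>

primrec jump_iter :: "('c::topological_space \<Rightarrow> 'c measure) \<Rightarrow> nat \<Rightarrow> ('c \<Rightarrow> ennreal) \<Rightarrow> real \<Rightarrow> 'c \<Rightarrow> ennreal" where
  "jump_iter k 0 = (\<lambda>f t z. 0)"
| "jump_iter k (Suc m) = (\<lambda>f t z. ennreal (exp (- measure (k z) UNIV * t)) * f z +
     (\<integral>\<^sup>+ s. ennreal (exp (- measure (k z) UNIV * (t - s))) * indicator {0..t} s *
        (\<integral>\<^sup>+ w. jump_iter k m f s w \<partial>k z) \<partial>lborel))"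

locale jump_kernel =
  fixes k :: "'c::second_countable_topology \<Rightarrow> 'c measure"
  assumes k: "finite_kernel k"
begin

definition rate :: "'c \<Rightarrow> real" where
  "rate z = measure (k z) UNIV"

lemma sets_k [simp, measurable_cong]: "sets (k z) = sets borel"
  using k by (simp add: finite_kernel_def)

lemma space_k [simp]: "space (k z) = UNIV"
  using sets_eq_imp_space_eq[OF sets_k] by simp

lemma finite_measure_k: "finite_measure (k z)"
  using k by (simp add: finite_kernel_def)

lemma emeasure_k_UNIV: "emeasure (k z) UNIV = ennreal (rate z)"
  unfolding rate_def by (rule finite_measure.emeasure_eq_measure[OF finite_measure_k])

lemma rate_nonneg: "0 \<le> rate z"
  by (simp add: rate_def)

lemma measurable_k: "f \<in> borel_measurable borel \<Longrightarrow> f \<in> borel_measurable (k z)"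
  by (simp add: measurable_cong_sets[OF sets_k refl])

lemma rate_measurable[measurable]: "rate \<in> borel_measurable borel"
proof -
  have "(\<lambda>z. emeasure (k z) UNIV) \<in> borel_measurable borel" using k by (simp add: finite_kernel_def)
  then show ?thesis unfolding rate_def[abs_def] measure_def by measurable
qed

lemma jump_iter_Suc:
  "jump_iter k (Suc m) f t z = ennreal (exp (- rate z * t)) * f z +
     (\<integral>\<^sup>+ s. ennreal (exp (- rate z * (t - s))) * indicator {0..t} s * (\<integral>\<^sup>+ w. jump_iter k m f s w \<partial>k z) \<partial>lborel)"
  by (simp add: rate_def)

lemma kernel_integral_measurable:
  assumes "(\<lambda>(s, w). f s w) \<in> borel_measurable (borel \<Otimes>\<^sub>M borel)"
  shows "(\<lambda>(s, z). \<integral>\<^sup>+ w. f s w \<partial>k z) \<in> borel_measurable ((borel :: real measure) \<Otimes>\<^sub>M borel)"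
proof -
  have "(\<lambda>p. \<integral>\<^sup>+ w. f (fst p) w \<partial>k (snd p)) \<in> borel_measurable ((borel :: real measure) \<Otimes>\<^sub>M borel)"
  proof (rule nn_integral_measurable_finite_kernel[where N=borel])
    show "(\<lambda>p. emeasure (k (snd p)) A) \<in> borel_measurable ((borel :: real measure) \<Otimes>\<^sub>M borel)" if "A \<in> sets borel" for A
    proof (rule measurable_compose[OF measurable_snd])
      show "(\<lambda>z. emeasure (k z) A) \<in> borel_measurable borel" using k that by (simp add: finite_kernel_def)
    qed
    have "(\<lambda>q. (\<lambda>(s, w). f s w) (fst (fst q), snd q)) \<in> borel_measurable ((borel \<Otimes>\<^sub>M borel) \<Otimes>\<^sub>M borel)"
      by (rule measurable_compose[OF _ assms]) measurable
    then show "(\<lambda>(p, w). f (fst p) w) \<in> borel_measurable (((borel :: real measure) \<Otimes>\<^sub>M (borel :: 'c measure)) \<Otimes>\<^sub>M borel)"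
      by (simp add: case_prod_beta')
  qed (simp_all add: finite_measure_k)
  then show ?thesis by (simp add: case_prod_beta')
qed

text \<open>Measurability is proved jointly in time and state, because the recursion integrates the
  previous iterate over both.\<close>

lemma jump_iter_measurable2:
  assumes [measurable]: "f \<in> borel_measurable borel"
  shows "(\<lambda>(t, z). jump_iter k m f t z) \<in> borel_measurable (borel \<Otimes>\<^sub>M borel)"
proof (induction m)
  case (Suc m)
  note [measurable] = kernel_integral_measurable[OF Suc]
  have [measurable]: "(\<lambda>q. \<integral>\<^sup>+ w. jump_iter k m f (snd q) w \<partial>k (snd (fst q))) \<in> borel_measurable ((borel \<Otimes>\<^sub>M borel) \<Otimes>\<^sub>M lborel)"
  proof -
    have "(\<lambda>q. (\<lambda>(s, z). \<integral>\<^sup>+ w. jump_iter k m f s w \<partial>k z) (snd q, snd (fst q)))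
       \<in> borel_measurable (((borel :: real measure) \<Otimes>\<^sub>M (borel :: 'c measure)) \<Otimes>\<^sub>M lborel)"
      by (rule measurable_compose[OF _ kernel_integral_measurable[OF Suc]]) measurable
    then show ?thesis by simp
  qed
  have ind: "(\<lambda>q. indicator {0..fst (fst q)} (snd q) :: ennreal) \<in> borel_measurable (((borel :: real measure) \<Otimes>\<^sub>M (borel :: 'c measure)) \<Otimes>\<^sub>M lborel)"
  proof -
    have "(\<lambda>q. if 0 \<le> snd q \<and> snd q \<le> fst (fst q) then 1 else 0 :: ennreal) \<in> borel_measurable (((borel :: real measure) \<Otimes>\<^sub>M (borel :: 'c measure)) \<Otimes>\<^sub>M lborel)"
      by measurable
    then show ?thesis by (simp add: indicator_def of_bool_def)
  qed
  note [measurable] = ind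
  have "(\<lambda>p. \<integral>\<^sup>+ s. ennreal (exp (- rate (snd p) * (fst p - s))) * indicator {0..fst p} s * (\<integral>\<^sup>+ w. jump_iter k m f s w \<partial>k (snd p)) \<partial>lborel)
     \<in> borel_measurable (borel \<Otimes>\<^sub>M borel)"
  proof (rule lborel.borel_measurable_nn_integral)
    show "(\<lambda>(p, s). ennreal (exp (- rate (snd p) * (fst p - s))) * indicator {0..fst p} s * (\<integral>\<^sup>+ w. jump_iter k m f s w \<partial>k (snd p)))
       \<in> borel_measurable (((borel :: real measure) \<Otimes>\<^sub>M (borel :: 'c measure)) \<Otimes>\<^sub>M lborel)"
      unfolding case_prod_beta'
      by (intro borel_measurable_times_ennreal ind) measurable
  qed
  then show ?case unfolding jump_iter_Suc case_prod_beta' by (intro borel_measurable_add) measurable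
qed simp

lemma jump_iter_measurable:
  assumes "f \<in> borel_measurable borel"
  shows "jump_iter k m f t \<in> borel_measurable borel"
  using measurable_Pair2[OF jump_iter_measurable2[OF assms], of t m] by simp

lemma jump_iter_kernel_measurable:
  assumes "f \<in> borel_measurable borel"
  shows "(\<lambda>s. \<integral>\<^sup>+ w. jump_iter k m f s w \<partial>k z) \<in> borel_measurable borel"
  using measurable_Pair1[OF kernel_integral_measurable[OF jump_iter_measurable2[OF assms]], of z] by simp

lemma jump_iter_mono:
  assumes "\<And>z. f z \<le> g z" "m \<le> n"
  shows "jump_iter k m f t z \<le> jump_iter k n g t z"
  using assms(2)
proof (induction m arbitrary: n t z)
  case (Suc m)
  then obtain n' where n: "n = Suc n'" "m \<le> n'" by (metis Suc_le_D Suc_le_mono)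
  show ?case unfolding n jump_iter_Suc using assms(1) Suc.IH[OF n(2)]
    by (intro add_mono mult_left_mono nn_integral_mono) auto
qed simp

lemma incseq_jump_iter: "incseq (\<lambda>m. jump_iter k m f t z)"
  by (intro incseq_SucI jump_iter_mono) auto

lemma jump_iter_cmult:
  assumes f: "f \<in> borel_measurable borel"
  shows "jump_iter k m (\<lambda>z. c * f z) t z = c * jump_iter k m f t z"
proof (induction m arbitrary: t z)
  case (Suc m)
  show ?case unfolding jump_iter_Suc Suc
    using jump_iter_kernel_measurable[OF f] jump_iter_measurable[OF f]
    by (simp add: nn_integral_cmult measurable_k distrib_left mult.left_commute[of _ c])
qed simp

lemma jump_iter_add:
  assumes f: "f \<in> borel_measurable borel" and g: "g \<in> borel_measurable borel"
  shows "jump_iter k m (\<lambda>z. f z + g z) t z = jump_iter k m f t z + jump_iter k m g t z"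
proof (induction m arbitrary: t z)
  case (Suc m)
  let ?E = "\<lambda>s. ennreal (exp (- rate z * (t - s))) * indicator {0..t} s"
  note [measurable] = jump_iter_kernel_measurable[OF f] jump_iter_kernel_measurable[OF g]
  have 1: "(\<integral>\<^sup>+ w. jump_iter k m f s w + jump_iter k m g s w \<partial>k z) = (\<integral>\<^sup>+ w. jump_iter k m f s w \<partial>k z) + (\<integral>\<^sup>+ w. jump_iter k m g s w \<partial>k z)" for s
    by (intro nn_integral_add measurable_k jump_iter_measurable f g)
  have 2: "(\<integral>\<^sup>+ s. ?E s * ((\<integral>\<^sup>+ w. jump_iter k m f s w \<partial>k z) + (\<integral>\<^sup>+ w. jump_iter k m g s w \<partial>k z)) \<partial>lborel)
    = (\<integral>\<^sup>+ s. ?E s * (\<integral>\<^sup>+ w. jump_iter k m f s w \<partial>k z) \<partial>lborel) + (\<integral>\<^sup>+ s. ?E s * (\<integral>\<^sup>+ w. jump_iter k m g s w \<partial>k z) \<partial>lborel)"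
    unfolding distrib_left by (rule nn_integral_add) measurable
  show ?case unfolding jump_iter_Suc Suc 1 unfolding 2 unfolding distrib_left by (simp only: ac_simps)
qed simp

lemma jump_iter_SUP:
  fixes U :: "nat \<Rightarrow> 'c \<Rightarrow> ennreal"
  assumes U: "\<And>i. U i \<in> borel_measurable borel" and inc: "incseq U"
  shows "jump_iter k m (\<lambda>z. SUP i. U i z) t z = (SUP i. jump_iter k m (U i) t z)"
proof (induction m arbitrary: t z)
  case (Suc m)
  have mono: "jump_iter k m (U i) s w \<le> jump_iter k m (U j) s w" if "i \<le> j" for i j s w
    using inc that by (intro jump_iter_mono) (auto simp: incseq_def le_fun_def)
  have 1: "(\<integral>\<^sup>+ w. jump_iter k m (\<lambda>z. SUP i. U i z) s w \<partial>k z) = (SUP i. \<integral>\<^sup>+ w. jump_iter k m (U i) s w \<partial>k z)" for s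
    unfolding Suc using jump_iter_measurable[OF U] mono
    by (intro nn_integral_monotone_convergence_SUP) (auto simp: incseq_def le_fun_def measurable_k)
  have mono': "(\<integral>\<^sup>+ w. jump_iter k m (U i) s w \<partial>k z) \<le> (\<integral>\<^sup>+ w. jump_iter k m (U j) s w \<partial>k z)" if "i \<le> j" for i j s
    using mono[OF that] by (intro nn_integral_mono)
  let ?E = "\<lambda>s. ennreal (exp (- rate z * (t - s))) * indicator {0..t} s"
  have 2: "(\<integral>\<^sup>+ s. ?E s * (SUP i. \<integral>\<^sup>+ w. jump_iter k m (U i) s w \<partial>k z) \<partial>lborel)
     = (SUP i. \<integral>\<^sup>+ s. ?E s * (\<integral>\<^sup>+ w. jump_iter k m (U i) s w \<partial>k z) \<partial>lborel)"
    unfolding SUP_mult_left_ennreal using jump_iter_kernel_measurable[OF U] mono'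
    by (intro nn_integral_monotone_convergence_SUP) (auto simp: incseq_def le_fun_def intro!: mult_left_mono)
  let ?I = "\<lambda>i. \<integral>\<^sup>+ s. ?E s * (\<integral>\<^sup>+ w. jump_iter k m (U i) s w \<partial>k z) \<partial>lborel"
  have "jump_iter k (Suc m) (\<lambda>z. SUP i. U i z) t z = (SUP i. ennreal (exp (- rate z * t)) * U i z) + (SUP i. ?I i)"
    unfolding jump_iter_Suc 1 2 by (simp only: SUP_mult_left_ennreal)
  also have "\<dots> = (SUP i. ennreal (exp (- rate z * t)) * U i z + ?I i)"
  proof (rule ennreal_SUP_add[symmetric])
    show "incseq (\<lambda>i. ennreal (exp (- rate z * t)) * U i z)"
      using inc by (auto simp: incseq_def le_fun_def intro!: mult_left_mono)
    show "incseq ?I" by (intro incseq_SucI nn_integral_mono mult_left_mono mono') simp_all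
  qed
  also have "\<dots> = (SUP i. jump_iter k (Suc m) (U i) t z)" by (simp only: jump_iter_Suc)
  finally show ?case .
qed simp

lemma jump_iter_suminf:
  fixes f :: "nat \<Rightarrow> 'c \<Rightarrow> ennreal"
  assumes f: "\<And>i. f i \<in> borel_measurable borel"
  shows "jump_iter k m (\<lambda>z. \<Sum>i. f i z) t z = (\<Sum>i. jump_iter k m (f i) t z)"
proof (induction m arbitrary: t z)
  case (Suc m)
  show ?case unfolding jump_iter_Suc Suc
    using jump_iter_kernel_measurable[OF f] jump_iter_measurable[OF f]
    by (simp add: nn_integral_suminf measurable_k suminf_add[symmetric] flip: ennreal_suminf_cmult)
qed simp

text \<open>The iterates increase with the number of allowed jumps, so countable additivity survives
  the supremum. A total mass below 1 stands for infinitely many jumps before time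
  \<open>t\<close>.\<close>

definition minimal_law :: "real \<Rightarrow> 'c \<Rightarrow> 'c measure" where
  "minimal_law t z = measure_of UNIV (sets borel) (\<lambda>A. SUP m. jump_iter k m (indicator A) t z)"

lemma sets_minimal_law [simp, measurable_cong]: "sets (minimal_law t z) = sets borel"
  unfolding minimal_law_def using sets.sigma_sets_eq[of borel] by (simp add: sets_measure_of_conv)

lemma space_minimal_law [simp]: "space (minimal_law t z) = UNIV"
  by (simp add: minimal_law_def space_measure_of_conv)

lemma emeasure_minimal_law:
  assumes "A \<in> sets borel"
  shows "emeasure (minimal_law t z) A = (SUP m. jump_iter k m (indicator A) t z)"
proof (rule emeasure_measure_of[OF minimal_law_def])
  have zero: "jump_iter k m (\<lambda>_. 0) t z = 0" for m
    using jump_iter_cmult[of "\<lambda>_. 0" m 0 t z] by simp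
  show "positive (sets (minimal_law t z)) (\<lambda>A. SUP m. jump_iter k m (indicator A) t z)"
  proof -
    have "indicator {} = (\<lambda>_ :: 'c. 0 :: ennreal)" by auto
    then show ?thesis using zero by (simp add: positive_def)
  qed
  show "countably_additive (sets (minimal_law t z)) (\<lambda>A. SUP m. jump_iter k m (indicator A) t z)"
  proof (rule countably_additiveI)
    fix A :: "nat \<Rightarrow> 'c set" assume A: "range A \<subseteq> sets (minimal_law t z)" "disjoint_family A"
    have [measurable]: "A i \<in> sets borel" for i using A by auto
    have "(\<Sum>i. SUP m. jump_iter k m (indicator (A i)) t z) = (SUP m. \<Sum>i. jump_iter k m (indicator (A i)) t z)"
      by (rule ennreal_suminf_SUP_eq) (rule incseq_jump_iter)
    also have "\<dots> = (SUP m. jump_iter k m (\<lambda>w. \<Sum>i. indicator (A i) w) t z)"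
      by (subst jump_iter_suminf) auto
    also have "(\<lambda>w. \<Sum>i. indicator (A i) w :: ennreal) = indicator (\<Union> (range A))"
      using suminf_indicator[OF A(2)] by auto
    finally show "(\<Sum>i. SUP m. jump_iter k m (indicator (A i)) t z) = (SUP m. jump_iter k m (indicator (\<Union> (range A))) t z)" .
  qed
qed (use assms in auto)

lemma nn_integral_minimal_law:
  assumes "f \<in> borel_measurable borel"
  shows "(\<integral>\<^sup>+ w. f w \<partial>minimal_law t z) = (SUP m. jump_iter k m f t z)"
  using assms
proof (induction rule: borel_measurable_induct)
  case (cong f g)
  then have "f = g" by (auto simp: fun_eq_iff)
  then show ?case using cong by simp
next
  case (set A)
  then show ?case by (simp add: emeasure_minimal_law)
next
  case (mult u c)
  then show ?case by (simp add: nn_integral_cmult measurable_cong_sets[OF sets_minimal_law refl] jump_iter_cmult SUP_mult_left_ennreal)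
next
  case (add u v)
  then show ?case
    by (simp add: nn_integral_add measurable_cong_sets[OF sets_minimal_law refl] jump_iter_add ennreal_SUP_add incseq_jump_iter)
next
  case (seq U)
  have "(\<integral>\<^sup>+ w. (SUP i. U i w) \<partial>minimal_law t z) = (SUP i. \<integral>\<^sup>+ w. U i w \<partial>minimal_law t z)"
    using seq by (intro nn_integral_monotone_convergence_SUP) (auto simp: measurable_cong_sets[OF sets_minimal_law refl])
  also have "\<dots> = (SUP i. SUP m. jump_iter k m (U i) t z)" using seq by simp
  also have "\<dots> = (SUP m. SUP i. jump_iter k m (U i) t z)" by (rule SUP_commute)
  also have "\<dots> = (SUP m. jump_iter k m (\<lambda>w. SUP i. U i w) t z)" using seq by (subst jump_iter_SUP) auto
  finally show ?case by (simp add: image_comp)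
qed

section \<open>Exponential growth bound and composition in time of the iterates\<close>

lemma nn_integral_exp_rate:
  assumes "0 \<le> t" "0 \<le> S + rate z"
  shows "(\<integral>\<^sup>+ s. ennreal (exp (- rate z * (t - s)) * exp (S * s) * (S + rate z)) * indicator {0..t} s \<partial>lborel)
     = ennreal (exp (S * t) - exp (- rate z * t))"
proof -
  have "(\<integral>\<^sup>+ s. ennreal (exp (- rate z * (t - s)) * exp (S * s) * (S + rate z)) * indicator {0..t} s \<partial>lborel)
     = ennreal (exp (- rate z * (t - t)) * exp (S * t) - exp (- rate z * (t - 0)) * exp (S * 0))"
  proof (rule nn_integral_FTC_Icc)
    show "((\<lambda>s. exp (- rate z * (t - s)) * exp (S * s)) has_real_derivative exp (- rate z * (t - s)) * exp (S * s) * (S + rate z)) (at s)" for s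
      by (rule derivative_eq_intros refl)+ (simp add: algebra_simps)
  qed (use assms in auto)
  then show ?thesis by simp
qed

text \<open>\<open>exp (S * t) * d z\<close> is a supersolution of the recursion: inserted under the
  integral, the drift bound produces the derivative of
  \<open>exp (- rate z * (t - s)) * exp (S * s)\<close>, which integrates to the missing difference
  of exponentials. \<open>S\<close> may be negative; where \<open>d\<close> vanishes, the drift
  bound makes the jump term 0 whatever the sign of \<open>S + rate z\<close>.\<close>

lemma jump_iter_le_exp:
  assumes d: "d \<in> borel_measurable borel" and S: "\<And>z. d z = 0 \<or> 0 \<le> S + rate z"
    and drift: "\<And>z. (\<integral>\<^sup>+ w. d w \<partial>k z) \<le> ennreal (S + rate z) * d z"
    and "0 \<le> t"
  shows "jump_iter k m d t z \<le> ennreal (exp (S * t)) * d z"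
  using \<open>0 \<le> t\<close>
proof (induction m arbitrary: t z)
  case (Suc m)
  have "jump_iter k (Suc m) d t z \<le> ennreal (exp (- rate z * t)) * d z +
     (\<integral>\<^sup>+ s. ennreal (exp (- rate z * (t - s)) * exp (S * s) * (S + rate z)) * indicator {0..t} s * d z \<partial>lborel)"
    unfolding jump_iter_Suc
  proof (intro add_left_mono nn_integral_mono)
    fix s
    show "ennreal (exp (- rate z * (t - s))) * indicator {0..t} s * (\<integral>\<^sup>+ w. jump_iter k m d s w \<partial>k z)
       \<le> ennreal (exp (- rate z * (t - s)) * exp (S * s) * (S + rate z)) * indicator {0..t} s * d z"
    proof (cases "s \<in> {0..t}")
      case True
      have "(\<integral>\<^sup>+ w. jump_iter k m d s w \<partial>k z) \<le> (\<integral>\<^sup>+ w. ennreal (exp (S * s)) * d w \<partial>k z)"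
        using True by (intro nn_integral_mono Suc.IH) auto
      also have "\<dots> = ennreal (exp (S * s)) * (\<integral>\<^sup>+ w. d w \<partial>k z)" using d by (simp add: nn_integral_cmult measurable_k)
      also have "\<dots> \<le> ennreal (exp (S * s)) * (ennreal (S + rate z) * d z)" by (intro mult_left_mono drift) simp
      finally have "ennreal (exp (- rate z * (t - s))) * (\<integral>\<^sup>+ w. jump_iter k m d s w \<partial>k z)
         \<le> ennreal (exp (- rate z * (t - s))) * (ennreal (exp (S * s)) * (ennreal (S + rate z) * d z))" by (intro mult_left_mono) simp_all
      then show ?thesis using True by (simp add: ennreal_mult' mult.assoc)
    qed simp
  qed
  also have "\<dots> \<le> ennreal (exp (S * t)) * d z"
  proof (cases "d z = 0")
    case False
    then have S: "0 \<le> S + rate z" using S[of z] by simp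
    have "exp (- rate z * t) \<le> exp (S * t)" using S Suc.prems mult_right_mono[of "- rate z" S t] by simp
    then have "ennreal (exp (- rate z * t)) * d z + ennreal (exp (S * t) - exp (- rate z * t)) * d z = ennreal (exp (S * t)) * d z"
      by (simp flip: distrib_right ennreal_plus)
    moreover have "(\<integral>\<^sup>+ s. ennreal (exp (- rate z * (t - s)) * exp (S * s) * (S + rate z)) * indicator {0..t} s * d z \<partial>lborel)
       = ennreal (exp (S * t) - exp (- rate z * t)) * d z"
      unfolding nn_integral_exp_rate[OF Suc.prems S, symmetric] by (rule nn_integral_multc) measurable
    ultimately show ?thesis by simp
  qed simp
  finally show ?case .
qed simp

text \<open>Fewer than \<open>m\<close> jumps before time \<open>h\<close> and fewer than
  \<open>l\<close> during the following time \<open>t\<close> make fewer than \<open>m + l\<close>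
  in total. The induction conditions on the first jump.\<close>

lemma jump_iter_add_time:
  assumes f: "f \<in> borel_measurable borel" and t: "0 \<le> t" and "0 \<le> h"
  shows "jump_iter k m (jump_iter k l f t) h z \<le> jump_iter k (m + l) f (t + h) z"
  using \<open>0 \<le> h\<close>
proof (induction m arbitrary: h z)
  case (Suc m)
  show ?case
  proof (cases l)
    case 0
    have "jump_iter k (Suc m) (\<lambda>_. 0) h z = 0"
      using jump_iter_cmult[of "\<lambda>_. 0" "Suc m" 0 h z] by simp
    then show ?thesis by (simp add: 0)
  next
    case l: (Suc l')
    let ?r = "rate z"
    \<comment> \<open>\<open>s\<close> is the time left after the first jump. A jump within
      \<open>h\<close> leaves \<open>s\<close> in \<open>{t..t + h}\<close>, a later one in
      \<open>{0..t}\<close>; the two pieces share their integrand and overlap in one null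
      point.\<close>
    define G where "G s = (\<integral>\<^sup>+ w. jump_iter k (m + l) f s w \<partial>k z)" for s
    have [measurable]: "G \<in> borel_measurable borel" unfolding G_def by (rule jump_iter_kernel_measurable[OF f])
    let ?g = "\<lambda>s. ennreal (exp (- ?r * (t + h - s))) * G s"
    have A: "(\<integral>\<^sup>+ s. ennreal (exp (- ?r * (t - s))) * indicator {0..t} s * (\<integral>\<^sup>+ w. jump_iter k l' f s w \<partial>k z) \<partial>lborel)
       \<le> (\<integral>\<^sup>+ s. ennreal (exp (- ?r * (t - s))) * indicator {0..t} s * G s \<partial>lborel)"
      unfolding G_def by (intro nn_integral_mono mult_left_mono jump_iter_mono) (auto simp: l)
    have B: "(\<integral>\<^sup>+ s. ennreal (exp (- ?r * (h - s))) * indicator {0..h} s * (\<integral>\<^sup>+ w. jump_iter k m (jump_iter k l f t) s w \<partial>k z) \<partial>lborel)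
       \<le> (\<integral>\<^sup>+ s. ennreal (exp (- ?r * (h - s))) * indicator {0..h} s * G (t + s) \<partial>lborel)"
    proof (intro nn_integral_mono)
      fix s
      show "ennreal (exp (- ?r * (h - s))) * indicator {0..h} s * (\<integral>\<^sup>+ w. jump_iter k m (jump_iter k l f t) s w \<partial>k z)
         \<le> ennreal (exp (- ?r * (h - s))) * indicator {0..h} s * G (t + s)"
        unfolding G_def using Suc.IH[of s] by (cases "s \<in> {0..h}") (auto intro!: mult_left_mono nn_integral_mono)
    qed
    have L: "jump_iter k l f t z = ennreal (exp (- ?r * t)) * f z +
        (\<integral>\<^sup>+ s. ennreal (exp (- ?r * (t - s))) * indicator {0..t} s * (\<integral>\<^sup>+ w. jump_iter k l' f s w \<partial>k z) \<partial>lborel)"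
      unfolding l by (rule jump_iter_Suc)
    have "jump_iter k (Suc m) (jump_iter k l f t) h z = ennreal (exp (- ?r * h)) * jump_iter k l f t z +
        (\<integral>\<^sup>+ s. ennreal (exp (- ?r * (h - s))) * indicator {0..h} s * (\<integral>\<^sup>+ w. jump_iter k m (jump_iter k l f t) s w \<partial>k z) \<partial>lborel)"
      by (rule jump_iter_Suc)
    also have "\<dots> \<le>
       ennreal (exp (- ?r * h)) * (ennreal (exp (- ?r * t)) * f z + (\<integral>\<^sup>+ s. ennreal (exp (- ?r * (t - s))) * indicator {0..t} s * G s \<partial>lborel))
       + (\<integral>\<^sup>+ s. ennreal (exp (- ?r * (h - s))) * indicator {0..h} s * G (t + s) \<partial>lborel)"
      unfolding L by (rule add_mono[OF mult_left_mono[OF add_left_mono[OF A]] B]) simp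
    also have "(\<integral>\<^sup>+ s. ennreal (exp (- ?r * (h - s))) * indicator {0..h} s * G (t + s) \<partial>lborel) = (\<integral>\<^sup>+ s. ?g s * indicator {t..t + h} s \<partial>lborel)"
      by (subst (2) nn_integral_real_affine[where c=1 and t=t])
        (auto intro!: nn_integral_cong split: split_indicator simp: algebra_simps)
    also have "ennreal (exp (- ?r * h)) * (ennreal (exp (- ?r * t)) * f z + (\<integral>\<^sup>+ s. ennreal (exp (- ?r * (t - s))) * indicator {0..t} s * G s \<partial>lborel))
       = ennreal (exp (- ?r * (t + h))) * f z + (\<integral>\<^sup>+ s. ?g s * indicator {0..t} s \<partial>lborel)"
    proof -
      have e: "ennreal (exp (- ?r * h)) * ennreal (exp (- ?r * u)) = ennreal (exp (- ?r * (u + h)))" for u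
        unfolding ennreal_mult[OF exp_ge_zero exp_ge_zero, symmetric] mult_exp_exp by (simp add: distrib_left add.commute)
      have "ennreal (exp (- ?r * h)) * (\<integral>\<^sup>+ s. ennreal (exp (- ?r * (t - s))) * indicator {0..t} s * G s \<partial>lborel)
        = (\<integral>\<^sup>+ s. ennreal (exp (- ?r * h)) * (ennreal (exp (- ?r * (t - s))) * indicator {0..t} s * G s) \<partial>lborel)"
        by (rule nn_integral_cmult[symmetric]) measurable
      also have "\<dots> = (\<integral>\<^sup>+ s. ?g s * indicator {0..t} s \<partial>lborel)"
      proof (intro nn_integral_cong)
        fix s
        have "t - s + h = t + h - s" by simp
        then show "ennreal (exp (- ?r * h)) * (ennreal (exp (- ?r * (t - s))) * indicator {0..t} s * G s) = ?g s * indicator {0..t} s"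
          using e[of "t - s"] by (simp only: mult.assoc[symmetric]) (simp only: mult_ac)
      qed
      finally show ?thesis by (simp only: distrib_left mult.assoc[symmetric] e)
    qed
    also have "ennreal (exp (- ?r * (t + h))) * f z + (\<integral>\<^sup>+ s. ?g s * indicator {0..t} s \<partial>lborel) + (\<integral>\<^sup>+ s. ?g s * indicator {t..t + h} s \<partial>lborel)
       = ennreal (exp (- ?r * (t + h))) * f z + (\<integral>\<^sup>+ s. ?g s * indicator {0..t} s + ?g s * indicator {t..t + h} s \<partial>lborel)"
      by (subst nn_integral_add) (auto simp: add.assoc)
    also have "(\<integral>\<^sup>+ s. ?g s * indicator {0..t} s + ?g s * indicator {t..t + h} s \<partial>lborel) = (\<integral>\<^sup>+ s. ennreal (exp (- ?r * (t + h - s))) * indicator {0..t + h} s * G s \<partial>lborel)"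
    proof (rule nn_integral_cong_AE)
      show "AE s in lborel. ?g s * indicator {0..t} s + ?g s * indicator {t..t + h} s = ennreal (exp (- ?r * (t + h - s))) * indicator {0..t + h} s * G s"
        using AE_lborel_singleton[of t] by eventually_elim (use t Suc.prems in \<open>auto split: split_indicator\<close>)
    qed
    also have "ennreal (exp (- ?r * (t + h))) * f z + \<dots> = jump_iter k (Suc m + l) f (t + h) z"
      by (simp only: add_Suc jump_iter_Suc G_def)
    finally show ?thesis .
  qed
qed simp

end

section \<open>Non-explosion of the coupled process\<close>

context jump_process
begin

text \<open>The Markov property is given for events; induction over measurable functions extends it
  to integrands.\<close>

lemma nn_integral_Markov:
  assumes D: "D \<in> past_events (P x) X s" and s: "0 \<le> s" and t: "0 \<le> t" and f: "f \<in> borel_measurable borel"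
  shows "(\<integral>\<^sup>+ \<omega>. f (X (s + t) \<omega>) * indicator D \<omega> \<partial>P x) = (\<integral>\<^sup>+ \<omega>. (\<integral>\<^sup>+ u. f u \<partial>law t (X s \<omega>)) * indicator D \<omega> \<partial>P x)"
proof -
  note [measurable] = X_measurable[OF s] X_measurable[of "s + t"] law_measurable[OF t]
  have st: "0 \<le> s + t" using s t by simp
  have "past_events (P x) X s \<subseteq> sets (P x)"
    unfolding past_events_def
    by (rule sets.sigma_sets_subset) (auto intro: measurable_sets[OF X_measurable])
  then have [measurable]: "D \<in> sets (P x)" using D by blast
  have law_m: "(\<lambda>u. \<integral>\<^sup>+ v. g v \<partial>law t u) \<in> borel_measurable borel" if "g \<in> borel_measurable borel" for g :: "'b \<Rightarrow> ennreal"
    using measurable_compose[OF law_measurable[OF t] nn_integral_measurable_subprob_algebra[OF that]] .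
  have law_X: "(\<lambda>\<omega>. \<integral>\<^sup>+ v. g v \<partial>law t (X s \<omega>)) \<in> borel_measurable (P x)" if "g \<in> borel_measurable borel" for g :: "'b \<Rightarrow> ennreal"
    using measurable_compose[OF X_measurable[OF s] law_m[OF that]] .
  have X_m: "(\<lambda>\<omega>. g (X (s + t) \<omega>)) \<in> borel_measurable (P x)" if "g \<in> borel_measurable borel" for g :: "'b \<Rightarrow> ennreal"
    using measurable_compose[OF X_measurable[OF st] that] .
  have lm: "g \<in> borel_measurable (law t u)" if "g \<in> borel_measurable borel" for g :: "'b \<Rightarrow> ennreal" and u
    using that by (simp add: measurable_cong_sets[OF sets_law refl])
  show ?thesis using f
  proof (induction rule: borel_measurable_induct)
    case (cong f g)
    then have "f = g" by (auto simp: fun_eq_iff)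
    then show ?case using cong by simp
  next
    case (set A)
    then have A: "A \<in> sets borel" by simp
    have "(\<integral>\<^sup>+ \<omega>. indicator A (X (s + t) \<omega>) * indicator D \<omega> \<partial>P x) = (\<integral>\<^sup>+ \<omega>. indicator (D \<inter> X (s + t) -` A) \<omega> \<partial>P x)"
      by (intro nn_integral_cong) (auto split: split_indicator)
    also have "\<dots> = emeasure (P x) (D \<inter> X (s + t) -` A)"
    proof (rule nn_integral_indicator)
      have "D \<inter> X (s + t) -` A = D \<inter> (X (s + t) -` A \<inter> space (P x))" using sets.sets_into_space[of D "P x"] by auto
      then show "D \<inter> X (s + t) -` A \<in> sets (P x)" using measurable_sets[OF X_measurable[OF st] A] by simp
    qed
    also have "\<dots> = (\<integral>\<^sup>+ \<omega>\<in>D. emeasure (law t (X s \<omega>)) A \<partial>P x)"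
      using process D s t A by (simp add: pure_jump_Markov_process_def)
    finally show ?case using A by simp
  next
    case (mult u c)
    then have u: "u \<in> borel_measurable borel" by simp
    have "(\<integral>\<^sup>+ \<omega>. c * u (X (s + t) \<omega>) * indicator D \<omega> \<partial>P x) = c * (\<integral>\<^sup>+ \<omega>. u (X (s + t) \<omega>) * indicator D \<omega> \<partial>P x)"
      unfolding mult.assoc using X_m[OF u] by (intro nn_integral_cmult borel_measurable_times_ennreal) auto
    also have "\<dots> = c * (\<integral>\<^sup>+ \<omega>. (\<integral>\<^sup>+ v. u v \<partial>law t (X s \<omega>)) * indicator D \<omega> \<partial>P x)" by (simp only: mult.IH)
    also have "\<dots> = (\<integral>\<^sup>+ \<omega>. c * ((\<integral>\<^sup>+ v. u v \<partial>law t (X s \<omega>)) * indicator D \<omega>) \<partial>P x)"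
      using law_X[OF u] by (intro nn_integral_cmult[symmetric] borel_measurable_times_ennreal) auto
    also have "\<dots> = (\<integral>\<^sup>+ \<omega>. (\<integral>\<^sup>+ v. c * u v \<partial>law t (X s \<omega>)) * indicator D \<omega> \<partial>P x)"
      by (intro nn_integral_cong) (simp only: nn_integral_cmult[OF lm[OF u]] mult.assoc)
    finally show ?case .
  next
    case (add u v)
    then have u: "u \<in> borel_measurable borel" and v: "v \<in> borel_measurable borel" by simp_all
    have "(\<integral>\<^sup>+ \<omega>. (v (X (s + t) \<omega>) + u (X (s + t) \<omega>)) * indicator D \<omega> \<partial>P x) =
        (\<integral>\<^sup>+ \<omega>. v (X (s + t) \<omega>) * indicator D \<omega> \<partial>P x) + (\<integral>\<^sup>+ \<omega>. u (X (s + t) \<omega>) * indicator D \<omega> \<partial>P x)"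
      unfolding distrib_right using X_m[OF u] X_m[OF v] by (intro nn_integral_add borel_measurable_times_ennreal) auto
    also have "\<dots> = (\<integral>\<^sup>+ \<omega>. (\<integral>\<^sup>+ w. v w \<partial>law t (X s \<omega>)) * indicator D \<omega> \<partial>P x) + (\<integral>\<^sup>+ \<omega>. (\<integral>\<^sup>+ w. u w \<partial>law t (X s \<omega>)) * indicator D \<omega> \<partial>P x)"
      by (simp only: add.IH)
    also have "\<dots> = (\<integral>\<^sup>+ \<omega>. (\<integral>\<^sup>+ w. v w \<partial>law t (X s \<omega>)) * indicator D \<omega> + (\<integral>\<^sup>+ w. u w \<partial>law t (X s \<omega>)) * indicator D \<omega> \<partial>P x)"
      using law_X[OF u] law_X[OF v] by (intro nn_integral_add[symmetric] borel_measurable_times_ennreal) auto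
    also have "\<dots> = (\<integral>\<^sup>+ \<omega>. (\<integral>\<^sup>+ w. v w + u w \<partial>law t (X s \<omega>)) * indicator D \<omega> \<partial>P x)"
      by (intro nn_integral_cong) (simp only: nn_integral_add[OF lm[OF v] lm[OF u]] distrib_right)
    finally show ?case .
  next
    case (seq U)
    have "(\<integral>\<^sup>+ \<omega>. (SUP i. U i (X (s + t) \<omega>)) * indicator D \<omega> \<partial>P x) = (SUP i. \<integral>\<^sup>+ \<omega>. U i (X (s + t) \<omega>) * indicator D \<omega> \<partial>P x)"
      unfolding SUP_mult_right_ennreal using seq(1,3) X_m
      by (intro nn_integral_monotone_convergence_SUP) (auto simp: incseq_def le_fun_def intro!: mult_right_mono)
    also have "\<dots> = (SUP i. \<integral>\<^sup>+ \<omega>. (\<integral>\<^sup>+ u. U i u \<partial>law t (X s \<omega>)) * indicator D \<omega> \<partial>P x)" by (simp only: seq.IH)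
    also have "\<dots> = (\<integral>\<^sup>+ \<omega>. (SUP i. \<integral>\<^sup>+ u. U i u \<partial>law t (X s \<omega>)) * indicator D \<omega> \<partial>P x)"
      unfolding SUP_mult_right_ennreal using seq(1,3) law_X
      by (intro nn_integral_monotone_convergence_SUP[symmetric]) (auto simp: incseq_def le_fun_def intro!: mult_right_mono nn_integral_mono)
    also have "\<dots> = (\<integral>\<^sup>+ \<omega>. (\<integral>\<^sup>+ u. (SUP i. U i u) \<partial>law t (X s \<omega>)) * indicator D \<omega> \<partial>P x)"
    proof -
      have "(\<integral>\<^sup>+ u. (SUP i. U i u) \<partial>law t y) = (SUP i. \<integral>\<^sup>+ u. U i u \<partial>law t y)" for y
        by (rule nn_integral_monotone_convergence_SUP[OF seq(3) lm[OF seq(1)]])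
      then show ?thesis by (simp only:)
    qed
    finally show ?case by (simp add: image_comp)
  qed
qed

text \<open>The transition operator killed outside \<open>A\<close>: the present state is tested,
  then a step of length \<open>h\<close> is made.\<close>

definition stay_op :: "'b set \<Rightarrow> real \<Rightarrow> ('b \<Rightarrow> ennreal) \<Rightarrow> 'b \<Rightarrow> ennreal" where
  "stay_op A h f x = indicator A x * (\<integral>\<^sup>+ u. f u \<partial>law h x)"

lemma stay_op_measurable:
  assumes "0 \<le> h" "A \<in> sets borel" "f \<in> borel_measurable borel"
  shows "stay_op A h f \<in> borel_measurable borel"
proof -
  have "(\<lambda>x. \<integral>\<^sup>+ u. f u \<partial>law h x) \<in> borel_measurable borel"
    using measurable_compose[OF law_measurable[OF assms(1)] nn_integral_measurable_subprob_algebra[OF assms(3)]] .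
  then show ?thesis unfolding stay_op_def using assms(2) by (intro borel_measurable_times_ennreal) auto
qed

text \<open>Powers of the killed operator account for the paths that meet \<open>A\<close> at the
  times \<open>0, h, ..., (i - 1) * h\<close>. Time \<open>i * h\<close> is left untested; the
  induction tests it by putting \<open>stay_op A h f\<close> in place of \<open>f\<close>.\<close>

lemma stay_op_iter:
  assumes h: "0 \<le> h" and A: "A \<in> sets borel" and f: "f \<in> borel_measurable borel"
  shows "(\<integral>\<^sup>+ \<omega>. f (X (real i * h) \<omega>) * indicator {\<omega>\<in>space (P x). \<forall>j<i. X (real j * h) \<omega> \<in> A} \<omega> \<partial>P x) = ((stay_op A h) ^^ i) f x"
  using f
proof (induction i arbitrary: f)
  case 0
  have "(\<integral>\<^sup>+ \<omega>. f (X 0 \<omega>) * indicator (space (P x)) \<omega> \<partial>P x) = (\<integral>\<^sup>+ \<omega>. f (X 0 \<omega>) \<partial>P x)"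
    by (intro nn_integral_cong) simp
  also have "\<dots> = f x" using nn_integral_law[of 0 f x] 0 by (simp add: law_zero nn_integral_return)
  finally show ?case by simp
next
  case (Suc i)
  let ?D = "\<lambda>i. {\<omega>\<in>space (P x). \<forall>j<i. X (real j * h) \<omega> \<in> A}"
  \<comment> \<open>The tests use times up to \<open>real i * h\<close>, so the event belongs to the
    past at that time.\<close>
  have D: "?D (Suc i) \<in> past_events (P x) X (real i * h)"
  proof -
    interpret S: sigma_algebra "space (P x)" "past_events (P x) X (real i * h)"
      unfolding past_events_def by (rule sigma_algebra_sigma_sets) auto
    have "?D n \<in> past_events (P x) X (real i * h)" if "n \<le> Suc i" for n
      using that
    proof (induction n)
      case 0
      show ?case unfolding past_events_def by (simp add: sigma_sets_top)
    next
      case (Suc n)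
      have "X (real n * h) -` A \<inter> space (P x) \<in> past_events (P x) X (real i * h)"
        unfolding past_events_def using Suc.prems h A 
        by (intro sigma_sets.Basic CollectI exI[of _ "real n * h"] exI[of _ A] conjI refl) (auto intro: mult_right_mono)
      moreover have "?D n \<in> past_events (P x) X (real i * h)" using Suc by simp
      ultimately have "(X (real n * h) -` A \<inter> space (P x)) \<inter> ?D n \<in> past_events (P x) X (real i * h)"
        by (rule S.Int)
      moreover have "(X (real n * h) -` A \<inter> space (P x)) \<inter> ?D n = ?D (Suc n)" by (auto simp: less_Suc_eq)
      ultimately show ?case by simp
    qed
    then show ?thesis by simp
  qed
  have "(\<integral>\<^sup>+ \<omega>. f (X (real (Suc i) * h) \<omega>) * indicator (?D (Suc i)) \<omega> \<partial>P x) =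
      (\<integral>\<^sup>+ \<omega>. f (X (real i * h + h) \<omega>) * indicator (?D (Suc i)) \<omega> \<partial>P x)"
    by (simp add: distrib_right add.commute)
  also have "\<dots> = (\<integral>\<^sup>+ \<omega>. (\<integral>\<^sup>+ u. f u \<partial>law h (X (real i * h) \<omega>)) * indicator (?D (Suc i)) \<omega> \<partial>P x)"
    using h by (intro nn_integral_Markov[OF D _ h Suc.prems]) simp
  also have "\<dots> = (\<integral>\<^sup>+ \<omega>. stay_op A h f (X (real i * h) \<omega>) * indicator (?D i) \<omega> \<partial>P x)"
    by (intro nn_integral_cong) (auto simp: stay_op_def less_Suc_eq split: split_indicator)
  also have "\<dots> = ((stay_op A h) ^^ i) (stay_op A h f) x" by (rule Suc.IH[OF stay_op_measurable[OF h A Suc.prems]])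
  finally show ?case by (simp only: funpow_Suc_right comp_apply)
qed

text \<open>A step path visits finitely many points up to time \<open>t\<close>, hence stays in one of the sets of an
  increasing exhaustion.\<close>

lemma stay_probability_tendsto:
  assumes A: "\<And>n. A n \<in> sets borel" "incseq A" "(\<Union>n. A n) = UNIV" and t: "0 \<le> t"
  shows "(\<lambda>n. emeasure (P x) {\<omega>\<in>space (P x). \<forall>q\<in>{0..1}. X (t * of_rat q) \<omega> \<in> A n}) \<longlonglongrightarrow> 1"
proof -
  interpret prob_space "P x" by (rule prob_space_P)
  \<comment> \<open>Rational fractions of \<open>t\<close> keep the event measurable and contain
    every grid \<open>t * j / M\<close>, whatever \<open>M\<close> is chosen later.\<close>
  let ?E = "\<lambda>n. {\<omega>\<in>space (P x). \<forall>q\<in>{0..1}. X (t * of_rat q) \<omega> \<in> A n}"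
  have E[measurable]: "?E n \<in> sets (P x)" for n
  proof -
    have "Measurable.pred (P x) (\<lambda>\<omega>. X (t * of_rat q) \<omega> \<in> A n)" if "q \<in> {0..1}" for q
    proof -
      have "X (t * of_rat q) \<in> P x \<rightarrow>\<^sub>M borel" using that t by (intro X_measurable) auto
      then show ?thesis using A(1)[of n] by measurable
    qed
    then have "Measurable.pred (P x) (\<lambda>\<omega>. \<forall>q\<in>{0..1}. X (t * of_rat q) \<omega> \<in> A n)"
      by (rule pred_intros_countable_bounded)
    then show ?thesis by (simp add: pred_def)
  qed
  have "(\<lambda>n. emeasure (P x) (?E n)) \<longlonglongrightarrow> emeasure (P x) (\<Union>n. ?E n)"
  proof (rule Lim_emeasure_incseq)
    show "incseq ?E" using A(2) by (fastforce simp: incseq_def)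
  qed (use E in auto)
  moreover have "emeasure (P x) (\<Union>n. ?E n) = 1"
  proof (rule emeasure_eq_1_AE)
    have "AE \<omega> in P x. X 0 \<omega> = x \<and> step_path (\<lambda>t. X t \<omega>)"
      using process by (simp add: pure_jump_Markov_process_def)
    then show "AE \<omega> in P x. \<omega> \<in> (\<Union>n. ?E n)"
    proof (rule AE_mp, intro AE_I2 impI)
      fix \<omega> assume \<omega>: "\<omega> \<in> space (P x)" and "X 0 \<omega> = x \<and> step_path (\<lambda>t. X t \<omega>)"
      then obtain T :: "nat \<Rightarrow> real" where T: "T 0 = 0" "strict_mono T" "filterlim T at_top sequentially"
        "\<And>k s. s \<in> {T k..<T (Suc k)} \<Longrightarrow> X s \<omega> = X (T k) \<omega>"
        unfolding step_path_def by blast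
      obtain K where K: "T K > t"
        using T(3) unfolding filterlim_at_top_dense by (meson eventually_sequentially order_refl)
      have "\<exists>n. X (T k) \<omega> \<in> A n" for k using A(3) by (metis UNIV_I UN_E)
      then obtain n where n: "\<And>k. X (T k) \<omega> \<in> A (n k)" by metis
      define N where "N = Max (n ` {..K})"
      have N: "X (T k) \<omega> \<in> A N" if "k \<le> K" for k
      proof -
        have "n k \<le> N" unfolding N_def using that by (intro Max_ge) auto
        then show ?thesis using n[of k] A(2) by (auto simp: incseq_def)
      qed
      have "X s \<omega> \<in> A N" if s: "0 \<le> s" "s \<le> t" for s
      proof -
        define k where "k = (LEAST k. s < T (Suc k))"
        have ex: "\<exists>k. s < T (Suc k)"
          using K s strict_monoD[OF T(2), of K "Suc K"] by (intro exI[of _ K]) auto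
        have k: "s < T (Suc k)" unfolding k_def by (rule LeastI_ex[OF ex])
        have "T k \<le> s"
        proof (cases k)
          case 0
          then show ?thesis using T(1) s by simp
        next
          case (Suc k')
          then have "\<not> s < T (Suc k')" unfolding k_def by (intro not_less_Least) auto
          then show ?thesis using Suc by simp
        qed
        moreover have "k \<le> K"
        proof (rule ccontr)
          assume "\<not> k \<le> K"
          then have "T K < T k" using strict_monoD[OF T(2), of K k] by simp
          then show False using \<open>T k \<le> s\<close> K s by simp
        qed
        ultimately show ?thesis using T(4)[of s k] k N by simp
      qed
      then have "\<omega> \<in> ?E N" using \<omega> t by (auto simp: mult_left_le)
      then show "\<omega> \<in> (\<Union>n. ?E n)" by blast
    qed
  qed (use E in auto)
  ultimately show ?thesis by simp
qed

end

text \<open>The generator \<open>L\<close> belongs to the single kernel \<open>\<kappa>\<close> and,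
  through both marginals, to \<open>k\<close>. The bound on the rates lets the activity of the pair
  be charged to its coordinates.\<close>

locale coupled_jump_process = jump_process \<kappa> L P X
  for \<kappa> :: "'b::polish_space \<Rightarrow> 'b measure" and L :: "('b \<Rightarrow> real) \<Rightarrow> 'b \<Rightarrow> real"
    and P :: "'b \<Rightarrow> 'w measure" and X :: "real \<Rightarrow> 'w \<Rightarrow> 'b" +
  fixes k :: "'b \<times> 'b \<Rightarrow> ('b \<times> 'b) measure"
  assumes coupling: "coupling_kernel L k"
    and rate_le: "\<And>x y. measure (k (x, y)) UNIV \<le> measure (\<kappa> x) UNIV + measure (\<kappa> y) UNIV"
begin

sublocale jump_kernel k
  using coupling by unfold_locales (simp add: coupling_kernel_def)

sublocale single: jump_kernel \<kappa>
  by unfold_locales (rule kernel)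

lemma jump_operator_marginal:
  "\<forall>g z. bounded_measurable g \<longrightarrow> jump_operator k (\<lambda>w. g (fst w)) z = L g (fst z)"
  "\<forall>g z. bounded_measurable g \<longrightarrow> jump_operator k (\<lambda>w. g (snd w)) z = L g (snd z)"
  using coupling by (simp_all add: coupling_kernel_def case_prod_beta')

text \<open>By the backward equation with the rate of \<open>k\<close>, the transition function of
  the marginal is a fixed point of the same recursion; iterating from 0 stays below it.\<close>

lemma jump_iter_marginal:
  assumes pr: "pr \<in> borel \<rightarrow>\<^sub>M borel"
    and marginal: "\<forall>g z. bounded_measurable g \<longrightarrow> jump_operator k (\<lambda>w. g (pr w)) z = L g (pr z)"
    and g: "unit_function g" and t: "0 \<le> t"
  shows "jump_iter k m (\<lambda>w. ennreal (g (pr w))) t z \<le> ennreal (markov_op t g (pr z))"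
  using t
proof (induction m arbitrary: t z)
  case (Suc m)
  show ?case
    unfolding jump_iter_Suc backward_equation[OF k pr marginal Suc.prems g] rate_def
  proof (intro add_left_mono nn_integral_mono)
    fix s
    show "ennreal (exp (- measure (k z) UNIV * (t - s))) * indicator {0..t} s * (\<integral>\<^sup>+ w. jump_iter k m (\<lambda>w. ennreal (g (pr w))) s w \<partial>k z)
      \<le> ennreal (exp (- measure (k z) UNIV * (t - s))) * indicator {0..t} s * (\<integral>\<^sup>+ w. ennreal (markov_op s g (pr w)) \<partial>k z)"
      using Suc.IH[of s] by (cases "s \<in> {0..t}") (auto intro!: mult_left_mono nn_integral_mono)
  qed
qed simp

lemma nn_integral_minimal_law_marginal:
  assumes pr: "pr \<in> borel \<rightarrow>\<^sub>M borel"
    and marginal: "\<forall>g z. bounded_measurable g \<longrightarrow> jump_operator k (\<lambda>w. g (pr w)) z = L g (pr z)"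
    and f: "f \<in> borel_measurable borel" "\<And>u. f u \<le> 1" and t: "0 \<le> t"
  shows "(\<integral>\<^sup>+ w. f (pr w) \<partial>minimal_law t z) \<le> (\<integral>\<^sup>+ u. f u \<partial>law t (pr z))"
proof -
  define g where "g u = enn2real (f u)" for u
  have fg: "f u = ennreal (g u)" for u
    using le_less_trans[OF f(2)[of u] ennreal_one_less_top] by (simp add: g_def)
  have g: "unit_function g" unfolding unit_function_def
  proof (intro conjI allI)
    show "g \<in> borel_measurable borel" unfolding g_def using f(1) by (rule borel_measurable_enn2real)
  qed (use f(2) in \<open>auto simp: g_def enn2real_leI\<close>)
  have m: "(\<lambda>w. f (pr w)) \<in> borel_measurable borel" using measurable_compose[OF pr f(1)] .
  have "(\<integral>\<^sup>+ w. f (pr w) \<partial>minimal_law t z) = (SUP m. jump_iter k m (\<lambda>w. ennreal (g (pr w))) t z)"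
    using nn_integral_minimal_law[OF m] by (simp add: fg)
  also have "\<dots> \<le> ennreal (markov_op t g (pr z))"
    by (intro SUP_least jump_iter_marginal pr marginal g t)
  also have "\<dots> = (\<integral>\<^sup>+ u. f u \<partial>law t (pr z))" by (simp add: ennreal_markov_op[OF t g] fg)
  finally show ?thesis .
qed

lemma fst_measurable: "(fst :: 'b \<times> 'b \<Rightarrow> 'b) \<in> borel \<rightarrow>\<^sub>M borel"
  and snd_measurable: "(snd :: 'b \<times> 'b \<Rightarrow> 'b) \<in> borel \<rightarrow>\<^sub>M borel"
  unfolding borel_prod[symmetric] by simp_all

lemmas minimal_law_fst = nn_integral_minimal_law_marginal[OF fst_measurable jump_operator_marginal(1)]
  and minimal_law_snd = nn_integral_minimal_law_marginal[OF snd_measurable jump_operator_marginal(2)]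

definition mass :: "real \<Rightarrow> 'b \<times> 'b \<Rightarrow> ennreal" where
  "mass t z = emeasure (minimal_law t z) UNIV"

lemma mass_eq: "mass t z = (SUP m. jump_iter k m (\<lambda>_. 1) t z)"
  using nn_integral_minimal_law[of "\<lambda>_. 1" t z] by (simp add: mass_def)

lemma mass_le_1: "0 \<le> t \<Longrightarrow> mass t z \<le> 1"
  using minimal_law_fst[of "\<lambda>_. 1" t z] prob_space.emeasure_space_1[OF prob_space_law, of t "fst z"] by (simp add: mass_def)

lemma mass_measurable: "mass t \<in> borel_measurable borel"
  unfolding mass_eq[abs_def] by (intro borel_measurable_SUP jump_iter_measurable) auto

lemma mass_add:
  assumes t: "0 \<le> t" and h: "0 \<le> h"
  shows "(\<integral>\<^sup>+ w. mass t w \<partial>minimal_law h z) \<le> mass (t + h) z"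
proof -
  have m: "jump_iter k l (\<lambda>_. 1) t \<in> borel_measurable borel" for l by (rule jump_iter_measurable) simp
  have "(\<integral>\<^sup>+ w. mass t w \<partial>minimal_law h z) = (SUP l. \<integral>\<^sup>+ w. jump_iter k l (\<lambda>_. 1) t w \<partial>minimal_law h z)"
    unfolding mass_eq using incseq_jump_iter m
    by (intro nn_integral_monotone_convergence_SUP) (auto simp: incseq_def le_fun_def measurable_cong_sets[OF sets_minimal_law refl])
  also have "\<dots> \<le> mass (t + h) z"
  proof (rule SUP_least)
    fix l
    have "(\<integral>\<^sup>+ w. jump_iter k l (\<lambda>_. 1) t w \<partial>minimal_law h z) = (SUP m. jump_iter k m (jump_iter k l (\<lambda>_. 1) t) h z)"
      by (rule nn_integral_minimal_law[OF m])
    also have "\<dots> \<le> mass (t + h) z" unfolding mass_eq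
    proof (rule SUP_least)
      fix n
      have "jump_iter k n (jump_iter k l (\<lambda>_. 1) t) h z \<le> jump_iter k (n + l) (\<lambda>_. 1) (t + h) z"
        by (rule jump_iter_add_time) (use t h in auto)
      also have "\<dots> \<le> (SUP m. jump_iter k m (\<lambda>_. 1) (t + h) z)" by (rule SUP_upper) simp
      finally show "jump_iter k n (jump_iter k l (\<lambda>_. 1) t) h z \<le> (SUP m. jump_iter k m (\<lambda>_. 1) (t + h) z)" .
    qed
    finally show "(\<integral>\<^sup>+ w. jump_iter k l (\<lambda>_. 1) t w \<partial>minimal_law h z) \<le> mass (t + h) z" .
  qed
  finally show ?thesis .
qed

text \<open>The mass that survives \<open>h\<close> splits into what survives a further time
  \<open>t\<close> and what does not, and the first part is at most
  \<open>mass (t + h) z\<close>.\<close>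

lemma defect_add:
  assumes t: "0 \<le> t" and h: "0 \<le> h"
  shows "1 - mass (t + h) z \<le> (1 - mass h z) + (\<integral>\<^sup>+ w. 1 - mass t w \<partial>minimal_law h z)"
proof -
  note [measurable] = mass_measurable
  have mm: "mass t \<in> borel_measurable (minimal_law h z)" by (simp add: measurable_cong_sets[OF sets_minimal_law refl] mass_measurable)
  have "mass h z = (\<integral>\<^sup>+ w. mass t w + (1 - mass t w) \<partial>minimal_law h z)"
    using mass_le_1[OF t] by (simp add: mass_def[of h] add_diff_inverse_ennreal add_diff_eq_iff_ennreal)
  also have "\<dots> = (\<integral>\<^sup>+ w. mass t w \<partial>minimal_law h z) + (\<integral>\<^sup>+ w. 1 - mass t w \<partial>minimal_law h z)"
    using mm by (intro nn_integral_add) auto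
  also have "\<dots> \<le> mass (t + h) z + (\<integral>\<^sup>+ w. 1 - mass t w \<partial>minimal_law h z)" by (intro add_right_mono mass_add t h)
  finally have "(1 - mass h z) + mass h z \<le> (1 - mass h z) + (mass (t + h) z + (\<integral>\<^sup>+ w. 1 - mass t w \<partial>minimal_law h z))"
    by (intro add_left_mono)
  then have "1 \<le> mass (t + h) z + ((1 - mass h z) + (\<integral>\<^sup>+ w. 1 - mass t w \<partial>minimal_law h z))"
    unfolding diff_add_cancel_ennreal[OF mass_le_1[OF h]] by (simp only: ac_simps)
  then show ?thesis by (simp add: ennreal_minus_le_iff)
qed

end

context coupled_jump_process
begin

text \<open>The iterate with at most one jump already bounds the mass from below. What it misses
  needs a first jump within \<open>h\<close>, which supplies the factor \<open>h\<close>, and then a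
  further one from the new state \<open>w\<close>, of probability at most
  \<open>1 - exp (- rate w * h)\<close>.\<close>

lemma defect_small_time:
  assumes h: "0 \<le> h"
  shows "1 - mass h z \<le> ennreal h * (\<integral>\<^sup>+ w. ennreal (1 - exp (- rate w * h)) \<partial>k z)"
proof -
  let ?r = "rate z"
  define I where "I = (\<integral>\<^sup>+ s. ennreal (exp (- ?r * (h - s))) * indicator {0..h} s \<partial>lborel)"
  define E where "E = (\<integral>\<^sup>+ w. ennreal (exp (- rate w * h)) \<partial>k z)"
  define B where "B = (\<integral>\<^sup>+ w. ennreal (1 - exp (- rate w * h)) \<partial>k z)"
  have EB: "E + B = ennreal ?r"
  proof -
    have "E + B = (\<integral>\<^sup>+ w. ennreal (exp (- rate w * h)) + ennreal (1 - exp (- rate w * h)) \<partial>k z)"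
      unfolding E_def B_def by (intro nn_integral_add[symmetric] measurable_k) measurable
    also have "\<dots> = (\<integral>\<^sup>+ w. 1 \<partial>k z)"
      using h rate_nonneg by (intro nn_integral_cong) (simp flip: ennreal_plus)
    finally show ?thesis by (simp add: emeasure_k_UNIV)
  qed
  have I_le: "I \<le> ennreal h"
  proof -
    have "I \<le> (\<integral>\<^sup>+ s. 1 * indicator {0..h} s \<partial>lborel)"
      unfolding I_def using rate_nonneg[of z] by (intro nn_integral_mono) (auto split: split_indicator)
    then show ?thesis using h by simp
  qed
  \<comment> \<open>Normalisation of the exponential waiting time: no jump up to \<open>h\<close>,
    or a first jump before. It is the growth integral with \<open>S = 0\<close>.\<close>
  have one: "1 = ennreal (exp (- ?r * h)) + I * ennreal ?r"
  proof -
    have "I * ennreal ?r = (\<integral>\<^sup>+ s. ennreal (exp (- ?r * (h - s))) * indicator {0..h} s * ennreal ?r \<partial>lborel)"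
      unfolding I_def by (rule nn_integral_multc[symmetric]) measurable
    also have "\<dots> = (\<integral>\<^sup>+ s. ennreal (exp (- ?r * (h - s)) * exp (0 * s) * (0 + ?r)) * indicator {0..h} s \<partial>lborel)"
      using rate_nonneg[of z] by (intro nn_integral_cong) (auto simp: ennreal_mult split: split_indicator)
    also have "\<dots> = ennreal (exp (0 * h) - exp (- ?r * h))"
      by (rule nn_integral_exp_rate) (use h rate_nonneg in auto)
    finally show ?thesis using h rate_nonneg[of z] by (simp flip: ennreal_plus)
  qed
  have one_jump: "jump_iter k (Suc 0) (\<lambda>_. 1) s w = ennreal (exp (- rate w * s))" for s w
    unfolding jump_iter_Suc by simp
  have "ennreal (exp (- ?r * h)) + I * E \<le> jump_iter k (Suc (Suc 0)) (\<lambda>_. 1) h z"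
  proof -
    have "I * E = (\<integral>\<^sup>+ s. ennreal (exp (- ?r * (h - s))) * indicator {0..h} s * E \<partial>lborel)"
      unfolding I_def by (rule nn_integral_multc[symmetric]) measurable
    also have "\<dots> \<le> (\<integral>\<^sup>+ s. ennreal (exp (- ?r * (h - s))) * indicator {0..h} s * (\<integral>\<^sup>+ w. ennreal (exp (- rate w * s)) \<partial>k z) \<partial>lborel)"
    proof (intro nn_integral_mono)
      fix s
      show "ennreal (exp (- ?r * (h - s))) * indicator {0..h} s * E \<le> ennreal (exp (- ?r * (h - s))) * indicator {0..h} s * (\<integral>\<^sup>+ w. ennreal (exp (- rate w * s)) \<partial>k z)"
      proof (cases "s \<in> {0..h}")
        case True
        then have "E \<le> (\<integral>\<^sup>+ w. ennreal (exp (- rate w * s)) \<partial>k z)"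
          unfolding E_def using rate_nonneg by (intro nn_integral_mono ennreal_leI) (auto intro!: mult_left_mono)
        then show ?thesis by (intro mult_left_mono) auto
      qed simp
    qed
    finally show ?thesis unfolding jump_iter_Suc[of "Suc 0"] one_jump by (simp add: add_left_mono)
  qed
  also have "\<dots> \<le> mass h z" unfolding mass_eq by (rule SUP_upper) simp
  finally have "ennreal (exp (- ?r * h)) + I * E + I * B \<le> mass h z + ennreal h * B"
    using I_le by (intro add_mono mult_right_mono) auto
  moreover have "ennreal (exp (- ?r * h)) + I * E + I * B = 1"
    using one EB by (simp add: add.assoc distrib_left[symmetric])
  ultimately show ?thesis by (simp add: ennreal_minus_le_iff B_def)
qed

section \<open>Second jumps within a short time\<close>

definition active :: "real \<Rightarrow> 'b \<Rightarrow> real" where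
  "active h u = 1 - exp (- single.rate u * h)"

text \<open>The rate of jumping into a state from which a further jump follows within
  \<open>h\<close>. It tends to 0 with \<open>h\<close> at each \<open>x\<close>, but perhaps not
  uniformly, as the rates may be unbounded.\<close>

definition neighbour_active :: "real \<Rightarrow> 'b \<Rightarrow> real" where
  "neighbour_active h x = (\<integral>u. active h u \<partial>\<kappa> x)"

lemma unit_function_active: "0 \<le> h \<Longrightarrow> unit_function (active h)"
proof -
  assume h: "0 \<le> h"
  note [measurable] = single.rate_measurable
  have "active h \<in> borel_measurable borel" unfolding active_def by measurable
  then show ?thesis using h single.rate_nonneg by (simp add: unit_function_def active_def)
qed

lemma active_le: "active h u \<le> single.rate u * h"
  using exp_ge_add_one_self[of "- single.rate u * h"] by (simp add: active_def)

lemma active_mono: "h \<le> h' \<Longrightarrow> active h u \<le> active h' u"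
  using single.rate_nonneg[of u] by (simp add: active_def mult_left_mono)

lemma integrable_active: "0 \<le> h \<Longrightarrow> integrable (\<kappa> x) (active h)"
proof -
  assume "0 \<le> h"
  then have u: "unit_function (active h)" by (rule unit_function_active)
  interpret finite_measure "\<kappa> x" by (rule single.finite_measure_k)
  show ?thesis
    using u by (intro integrable_const_bound[of _ 1]) (auto simp: unit_function_def single.measurable_k)
qed

lemma neighbour_active_mono: "0 \<le> h \<Longrightarrow> h \<le> h' \<Longrightarrow> neighbour_active h x \<le> neighbour_active h' x"
  unfolding neighbour_active_def by (intro integral_mono integrable_active active_mono) auto

lemma neighbour_active_measurable:
  assumes h: "0 \<le> h"
  shows "neighbour_active h \<in> borel_measurable borel"
proof -
  have u: "unit_function (active h)" using h by (rule unit_function_active)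
  have m: "(\<lambda>p. ennreal (active h (snd p))) \<in> borel_measurable (borel \<Otimes>\<^sub>M borel)"
    using u by (intro measurable_compose[OF measurable_snd]) (auto simp: unit_function_def)
  have "(\<lambda>x. \<integral>\<^sup>+ u. ennreal (active h u) \<partial>\<kappa> x) \<in> borel_measurable borel"
  proof (rule nn_integral_measurable_finite_kernel[where N=borel])
    show "(\<lambda>x. emeasure (\<kappa> x) A) \<in> borel_measurable borel" if "A \<in> sets borel" for A
      using kernel that by (simp add: finite_kernel_def)
    show "(\<lambda>(x, u). ennreal (active h u)) \<in> borel_measurable (borel \<Otimes>\<^sub>M borel)"
      using m by (simp add: case_prod_beta')
  qed (simp_all add: single.finite_measure_k)
  moreover have "neighbour_active h = (\<lambda>x. enn2real (\<integral>\<^sup>+ u. ennreal (active h u) \<partial>\<kappa> x))"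
    unfolding neighbour_active_def using u
    by (intro ext integral_eq_nn_integral) (auto simp: unit_function_def single.measurable_k)
  ultimately show ?thesis by simp
qed

lemma neighbour_active_tendsto: "(\<lambda>n. neighbour_active (1 / real (Suc n)) x) \<longlonglongrightarrow> 0"
proof -
  interpret finite_measure "\<kappa> x" by (rule single.finite_measure_k)
  have u: "unit_function (active (1 / real (Suc n)))" for n by (rule unit_function_active) simp
  have "(\<lambda>n. \<integral>u. active (1 / real (Suc n)) u \<partial>\<kappa> x) \<longlonglongrightarrow> (\<integral>u. 0 \<partial>\<kappa> x)"
  proof (rule integral_dominated_convergence[where w="\<lambda>_. 1"])
    show "AE u in \<kappa> x. (\<lambda>n. active (1 / real (Suc n)) u) \<longlonglongrightarrow> 0"
    proof (rule AE_I2)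
      fix u
      have "(\<lambda>n. 1 - exp (- single.rate u * (1 / real (Suc n)))) \<longlonglongrightarrow> 1 - exp (- single.rate u * 0)"
        using LIMSEQ_Suc[OF lim_1_over_n] by (intro tendsto_intros) simp
      then show "(\<lambda>n. active (1 / real (Suc n)) u) \<longlonglongrightarrow> 0" by (simp add: active_def)
    qed
  qed (use u in \<open>auto simp: unit_function_def single.measurable_k\<close>)
  then show ?thesis by (simp add: neighbour_active_def)
qed

text \<open>The rate of the pair is at most the sum of the single rates, so
  \<open>1 - a * b \<le> (1 - a) + (1 - b)\<close> splits its activity between the coordinates. A
  function of one coordinate is integrated against \<open>k\<close> through the marginal property,
  which brings in the single kernel and an error of order \<open>h\<close> at the present
  state.\<close>

lemma nn_integral_rate_bound:
  assumes h: "0 \<le> h"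
  shows "(\<integral>\<^sup>+ w. ennreal (1 - exp (- rate w * h)) \<partial>k (x, y)) \<le>
    ennreal (neighbour_active h x + neighbour_active h y + rate (x, y) * (single.rate x + single.rate y) * h)"
proof -
  interpret K: finite_measure "k (x, y)" by (rule finite_measure_k)
  have u: "unit_function (active h)" by (rule unit_function_active[OF h])
  have bound: "(\<integral>\<^sup>+ w. ennreal (active h (pr w)) \<partial>k z) \<le> ennreal (neighbour_active h (pr z) + rate z * (single.rate (pr z) * h))"
    and m: "(\<lambda>w. ennreal (active h (pr w))) \<in> borel_measurable (k z)"
    if pr: "pr \<in> borel \<rightarrow>\<^sub>M borel" and marginal: "\<forall>g z. bounded_measurable g \<longrightarrow> jump_operator k (\<lambda>w. g (pr w)) z = L g (pr z)"
    for pr :: "'b \<times> 'b \<Rightarrow> 'b" and z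
  proof -
    interpret Kz: finite_measure "k z" by (rule finite_measure_k)
    interpret S: finite_measure "\<kappa> (pr z)" by (rule single.finite_measure_k)
    have mr: "(\<lambda>w. active h (pr w)) \<in> borel_measurable (k z)"
      using measurable_compose[OF pr, of "active h" borel] u by (simp add: unit_function_def measurable_k)
    then show "(\<lambda>w. ennreal (active h (pr w))) \<in> borel_measurable (k z)" by measurable
    have int: "integrable (k z) (\<lambda>w. active h (pr w))"
      using u mr by (intro Kz.integrable_const_bound[of _ 1]) (auto simp: unit_function_def)
    \<comment> \<open>The marginal property concerns increments; the value at the present state is
      added back with the rate of \<open>k\<close> and taken off with that of
      \<open>\<kappa>\<close>.\<close>
    have "(\<integral>w. active h (pr w) \<partial>k z) = jump_operator k (\<lambda>w. active h (pr w)) z + rate z * active h (pr z)"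
      unfolding jump_operator_def using int by (subst Bochner_Integration.integral_diff) (auto simp: rate_def)
    also have "jump_operator k (\<lambda>w. active h (pr w)) z = jump_operator \<kappa> (active h) (pr z)"
      using marginal[rule_format, OF unit_function_bounded[OF u], of z] generator[OF unit_function_bounded[OF u], of "pr z"] by simp
    also have "\<dots> = neighbour_active h (pr z) - single.rate (pr z) * active h (pr z)"
      unfolding jump_operator_def neighbour_active_def using integrable_active[OF h]
      by (subst Bochner_Integration.integral_diff) (auto simp: single.rate_def)
    also have "\<dots> + rate z * active h (pr z) \<le> neighbour_active h (pr z) + rate z * (single.rate (pr z) * h)"
    proof -
      have "0 \<le> single.rate (pr z) * active h (pr z)" using single.rate_nonneg u by (simp add: unit_function_def)
      moreover have "rate z * active h (pr z) \<le> rate z * (single.rate (pr z) * h)"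
        by (intro mult_left_mono active_le rate_nonneg)
      ultimately show ?thesis by linarith
    qed
    finally have "(\<integral>w. active h (pr w) \<partial>k z) \<le> neighbour_active h (pr z) + rate z * (single.rate (pr z) * h)" .
    moreover have "(\<integral>\<^sup>+ w. ennreal (active h (pr w)) \<partial>k z) = ennreal (\<integral>w. active h (pr w) \<partial>k z)"
      using u by (intro nn_integral_eq_integral int) (auto simp: unit_function_def)
    ultimately show "(\<integral>\<^sup>+ w. ennreal (active h (pr w)) \<partial>k z) \<le> ennreal (neighbour_active h (pr z) + rate z * (single.rate (pr z) * h))"
      by (simp add: ennreal_leI)
  qed
  note b1 = bound[OF fst_measurable jump_operator_marginal(1), of "(x, y)", simplified]
    and b2 = bound[OF snd_measurable jump_operator_marginal(2), of "(x, y)", simplified]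
    and m1 = m[OF fst_measurable jump_operator_marginal(1), of "(x, y)"]
    and m2 = m[OF snd_measurable jump_operator_marginal(2), of "(x, y)"]
  have "(\<integral>\<^sup>+ w. ennreal (1 - exp (- rate w * h)) \<partial>k (x, y)) \<le> (\<integral>\<^sup>+ w. ennreal (active h (fst w)) + ennreal (active h (snd w)) \<partial>k (x, y))"
  proof (intro nn_integral_mono)
    fix w :: "'b \<times> 'b"
    define a b where "a = exp (- single.rate (fst w) * h)" and "b = exp (- single.rate (snd w) * h)"
    have ab: "0 \<le> a" "a \<le> 1" "0 \<le> b" "b \<le> 1" using h single.rate_nonneg by (simp_all add: a_def b_def)
    have "rate w * h \<le> (single.rate (fst w) + single.rate (snd w)) * h"
      using rate_le[of "fst w" "snd w"] h by (intro mult_right_mono) (auto simp: rate_def single.rate_def)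
    then have "a * b \<le> exp (- rate w * h)" unfolding a_def b_def mult_exp_exp by (simp add: algebra_simps)
    moreover have "0 \<le> (1 - a) * (1 - b)" using ab by simp
    ultimately have "1 - exp (- rate w * h) \<le> (1 - a) + (1 - b)" by (simp add: algebra_simps)
    then have "ennreal (1 - exp (- rate w * h)) \<le> ennreal ((1 - a) + (1 - b))" by (rule ennreal_leI)
    also have "\<dots> = ennreal (1 - a) + ennreal (1 - b)" using ab by (intro ennreal_plus) auto
    also have "\<dots> = ennreal (active h (fst w)) + ennreal (active h (snd w))" by (simp add: active_def a_def b_def)
    finally show "ennreal (1 - exp (- rate w * h)) \<le> ennreal (active h (fst w)) + ennreal (active h (snd w))" .
  qed
  also have "\<dots> = (\<integral>\<^sup>+ w. ennreal (active h (fst w)) \<partial>k (x, y)) + (\<integral>\<^sup>+ w. ennreal (active h (snd w)) \<partial>k (x, y))"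
    by (rule nn_integral_add[OF m1 m2])
  also have "\<dots> \<le> ennreal (neighbour_active h x + rate (x, y) * (single.rate x * h)) + ennreal (neighbour_active h y + rate (x, y) * (single.rate y * h))"
    by (intro add_mono b1 b2)
  also have "\<dots> = ennreal (neighbour_active h x + neighbour_active h y + rate (x, y) * (single.rate x + single.rate y) * h)"
  proof -
    have na: "0 \<le> neighbour_active h u" for u
      unfolding neighbour_active_def using u by (intro integral_nonneg_AE) (auto simp: unit_function_def)
    have "0 \<le> rate (x, y) * (single.rate u * h)" for u using rate_nonneg single.rate_nonneg h by simp
    with na show ?thesis by (simp add: algebra_simps flip: ennreal_plus)
  qed
  finally show ?thesis .
qed

text \<open>States at which the rate and second jumps are under control at the time scale
  \<open>1 / real (Suc n)\<close>. A single index drives both conditions, so the sets increase, and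
  for \<open>e > 0\<close> they exhaust the space.\<close>

definition tame :: "real \<Rightarrow> nat \<Rightarrow> 'b set" where
  "tame e n = {x. single.rate x \<le> real n \<and> neighbour_active (1 / real (Suc n)) x \<le> e}"

lemma tame_measurable: "tame e n \<in> sets borel"
proof -
  note [measurable] = single.rate_measurable neighbour_active_measurable[of "1 / real (Suc n)", simplified]
  have "Measurable.pred borel (\<lambda>x. single.rate x \<le> real n \<and> neighbour_active (1 / (1 + real n)) x \<le> e)" by measurable
  then show ?thesis by (simp add: tame_def pred_def)
qed

lemma incseq_tame: "incseq (tame e)"
proof (rule incseq_SucI, rule subsetI)
  fix n x assume "x \<in> tame e n"
  moreover have "neighbour_active (1 / real (Suc (Suc n))) x \<le> neighbour_active (1 / real (Suc n)) x"
    by (rule neighbour_active_mono) (auto simp: frac_le)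
  ultimately show "x \<in> tame e (Suc n)" by (simp add: tame_def)
qed

lemma UN_tame:
  assumes "0 < e"
  shows "(\<Union>n. tame e n) = UNIV"
proof -
  have "\<exists>n. x \<in> tame e n" for x
  proof -
    have "eventually (\<lambda>n. neighbour_active (1 / real (Suc n)) x < e) sequentially"
      using neighbour_active_tendsto assms by (rule order_tendstoD)
    moreover have "eventually (\<lambda>n. single.rate x \<le> real n) sequentially"
      by (rule eventually_sequentiallyI[of "nat \<lceil>single.rate x\<rceil>"]) linarith
    ultimately have "eventually (\<lambda>n. neighbour_active (1 / real (Suc n)) x < e \<and> single.rate x \<le> real n) sequentially"
      by (rule eventually_conj)
    then show ?thesis by (auto simp: tame_def eventually_sequentially intro: less_imp_le)
  qed
  then show ?thesis by auto
qed

text \<open>The rate of the pair and the sum of the single rates are at most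
  \<open>2 * real n\<close> each, whence \<open>4 * (real n)\<^sup>2\<close>. What matters is the
  factor \<open>h\<close> in front of a small number: over \<open>t / h\<close> steps the losses
  stay of order \<open>e\<close>.\<close>

lemma defect_tame:
  assumes h: "0 \<le> h" "h \<le> 1 / real (Suc n)" and xy: "x \<in> tame e n" "y \<in> tame e n"
  shows "1 - mass h (x, y) \<le> ennreal (h * (2 * e + 4 * (real n)\<^sup>2 * h))"
proof -
  have q: "single.rate x \<le> real n" "single.rate y \<le> real n" using xy by (auto simp: tame_def)
  have "neighbour_active h x \<le> e" "neighbour_active h y \<le> e"
    using neighbour_active_mono[OF h, of x] neighbour_active_mono[OF h, of y] xy by (auto simp: tame_def)
  moreover have "rate (x, y) * (single.rate x + single.rate y) * h \<le> (2 * real n) * (2 * real n) * h"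
    using rate_le[of x y] q h rate_nonneg single.rate_nonneg
    by (intro mult_mono) (auto simp: rate_def single.rate_def)
  ultimately have "ennreal (neighbour_active h x + neighbour_active h y + rate (x, y) * (single.rate x + single.rate y) * h)
      \<le> ennreal (2 * e + 4 * (real n)\<^sup>2 * h)"
    by (intro ennreal_leI) (simp add: power2_eq_square)
  then have "ennreal h * (\<integral>\<^sup>+ w. ennreal (1 - exp (- rate w * h)) \<partial>k (x, y)) \<le> ennreal h * ennreal (2 * e + 4 * (real n)\<^sup>2 * h)"
    using nn_integral_rate_bound[OF h(1), of x y] by (intro mult_left_mono) auto
  then show ?thesis
    using defect_small_time[OF h(1), of "(x, y)"] h(1) by (simp add: ennreal_mult')
qed

lemma stay_op_le_1: "0 \<le> h \<Longrightarrow> (\<And>u. f u \<le> 1) \<Longrightarrow> stay_op A h f x \<le> 1"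
proof -
  assume h: "0 \<le> h" and f: "\<And>u. f u \<le> 1"
  have "(\<integral>\<^sup>+ u. f u \<partial>law h x) \<le> (\<integral>\<^sup>+ u. 1 \<partial>law h x)" by (intro nn_integral_mono f)
  also have "\<dots> = 1" using prob_space.emeasure_space_1[OF prob_space_law[OF h]] by simp
  finally show ?thesis unfolding stay_op_def by (auto split: split_indicator)
qed

text \<open>Along the grid mass is lost either in a step from two states in \<open>A\<close>, at
  most \<open>h * c\<close> each time, or after a coordinate has left \<open>A\<close>, which is
  charged in full to its marginal law. A union bound over the coordinates replaces any knowledge of
  their joint law.\<close>

lemma defect_grid:
  assumes A: "A \<in> sets borel" and h: "0 \<le> h" and c: "0 \<le> c"
    and small: "\<And>x y. x \<in> A \<Longrightarrow> y \<in> A \<Longrightarrow> 1 - mass h (x, y) \<le> ennreal (h * c)"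
  shows "1 - mass (real i * h) (x, y) \<le> (1 - ((stay_op A h) ^^ i) (\<lambda>_. 1) x) + (1 - ((stay_op A h) ^^ i) (\<lambda>_. 1) y) + ennreal (real i * h * c)"
proof (induction i arbitrary: x y)
  case 0
  have "jump_iter k (Suc 0) (\<lambda>_. 1) 0 (x, y) \<le> mass 0 (x, y)" unfolding mass_eq by (rule SUP_upper) simp
  then have "1 \<le> mass 0 (x, y)" unfolding jump_iter_Suc by simp
  then have "1 - mass 0 (x, y) = 0" by (simp add: diff_eq_0_iff_ennreal)
  then show ?case by simp
next
  case (Suc i)
  define V where "V i = ((stay_op A h) ^^ i) (\<lambda>_. 1)" for i
  have V_Suc: "V (Suc i) = stay_op A h (V i)" for i by (simp add: V_def)
  have V_m: "V i \<in> borel_measurable borel" for i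
    by (induction i) (simp add: V_def, simp add: V_Suc stay_op_measurable[OF h A])
  have V1: "V i u \<le> 1" for i u
    by (induction i arbitrary: u) (simp add: V_def, simp add: V_Suc stay_op_le_1[OF h])
  show ?case
  proof (cases "x \<in> A \<and> y \<in> A")
    case False
    \<comment> \<open>Outside \<open>A\<close> one of the killed iterates is 0, so the right-hand
      side is at least 1.\<close>
    then have "V (Suc i) x = 0 \<or> V (Suc i) y = 0" unfolding V_Suc stay_op_def by auto
    then have "1 \<le> (1 - V (Suc i) x) + (1 - V (Suc i) y)" by (auto simp: add_increasing add_increasing2)
    moreover have "1 - mass (real (Suc i) * h) (x, y) \<le> 1" by (rule diff_le_self_ennreal)
    ultimately show ?thesis unfolding V_def[symmetric] by (meson order_trans add_increasing2 zero_le order_refl)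
  next
    case True
    let ?N = "minimal_law h (x, y)"
    have ih: "0 \<le> real i * h" using h by simp
    have compl: "(\<lambda>u. 1 - V i u) \<in> borel_measurable borel" using V_m by measurable
    have m: "(\<lambda>w. 1 - V i (fst w)) \<in> borel_measurable ?N" "(\<lambda>w. 1 - V i (snd w)) \<in> borel_measurable ?N"
      using measurable_compose[OF fst_measurable compl] measurable_compose[OF snd_measurable compl]
      by (simp_all add: measurable_cong_sets[OF sets_minimal_law refl])
    \<comment> \<open>On \<open>A\<close> the killed operator is plain integration against a
      probability law, so complements pass through it.\<close>
    have law_V: "(\<integral>\<^sup>+ u. 1 - V i u \<partial>law h v) = 1 - V (Suc i) v" if "v \<in> A" for v
    proof -
      have fin: "(\<integral>\<^sup>+ u. V i u \<partial>law h v) \<noteq> \<infinity>"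
      proof -
        have "(\<integral>\<^sup>+ u. V i u \<partial>law h v) \<le> (\<integral>\<^sup>+ u. 1 \<partial>law h v)" by (intro nn_integral_mono V1)
        also have "\<dots> = 1" using prob_space.emeasure_space_1[OF prob_space_law[OF h]] by simp
        finally show ?thesis by (auto simp: top_unique)
      qed
      have "(\<integral>\<^sup>+ u. 1 - V i u \<partial>law h v) = (\<integral>\<^sup>+ u. 1 \<partial>law h v) - (\<integral>\<^sup>+ u. V i u \<partial>law h v)"
        using V_m V1 fin by (intro nn_integral_diff) (auto simp: measurable_cong_sets[OF sets_law refl])
      also have "(\<integral>\<^sup>+ u. 1 \<partial>law h v) = 1" using prob_space.emeasure_space_1[OF prob_space_law[OF h]] by simp
      finally show ?thesis using that by (simp add: V_Suc stay_op_def)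
    qed
    have "1 - mass (real (Suc i) * h) (x, y) \<le> (1 - mass h (x, y)) + (\<integral>\<^sup>+ w. 1 - mass (real i * h) w \<partial>?N)"
      using defect_add[OF ih h, of "(x, y)"] by (simp add: distrib_right add.commute)
    also have "\<dots> \<le> ennreal (h * c) + (\<integral>\<^sup>+ w. (1 - V i (fst w)) + (1 - V i (snd w)) + ennreal (real i * h * c) \<partial>?N)"
      using True small Suc.IH unfolding V_def by (intro add_mono nn_integral_mono) auto
    also have "(\<integral>\<^sup>+ w. (1 - V i (fst w)) + (1 - V i (snd w)) + ennreal (real i * h * c) \<partial>?N)
       = (\<integral>\<^sup>+ w. 1 - V i (fst w) \<partial>?N) + (\<integral>\<^sup>+ w. 1 - V i (snd w) \<partial>?N) + ennreal (real i * h * c) * mass h (x, y)"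
      using m by (simp add: nn_integral_add mass_def)
    also have "\<dots> \<le> (1 - V (Suc i) x) + (1 - V (Suc i) y) + ennreal (real i * h * c) * 1"
      using minimal_law_fst[OF compl diff_le_self_ennreal h, of "(x, y)"] minimal_law_snd[OF compl diff_le_self_ennreal h, of "(x, y)"] True
      by (intro add_mono mult_left_mono mass_le_1 h) (auto simp: law_V)
    also have "ennreal (h * c) + ((1 - V (Suc i) x) + (1 - V (Suc i) y) + ennreal (real i * h * c) * 1)
       = (1 - V (Suc i) x) + (1 - V (Suc i) y) + ennreal (real (Suc i) * h * c)"
    proof -
      have "ennreal (h * c) + ennreal (real i * h * c) = ennreal (real (Suc i) * h * c)"
        using h c by (simp add: distrib_right distrib_left flip: ennreal_plus)
      then show ?thesis by (simp add: ac_simps)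
    qed
    finally show ?thesis unfolding V_def by (simp add: add_left_mono)
  qed
qed

text \<open>Both marginals stay in a tame set along a grid with high probability, and while they do so the
  minimal coupled process loses little mass per step.\<close>

lemma mass_eq_1:
  assumes t: "0 \<le> t"
  shows "mass t z = 1"
proof -
  obtain x y where z: "z = (x, y)" by (cases z)
  have bound: "1 - mass t z \<le> ennreal ((2 + 3 * t) * e)" if e: "0 < e" "e < 1" for e
  proof -
    let ?E = "\<lambda>n x. emeasure (P x) {\<omega>\<in>space (P x). \<forall>q\<in>{0..1}. X (t * of_rat q) \<omega> \<in> tame e n}"
    have "eventually (\<lambda>n. 1 - ennreal e < ?E n x) sequentially" for x
      using stay_probability_tendsto[OF tame_measurable incseq_tame UN_tame[OF e(1)] t, of x] e
      by (intro order_tendstoD(1)) (auto simp: ennreal_minus ennreal_less_iff simp flip: ennreal_1 simp del: ennreal_eq_1)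
    then have "eventually (\<lambda>n. 1 - ennreal e < ?E n x \<and> 1 - ennreal e < ?E n y) sequentially"
      by (intro eventually_conj)
    then obtain n where n: "1 - ennreal e < ?E n x" "1 - ennreal e < ?E n y"
      using eventually_happens'[OF sequentially_bot] by blast
    \<comment> \<open>So many grid steps that \<open>h\<close> is below the time scale of
      \<open>tame e n\<close> and \<open>4 * (real n)\<^sup>2 * h\<close> is at most
      \<open>e\<close>; the successor keeps the number positive when \<open>t = 0\<close>.\<close>
    define M where "M = Suc (nat \<lceil>t * real (Suc n) + 4 * (real n)\<^sup>2 * t / e\<rceil>)"
    have M: "0 < real M" "t * real (Suc n) \<le> real M" "4 * (real n)\<^sup>2 * t / e \<le> real M"
    proof -
      have "0 \<le> t * real (Suc n)" "0 \<le> 4 * (real n)\<^sup>2 * t / e" using t e by auto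
      moreover have "t * real (Suc n) + 4 * (real n)\<^sup>2 * t / e \<le> real M" unfolding M_def by linarith
      ultimately show "t * real (Suc n) \<le> real M" "4 * (real n)\<^sup>2 * t / e \<le> real M" by linarith+
    qed (simp add: M_def)
    define h where "h = t / real M"
    have h: "0 \<le> h" "h \<le> 1 / real (Suc n)" "4 * (real n)\<^sup>2 * h \<le> e" "real M * h = t"
      using t M e by (auto simp: h_def divide_simps mult_ac)
    let ?V = "((stay_op (tame e n) h) ^^ M) (\<lambda>_. 1)"
    have V: "1 - ?V u \<le> ennreal e" if "1 - ennreal e < ?E n u" for u
    proof -
      have "{\<omega>\<in>space (P u). X (real j * h) \<omega> \<in> tame e n} \<in> sets (P u)" for j
        using measurable_sets[OF X_measurable[of "real j * h" u] tame_measurable[of e n]] h(1)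
        by (simp add: vimage_def Int_def conj_commute)
      then have "{\<omega>\<in>space (P u). \<forall>j\<in>{..<M}. X (real j * h) \<omega> \<in> tame e n} \<in> sets (P u)"
        by (rule sets.sets_Collect_countable_Ball)
      then have ev: "{\<omega>\<in>space (P u). \<forall>j<M. X (real j * h) \<omega> \<in> tame e n} \<in> sets (P u)"
        by (simp only: Ball_def lessThan_iff)
      have "?E n u \<le> emeasure (P u) {\<omega>\<in>space (P u). \<forall>j<M. X (real j * h) \<omega> \<in> tame e n}"
      proof (rule emeasure_mono[OF _ ev], safe)
        fix \<omega> j assume *: "\<forall>q\<in>{0..1}. X (t * of_rat q) \<omega> \<in> tame e n" and j: "j < M"
        have "(of_nat j / of_nat M :: rat) \<in> {0..1}" using j by (simp add: divide_le_eq)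
        then have "X (t * of_rat (of_nat j / of_nat M)) \<omega> \<in> tame e n" using * by blast
        then show "X (real j * h) \<omega> \<in> tame e n" by (simp add: h_def of_rat_divide mult.commute)
      qed
      also have "\<dots> = ?V u"
        using stay_op_iter[where f="\<lambda>_. 1" and i=M and x=u, OF h(1) tame_measurable[of e n] borel_measurable_const]
        by (simp only: mult_1_left nn_integral_indicator[OF ev])
      finally have "?E n u \<le> ?V u" .
      with that have "1 - ennreal e \<le> ?V u" by (rule less_imp_le[OF less_le_trans])
      then have "1 \<le> ennreal e + ?V u" by (simp only: ennreal_minus_le_iff)
      then show ?thesis by (simp only: ennreal_minus_le_iff add.commute) simp
    qed
    have small: "1 - mass h (u, v) \<le> ennreal (h * (3 * e))" if "u \<in> tame e n" "v \<in> tame e n" for u v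
    proof -
      have "h * (2 * e + 4 * (real n)\<^sup>2 * h) \<le> h * (3 * e)" using h by (intro mult_left_mono) auto
      then show ?thesis by (rule order_trans[OF defect_tame[OF h(1,2) that] ennreal_leI])
    qed
    \<comment> \<open>One \<open>e\<close> for each coordinate leaving the tame set and
      \<open>3 * e\<close> per unit of time for the short steps, hence the factor
      \<open>2 + 3 * t\<close>.\<close>
    have "1 - mass (real M * h) (x, y) \<le> (1 - ?V x) + (1 - ?V y) + ennreal (real M * h * (3 * e))"
      by (rule defect_grid[OF tame_measurable h(1) _ small]) (use e in auto)
    also have "\<dots> \<le> ennreal e + ennreal e + ennreal (t * (3 * e))"
      using V[OF n(1)] V[OF n(2)] by (intro add_mono) (auto simp: h(4))
    also have "\<dots> = ennreal ((2 + 3 * t) * e)" using t e by (simp add: algebra_simps flip: ennreal_plus)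
    finally show ?thesis by (simp add: h(4) z)
  qed
  have "1 - mass t z \<le> 0"
  proof (rule ennreal_le_epsilon)
    fix d :: real assume "0 < d"
    define e where "e = min (1/2) (d / (2 + 3 * t))"
    have e: "0 < e" "e < 1" "(2 + 3 * t) * e \<le> d"
    proof -
      show "0 < e" "e < 1" using \<open>0 < d\<close> t by (auto simp: e_def)
      have "(2 + 3 * t) * e \<le> (2 + 3 * t) * (d / (2 + 3 * t))" using t by (intro mult_left_mono) (auto simp: e_def)
      then show "(2 + 3 * t) * e \<le> d" using t by simp
    qed
    then have "1 - mass t z \<le> ennreal d" by (intro order_trans[OF bound[OF e(1,2)] ennreal_leI])
    then show "1 - mass t z \<le> 0 + ennreal d" by simp
  qed
  then have "1 \<le> mass t z" by (simp add: diff_eq_0_iff_ennreal)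
  then show ?thesis using mass_le_1[OF t, of z] by (rule antisym[rotated])
qed

text \<open>Both marginals are dominated by probability laws and the total mass is 1. Domination on
  a set and on its complement then forces equality.\<close>

lemma minimal_law_coupling:
  assumes t: "0 \<le> t"
  shows "minimal_law t (x, y) \<in> couplings (law t x) (law t y)"
proof -
  let ?N = "minimal_law t (x, y)"
  interpret N: prob_space ?N by (rule prob_spaceI) (use mass_eq_1[OF t, of "(x, y)"] in \<open>simp add: mass_def\<close>)
  have marg: "emeasure ?N (pr -` A) = emeasure (law t (pr (x, y))) A"
    if pr: "pr \<in> borel \<rightarrow>\<^sub>M borel" and A: "A \<in> sets borel"
      and le: "\<And>B. B \<in> sets borel \<Longrightarrow> (\<integral>\<^sup>+ w. indicator B (pr w) \<partial>?N) \<le> (\<integral>\<^sup>+ u. indicator B u \<partial>law t (pr (x, y)))"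
    for pr :: "'b \<times> 'b \<Rightarrow> 'b" and A
  proof -
    interpret l: prob_space "law t (pr (x, y))" by (rule prob_space_law[OF t])
    have m: "pr -` B \<in> sets ?N" if "B \<in> sets borel" for B using measurable_sets[OF pr that] by simp
    have le': "N.prob (pr -` B) \<le> l.prob B" if "B \<in> sets borel" for B
    proof -
      have "(\<integral>\<^sup>+ w. indicator B (pr w) \<partial>?N) = emeasure ?N (pr -` B)"
        using m[OF that] by (simp flip: nn_integral_indicator add: indicator_vimage)
      then show ?thesis using le[OF that] that by (simp add: N.emeasure_eq_measure l.emeasure_eq_measure)
    qed
    have "pr -` (- A) = space ?N - pr -` A" by auto
    then have "N.prob (pr -` (- A)) = 1 - N.prob (pr -` A)" using N.prob_compl[OF m[OF A]] by simp
    moreover have "l.prob (- A) = 1 - l.prob A" using l.prob_compl[of A] A by (simp add: Compl_eq_Diff_UNIV)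
    ultimately have "N.prob (pr -` A) = l.prob A" using le'[OF A] le'[of "- A"] A by simp
    then show ?thesis by (simp add: N.emeasure_eq_measure l.emeasure_eq_measure)
  qed
  have 1: "emeasure ?N (fst -` A) = emeasure (law t x) A" if "A \<in> sets borel" for A
  proof -
    have "emeasure ?N (fst -` A) = emeasure (law t (fst (x, y))) A"
      by (rule marg[OF fst_measurable that]) (rule minimal_law_fst, (auto simp: indicator_def t))
    then show ?thesis by simp
  qed
  have 2: "emeasure ?N (snd -` A) = emeasure (law t y) A" if "A \<in> sets borel" for A
  proof -
    have "emeasure ?N (snd -` A) = emeasure (law t (snd (x, y))) A"
      by (rule marg[OF snd_measurable that]) (rule minimal_law_snd, (auto simp: indicator_def t))
    then show ?thesis by simp
  qed
  have "sets ?N = sets (law t x \<Otimes>\<^sub>M law t y)"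
    unfolding sets_minimal_law borel_prod[symmetric] by (rule sets_pair_measure_cong) simp_all
  moreover have "A \<times> (UNIV :: 'b set) = fst -` A" "(UNIV :: 'b set) \<times> A = snd -` A" for A :: "'b set" by auto
  ultimately show ?thesis using 1 2 by (simp add: couplings_iff)
qed

text \<open>The minimal law competes in the infimum, and monotone limits carry the growth bound of
  the iterates over to the unbounded distance.\<close>

lemma wasserstein_law_le:
  assumes d: "(\<lambda>w. ennreal (d (fst w) (snd w))) \<in> borel_measurable borel"
    and S: "\<And>x y. d x y = 0 \<or> 0 \<le> S + rate (x, y)"
    and drift: "\<And>x y. (\<integral>\<^sup>+ w. ennreal (d (fst w) (snd w)) \<partial>k (x, y)) \<le> ennreal (S + rate (x, y)) * ennreal (d x y)"
    and t: "0 \<le> t"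
  shows "wasserstein d (law t x) (law t y) \<le> ennreal (exp (S * t)) * ennreal (d x y)"
proof -
  have "wasserstein d (law t x) (law t y) \<le> (\<integral>\<^sup>+ w. ennreal (d (fst w) (snd w)) \<partial>minimal_law t (x, y))"
    unfolding wasserstein_def case_prod_beta' by (rule INF_lower[OF minimal_law_coupling[OF t]])
  also have "\<dots> = (SUP m. jump_iter k m (\<lambda>w. ennreal (d (fst w) (snd w))) t (x, y))" by (rule nn_integral_minimal_law[OF d])
  also have "\<dots> \<le> ennreal (exp (S * t)) * ennreal (d (fst (x, y)) (snd (x, y)))"
  proof (rule SUP_least, rule jump_iter_le_exp[OF d _ _ t])
    show "ennreal (d (fst z) (snd z)) = 0 \<or> 0 \<le> S + rate z" for z using S[of "fst z" "snd z"] by auto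
    show "(\<integral>\<^sup>+ w. ennreal (d (fst w) (snd w)) \<partial>k z) \<le> ennreal (S + rate z) * ennreal (d (fst z) (snd z))" for z
      using drift[of "fst z" "snd z"] by simp
  qed
  finally show ?thesis by simp
qed

end

section \<open>Curvature\<close>

lemma wasserstein_self_eq_0:
  assumes d: "(\<lambda>(u, v). ennreal (d u v)) \<in> borel_measurable (\<mu> \<Otimes>\<^sub>M \<mu>)" and zero: "\<And>u. d u u = 0"
  shows "wasserstein d \<mu> \<mu> = 0"
proof -
  let ?\<pi> = "distr \<mu> (\<mu> \<Otimes>\<^sub>M \<mu>) (\<lambda>u. (u, u))"
  have m: "(\<lambda>u. (u, u)) \<in> \<mu> \<rightarrow>\<^sub>M \<mu> \<Otimes>\<^sub>M \<mu>" by measurable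
  have "distr \<mu> \<mu> (\<lambda>u. u) = \<mu>" by (rule distr_id2) simp
  then have "?\<pi> \<in> couplings \<mu> \<mu>"
    by (simp add: couplings_def distr_distr[OF measurable_fst m] distr_distr[OF measurable_snd m] comp_def)
  then have "wasserstein d \<mu> \<mu> \<le> (\<integral>\<^sup>+ (u, v). ennreal (d u v) \<partial>?\<pi>)"
    unfolding wasserstein_def by (rule INF_lower)
  also have "\<dots> = (\<integral>\<^sup>+ u. ennreal (d u u) \<partial>\<mu>)"
    using nn_integral_distr[OF m, of "\<lambda>(u, v). ennreal (d u v)"] d by simp
  also have "\<dots> = 0" by (simp add: zero)
  finally show ?thesis by simp
qed

lemma wasserstein_return_le:
  fixes x y :: "'b::second_countable_topology"
  assumes d: "(\<lambda>(u, v). ennreal (d u v)) \<in> borel_measurable borel"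
  shows "wasserstein d (return borel x) (return borel y) \<le> ennreal (d x y)"
proof -
  have "sets (return borel (x, y)) = sets (return borel x \<Otimes>\<^sub>M return borel y)"
    unfolding sets_return borel_prod[symmetric] by (rule sets_pair_measure_cong) simp_all
  moreover have "A \<times> (UNIV :: 'b set) \<in> sets borel" "(UNIV :: 'b set) \<times> A \<in> sets borel" if "A \<in> sets borel" for A :: "'b set"
    using that unfolding borel_prod[symmetric] by auto
  ultimately have "return borel (x, y) \<in> couplings (return borel x) (return borel y)"
    by (simp add: couplings_iff indicator_def)
  then have "wasserstein d (return borel x) (return borel y) \<le> (\<integral>\<^sup>+ (u, v). ennreal (d u v) \<partial>return borel (x, y))"
    unfolding wasserstein_def by (rule INF_lower)
  also have "\<dots> = ennreal (d x y)" using nn_integral_return[OF _ d, of "(x, y)"] by simp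
  finally show ?thesis .
qed

text \<open>Serves on the diagonal, where the quotients in the supremum give no information; the
  diagonal coupling has cost 0.\<close>

lemma J_self_eq_0:
  fixes m :: "'a::{metric_space, second_countable_topology} measure"
  assumes "sets m = sets borel"
  shows "J x x m m = 0"
proof -
  let ?\<mu> = "add_measure m (scale_measure (emeasure m UNIV) (return borel x))"
  have s: "sets (?\<mu> \<Otimes>\<^sub>M ?\<mu>) = sets (borel \<Otimes>\<^sub>M borel)" by (rule sets_pair_measure_cong) (simp_all add: assms)
  have "wasserstein dist ?\<mu> ?\<mu> = 0"
    by (rule wasserstein_self_eq_0) (simp_all add: measurable_cong_sets[OF s refl] case_prod_beta')
  then show ?thesis by (simp add: J_def)
qed

text \<open>The admissible \<open>\<sigma>\<close> form a set that contains its supremum, so that the greatest one exists.\<close>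

lemma coarse_Ricci_curvature_ge:
  fixes d :: "'b \<Rightarrow> 'b \<Rightarrow> real" and Q :: "real \<Rightarrow> 'b \<Rightarrow> 'b measure"
  assumes self: "\<And>t x. 0 \<le> t \<Longrightarrow> wasserstein d (Q t x) (Q t x) = 0"
    and zero: "\<And>x y. wasserstein d (Q 0 x) (Q 0 y) \<le> ennreal (d x y)"
    and pos: "\<And>x y. x \<noteq> y \<Longrightarrow> 0 < d x y"
    and \<sigma>: "\<And>t x y. 0 < t \<Longrightarrow> x \<noteq> y \<Longrightarrow> wasserstein d (Q t x) (Q t y) \<le> exp_ereal (- \<sigma> * ereal t) * ennreal (d x y)"
  shows "\<sigma> \<le> coarse_Ricci_curvature d Q"
proof -
  define adm where "adm \<sigma> \<longleftrightarrow> (\<forall>t\<ge>0. \<forall>x y. wasserstein d (Q t x) (Q t y) \<le> exp_ereal (- \<sigma> * ereal t) * ennreal (d x y))" for \<sigma>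
  have admI: "adm \<sigma>" if "\<And>t x y. 0 < t \<Longrightarrow> x \<noteq> y \<Longrightarrow> wasserstein d (Q t x) (Q t y) \<le> exp_ereal (- \<sigma> * ereal t) * ennreal (d x y)" for \<sigma>
    unfolding adm_def
  proof (intro allI impI)
    fix t :: real and x y :: 'b assume t: "0 \<le> t"
    consider "x = y" | "t = 0" | "0 < t" "x \<noteq> y" using t by linarith
    then show "wasserstein d (Q t x) (Q t y) \<le> exp_ereal (- \<sigma> * ereal t) * ennreal (d x y)"
    proof cases
      case 1 then show ?thesis by (simp add: self[OF t])
    next
      case 2
      have "exp_ereal (- \<sigma> * ereal 0) = 1" by (simp add: exp_ereal_def flip: zero_ereal_def) (simp add: zero_ereal_def)
      then show ?thesis using zero[of x y] 2 by simp
    next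
      case 3 then show ?thesis by (rule that)
    qed
  qed
  define s where "s = Sup {\<sigma>. adm \<sigma>}"
  \<comment> \<open>For \<open>q\<close> below the supremum some admissible value lies above
    \<open>q\<close>, and the bound decreases in that value. Letting \<open>q\<close> rise to
    \<open>s\<close> then yields the bound at \<open>s\<close>.\<close>
  have below: "wasserstein d (Q t x) (Q t y) \<le> ennreal (exp (- (q * t)) * d x y)"
    if t: "0 < t" and xy: "x \<noteq> y" and q: "ereal q < s" for t x y q
  proof -
    obtain a where a: "adm a" "ereal q < a" using q unfolding s_def less_Sup_iff by auto
    have "exp_ereal (- a * ereal t) \<le> ennreal (exp (- (q * t)))"
      using a(2) t by (cases a) (auto simp: exp_ereal_def mult_right_mono intro!: ennreal_leI)
    then have "exp_ereal (- a * ereal t) * ennreal (d x y) \<le> ennreal (exp (- (q * t))) * ennreal (d x y)"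
      by (intro mult_right_mono) auto
    also have "\<dots> = ennreal (exp (- (q * t)) * d x y)" by (simp add: ennreal_mult')
    finally show ?thesis using a(1) t unfolding adm_def by (meson order_trans less_imp_le)
  qed
  have "adm s"
  proof (rule admI)
    fix t :: real and x y :: 'b assume t: "0 < t" and xy: "x \<noteq> y"
    show "wasserstein d (Q t x) (Q t y) \<le> exp_ereal (- s * ereal t) * ennreal (d x y)"
    proof (cases s)
      case (real r)
      have "(\<lambda>n. ennreal (exp (- ((r - 1 / real (Suc n)) * t)) * d x y)) \<longlonglongrightarrow> ennreal (exp (- ((r - 0) * t)) * d x y)"
        by (intro tendsto_intros LIMSEQ_Suc lim_1_over_n)
      moreover have "wasserstein d (Q t x) (Q t y) \<le> ennreal (exp (- ((r - 1 / real (Suc n)) * t)) * d x y)" for n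
        by (rule below[OF t xy]) (simp add: real)
      ultimately have "wasserstein d (Q t x) (Q t y) \<le> ennreal (exp (- ((r - 0) * t)) * d x y)"
        by (intro LIMSEQ_le_const) auto
      then show ?thesis by (simp add: real exp_ereal_def ennreal_mult')
    next
      case PInf
      \<comment> \<open>As \<open>q\<close> grows the bound tends to 0, which is the value of
        \<open>exp_ereal\<close> at minus infinity.\<close>
      have "filterlim (\<lambda>n. real n * t) at_top sequentially"
        by (rule filterlim_at_top_mult_tendsto_pos[OF tendsto_const t filterlim_real_sequentially])
      then have "(\<lambda>n. ennreal (exp (- (real n * t)) * d x y)) \<longlonglongrightarrow> ennreal (0 * d x y)"
        by (intro tendsto_ennrealI tendsto_mult tendsto_const filterlim_compose[OF exp_at_bot])
          (simp add: filterlim_uminus_at_bot)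
      moreover have "wasserstein d (Q t x) (Q t y) \<le> ennreal (exp (- (real n * t)) * d x y)" for n
        by (rule below[OF t xy]) (simp add: PInf)
      ultimately have "wasserstein d (Q t x) (Q t y) \<le> ennreal (0 * d x y)"
        by (intro LIMSEQ_le_const) auto
      then show ?thesis by simp
    next
      case MInf
      \<comment> \<open>The right-hand side is infinite, because \<open>d x y\<close> is
        positive.\<close>
      then show ?thesis using t pos[OF xy] by (simp add: exp_ereal_def ennreal_top_mult)
    qed
  qed
  then have "coarse_Ricci_curvature d Q = s"
    unfolding coarse_Ricci_curvature_def adm_def[symmetric] by (rule Greatest_equality) (simp add: s_def Sup_upper)
  moreover have "adm \<sigma>" by (rule admI[OF \<sigma>])
  then have "\<sigma> \<le> s" by (simp add: s_def Sup_upper)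
  ultimately show ?thesis by simp
qed

theorem theorem2p1:
  fixes F :: "'n::finite \<Rightarrow> 'a::polish_space \<Rightarrow> ('n \<Rightarrow> 'a) \<Rightarrow> 'a measure"
    and P :: "('n \<Rightarrow> 'a) \<Rightarrow> 'w measure"
    and X :: "real \<Rightarrow> 'w \<Rightarrow> ('n \<Rightarrow> 'a)"
  assumes "\<And>i. finite_kernel (\<lambda>(z, x). F i z x)"
    and "\<And>i z x. F i z x \<in> first_moment_measures"
    and "pure_jump_Markov_process (particle_generator F) P X"
  shows "(\<exists>k. coupling_kernel (particle_generator F) k \<and>
            (\<forall>x y. integrable (k (x, y)) (\<lambda>(u, v). avg_dist u v) \<and>
               jump_operator k (\<lambda>(u, v). avg_dist u v) (x, y) =
                 (\<Sum>i\<in>UNIV. J (x i) (y i) (F i (x i) x) (F i (y i) y)) / real CARD('n))) \<and>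
         coarse_Ricci_curvature avg_dist (law_at P X) \<ge>
           - (SUP (x, y)\<in>{(x, y). x \<noteq> y}.
                ereal ((\<Sum>i\<in>UNIV. J (x i) (y i) (F i (x i) x) (F i (y i) y)) / real CARD('n)
                       / avg_dist x y))"
proof -
  define c where "c x y = (\<Sum>i\<in>UNIV. J (x i) (y i) (F i (x i) x) (F i (y i) y)) / real CARD('n)" for x y
  obtain k where k: "coupling_kernel (particle_generator F) k"
    and int: "\<And>x y. integrable (k (x, y)) (\<lambda>(u, v). avg_dist u v)"
    and jump: "\<And>x y. jump_operator k (\<lambda>(u, v). avg_dist u v) (x, y) = c x y"
    and total: "\<And>x y. emeasure (k (x, y)) UNIV =
            (\<Sum>i\<in>UNIV. emeasure (F i (x i) x) UNIV) + (\<Sum>i\<in>UNIV. emeasure (F i (y i) y) UNIV)"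
    using optimal_coupling_kernel[of F] assms(1,2) unfolding c_def by blast
  obtain \<kappa> where \<kappa>: "finite_kernel \<kappa>"
    and gen: "\<And>g x. bounded_measurable g \<Longrightarrow> particle_generator F g x = jump_operator \<kappa> g x"
    and total': "\<And>x. emeasure (\<kappa> x) UNIV = (\<Sum>i\<in>UNIV. emeasure (F i (x i) x) UNIV)"
    using particle_generator_kernel[of F] assms(1) by blast
  have "measure (k (x, y)) UNIV = measure (\<kappa> x) UNIV + measure (\<kappa> y) UNIV" for x y
  proof -
    interpret a: finite_measure "\<kappa> x" using \<kappa> by (simp add: finite_kernel_def)
    interpret b: finite_measure "\<kappa> y" using \<kappa> by (simp add: finite_kernel_def)
    have "emeasure (k (x, y)) UNIV = emeasure (\<kappa> x) UNIV + emeasure (\<kappa> y) UNIV" by (simp add: total total')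
    then show ?thesis
      by (simp add: measure_def enn2real_plus a.emeasure_finite b.emeasure_finite less_top[symmetric])
  qed
  then interpret C: coupled_jump_process \<kappa> "particle_generator F" P X k
    by unfold_locales (use \<kappa> gen assms(3) k in auto)
  define S where "S = (SUP (x, y)\<in>{(x, y). x \<noteq> y}. ereal (c x y / avg_dist x y))"
  have pos: "0 < avg_dist x y" if xy: "x \<noteq> y" for x y :: "'n \<Rightarrow> 'a"
  proof -
    obtain i where "x i \<noteq> y i" using xy by (auto simp: fun_eq_iff)
    then have "0 < (\<Sum>i\<in>UNIV. dist (x i) (y i))" by (intro sum_pos2[of _ i]) auto
    then show ?thesis by (simp add: avg_dist_def)
  qed
  have self: "avg_dist x x = 0" for x :: "'n \<Rightarrow> 'a" by (simp add: avg_dist_def)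
  have nonneg: "0 \<le> avg_dist x y" for x y :: "'n \<Rightarrow> 'a" using pos[of x y] self[of x] by (cases "x = y") auto
  have meas: "(\<lambda>(u, v). ennreal (avg_dist u v)) \<in> borel_measurable (borel :: (('n \<Rightarrow> 'a) \<times> ('n \<Rightarrow> 'a)) measure)"
    using borel_measurable_avg_dist unfolding case_prod_beta' by (rule measurable_compose[OF _ measurable_ennreal])
  have "- S \<le> coarse_Ricci_curvature avg_dist (law_at P X)"
  proof (rule coarse_Ricci_curvature_ge)
    show "wasserstein avg_dist (C.law t x) (C.law t x) = 0" for t x
    proof (rule wasserstein_self_eq_0)
      have s: "sets (C.law t x \<Otimes>\<^sub>M C.law t x) = sets borel"
        unfolding borel_prod[symmetric] by (rule sets_pair_measure_cong) simp_all
      show "(\<lambda>(u, v). ennreal (avg_dist u v)) \<in> borel_measurable (C.law t x \<Otimes>\<^sub>M C.law t x)"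
        unfolding measurable_cong_sets[OF s refl] by (rule meas)
    qed (rule self)
    show "wasserstein avg_dist (C.law 0 x) (C.law 0 y) \<le> ennreal (avg_dist x y)" for x y
      unfolding C.law_zero by (rule wasserstein_return_le[OF meas])
    show "0 < avg_dist x y" if "x \<noteq> y" for x y :: "'n \<Rightarrow> 'a" by (rule pos[OF that])
    fix t :: real and x y :: "'n \<Rightarrow> 'a" assume t: "0 < t" and xy: "x \<noteq> y"
    have S_ge: "ereal (c u v / avg_dist u v) \<le> S" if "u \<noteq> v" for u v
      unfolding S_def using that by (intro SUP_upper2[of "(u, v)"]) auto
    show "wasserstein avg_dist (C.law t x) (C.law t y) \<le> exp_ereal (- (- S) * ereal t) * ennreal (avg_dist x y)"
    proof (cases S)
      case (real r)
      \<comment> \<open>Off the diagonal this is the definition of the supremum; on it both sides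
        are 0.\<close>
      have c_le: "c u v \<le> r * avg_dist u v" for u v
      proof (cases "u = v")
        case True
        have "sets (F i z w) = sets borel" for i z w using assms(2)[of i z w] by (simp add: first_moment_measures_def)
        then show ?thesis unfolding True c_def by (simp add: J_self_eq_0 self)
      next
        case False
        then show ?thesis using S_ge[OF False] pos[OF False] by (simp add: real divide_le_eq)
      qed
      \<comment> \<open>Adding the rate times the present distance turns the bound on the increment
        into the drift inequality for nonnegative integrals.\<close>
      have cost_le: "(\<integral>w. avg_dist (fst w) (snd w) \<partial>k (u, v)) \<le> (r + C.rate (u, v)) * avg_dist u v" for u v
      proof -
        interpret K: finite_measure "k (u, v)" by (rule C.finite_measure_k)
        have "c u v = (\<integral>w. avg_dist (fst w) (snd w) \<partial>k (u, v)) - C.rate (u, v) * avg_dist u v"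
          unfolding jump[symmetric] jump_operator_def case_prod_beta'
          using int[of u v] by (subst Bochner_Integration.integral_diff) (auto simp: C.rate_def case_prod_beta')
        then show ?thesis using c_le[of u v] by (simp add: distrib_right)
      qed
      have cost_nonneg: "0 \<le> (\<integral>w. avg_dist (fst w) (snd w) \<partial>k (u, v))" for u v
        by (intro integral_nonneg_AE) (simp add: nonneg)
      \<comment> \<open>The integral of the distance is nonnegative, which forces the coefficient in
        its upper bound to be nonnegative wherever the distance is positive; \<open>r\<close> itself
        may be negative.\<close>
      have S_rate: "avg_dist u v = 0 \<or> 0 \<le> r + C.rate (u, v)" for u v
        using order_trans[OF cost_nonneg cost_le, of u v] nonneg[of u v] by (auto simp: zero_le_mult_iff)
      have "wasserstein avg_dist (C.law t x) (C.law t y) \<le> ennreal (exp (r * t)) * ennreal (avg_dist x y)"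
      proof (rule C.wasserstein_law_le[OF _ S_rate])
        show "(\<lambda>w. ennreal (avg_dist (fst w) (snd w))) \<in> borel_measurable (borel :: (('n \<Rightarrow> 'a) \<times> ('n \<Rightarrow> 'a)) measure)"
          using meas by (simp add: case_prod_beta')
        show "(\<integral>\<^sup>+ w. ennreal (avg_dist (fst w) (snd w)) \<partial>k (u, v)) \<le> ennreal (r + C.rate (u, v)) * ennreal (avg_dist u v)" for u v
        proof -
          have "(\<integral>\<^sup>+ w. ennreal (avg_dist (fst w) (snd w)) \<partial>k (u, v)) = ennreal (\<integral>w. avg_dist (fst w) (snd w) \<partial>k (u, v))"
            using int[of u v] by (intro nn_integral_eq_integral) (simp_all add: nonneg case_prod_beta')
          also have "\<dots> \<le> ennreal ((r + C.rate (u, v)) * avg_dist u v)" by (rule ennreal_leI[OF cost_le])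
          also have "\<dots> = ennreal (r + C.rate (u, v)) * ennreal (avg_dist u v)"
            using S_rate[of u v] nonneg[of u v] by (auto simp: ennreal_mult)
          finally show ?thesis .
        qed
        show "0 \<le> t" using t by simp
      qed
      then show ?thesis by (simp add: real exp_ereal_def)
    next
      case PInf
      \<comment> \<open>If the supremum is infinite, the right-hand side is infinite and nothing is
        claimed.\<close>
      then show ?thesis using t pos[OF xy] by (simp add: exp_ereal_def ennreal_top_mult)
    next
      case MInf
      \<comment> \<open>The supremum is minus infinity only if there are no distinct configurations,
        whereas \<open>x\<close> and \<open>y\<close> are distinct here.\<close>
      then show ?thesis using S_ge[OF xy] by simp
    qed
  qed
  then show ?thesis using k int jump unfolding S_def c_def by (intro conjI exI[of _ k]) auto
qed

end
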